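(* Let $q$ be an odd prime power with $5\nmid q$ and let $m$ be the order of $q$ in $\mathbb{F}_5^\times$. The average class number of the family $\mathcal{HE}_5(\mathbb{F}_q)=\{\mathbb{F}_q(T,\sqrt[5]{T^2+aT+b})\mid a,b\in\mathbb{F}_q,\ a^2-4b\neq 0\}$ is $$(h_K)^{\mathrm{av}}=\begin{cases}(q+1)^2 & \text{if } m=1,2 \ (\text{i.e. } q\equiv\pm1 \pmod 5),\\ q^2+1 & \text{if } m=4 \ (\text{i.e. } q\not\equiv\pm1\pmod 5).\end{cases}$$ Moreover, the average does not depend on whether $a^2-4b$ is a square or a non-square in $\mathbb{F}_{q^m}^\times$: the average of $h_K$ over the subfamily of those $(a,b)$ with $a^2-4b$ a nonzero square in $\mathbb{F}_{q^m}$, and the average over the subfamily with $a^2-4b$ a non-square in $\mathbb{F}_{q^m}$ (whenever this subfamily is non-empty), are both equal to the value above.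
   Context: The class number $h_K$ of a function field $K$ over $\mathbb{F}_q$ is the number of divisor classes of degree zero of $K$. The average of $h_K$ over a family is the arithmetic mean of $h_K$ over the fields $K=\mathbb{F}_q(T,\sqrt[5]{T^2+aT+b})$, indexed by the pairs $(a,b)\in\mathbb{F}_q^2$ satisfying the stated condition. *)

theory Defs
  imports
    "HOL-Algebra.Algebra"
    "HOL-Algebra.Algebraic_Closure_Type"
    "HOL-Computational_Algebra.Computational_Algebra"
    "HOL-Number_Theory.Number_Theory"
    "HOL-Library.Cardinality"
begin

section \<open>Places and divisor classes of a function field\<close>

text \<open>
  \<open>K\<close> is a field in the sense of HOL-Algebra and \<open>k\<close> is the (carrier of the) field of constants
  inside \<open>K\<close>. Valuation rings, places, divisors and the class group follow the standard treatment
  (e.g. Stichtenoth, Algebraic Function Fields and Codes, Chapter 1).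
\<close>

definition valuation_ring :: "'f set \<Rightarrow> ('f, 'm) ring_scheme \<Rightarrow> 'f set \<Rightarrow> bool" where
  "valuation_ring k K V \<longleftrightarrow>
     subring V K \<and> k \<subset> V \<and> V \<subset> carrier K \<and>
     (\<forall>z \<in> carrier K - {\<zero>\<^bsub>K\<^esub>}. z \<in> V \<or> inv\<^bsub>K\<^esub> z \<in> V)"

definition places :: "'f set \<Rightarrow> ('f, 'm) ring_scheme \<Rightarrow> 'f set set" where
  "places k K = {P. \<exists>V. valuation_ring k K V \<and> maximalideal P (K\<lparr>carrier := V\<rparr>)}"

text \<open>The valuation ring is determined by its maximal ideal \<open>P\<close>.\<close>

definition place_ring :: "('f, 'm) ring_scheme \<Rightarrow> 'f set \<Rightarrow> ('f, 'm) ring_scheme" where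
  "place_ring K P = K\<lparr>carrier := {z \<in> carrier K. z = \<zero>\<^bsub>K\<^esub> \<or> inv\<^bsub>K\<^esub> z \<notin> P}\<rparr>"

text \<open>
  The valuation at \<open>P\<close> of a nonzero \<open>z\<close>: write \<open>z = t\<^sup>n u\<close> with \<open>t\<close> a generator of \<open>P\<close> and \<open>u\<close> a unit
  of the valuation ring.
\<close>

definition place_val :: "('f, 'm) ring_scheme \<Rightarrow> 'f set \<Rightarrow> 'f \<Rightarrow> int" where
  "place_val K P z =
     (THE n. \<exists>t \<in> P. \<exists>u \<in> Units (place_ring K P).
        P = PIdl\<^bsub>place_ring K P\<^esub> t \<and> z = (t [^]\<^bsub>K\<^esub> n) \<otimes>\<^bsub>K\<^esub> u)"

text \<open>The degree is the dimension of the residue class field over the image of \<open>k\<close> in it.\<close>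

definition place_degree :: "'f set \<Rightarrow> ('f, 'm) ring_scheme \<Rightarrow> 'f set \<Rightarrow> nat" where
  "place_degree k K P =
     (let O\<^sub>P = place_ring K P; F = O\<^sub>P Quot P
      in ring.dim F ((\<lambda>c. P +>\<^bsub>O\<^sub>P\<^esub> c) ` k) (carrier F))"

definition divisor_degree ::
  "'f set \<Rightarrow> ('f, 'm) ring_scheme \<Rightarrow> ('f set \<Rightarrow>\<^sub>0 int) \<Rightarrow> int" where
  "divisor_degree k K D =
     (\<Sum>P \<in> Poly_Mapping.keys D. Poly_Mapping.lookup D P * int (place_degree k K P))"

definition divisors_deg0 :: "'f set \<Rightarrow> ('f, 'm) ring_scheme \<Rightarrow> ('f set \<Rightarrow>\<^sub>0 int) monoid" where
  "divisors_deg0 k K =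
     (let Div = free_Abelian_group (places k K)
      in Div\<lparr>carrier := {D \<in> carrier Div. divisor_degree k K D = 0}\<rparr>)"

definition principal_divisors :: "'f set \<Rightarrow> ('f, 'm) ring_scheme \<Rightarrow> ('f set \<Rightarrow>\<^sub>0 int) set" where
  "principal_divisors k K =
     {D \<in> carrier (free_Abelian_group (places k K)).
        \<exists>z \<in> carrier K - {\<zero>\<^bsub>K\<^esub>}. \<forall>P \<in> places k K. Poly_Mapping.lookup D P = place_val K P z}"

definition class_number :: "'f set \<Rightarrow> ('f, 'm) ring_scheme \<Rightarrow> nat" where
  "class_number k K = Coset.order (divisors_deg0 k K Mod principal_divisors k K)"


section \<open>The family of fields\<close>

text \<open>
  The finite field \<open>\<bbbF>\<^sub>q\<close> is the type \<open>'a\<close>; all function fields are taken inside the algebraic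
  closure of the rational function field \<open>\<bbbF>\<^sub>q(T)\<close>, which is the type \<open>'a poly fract\<close>.
\<close>

definition poly_embed :: "'a::field poly \<Rightarrow> 'a poly fract alg_closure" where
  "poly_embed f = to_ac (to_fract f)"

definition const_field :: "'a::field poly fract alg_closure set" where
  "const_field = range (\<lambda>c. poly_embed [:c:])"

text \<open>The field \<open>\<bbbF>\<^sub>q(T, r)\<close>.\<close>

definition adjoin ::
  "'a::field poly fract alg_closure \<Rightarrow> 'a poly fract alg_closure ring" where
  "adjoin r =
     ring_of_type_algebra\<lparr>carrier := generate_field ring_of_type_algebra (insert r (range to_ac))\<rparr>"

definition HE5_params :: "('a::field \<times> 'a) set" where
  "HE5_params = {(a, b). a\<^sup>2 - 4 * b \<noteq> 0}"

text \<open>The field \<open>\<bbbF>\<^bsub>q^m\<^esub>\<close> as a subfield of the algebraic closure of \<open>\<bbbF>\<^sub>q\<close>.\<close>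

definition finite_ext :: "nat \<Rightarrow> 'a::{field,finite} alg_closure set" where
  "finite_ext m =
     (THE F. subfield F ring_of_type_algebra \<and> finite F \<and> card F = CARD('a) ^ m)"

definition HE5_params_square :: "nat \<Rightarrow> ('a::{field,finite} \<times> 'a) set" where
  "HE5_params_square m =
     {(a, b) \<in> HE5_params. \<exists>s \<in> finite_ext m. to_ac (a\<^sup>2 - 4 * b) = s\<^sup>2}"

definition HE5_params_nonsquare :: "nat \<Rightarrow> ('a::{field,finite} \<times> 'a) set" where
  "HE5_params_nonsquare m =
     {(a, b) \<in> HE5_params. \<not> (\<exists>s \<in> finite_ext m. to_ac (a\<^sup>2 - 4 * b) = s\<^sup>2)}"

text \<open>
  The arithmetic mean of the class numbers over the pairs \<open>(a, b)\<close> in \<open>S\<close>, where \<open>\<rho> (a, b)\<close> is the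
  fifth root that is adjoined to \<open>\<bbbF>\<^sub>q(T)\<close>.
\<close>

definition average_class_number ::
  "('a::field \<times> 'a \<Rightarrow> 'a poly fract alg_closure) \<Rightarrow> ('a \<times> 'a) set \<Rightarrow> real" where
  "average_class_number \<rho> S =
     (\<Sum>p\<in>S. real (class_number const_field (adjoin (\<rho> p)))) / real (card S)"

end

theory Submission imports Defs begin

text \<open>
  Completing the square, \<open>w = T + a/2\<close> satisfies \<open>w\<^sup>2 = y\<^sup>5 + e\<close> with \<open>e = (a\<^sup>2 - 4 b)/4\<close>, so the field
  is the function field of a hyperelliptic curve of genus 2 with one rational point at infinity,
  and its class number is the number \<open>N(e)\<close> of Mumford pairs \<open>(u, v)\<close>: \<open>u\<close> monic of degree at most 2,
  \<open>deg v < deg u\<close>, \<open>u\<close> dividing \<open>y\<^sup>5 + e - v\<^sup>2\<close>. This uses neither Riemann-Roch nor zeta functions: every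
  degree-zero class is reduced by division by functions \<open>g + h w\<close>, and two reduced divisors are
  inequivalent by a comparison of pole orders at infinity.

  Write \<open>u = y\<^sup>2 - s y + p\<close>, so \<open>y\<^sup>5 = A y + B\<close> in \<open>\<bbbF>\<^sub>q[y]/(u)\<close>. The condition \<open>u dvd y\<^sup>5 + e - v\<^sup>2\<close> consists of an
  equation for the coefficient of \<open>y\<close>, which does not involve \<open>e\<close>, and of one that determines \<open>e\<close>;
  this gives \<open>\<Sum>\<^sub>e N(e)\<close>. For \<open>e = f\<^sup>2\<close> the condition reads \<open>y\<^sup>5 = (v - f)(v + f)\<close>, so \<open>\<Sum>\<^sub>f N(f\<^sup>2)\<close>
  counts certain factorisations of \<open>y\<^sup>5\<close>, which a torus action reduces to a count without the
  constraint on the linear coefficients. Both sums depend on \<open>q\<close> modulo 5 only through the number of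
  zeros of \<open>A = s\<^sup>4 - 3 s\<^sup>2 p + p\<^sup>2\<close>, a binary quadratic form in \<open>s\<^sup>2\<close> and \<open>p\<close> of discriminant 5.
\<close>

section \<open>Valuations and places\<close>

text \<open>The class number is defined through all valuation rings of the field, so the places must
  be classified completely before any divisor is reduced; the same local theory is applied in the
  coordinates \<open>y\<close> and \<open>1/y\<close>. Because the single place at infinity has
  degree 1, a degree-zero divisor is just an arbitrary choice of affine coefficients, and all
  reduction happens on the affine curve. The parameter \<open>e = 0\<close> belongs to a cuspidal
  curve outside the family, yet both sums are easiest over all of \<open>F_q\<close>; hence
  \<open>N(0)\<close> is evaluated by itself and subtracted from each. The sum over \<open>f\<close>
  counts every nonzero square twice; its agreement with the sum over \<open>e\<close> gives the
  average over squares, and that over non-squares follows by difference. This split matters only for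
  \<open>m = 1\<close>: for \<open>m = 2, 4\<close> every element of \<open>F_q\<close> is a square
  in \<open>F_(q^2)\<close>, which lies in \<open>F_(q^m)\<close>. The discriminant 5 is linked to
  \<open>m\<close> by a Gauss sum: 5 is a square in \<open>F_q\<close> exactly when \<open>q\<close>
  is 1 or -1 modulo 5.\<close>

lemma (in ring) card_dimension:
  assumes K: "subfield K R" "finite K" and d: "dimension n K E"
  shows "finite E \<and> card E = card K ^ n"
  using d K
proof (induct n K E rule: dimension.induct)
  case (zero_dim K)
  then show ?case by simp
next
  case (Suc_dim v E n K)
  note props = space_subgroup_props[OF Suc_dim(5) Suc_dim(3)]
  have KR: "K \<subseteq> carrier R" "\<And>a. a \<in> K \<Longrightarrow> \<ominus> a \<in> K"
       "\<And>a b. a \<in> K \<Longrightarrow> b \<in> K \<Longrightarrow> a \<oplus> b \<in> K"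
    using subringE(1,5,7)[OF subfieldE(1)[OF Suc_dim(5)]] by auto
  \<comment> \<open>Two expressions of one vector would put \<open>(a - b) v\<close> into
    \<open>E\<close>; as \<open>v\<close> is not in \<open>E\<close>, the coefficient
    \<open>a - b\<close> must vanish.\<close>
  have inj: "inj_on (\<lambda>(a, e). a \<otimes> v \<oplus> e) (K \<times> E)"
  proof (rule inj_onI, clarify)
    fix a e b g
    assume A: "a \<in> K" "e \<in> E" "b \<in> K" "g \<in> E" "a \<otimes> v \<oplus> e = b \<otimes> v \<oplus> g"
    have carr: "a \<in> carrier R" "b \<in> carrier R" "e \<in> carrier R" "g \<in> carrier R"
      using A KR(1) props(1) by auto
    have eq: "(a \<oplus> \<ominus> b) \<otimes> v = g \<oplus> \<ominus> e"
    proof -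
      have "(a \<oplus> \<ominus> b) \<otimes> v = (a \<otimes> v \<oplus> e) \<oplus> \<ominus> e \<oplus> \<ominus> (b \<otimes> v)"
        using carr Suc_dim(1) by algebra
      also have "\<dots> = (b \<otimes> v \<oplus> g) \<oplus> \<ominus> e \<oplus> \<ominus> (b \<otimes> v)" using A(5) by simp
      also have "\<dots> = g \<oplus> \<ominus> e" using carr Suc_dim(1) by algebra
      finally show ?thesis .
    qed
    have "g \<oplus> \<ominus> e \<in> E" using A props(3,4) by auto
    moreover have "a \<oplus> \<ominus> b \<in> K" using A KR by auto
    ultimately have "a \<oplus> \<ominus> b = \<zero>"
      using props(6)[of "a \<oplus> \<ominus> b" v] eq Suc_dim(1,2) by (metis DiffI singletonD)
    then have ab: "a = b" using carr by (metis add.inv_closed minus_minus minus_equality)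
    then have "e = g" using A(5) carr Suc_dim(1) by (metis add.l_cancel m_closed)
    with ab show "a = b \<and> e = g" by simp
  qed
  have img: "line_extension K v E = (\<lambda>(a, e). a \<otimes> v \<oplus> e) ` (K \<times> E)"
    by (fastforce simp: line_extension_mem_iff image_iff)
  show ?case
    unfolding img using Suc_dim card_image[OF inj] by (auto simp: card_cartesian_product)
qed

text \<open>Place degrees are dimensions of finite residue fields; this lets them be read off by
  counting representatives, so no basis of a residue field is ever exhibited.\<close>

lemma (in field) dim_eq_of_card:
  assumes "subfield K R" "finite (carrier R)" "card (carrier R) = card K ^ n"
  shows "dim K (carrier R) = n"
proof -
  have finK: "finite K" using assms subfieldE(3) finite_subset by metis
  obtain Us where Us: "set Us = carrier R" using finite_list[OF assms(2)] by blast
  have "Span K Us = carrier R"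
    using Span_base_incl[OF assms(1), of Us] Span_subgroup_props(1)[OF assms(1), of Us] Us by auto
  then obtain d where d: "dimension d K (carrier R)"
    using Span_finite_dimension[OF assms(1), of Us] Us unfolding finite_dimension_def by auto
  have "card K \<ge> 2"
  proof -
    have "{\<zero>, \<one>} \<subseteq> K" using subringE(2,3)[OF subfieldE(1)[OF assms(1)]] by auto
    then show ?thesis using card_mono[OF finK, of "{\<zero>, \<one>}"] by simp
  qed
  moreover have "card K ^ d = card K ^ n" using card_dimension[OF assms(1) finK d] assms(3) by simp
  ultimately have "d = n" by (simp add: power_inject_exp)
  then show ?thesis using dimI[OF assms(1) d] unfolding over_def by simp
qed

section \<open>Valuation rings and normalised valuations of a field given as a subset of a
  type\<close>

locale const_ext =
  fixes C k :: "'l::field set"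
  assumes C1: "1 \<in> C" and Cadd: "\<And>a b. a \<in> C \<Longrightarrow> b \<in> C \<Longrightarrow> a + b \<in> C"
    and Cmult: "\<And>a b. a \<in> C \<Longrightarrow> b \<in> C \<Longrightarrow> a * b \<in> C"
    and Cuminus: "\<And>a. a \<in> C \<Longrightarrow> - a \<in> C" and Cinv: "\<And>a. a \<in> C \<Longrightarrow> inverse a \<in> C"
    and k1: "1 \<in> k" and kadd: "\<And>a b. a \<in> k \<Longrightarrow> b \<in> k \<Longrightarrow> a + b \<in> k"
    and kmult: "\<And>a b. a \<in> k \<Longrightarrow> b \<in> k \<Longrightarrow> a * b \<in> k"
    and kuminus: "\<And>a. a \<in> k \<Longrightarrow> - a \<in> k" and kinv: "\<And>a. a \<in> k \<Longrightarrow> inverse a \<in> k"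
    and kC: "k \<subseteq> C"
begin

abbreviation RC :: "'l set \<Rightarrow> 'l ring" where
  "RC V \<equiv> ring_of_type_algebra\<lparr>carrier := V\<rparr>"

lemma C0: "0 \<in> C" using Cadd[OF C1 Cuminus[OF C1]] by simp
lemma k0: "0 \<in> k" using kadd[OF k1 kuminus[OF k1]] by simp
lemma Cdiff: "a \<in> C \<Longrightarrow> b \<in> C \<Longrightarrow> a - b \<in> C" using Cadd[OF _ Cuminus, of a b] by simp
lemma Cdiv: "a \<in> C \<Longrightarrow> b \<in> C \<Longrightarrow> a / b \<in> C" using Cmult[OF _ Cinv, of a b] by (simp add: divide_inverse)

lemma RC_simps [simp]:
  "carrier (RC V) = V" "monoid.mult (RC V) = (*)" "ring.add (RC V) = (+)"
  "\<one>\<^bsub>RC V\<^esub> = 1" "\<zero>\<^bsub>RC V\<^esub> = 0"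
  by (auto simp: ring_of_type_algebra_def fun_eq_iff)

definition subring_set :: "'l set \<Rightarrow> bool" where
  "subring_set V \<longleftrightarrow> 1 \<in> V \<and> (\<forall>a\<in>V. \<forall>b\<in>V. a + b \<in> V \<and> a * b \<in> V) \<and> (\<forall>a\<in>V. - a \<in> V)"

lemma cring_RC: assumes "subring_set V" shows "cring (RC V)"
proof -
  have z: "0 \<in> V" using assms unfolding subring_set_def by (metis add.right_inverse)
  have "\<exists>y\<in>V. x + y = 0" if "x \<in> V" for x
    using assms that unfolding subring_set_def by (metis add.right_inverse)
  then have "\<forall>x\<in>V. \<exists>y\<in>V. x + y = 0 \<and> y + x = 0" by (metis add.commute)
  with z assms show ?thesis unfolding subring_set_def
    by unfold_locales (auto simp: algebra_simps Units_def)
qed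

lemma subring_set_C: "subring_set C"
  unfolding subring_set_def by (auto simp: C1 Cadd Cmult Cuminus)

lemma inv_unit_RC:
  assumes "subring_set V" "z \<in> V" "inverse z \<in> V" "z \<noteq> 0"
  shows "inv\<^bsub>RC V\<^esub> z = inverse z"
proof -
  interpret cring "RC V" using cring_RC assms by auto
  show ?thesis using comm_inv_char[of z "inverse z"] assms by simp
qed

lemma Units_RC:
  assumes "subring_set V"
  shows "Units (RC V) = {z \<in> V. z \<noteq> 0 \<and> inverse z \<in> V}"
proof -
  have 1: "z \<noteq> 0" "inverse z = x" if "x * z = 1" for x z :: 'l
    using that inverse_unique[of z x] by (auto simp: mult.commute)
  show ?thesis
  proof (intro equalityI subsetI)
    fix z assume "z \<in> Units (RC V)"
    then obtain x where "x \<in> V" "x * z = 1" "z \<in> V" unfolding Units_def by auto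
    with 1[of x z] show "z \<in> {z \<in> V. z \<noteq> 0 \<and> inverse z \<in> V}" by auto
  next
    fix z assume "z \<in> {z \<in> V. z \<noteq> 0 \<and> inverse z \<in> V}"
    then show "z \<in> Units (RC V)"
      unfolding Units_def by (auto intro!: bexI[of _ "inverse z"])
  qed
qed

lemma field_RC: "field (RC C)"
proof -
  interpret cring "RC C" using cring_RC subring_set_C by auto
  show ?thesis
    by (rule cring_fieldI) (auto simp: Units_RC[OF subring_set_C] Cinv)
qed

lemma inv_RC: "z \<in> C \<Longrightarrow> z \<noteq> 0 \<Longrightarrow> inv\<^bsub>RC C\<^esub> z = inverse z"
  using inv_unit_RC[OF subring_set_C] Cinv by auto

lemma uminus_RC: assumes "subring_set V" "a \<in> V" shows "\<ominus>\<^bsub>RC V\<^esub> a = - a"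
proof -
  interpret cring "RC V" using cring_RC assms by auto
  show ?thesis using minus_equality[of "- a" a] assms unfolding subring_set_def by simp
qed

lemma subring_RC: "V \<subseteq> C \<Longrightarrow> subring V (RC C) \<longleftrightarrow> subring_set V"
proof -
  assume V: "V \<subseteq> C"
  interpret field "RC C" by (rule field_RC)
  show ?thesis
  proof
    assume "subring V (RC C)"
    note E = subringE[OF this]
    have "- a \<in> V" if "a \<in> V" for a
      using E(5)[OF that] uminus_RC[OF subring_set_C, of a] V that by auto
    then show "subring_set V" unfolding subring_set_def using E(3,6,7) by simp
  next
    assume S: "subring_set V"
    show "subring V (RC C)"
      by (rule subringI) (use S V uminus_RC[OF subring_set_C] in \<open>auto simp: subring_set_def subset_iff\<close>)
  qed
qed

lemma valuation_ring_RC: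
  "valuation_ring k (RC C) V \<longleftrightarrow> subring_set V \<and> k \<subset> V \<and> V \<subset> C \<and>
     (\<forall>z\<in>C - {0}. z \<in> V \<or> inverse z \<in> V)"
  unfolding valuation_ring_def using subring_RC[of V] by (auto simp: inv_RC)

definition nonunits :: "'l set \<Rightarrow> 'l set" where
  "nonunits V = {z \<in> V. z = 0 \<or> inverse z \<notin> V}"

text \<open>Closure under addition is where the valuation property enters: for nonzero
  \<open>x\<close>, \<open>y\<close> one of \<open>x / y\<close>, \<open>y / x\<close> lies in
  \<open>V\<close>, so the sum is a multiple of one summand by an element of
  \<open>V\<close>.\<close>

lemma nonunits_ideal:
  assumes "valuation_ring k (RC C) V"
  shows "ideal (nonunits V) (RC V)"
proof -
  note V = assms[unfolded valuation_ring_RC subring_set_def]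
  have SV: "subring_set V" using assms valuation_ring_RC by simp
  interpret cring "RC V" using cring_RC SV by auto
  have V0: "0 \<in> V" using zero_closed by simp
  have mult: "x * a \<in> nonunits V" if "a \<in> nonunits V" "x \<in> V" for a x
  proof -
    have "inverse a \<in> V" if i: "inverse (x * a) \<in> V" "x \<noteq> 0" "a \<noteq> 0"
    proof -
      have "x * inverse (x * a) \<in> V" using V i \<open>x \<in> V\<close> by auto
      then show ?thesis using i by (simp add: field_simps)
    qed
    then show ?thesis using that V unfolding nonunits_def by auto
  qed
  have addn: "x + y \<in> nonunits V" if xy: "x \<in> nonunits V" "y \<in> nonunits V" "y \<noteq> 0" "x / y \<in> V" for x y
  proof -
    have "x + y = (x / y + 1) * y" using xy by (simp add: field_simps)
    moreover have "x / y + 1 \<in> V" using V xy by auto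
    ultimately show ?thesis using mult xy by metis
  qed
  have add: "x + y \<in> nonunits V" if xy: "x \<in> nonunits V" "y \<in> nonunits V" for x y
  proof (cases "x = 0 \<or> y = 0")
    case False
    then have "x / y \<in> C - {0}" using xy V Cdiv[of x y] unfolding nonunits_def by (simp add: subset_iff psubset_eq)
    then have "x / y \<in> V \<or> inverse (x / y) \<in> V" using V by blast
    then show ?thesis using addn[of x y] addn[of y x] xy False by (auto simp: add.commute)
  qed (use xy in auto)
  show ?thesis
  proof (rule idealI)
    show "ring (RC V)" by (rule ring_axioms)
    have "- a \<in> nonunits V" if "a \<in> nonunits V" for a
      using mult[OF that, of "- 1"] V by auto
    then show "subgroup (nonunits V) (add_monoid (RC V))"
      using add V0 uminus_RC[OF SV] by (intro add.subgroupI) (auto simp: nonunits_def a_inv_def)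
  qed (use mult in \<open>auto simp: mult.commute\<close>)
qed

text \<open>An ideal containing a nonzero element whose inverse lies in \<open>V\<close> is all of
  \<open>V\<close>, so every proper ideal sits inside \<open>nonunits V\<close>. Thus a place is
  nothing but a valuation ring, seen through its nonunits.\<close>

lemma maximalideal_RC:
  assumes "valuation_ring k (RC C) V"
  shows "maximalideal P (RC V) \<longleftrightarrow> P = nonunits V"
proof -
  note V = assms[unfolded valuation_ring_RC subring_set_def]
  have SV: "subring_set V" using assms valuation_ring_RC by simp
  interpret cring "RC V" using cring_RC SV by auto
  have sub: "J \<subseteq> nonunits V" if J: "ideal J (RC V)" "J \<noteq> V" for J
  proof -
    interpret J: ideal J "RC V" by fact
    have JV: "J \<subseteq> V" using J.a_subset by simp
    have "z = 0 \<or> inverse z \<notin> V" if z: "z \<in> J" for z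
    proof (rule ccontr)
      assume A: "\<not> (z = 0 \<or> inverse z \<notin> V)"
      have "x \<in> J" if "x \<in> V" for x
      proof -
        have "x * inverse z \<in> V" using V A that by auto
        from J.I_l_closed[OF z, of "x * inverse z"] this A show ?thesis by (simp add: field_simps)
      qed
      then show False using JV J(2) by auto
    qed
    then show ?thesis using JV unfolding nonunits_def by auto
  qed
  have "1 \<in> V" "1 \<notin> nonunits V" using V unfolding nonunits_def by simp_all
  then have ne: "V \<noteq> nonunits V" by metis
  have nV: "nonunits V \<subseteq> V" unfolding nonunits_def by auto
  show ?thesis
  proof
    assume P: "maximalideal P (RC V)"
    then interpret P: maximalideal P "RC V" .
    have "P \<subseteq> nonunits V" using sub[OF P.is_ideal] P.I_notcarr by simp
    with P.I_maximal[OF nonunits_ideal[OF assms]] nV have "nonunits V = P \<or> nonunits V = V" by simp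
    with ne show "P = nonunits V" by metis
  next
    assume P: "P = nonunits V"
    show "maximalideal P (RC V)" unfolding P
    proof (rule maximalidealI[OF nonunits_ideal[OF assms]])
      fix J assume "ideal J (RC V)" "nonunits V \<subseteq> J" "J \<subseteq> carrier (RC V)"
      then show "J = nonunits V \<or> J = carrier (RC V)" using sub[of J] by simp blast
    qed (use ne in simp)
  qed
qed

lemma places_RC: "places k (RC C) = {nonunits V |V. valuation_ring k (RC C) V}"
  unfolding places_def using maximalideal_RC by auto

text \<open>Normalised discrete valuations of \<open>C\<close>, trivial on \<open>k\<close>. The
  value at 0 is left arbitrary, which is why the laws below carry nonzero hypotheses.\<close>

definition dval :: "('l \<Rightarrow> int) \<Rightarrow> bool" where
  "dval \<nu> \<longleftrightarrow> (\<forall>a\<in>C - {0}. \<forall>b\<in>C - {0}. \<nu> (a * b) = \<nu> a + \<nu> b) \<and>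
     (\<forall>a\<in>C - {0}. \<forall>b\<in>C - {0}. a + b \<noteq> 0 \<longrightarrow> min (\<nu> a) (\<nu> b) \<le> \<nu> (a + b)) \<and>
     (\<exists>t\<in>C - {0}. \<nu> t = 1) \<and> (\<forall>c\<in>k - {0}. \<nu> c = 0)"

definition vring :: "('l \<Rightarrow> int) \<Rightarrow> 'l set" where "vring \<nu> = {z \<in> C. z = 0 \<or> \<nu> z \<ge> 0}"
definition vplace :: "('l \<Rightarrow> int) \<Rightarrow> 'l set" where "vplace \<nu> = {z \<in> C. z = 0 \<or> \<nu> z > 0}"

context
  fixes \<nu> assumes \<nu>: "dval \<nu>"
begin

lemma dval_mult: "a \<in> C \<Longrightarrow> a \<noteq> 0 \<Longrightarrow> b \<in> C \<Longrightarrow> b \<noteq> 0 \<Longrightarrow> \<nu> (a * b) = \<nu> a + \<nu> b"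
  and dval_add: "a \<in> C \<Longrightarrow> a \<noteq> 0 \<Longrightarrow> b \<in> C \<Longrightarrow> b \<noteq> 0 \<Longrightarrow> a + b \<noteq> 0 \<Longrightarrow> min (\<nu> a) (\<nu> b) \<le> \<nu> (a + b)"
  and dval_const: "c \<in> k \<Longrightarrow> c \<noteq> 0 \<Longrightarrow> \<nu> c = 0"
  and dval_uniformizer: "\<exists>t\<in>C - {0}. \<nu> t = 1"
  using \<nu> unfolding dval_def by auto

lemma dval_1: "\<nu> 1 = 0" using dval_mult[of 1 1] C1 by simp

lemma dval_inverse: "a \<in> C \<Longrightarrow> a \<noteq> 0 \<Longrightarrow> \<nu> (inverse a) = - \<nu> a"
  using dval_mult[of a "inverse a"] Cinv dval_1 by simp

lemma dval_uminus: "a \<in> C \<Longrightarrow> a \<noteq> 0 \<Longrightarrow> \<nu> (- a) = \<nu> a"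
  using dval_mult[of "- 1" a] Cuminus[OF C1] dval_const[OF kuminus[OF k1]] by simp

lemma dval_power: "a \<in> C \<Longrightarrow> a \<noteq> 0 \<Longrightarrow> \<nu> (a ^ n) = int n * \<nu> a \<and> a ^ n \<in> C"
  by (induction n) (auto simp: dval_1 dval_mult Cmult C1 algebra_simps)

lemma vring_valuation_ring: "valuation_ring k (RC C) (vring \<nu>)"
proof -
  obtain t where t: "t \<in> C" "t \<noteq> 0" "\<nu> t = 1" using dval_uniformizer by auto
  have add: "a + b \<in> vring \<nu>" if "a \<in> vring \<nu>" "b \<in> vring \<nu>" for a b
    using that dval_add[of a b] Cadd unfolding vring_def by (cases "a = 0"; cases "b = 0") auto
  have "subring_set (vring \<nu>)" unfolding subring_set_def
  proof (intro conjI ballI)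
    fix a b assume "a \<in> vring \<nu>" "b \<in> vring \<nu>"
    then show "a + b \<in> vring \<nu>" "a * b \<in> vring \<nu>" using add dval_mult[of a b]
      by (auto simp: vring_def Cmult)
  qed (auto simp: vring_def C1 dval_1 Cuminus dval_uminus)
  moreover have "k \<subset> vring \<nu>"
  proof -
    have "c \<in> vring \<nu>" if "c \<in> k" for c
      using kC that dval_const[OF that] unfolding vring_def by auto
    then have "k \<subseteq> vring \<nu>" by auto
    moreover have "t \<in> vring \<nu>" "t \<notin> k" using t dval_const[of t] unfolding vring_def by auto
    ultimately show ?thesis by (metis psubsetI)
  qed
  moreover have "vring \<nu> \<subset> C"
  proof -
    have "inverse t \<notin> vring \<nu>" using dval_inverse[of t] t unfolding vring_def by auto
    moreover have "vring \<nu> \<subseteq> C" unfolding vring_def by auto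
    ultimately show ?thesis using Cinv[OF t(1)] by (metis psubsetI)
  qed
  moreover have "z \<in> vring \<nu> \<or> inverse z \<in> vring \<nu>" if "z \<in> C - {0}" for z
    using that dval_inverse[of z] unfolding vring_def by (auto simp: Cinv)
  ultimately show ?thesis unfolding valuation_ring_RC by simp
qed

lemma nonunits_vring: "nonunits (vring \<nu>) = vplace \<nu>"
  unfolding nonunits_def vring_def vplace_def by (auto simp: dval_inverse Cinv)

lemma vplace_places: "vplace \<nu> \<in> places k (RC C)"
  unfolding places_RC using vring_valuation_ring nonunits_vring by blast

lemma place_ring_vplace: "place_ring (RC C) (vplace \<nu>) = RC (vring \<nu>)"
proof -
  have "{z \<in> C. z = 0 \<or> inv\<^bsub>RC C\<^esub> z \<notin> vplace \<nu>} = vring \<nu>"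
    unfolding vplace_def vring_def by (auto simp: inv_RC dval_inverse Cinv)
  then show ?thesis unfolding place_ring_def by simp
qed

lemma int_pow_RC: assumes "t \<in> C" "t \<noteq> 0" shows "t [^]\<^bsub>RC C\<^esub> (n::int) = t powi n"
proof -
  interpret field "RC C" by (rule field_RC)
  have nat: "t [^]\<^bsub>RC C\<^esub> (j::nat) = t ^ j" for j
    by (induction j) (auto simp: mult.commute)
  have pC: "t ^ j \<in> C" for j using dval_power assms by simp
  show ?thesis
    using inv_RC[OF pC] assms
    by (simp add: int_pow_def2 nat power_int_def power_inverse)
qed

lemma dval_powi: "a \<in> C \<Longrightarrow> a \<noteq> 0 \<Longrightarrow> \<nu> (a powi n) = n * \<nu> a \<and> a powi n \<in> C"
  using dval_power[of a] dval_power[of "inverse a"] dval_inverse[of a] Cinv[of a]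
  by (auto simp: power_int_def)

text \<open>The definite description is well posed because every generator of the maximal ideal has
  value 1, so the exponent does not depend on the generator chosen.\<close>

lemma place_val_vplace:
  assumes z: "z \<in> C" "z \<noteq> 0"
  shows "place_val (RC C) (vplace \<nu>) z = \<nu> z"
proof -
  have SV: "subring_set (vring \<nu>)" using vring_valuation_ring valuation_ring_RC by auto
  interpret cring "RC (vring \<nu>)" using cring_RC SV by auto
  have PIdl: "PIdl\<^bsub>RC (vring \<nu>)\<^esub> t = {x * t |x. x \<in> vring \<nu>}" for t
    unfolding cgenideal_def by simp
  \<comment> \<open>A uniformiser \<open>s\<close> is a multiple \<open>x * t\<close> with
    \<open>\<nu> x\<close> nonnegative, so \<open>1 = \<nu> x + \<nu> t\<close> with
    \<open>\<nu> t\<close> positive leaves only \<open>\<nu> t = 1\<close>.\<close>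
  have gen: "\<nu> t = 1 \<and> t \<noteq> 0" if t: "t \<in> vplace \<nu>" "vplace \<nu> = PIdl\<^bsub>RC (vring \<nu>)\<^esub> t" for t
  proof -
    obtain s where s: "s \<in> C" "s \<noteq> 0" "\<nu> s = 1" using dval_uniformizer by auto
    have "s \<in> vplace \<nu>" unfolding vplace_def using s by auto
    then obtain x where x: "s = x * t" "x \<in> vring \<nu>" using t PIdl by auto
    have nz: "x \<noteq> 0" "t \<noteq> 0" using x s by auto
    have "\<nu> s = \<nu> x + \<nu> t" unfolding x(1) using dval_mult x nz t unfolding vring_def vplace_def by auto
    then show ?thesis using s x nz t unfolding vring_def vplace_def by auto
  qed
  have U: "Units (RC (vring \<nu>)) = {z \<in> C. z \<noteq> 0 \<and> \<nu> z = 0}"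
    unfolding Units_RC[OF SV] by (auto simp: vring_def dval_inverse Cinv)
  show ?thesis unfolding place_val_def place_ring_vplace
  proof (rule the_equality)
    obtain t where t: "t \<in> C" "t \<noteq> 0" "\<nu> t = 1" using dval_uniformizer by auto
    have p: "vplace \<nu> = PIdl\<^bsub>RC (vring \<nu>)\<^esub> t"
    proof
      show "vplace \<nu> \<subseteq> PIdl\<^bsub>RC (vring \<nu>)\<^esub> t"
      proof
        fix x assume x: "x \<in> vplace \<nu>"
        have "x = (x / t) * t" using t by simp
        moreover have "x / t \<in> vring \<nu>"
          using x t dval_mult[of x "inverse t"] dval_inverse[of t] Cinv[of t]
          by (auto simp: vplace_def vring_def divide_inverse Cmult)
        ultimately show "x \<in> PIdl\<^bsub>RC (vring \<nu>)\<^esub> t" unfolding PIdl by blast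
      qed
      show "PIdl\<^bsub>RC (vring \<nu>)\<^esub> t \<subseteq> vplace \<nu>"
      proof
        fix z assume "z \<in> PIdl\<^bsub>RC (vring \<nu>)\<^esub> t"
        then obtain x where "z = x * t" "x \<in> vring \<nu>" unfolding PIdl by auto
        then show "z \<in> vplace \<nu>" using t dval_mult[of x t] Cmult[of x t]
          by (cases "x = 0") (auto simp: vplace_def vring_def)
      qed
    qed
    let ?n = "\<nu> z"
    define u where "u = z * t powi (- ?n)"
    have "u \<in> C" "u \<noteq> 0" "\<nu> u = 0" unfolding u_def
      using dval_powi[OF t(1,2), of "- ?n"] t z dval_mult[OF z, of "t powi (- ?n)"] by (auto simp: Cmult)
    moreover have "z = t [^]\<^bsub>RC C\<^esub> ?n * u" unfolding u_def int_pow_RC[OF t(1,2)]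
      using t(2) by (simp add: power_int_minus field_simps)
    moreover have "t \<in> vplace \<nu>" unfolding vplace_def using t by simp
    ultimately show "\<exists>t\<in>vplace \<nu>. \<exists>u\<in>Units (RC (vring \<nu>)). vplace \<nu> = PIdl\<^bsub>RC (vring \<nu>)\<^esub> t \<and>
        z = t [^]\<^bsub>RC C\<^esub> ?n \<otimes>\<^bsub>RC C\<^esub> u"
      unfolding U RC_simps using p by blast
  next
    fix n :: int
    assume "\<exists>t\<in>vplace \<nu>. \<exists>u\<in>Units (RC (vring \<nu>)). vplace \<nu> = PIdl\<^bsub>RC (vring \<nu>)\<^esub> t \<and>
        z = t [^]\<^bsub>RC C\<^esub> n \<otimes>\<^bsub>RC C\<^esub> u"
    then obtain t u where tu: "t \<in> vplace \<nu>" "vplace \<nu> = PIdl\<^bsub>RC (vring \<nu>)\<^esub> t"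
      "u \<in> C" "u \<noteq> 0" "\<nu> u = 0" "z = t [^]\<^bsub>RC C\<^esub> n * u" unfolding U RC_simps by blast
    from gen[OF tu(1,2)] have tn: "\<nu> t = 1" "t \<noteq> 0" by simp_all
    have t0: "t \<in> C" using tu(1) unfolding vplace_def by blast
    show "n = \<nu> z"
      using tu(6) int_pow_RC[OF t0 tn(2), of n] dval_powi[OF t0 tn(2), of n] dval_mult[of "t powi n" u] tu(3-5) tn
      by simp
  qed
qed

text \<open>\<open>S\<close> is a complete system of representatives of the residue field, so that
  field has \<open>card k ^ d\<close> elements; over the image of \<open>k\<close>, which is as
  large as \<open>k\<close>, this forces dimension \<open>d\<close>.\<close>

lemma place_degree_vplace:
  assumes k: "finite k" and S: "S \<subseteq> vring \<nu>" "card S = card k ^ d"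
    and rep: "\<And>z. z \<in> vring \<nu> \<Longrightarrow> \<exists>!s\<in>S. z - s \<in> vplace \<nu>"
  shows "place_degree k (RC C) (vplace \<nu>) = d"
proof -
  have finS: "finite S" using S(2) k k0 by (metis card.infinite card_gt_0_iff empty_iff power_eq_0_iff neq0_conv)
  have VR: "valuation_ring k (RC C) (vring \<nu>)" by (rule vring_valuation_ring)
  then have SV: "subring_set (vring \<nu>)" and kV: "k \<subseteq> vring \<nu>" using valuation_ring_RC by auto
  have CR: "cring (RC (vring \<nu>))" using cring_RC SV by auto
  interpret cring "RC (vring \<nu>)" by (rule CR)
  have M: "maximalideal (vplace \<nu>) (RC (vring \<nu>))"
    using maximalideal_RC[OF VR] nonunits_vring by simp
  interpret M: maximalideal "vplace \<nu>" "RC (vring \<nu>)" by (rule M)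
  define F where "F = RC (vring \<nu>) Quot vplace \<nu>"
  have fF: "field F" unfolding F_def by (rule M.quotient_is_field[OF CR])
  interpret F: field F by (rule fF)
  let ?h = "a_r_coset (RC (vring \<nu>)) (vplace \<nu>)"
  interpret h: ring_hom_ring "RC (vring \<nu>)" F ?h unfolding F_def by (rule M.rcos_ring_hom_ring)
  have subk: "subfield k (RC (vring \<nu>))"
  proof (rule subfield_iff(1))
    show "k \<subseteq> carrier (RC (vring \<nu>))" using kV by simp
    have "subring_set k" unfolding subring_set_def by (auto simp: k1 kadd kmult kuminus)
    then interpret kk: cring "RC k" using cring_RC by auto
    have "field (RC k)"
      by (rule kk.cring_fieldI) (auto simp: Units_RC[OF \<open>subring_set k\<close>] kinv)
    then show "field (RC (vring \<nu>)\<lparr>carrier := k\<rparr>)" by simp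
  qed
  have sub: "subfield (?h ` k) F" and inj: "inj_on ?h k"
    using h.img_is_subfield[OF subk F.one_not_zero] by auto
  have eqh: "?h a = ?h b \<longleftrightarrow> a - b \<in> vplace \<nu>" if "a \<in> vring \<nu>" "b \<in> vring \<nu>" for a b
  proof -
    have "?h a = ?h b \<longleftrightarrow> a \<ominus>\<^bsub>RC (vring \<nu>)\<^esub> b \<in> vplace \<nu>"
      using quotient_eq_iff_same_a_r_cos[OF M.is_ideal, of a b] that by simp
    then show ?thesis using uminus_RC[OF SV that(2)] by (simp add: a_minus_def)
  qed
  have carr: "carrier F = ?h ` S"
  proof -
    have "carrier F = ?h ` vring \<nu>" unfolding F_def FactRing_def A_RCOSETS_def' by auto
    also have "\<dots> = ?h ` S"
    proof
      show "?h ` vring \<nu> \<subseteq> ?h ` S"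
      proof
        fix Z assume "Z \<in> ?h ` vring \<nu>"
        then obtain z where z: "z \<in> vring \<nu>" "Z = ?h z" by auto
        then obtain s where "s \<in> S" "z - s \<in> vplace \<nu>" using rep[OF z(1)] by auto
        then show "Z \<in> ?h ` S" using z eqh[of z s] S(1) by auto
      qed
    qed (use S in auto)
    finally show ?thesis .
  qed
  have "inj_on ?h S"
  proof (rule inj_onI)
    fix a b assume ab: "a \<in> S" "b \<in> S" "?h a = ?h b"
    then have "a - b \<in> vplace \<nu>" using eqh S by auto
    moreover have "a - a \<in> vplace \<nu>" using C0 unfolding vplace_def by auto
    ultimately show "a = b" using rep[of a] ab S by blast
  qed
  then have "card (carrier F) = card (?h ` k) ^ d" "finite (carrier F)"
    unfolding carr using card_image[OF inj] card_image[of ?h S] S finS by auto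
  then have "F.dim (?h ` k) (carrier F) = d"
    using F.dim_eq_of_card[OF sub] by auto
  then show ?thesis
    unfolding place_degree_def place_ring_vplace Let_def F_def[symmetric] by simp
qed

end

end

section \<open>Local rings of the quadratic extension\<close>

hide_const (open) Divisibility.irreducible
hide_fact (open) Divisibility.irreducible_def Divisibility.irreducibleI

lemma irreducible_field_poly_degree: "irreducible (p :: 'a::field poly) \<Longrightarrow> Polynomial.degree p > 0"
  by (metis irreducible_def is_unit_iff_degree not_gr_zero)

text \<open>A divisor of least positive degree cannot factor further; dividing by its leading
  coefficient makes it monic.\<close>

lemma exists_irreducible_factor:
  fixes g :: "'a::field poly"
  assumes "Polynomial.degree g > 0"
  shows "\<exists>p. irreducible p \<and> lead_coeff p = 1 \<and> p dvd g"
proof -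
  obtain d where d: "d dvd g" "Polynomial.degree d > 0"
    and min: "\<And>e. e dvd g \<Longrightarrow> Polynomial.degree e > 0 \<Longrightarrow> Polynomial.degree d \<le> Polynomial.degree e"
    using ex_has_least_nat[of "\<lambda>d. d dvd g \<and> Polynomial.degree d > 0" g Polynomial.degree] assms
    by (metis dvd_refl)
  have d0: "d \<noteq> 0" using d(2) by auto
  have irr: "irreducible d"
  proof (rule irreducibleI)
    show "\<not> d dvd 1" using d(2) is_unit_iff_degree[OF d0] by simp
    fix a b assume ab: "d = a * b"
    then have nz: "a \<noteq> 0" "b \<noteq> 0" using d0 by auto
    have "a dvd g" "b dvd g" using d(1) unfolding ab by (metis dvd_mult_left, metis dvd_mult_right)
    have "Polynomial.degree a = 0 \<or> Polynomial.degree b = 0"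
      using min[OF \<open>a dvd g\<close>] min[OF \<open>b dvd g\<close>] degree_mult_eq[OF nz] ab by fastforce
    then show "a dvd 1 \<or> b dvd 1" using is_unit_iff_degree[OF nz(1)] is_unit_iff_degree[OF nz(2)] by simp
  qed (use d0 in auto)
  define p where "p = smult (inverse (lead_coeff d)) d"
  have "irreducible p" unfolding p_def
    using irr d0 irreducible_mult_unit_left[of "[:inverse (lead_coeff d):]" d] by (simp add: is_unit_iff_degree)
  moreover have "lead_coeff p = 1" "p dvd g" unfolding p_def using d d0 by (auto simp: smult_dvd_iff)
  ultimately show ?thesis by blast
qed

section \<open>Arithmetic modulo an irreducible polynomial over a finite field\<close>

locale irr_poly =
  fixes p :: "'a::{field,finite} poly"
  assumes irr: "irreducible p"
begin

lemma p0: "p \<noteq> 0" and deg_pos: "Polynomial.degree p > 0"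
  using irr irreducible_field_poly_degree by (auto simp: irreducible_def)

lemma prime_dvd_mult: "p dvd a * b \<longleftrightarrow> p dvd a \<or> p dvd b"
  using prime_elem_dvd_mult_iff[OF field_poly_irreducible_imp_prime[OF irr]] .

lemma not_dvd_1: "\<not> p dvd 1" using irr by (simp add: irreducible_def)

lemma dvd_power: "p dvd a ^ n \<Longrightarrow> p dvd a"
  by (induction n) (auto simp: not_dvd_1 prime_dvd_mult)

lemma dvd_small: "p dvd g \<Longrightarrow> Polynomial.degree g < Polynomial.degree p \<Longrightarrow> g = 0"
  by (metis dvd_imp_degree_le not_le)

lemma decomp: "g \<noteq> 0 \<Longrightarrow> \<exists>n g'. g = p ^ n * g' \<and> \<not> p dvd g'"
proof (induction "Polynomial.degree g" arbitrary: g rule: less_induct)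
  case less
  show ?case
  proof (cases "p dvd g")
    case True
    then obtain h where h: "g = p * h" by (elim dvdE)
    with less.prems have h0: "h \<noteq> 0" by auto
    then have "Polynomial.degree h < Polynomial.degree g" using h degree_mult_eq[OF p0] deg_pos by simp
    from less.hyps[OF this h0] obtain n g' where "h = p ^ n * g'" "\<not> p dvd g'" by blast
    then have "g = p ^ Suc n * g'" using h by simp
    then show ?thesis using \<open>\<not> p dvd g'\<close> by blast
  qed (auto intro: exI[of _ 0])
qed

lemma decomp2: "g \<noteq> 0 \<or> h \<noteq> 0 \<Longrightarrow> \<exists>n g' h'. g = p ^ n * g' \<and> h = p ^ n * h' \<and> \<not> (p dvd g' \<and> p dvd h')"
proof (induction "Polynomial.degree g + Polynomial.degree h" arbitrary: g h rule: less_induct)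
  case less
  show ?case
  proof (cases "p dvd g \<and> p dvd h")
    case True
    then obtain g1 h1 where h: "g = p * g1" "h = p * h1" by (elim conjE dvdE)
    with less.prems have h0: "g1 \<noteq> 0 \<or> h1 \<noteq> 0" by auto
    then have "Polynomial.degree g1 + Polynomial.degree h1 < Polynomial.degree g + Polynomial.degree h"
      using h degree_mult_eq[OF p0, of g1] degree_mult_eq[OF p0, of h1] deg_pos
      by (cases "g1 = 0"; cases "h1 = 0") auto
    from less.hyps[OF this h0] obtain n g' h' where
      "g1 = p ^ n * g'" "h1 = p ^ n * h'" "\<not> (p dvd g' \<and> p dvd h')" by blast
    then have "g = p ^ Suc n * g' \<and> h = p ^ Suc n * h'" using h by simp
    then show ?thesis using \<open>\<not> (p dvd g' \<and> p dvd h')\<close> by blast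
  qed (use less.prems in \<open>auto intro!: exI[of _ "0::nat"]\<close>)
qed

lemma decomp_unique:
  assumes "p ^ n * a = p ^ m * b" "\<not> p dvd a" "\<not> p dvd b"
  shows "n = m"
proof -
  have *: False if "p ^ n * a = p ^ m * b" "\<not> p dvd a" "n < m" for n m a b
  proof -
    have "p ^ m = p ^ n * p ^ (m - n)" using that(3) by (simp flip: power_add)
    then have "a = p ^ (m - n) * b" using that(1) p0 by (simp add: mult.assoc)
    moreover have "p dvd p ^ (m - n)" using that(3) by (simp add: dvd_power_same)
    ultimately show False using that(2) by auto
  qed
  show ?thesis using *[of n a m b] *[of m b n a] assms by (cases n m rule: linorder_cases) auto
qed

text \<open>Bezout: a nonzero element \<open>d\<close> of least degree in the ideal generated by
  \<open>p\<close> and \<open>g\<close> divides both. It is not an associate of \<open>p\<close>,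
  since \<open>p\<close> does not divide \<open>g\<close>, so it is a unit.\<close>

lemma inverse_mod: assumes "\<not> p dvd g" shows "\<exists>s. p dvd s * g - 1"
proof -
  let ?I = "{a * p + b * g |a b. True}"
  have "p = 1 * p + 0 * g" by simp
  then have pI: "p \<in> ?I" by blast
  have gI: "g \<in> ?I" by (rule CollectI, rule exI[of _ 0], rule exI[of _ 1]) simp
  obtain d where d: "d \<in> ?I" "d \<noteq> 0"
    and min: "\<And>e. e \<in> ?I \<Longrightarrow> e \<noteq> 0 \<Longrightarrow> Polynomial.degree d \<le> Polynomial.degree e"
    using ex_has_least_nat[of "\<lambda>d. d \<in> ?I \<and> d \<noteq> 0" p Polynomial.degree] pI p0
    by blast
  obtain a b where ab: "d = a * p + b * g" using d by blast
  have dd: "d dvd e" if e: "e \<in> ?I" for e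
  proof -
    obtain a' b' where ab': "e = a' * p + b' * g" using e by blast
    have "e mod d = (a' - e div d * a) * p + (b' - e div d * b) * g"
      using div_mult_mod_eq[of e d] unfolding ab' ab by (simp add: algebra_simps)
    then have "e mod d \<in> ?I" by blast
    then have "e mod d = 0" using min[of "e mod d"] degree_mod_less'[OF d(2), of e] by linarith
    then show ?thesis by (simp add: dvd_eq_mod_eq_0)
  qed
  obtain c where c: "p = d * c" using dd[OF pI] by (elim dvdE)
  have "\<not> c dvd 1"
  proof
    assume "c dvd 1"
    then have "p dvd d" unfolding c by (simp add: mult_unit_dvd_iff)
    then show False using dvd_trans[OF _ dd[OF gI]] assms by simp
  qed
  then have "d dvd 1" using Factorial_Ring.irreducibleD[OF irr c] by simp
  then obtain r where r: "1 = d * r" by (elim dvdE)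
  have "r * b * g - 1 = - (r * a * p)" unfolding r ab by (simp add: algebra_simps)
  then show ?thesis by (metis dvd_minus_iff dvd_triv_right)
qed

end

lemma card_polys_degree_less:
  "finite {g :: 'a::{field,finite} poly. g = 0 \<or> Polynomial.degree g < n} \<and>
   card {g :: 'a poly. g = 0 \<or> Polynomial.degree g < n} = CARD('a) ^ n"
proof (induction n)
  case 0
  have "{g :: 'a poly. g = 0 \<or> Polynomial.degree g < 0} = {0}" by auto
  then show ?case by simp
next
  case (Suc n)
  let ?A = "{g :: 'a poly. g = 0 \<or> Polynomial.degree g < n}"
  have "bij_betw (\<lambda>(a, g). pCons a g) (UNIV \<times> ?A) {g. g = 0 \<or> Polynomial.degree g < Suc n}"
  proof (rule bij_betwI')
    fix x y :: "'a \<times> 'a poly"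
    show "((\<lambda>(a, g). pCons a g) x = (\<lambda>(a, g). pCons a g) y) = (x = y)" by (cases x; cases y) auto
  next
    fix x :: "'a \<times> 'a poly" assume "x \<in> UNIV \<times> ?A"
    then show "(\<lambda>(a, g). pCons a g) x \<in> {g. g = 0 \<or> Polynomial.degree g < Suc n}" by (cases x) auto
  next
    fix y :: "'a poly" assume y: "y \<in> {g. g = 0 \<or> Polynomial.degree g < Suc n}"
    obtain a g where ag: "y = pCons a g" by (cases y)
    have "g \<in> ?A" using y unfolding ag by (auto split: if_splits)
    then show "\<exists>x\<in>UNIV \<times> ?A. y = (\<lambda>(a, g). pCons a g) x" using ag by (intro bexI[of _ "(a, g)"]) auto
  qed
  from bij_betw_same_card[OF this] bij_betw_finite[OF this] show ?case using Suc by (auto simp: card_cartesian_product)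
qed

section \<open>Discrete valuations attached to a prime of a subring\<close>

context const_ext
begin

text \<open>Says that \<open>C\<close> is the fraction field of \<open>A\<close> and that the
  localisation of \<open>A\<close> at the prime \<open>p\<close> is a discrete valuation ring with
  uniformiser \<open>t\<close>. The relation \<open>b * z = t ^ n * a\<close> with \<open>a\<close>,
  \<open>b\<close> outside \<open>p\<close> avoids forming the localisation.\<close>

definition datum :: "'l set \<Rightarrow> 'l set \<Rightarrow> 'l \<Rightarrow> bool" where
  "datum A p t \<longleftrightarrow> subring_set A \<and> k \<subseteq> A \<and> A \<subseteq> C \<and> (\<forall>z\<in>C. \<exists>a\<in>A. \<exists>b\<in>A - {0}. z * b = a) \<and>
     p \<subseteq> A \<and> (\<forall>x\<in>p. \<forall>y\<in>A. y * x \<in> p) \<and> (\<forall>x\<in>A - p. \<forall>y\<in>A - p. x * y \<in> A - p) \<and>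
     0 \<in> p \<and> 1 \<notin> p \<and> t \<in> p \<and> t \<noteq> 0 \<and>
     (\<forall>z\<in>A - {0}. \<exists>n. \<exists>a\<in>A - p. \<exists>b\<in>A - p. b * z = t ^ n * a)"

definition dord :: "'l set \<Rightarrow> 'l set \<Rightarrow> 'l \<Rightarrow> 'l \<Rightarrow> int" where
  "dord A p t z = (THE n. \<exists>a\<in>A - p. \<exists>b\<in>A - p. b * z = t powi n * a)"

context
  fixes A p t assumes dat: "datum A p t"
begin

lemma datum_facts:
  "1 \<in> A" "0 \<in> p" "1 \<notin> p" "t \<in> p" "t \<noteq> 0" "t \<in> A" "t \<in> C" "A \<subseteq> C" "p \<subseteq> A" "k \<subseteq> A"
  "a \<in> A \<Longrightarrow> b \<in> A \<Longrightarrow> a + b \<in> A" "a \<in> A \<Longrightarrow> b \<in> A \<Longrightarrow> a * b \<in> A" "a \<in> A \<Longrightarrow> - a \<in> A"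
  "x \<in> p \<Longrightarrow> y \<in> A \<Longrightarrow> y * x \<in> p" "x \<in> A - p \<Longrightarrow> y \<in> A - p \<Longrightarrow> x * y \<in> A - p"
  "x \<in> A - p \<Longrightarrow> x \<noteq> 0"
  using dat unfolding datum_def subring_set_def by blast+

lemma datum_frac: "\<forall>z\<in>C. \<exists>a\<in>A. \<exists>b\<in>A - {0}. z * b = a"
  using dat unfolding datum_def by (elim conjE)

lemma datum_decomp: "\<forall>z\<in>A - {0}. \<exists>n. \<exists>a\<in>A - p. \<exists>b\<in>A - p. b * z = t ^ n * a"
  using dat unfolding datum_def by (elim conjE)

lemma datum_pow_A: "t ^ n \<in> A"
  by (induction n) (auto simp: datum_facts)

lemma datum_pow_p: "n > 0 \<Longrightarrow> t ^ n \<in> p"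
  using datum_facts(14)[OF datum_facts(4) datum_pow_A[of "n - 1"]] by (cases n) (auto simp: mult.commute)

text \<open>If the exponents differed, cancelling the smaller power of \<open>t\<close> would equate
  a product of elements outside \<open>p\<close> with a multiple of a positive power of
  \<open>t\<close>, which lies in \<open>p\<close>.\<close>

lemma datum_unique:
  assumes "b * z = t powi n * a" "b' * z = t powi m * a'" "a \<in> A - p" "b \<in> A - p" "a' \<in> A - p" "b' \<in> A - p"
  shows "n = m"
proof -
  have *: False if h: "b * z = t powi n * a" "b' * z = t powi m * a'" "a \<in> A - p" "b \<in> A - p"
      "a' \<in> A - p" "b' \<in> A - p" "n < m" for a b a' b' n m
  proof -
    define j where "j = nat (m - n)"
    have m: "t powi m = t powi n * t ^ j"
      unfolding j_def using h(7) datum_facts(5) power_int_add[of t n "m - n"] by (simp add: power_int_def)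
    have "t powi n * (b' * a) = b' * (b * z)" using h(1) by (simp add: algebra_simps)
    also have "\<dots> = t powi n * (t ^ j * a' * b)" using h(2) unfolding m by (simp add: algebra_simps)
    finally have "b' * a = (a' * b) * t ^ j" using datum_facts(5) by (simp add: algebra_simps)
    moreover have "(a' * b) * t ^ j \<in> p"
      using datum_facts(14)[OF datum_pow_p[of j], of "a' * b"] h datum_facts(12)[of a' b] j_def by auto
    ultimately show False using datum_facts(15)[OF h(6,3)] by (metis DiffD2)
  qed
  show ?thesis using *[OF assms] *[OF assms(2,1,5,6,3,4)] by (cases n m rule: linorder_cases) auto
qed

lemma datum_exists:
  assumes "z \<in> C" "z \<noteq> 0"
  shows "\<exists>n. \<exists>a\<in>A - p. \<exists>b\<in>A - p. b * z = t powi n * a"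
proof -
  have "\<exists>a\<in>A. \<exists>b\<in>A - {0}. z * b = a" using datum_frac assms(1) by (rule bspec)
  then obtain a b where ab: "a \<in> A" "b \<in> A" "b \<noteq> 0" "z * b = a" by blast
  have a0: "a \<noteq> 0" using ab assms by auto
  have dec: "\<exists>n. \<exists>a\<in>A - p. \<exists>b\<in>A - p. b * z = t ^ n * a" if "z \<in> A" "z \<noteq> 0" for z
    using datum_decomp that by simp
  obtain n a1 a2 where 1: "a1 \<in> A - p" "a2 \<in> A - p" "a2 * a = t ^ n * a1" using dec[OF ab(1) a0] by blast
  obtain m b1 b2 where 2: "b1 \<in> A - p" "b2 \<in> A - p" "b2 * b = t ^ m * b1" using dec[OF ab(2,3)] by blast
  have tm: "t ^ m \<noteq> 0" using datum_facts(5) by simp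
  have "t ^ m * ((a2 * b1) * z) = a2 * (t ^ m * b1) * z" by (simp add: algebra_simps)
  also have "\<dots> = b2 * (a2 * a)" unfolding 2(3)[symmetric] using ab(4) by (simp add: algebra_simps)
  also have "\<dots> = t ^ n * (a1 * b2)" unfolding 1(3) by (simp add: algebra_simps)
  also have "\<dots> = t ^ m * (t powi (int n - int m) * (a1 * b2))"
    using datum_facts(5) by (simp add: power_int_diff)
  finally have "(a2 * b1) * z = t powi (int n - int m) * (a1 * b2)" unfolding mult_left_cancel[OF tm] .
  moreover have "a2 * b1 \<in> A - p" "a1 * b2 \<in> A - p"
    using datum_facts(15)[OF 1(2) 2(1)] datum_facts(15)[OF 1(1) 2(2)] by simp_all
  ultimately show ?thesis by blast
qed

lemma dord_eqI: "a \<in> A - p \<Longrightarrow> b \<in> A - p \<Longrightarrow> b * z = t powi n * a \<Longrightarrow> dord A p t z = n"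
  unfolding dord_def using datum_unique[of b z n a] by (intro the_equality) blast+

lemma dord_repr:
  assumes "z \<in> C" "z \<noteq> 0"
  obtains a b where "a \<in> A - p" "b \<in> A - p" "b * z = t powi (dord A p t z) * a"
  using datum_exists[OF assms] dord_eqI that by blast

lemma dord_A_repr:
  assumes "z \<in> A" "z \<noteq> 0"
  obtains n a b where "a \<in> A - p" "b \<in> A - p" "b * z = t ^ n * a" "dord A p t z = int n"
proof -
  have "\<exists>n. \<exists>a\<in>A - p. \<exists>b\<in>A - p. b * z = t ^ n * a"
    using datum_decomp assms by simp
  then obtain n a b where "a \<in> A - p" "b \<in> A - p" "b * z = t ^ n * a" by blast
  then show ?thesis using that[of a b n] dord_eqI[of a b z "int n"] by simp
qed

lemma dord_nonneg: "z \<in> A \<Longrightarrow> z \<noteq> 0 \<Longrightarrow> dord A p t z \<ge> 0"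
  by (erule (1) dord_A_repr) simp

lemma dord_mult:
  assumes "x \<in> C" "x \<noteq> 0" "y \<in> C" "y \<noteq> 0"
  shows "dord A p t (x * y) = dord A p t x + dord A p t y"
proof -
  obtain a b where 1: "a \<in> A - p" "b \<in> A - p" "b * x = t powi (dord A p t x) * a"
    using dord_repr[OF assms(1,2)] .
  obtain a' b' where 2: "a' \<in> A - p" "b' \<in> A - p" "b' * y = t powi (dord A p t y) * a'"
    using dord_repr[OF assms(3,4)] .
  have "(b * b') * (x * y) = (b * x) * (b' * y)" by (simp add: algebra_simps)
  also have "\<dots> = t powi (dord A p t x + dord A p t y) * (a * a')"
    unfolding 1 2 using datum_facts(5) by (simp add: power_int_add algebra_simps)
  finally show ?thesis by (rule dord_eqI[OF datum_facts(15)[OF 1(1) 2(1)] datum_facts(15)[OF 1(2) 2(2)]])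
qed

lemma dord_pos_iff: assumes "z \<in> A" "z \<noteq> 0" shows "dord A p t z > 0 \<longleftrightarrow> z \<in> p"
proof -
  obtain n a b where 1: "a \<in> A - p" "b \<in> A - p" "b * z = t ^ n * a" "dord A p t z = int n"
    using dord_A_repr[OF assms] .
  show ?thesis
  proof (cases "n = 0")
    case True
    then have "b * z \<notin> p" using 1 by auto
    then have "z \<notin> p" using 1 datum_facts(14)[of z b] by auto
    then show ?thesis using 1 True by simp
  next
    case False
    then have "a * t ^ n \<in> p" using datum_facts(14)[OF datum_pow_p, of n a] 1 by auto
    then have "b * z \<in> p" using 1 by (simp add: mult.commute)
    then have "z \<in> p" using datum_facts(15)[OF 1(2), of z] assms by blast
    then show ?thesis using 1 False by auto
  qed
qed

lemma dord_t: "dord A p t t = 1"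
  using dord_eqI[of 1 1 t 1] datum_facts(1,3) by simp

text \<open>After factoring out the smaller power of \<open>t\<close>, the sum is that power times
  an element \<open>c\<close> of \<open>A\<close>, up to a factor outside \<open>p\<close>; elements
  of \<open>A\<close> have nonnegative order.\<close>

lemma dord_add:
  assumes "x \<in> C" "x \<noteq> 0" "y \<in> C" "y \<noteq> 0" "x + y \<noteq> 0"
  shows "min (dord A p t x) (dord A p t y) \<le> dord A p t (x + y)"
proof -
  have *: "dord A p t x \<le> dord A p t (x + y)"
    if xy: "x \<in> C" "x \<noteq> 0" "y \<in> C" "y \<noteq> 0" "x + y \<noteq> 0" "dord A p t x \<le> dord A p t y" for x y
  proof -
    let ?n = "dord A p t x"
    obtain a b where 1: "a \<in> A - p" "b \<in> A - p" "b * x = t powi ?n * a"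
      using dord_repr[OF xy(1,2)] .
    obtain a' b' where 2: "a' \<in> A - p" "b' \<in> A - p" "b' * y = t powi (dord A p t y) * a'"
      using dord_repr[OF xy(3,4)] .
    define j where "j = nat (dord A p t y - ?n)"
    have m: "t powi (dord A p t y) = t powi ?n * t ^ j"
      unfolding j_def using xy(6) datum_facts(5) power_int_add[of t ?n "dord A p t y - ?n"]
      by (simp add: power_int_def)
    define c where "c = b' * a + b * (t ^ j * a')"
    have "b * b' * (x + y) = b' * (b * x) + b * (b' * y)" by (simp add: algebra_simps)
    also have "\<dots> = t powi ?n * c" unfolding c_def 1 2 m by (simp add: algebra_simps)
    finally have eq: "b * b' * (x + y) = t powi ?n * c" .
    have cA: "c \<in> A" unfolding c_def
      by (intro datum_facts(11,12)) (use 1 2 datum_pow_A in auto)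
    have bb: "b * b' \<in> A - p" using datum_facts(15)[OF 1(2) 2(2)] .
    then have c0: "c \<noteq> 0" using eq xy(5) datum_facts(16) by force
    have tn: "t powi ?n \<in> C" "t powi ?n \<noteq> 0"
    proof -
      have "t ^ j \<in> C" for j using datum_pow_A datum_facts(8) by blast
      then show "t powi ?n \<in> C" using Cinv[of "t ^ nat (- ?n)"]
        by (simp add: power_int_def power_inverse)
    qed (use datum_facts(5) in auto)
    have AC: "a \<in> A \<Longrightarrow> a \<in> C" for a using datum_facts(8) by blast
    have d0: "dord A p t (b * b') = 0" using dord_eqI[of "b * b'" 1 _ 0] bb datum_facts(1,3) by simp
    have dn: "dord A p t (t powi ?n) = ?n" using dord_eqI[of 1 1 _ ?n] datum_facts(1,3) by simp
    have "dord A p t (b * b') + dord A p t (x + y) = dord A p t (t powi ?n) + dord A p t c"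
      using dord_mult[of "b * b'" "x + y"] dord_mult[OF tn AC[OF cA] c0] eq bb AC[of "b * b'"] xy(5)
        datum_facts(16)[OF bb] Cadd[OF xy(1,3)] by simp
    then show ?thesis using d0 dn dord_nonneg[OF cA c0] by simp
  qed
  show ?thesis
    using *[OF assms] *[of y x] assms by (cases "dord A p t x \<le> dord A p t y") (auto simp: add.commute min_def)
qed

lemma dval_dord: "dval (dord A p t)"
proof -
  have "dord A p t c = 0" if c: "c \<in> k" "c \<noteq> 0" for c
  proof -
    have "c \<in> A" "inverse c \<in> A" using c kinv datum_facts(10) by auto
    then have "c \<in> A - p" using datum_facts(14)[of c "inverse c"] datum_facts(3) c(2) by auto
    then show ?thesis using dord_eqI[of c 1 c 0] datum_facts(1,3) by simp
  qed
  then show ?thesis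
    unfolding dval_def using dord_mult dord_add dord_t datum_facts(5,7) by (intro conjI ballI impI bexI[of _ t]) simp_all
qed

text \<open>\<open>V\<close> contains every element of nonnegative order, so an element of
  \<open>nonunits V\<close> of order at most 0 would have its inverse in \<open>V\<close>;
  conversely an element of positive order is a multiple of \<open>t\<close> by an element of
  \<open>V\<close>.\<close>

lemma nonunits_eq_vplace_dord:
  assumes V: "valuation_ring k (RC C) V" and AV: "A \<subseteq> V" and pV: "\<And>a. a \<in> A \<Longrightarrow> a \<in> nonunits V \<longleftrightarrow> a \<in> p"
  shows "nonunits V = vplace (dord A p t)"
proof -
  note V' = V[unfolded valuation_ring_RC subring_set_def]
  have Vm: "\<And>a b. a \<in> V \<Longrightarrow> b \<in> V \<Longrightarrow> a * b \<in> V" and VC: "V \<subseteq> C" using V' by auto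
  have unit: "inverse b \<in> V" "b \<noteq> 0" if "b \<in> A - p" for b
    using that pV[of b] AV datum_facts(16)[OF that] unfolding nonunits_def by auto
  have tV: "t ^ n \<in> V" for n using datum_pow_A AV by auto
  have sub: "z \<in> V" if z: "z \<in> C" "z \<noteq> 0" "dord A p t z \<ge> 0" for z
  proof -
    obtain a b where 1: "a \<in> A - p" "b \<in> A - p" "b * z = t powi (dord A p t z) * a"
      using dord_repr[OF z(1,2)] .
    have "z = inverse b * (t ^ nat (dord A p t z) * a)"
      using 1(3) z(3) unit(2)[OF 1(2)] by (simp add: power_int_def field_simps)
    then show ?thesis using Vm unit[OF 1(2)] tV 1(1) AV by (metis DiffD1 subsetD)
  qed
  have N: "x * a \<in> nonunits V" if "a \<in> nonunits V" "x \<in> V" for a x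
    using ideal.I_l_closed[OF nonunits_ideal[OF V], of a x] that by simp
  have dinv: "dord A p t (inverse z) = - dord A p t z" if "z \<in> C" "z \<noteq> 0" for z
    using dval_inverse[OF dval_dord that] .
  have 0: "0 \<in> nonunits V" using pV[of 0] datum_facts(2,9) by auto
  show ?thesis
  proof (intro equalityI subsetI)
    fix z assume z: "z \<in> nonunits V"
    then have zC: "z \<in> C" "z \<in> V" using VC unfolding nonunits_def by auto
    show "z \<in> vplace (dord A p t)"
    proof (rule ccontr)
      assume nz: "z \<notin> vplace (dord A p t)"
      then have "z \<noteq> 0" "dord A p t (inverse z) \<ge> 0" using zC dinv[of z] unfolding vplace_def by auto
      then have "inverse z \<in> V" using sub[of "inverse z"] Cinv zC by auto
      then show False using z \<open>z \<noteq> 0\<close> unfolding nonunits_def by auto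
    qed
  next
    fix z assume z: "z \<in> vplace (dord A p t)"
    show "z \<in> nonunits V"
    proof (cases "z = 0")
      case False
      have tC: "inverse t \<in> C" "inverse t \<noteq> 0" using datum_facts(5,7) Cinv by auto
      have zC: "z \<in> C" using z unfolding vplace_def by auto
      have "dord A p t (z * inverse t) = dord A p t z - 1"
        using dord_mult[OF zC False tC] dinv[OF datum_facts(7,5)] dord_t by simp
      then have "dord A p t (z * inverse t) \<ge> 0" using z False unfolding vplace_def by simp
      then have "z * inverse t \<in> V" using sub Cmult[OF zC tC(1)] False tC by simp
      moreover have "t \<in> nonunits V" using pV datum_facts(4,6) by simp
      ultimately have "(z * inverse t) * t \<in> nonunits V" using N by simp
      moreover have "(z * inverse t) * t = z" using datum_facts(5) by simp
      ultimately show ?thesis by metis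
    qed (use 0 in simp)
  qed
qed

end

end

section \<open>Affine quadratic charts \<open>w^2 = f\<close> and their primes\<close>

type_synonym 'b loc_index = "'b poly \<times> 'b poly option"

text \<open>The ring \<open>F_q[x] + F_q[x] w\<close> with \<open>w^2 = f\<close> squarefree, where
  \<open>\<iota>\<close> embeds the polynomials in \<open>x\<close>. It is instantiated twice, with
  \<open>x = y\<close> for the affine curve and with \<open>x = 1/y\<close> for a neighbourhood of
  infinity.\<close>

locale chart =
  fixes \<iota> :: "'a::{field,finite} poly \<Rightarrow> 'l::field" and w :: 'l and f :: "'a poly"
  assumes \<iota>_add: "\<iota> (p + q) = \<iota> p + \<iota> q" and \<iota>_mult: "\<iota> (p * q) = \<iota> p * \<iota> q"
    and \<iota>_1: "\<iota> 1 = 1" and \<iota>_inj: "\<iota> p = 0 \<Longrightarrow> p = 0"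
    and w2: "w * w = \<iota> f" and sqfree: "irreducible p \<Longrightarrow> \<not> p * p dvd f"
    and degf: "Polynomial.degree f > 0" and two: "(2::'a) \<noteq> 0"
begin

lemma \<iota>_0: "\<iota> 0 = 0" using \<iota>_add[of 0 0] by (metis add_0 add_cancel_right_right)
lemma \<iota>_uminus: "\<iota> (- p) = - \<iota> p" using \<iota>_add[of "- p" p] by (simp add: \<iota>_0 eq_neg_iff_add_eq_0)
lemma \<iota>_diff: "\<iota> (p - q) = \<iota> p - \<iota> q" using \<iota>_add[of p "- q"] by (simp add: \<iota>_uminus)
lemma \<iota>_power: "\<iota> (p ^ n) = \<iota> p ^ n" by (induction n) (simp_all add: \<iota>_1 \<iota>_mult)
lemma \<iota>_eq_0: "\<iota> p = 0 \<longleftrightarrow> p = 0" using \<iota>_inj[of p] by (auto simp: \<iota>_0)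
lemma \<iota>_eq: "\<iota> p = \<iota> q \<longleftrightarrow> p = q" using \<iota>_eq_0[of "p - q"] by (simp add: \<iota>_diff)

definition el :: "'a poly \<Rightarrow> 'a poly \<Rightarrow> 'l" where "el g h = \<iota> g + \<iota> h * w"
definition nrm :: "'a poly \<Rightarrow> 'a poly \<Rightarrow> 'a poly" where "nrm g h = g * g - h * h * f"
definition Oset :: "'l set" where "Oset = {el g h |g h. True}"
definition kset :: "'l set" where "kset = range (\<lambda>c. \<iota> [:c:])"
definition Cset :: "'l set" where "Cset = {z. \<exists>g h d. d \<noteq> 0 \<and> z * \<iota> d = el g h}"

lemma el_0: "el g 0 = \<iota> g" by (simp add: el_def \<iota>_0)
lemma el_w: "el 0 1 = w" by (simp add: el_def \<iota>_0 \<iota>_1)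
lemma el_add: "el g h + el g' h' = el (g + g') (h + h')" by (simp add: el_def \<iota>_add algebra_simps)
lemma el_uminus: "- el g h = el (- g) (- h)" by (simp add: el_def \<iota>_uminus)
lemma el_diff: "el g h - el g' h' = el (g - g') (h - h')" by (simp add: el_def \<iota>_diff algebra_simps)
lemma el_mult: "el g h * el g' h' = el (g * g' + h * h' * f) (g * h' + h * g')"
proof -
  have "el g h * el g' h' = \<iota> g * \<iota> g' + \<iota> h * \<iota> h' * (w * w) + (\<iota> g * \<iota> h' + \<iota> h * \<iota> g') * w"
    by (simp add: el_def algebra_simps)
  then show ?thesis by (simp add: el_def w2 \<iota>_add \<iota>_mult)
qed
lemma el_smult: "\<iota> c * el g h = el (c * g) (c * h)" by (simp add: el_def \<iota>_mult algebra_simps)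
lemma el_cj: "el g h * el g (- h) = \<iota> (nrm g h)" by (simp add: el_mult nrm_def flip: el_0)
lemma el_Oset: "el g h \<in> Oset" unfolding Oset_def by blast
lemma \<iota>_Oset: "\<iota> g \<in> Oset" using el_Oset[of g 0] by (simp add: el_0)

text \<open>\<open>f\<close> is not a square of a rational function: a prime divisor
  \<open>p\<close> of the squarefree \<open>f\<close> has even exponent in \<open>g * g\<close> and
  odd exponent in \<open>h * h * f\<close>.\<close>

lemma sqrt_f: assumes "g * g = h * h * f" shows "h = 0"
proof (rule ccontr)
  assume h: "h \<noteq> 0"
  obtain p where p: "irreducible p" "p dvd f" using exists_irreducible_factor[OF degf] by blast
  interpret irr_poly p by unfold_locales (rule p)
  obtain f' where f': "f = p * f'" using p(2) by (elim dvdE)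
  have nf': "\<not> p dvd f'" using sqfree[OF p(1)] unfolding f' using p0 by simp
  have g: "g \<noteq> 0" using assms h degf by (metis degree_0 less_irrefl mult_eq_0_iff)
  obtain a g' where g': "g = p ^ a * g'" "\<not> p dvd g'" using decomp[OF g] by blast
  obtain b h' where h': "h = p ^ b * h'" "\<not> p dvd h'" using decomp[OF h] by blast
  have "p ^ (2 * a) * (g' * g') = g * g" unfolding g' by (simp add: power_mult power2_eq_square power_mult_distrib)
  also have "\<dots> = p ^ (2 * b + 1) * (h' * h' * f')" unfolding assms unfolding h' f'
    by (simp add: power_mult power2_eq_square power_mult_distrib)
  finally have "2 * a = 2 * b + 1"
    by (rule decomp_unique) (simp_all add: prime_dvd_mult g' h' nf')
  then show False by presburger
qed

lemma nrm_eq_0: "nrm g h = 0 \<longleftrightarrow> g = 0 \<and> h = 0"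
  using sqrt_f[of g h] by (auto simp: nrm_def)

lemma el_eq_0: "el g h = 0 \<longleftrightarrow> g = 0 \<and> h = 0"
proof
  assume "el g h = 0"
  then have "\<iota> (nrm g h) = 0" using el_cj[of g h] by simp
  then show "g = 0 \<and> h = 0" using \<iota>_inj nrm_eq_0 by blast
qed (simp add: el_def \<iota>_0)

lemma el_eq: "el g h = el g' h' \<longleftrightarrow> g = g' \<and> h = h'"
  using el_eq_0[of "g - g'" "h - h'"] by (auto simp flip: el_diff)

lemma Cset_I: "d \<noteq> 0 \<Longrightarrow> z * \<iota> d = el g h \<Longrightarrow> z \<in> Cset" unfolding Cset_def by blast

lemma Cset_repr: assumes "z \<in> Cset" obtains g h d where "d \<noteq> 0" "z * \<iota> d = el g h" "z = el g h / \<iota> d"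
proof -
  obtain g h d where "d \<noteq> 0" "z * \<iota> d = el g h" using assms unfolding Cset_def by blast
  then show ?thesis using that[of d g h] \<iota>_eq_0[of d] by (simp add: field_simps)
qed

lemma Oset_Cset: "Oset \<subseteq> Cset"
proof
  fix z assume "z \<in> Oset"
  then obtain g h where "z = el g h" unfolding Oset_def by blast
  then show "z \<in> Cset" by (intro Cset_I[of 1 z g h]) (simp_all add: \<iota>_1)
qed

lemma kset_Oset: "kset \<subseteq> Oset" unfolding kset_def using \<iota>_Oset by blast

sublocale const_ext Cset kset
proof
  show "1 \<in> Cset" using \<iota>_Oset[of 1] Oset_Cset by (auto simp: \<iota>_1)
  show "kset \<subseteq> Cset" using kset_Oset Oset_Cset by blast
  show "1 \<in> kset" unfolding kset_def using \<iota>_1 by (auto intro!: image_eqI[of _ _ 1] simp: one_pCons)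
next
  fix a b assume "a \<in> Cset" "b \<in> Cset"
  then obtain g h d g' h' d' where 1: "d \<noteq> 0" "a * \<iota> d = el g h" and 2: "d' \<noteq> 0" "b * \<iota> d' = el g' h'"
    unfolding Cset_def by blast
  have "(a + b) * \<iota> (d * d') = \<iota> d' * (a * \<iota> d) + \<iota> d * (b * \<iota> d')" by (simp add: \<iota>_mult algebra_simps)
  also have "\<dots> = el (d' * g + d * g') (d' * h + d * h')" unfolding 1 2 by (simp add: el_smult el_add)
  finally show "a + b \<in> Cset" using Cset_I[of "d * d'"] 1 2 by simp
  have "(a * b) * \<iota> (d * d') = (a * \<iota> d) * (b * \<iota> d')" by (simp add: \<iota>_mult algebra_simps)
  also have "\<dots> = el (g * g' + h * h' * f) (g * h' + h * g')" unfolding 1 2 by (simp add: el_mult)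
  finally show "a * b \<in> Cset" using Cset_I[of "d * d'"] 1 2 by simp
next
  fix a assume "a \<in> Cset"
  then obtain g h d where 1: "d \<noteq> 0" "a * \<iota> d = el g h" unfolding Cset_def by blast
  have "(- a) * \<iota> d = el (- g) (- h)" using 1 by (simp flip: el_uminus)
  then show "- a \<in> Cset" using Cset_I[of d] 1 by simp
  show "inverse a \<in> Cset"
  proof (cases "a = 0")
    case True
    then show ?thesis using \<open>a \<in> Cset\<close> by simp
  next
    case False
    have d: "\<iota> d \<noteq> 0" using 1 \<iota>_eq_0 by simp
    then have "el g h \<noteq> 0" using 1 False by (metis mult_eq_0_iff)
    then have N: "nrm g h \<noteq> 0" by (simp add: nrm_eq_0 el_eq_0)
    \<comment> \<open>Rationalising the denominator: the conjugate \<open>el g (- h)\<close> times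
      \<open>el g h\<close> is the nonzero polynomial \<open>nrm g h\<close>.\<close>
    have "inverse a * \<iota> (nrm g h) = inverse a * (a * \<iota> d) * el g (- h)"
      unfolding el_cj[symmetric] 1(2) by simp
    also have "inverse a * (a * \<iota> d) = \<iota> d" using False by (simp flip: mult.assoc)
    also have "\<iota> d * el g (- h) = el (d * g) (d * (- h))" by (rule el_smult)
    finally show ?thesis using Cset_I[OF N] by blast
  qed
next
  fix a b assume "a \<in> kset" "b \<in> kset"
  then obtain c d where cd: "a = \<iota> [:c:]" "b = \<iota> [:d:]" unfolding kset_def by blast
  have "a + b = \<iota> [:c + d:]" "a * b = \<iota> [:c * d:]" unfolding cd by (simp_all add: mult.commute flip: \<iota>_add \<iota>_mult)
  then show "a + b \<in> kset" "a * b \<in> kset" unfolding kset_def by blast+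
next
  fix a assume "a \<in> kset"
  then obtain c where c: "a = \<iota> [:c:]" unfolding kset_def by blast
  have "- a = \<iota> [:- c:]" unfolding c by (simp flip: \<iota>_uminus)
  then show "- a \<in> kset" unfolding kset_def by blast
  have "inverse a = \<iota> [:inverse c:]"
  proof (cases "c = 0")
    case False
    then have "a * \<iota> [:inverse c:] = 1" unfolding c using \<iota>_1 by (simp flip: \<iota>_mult one_pCons)
    then show ?thesis by (rule inverse_unique)
  qed (simp add: c \<iota>_0)
  then show "inverse a \<in> kset" unfolding kset_def by blast
qed

lemma el_C: "el g h \<in> Cset" using el_Oset Oset_Cset by blast
lemma \<iota>_C: "\<iota> g \<in> Cset" using \<iota>_Oset Oset_Cset by blast
lemma w_C: "w \<in> Cset" using el_C[of 0 1] by (simp add: el_w)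
lemma subring_Oset: "subring_set Oset"
  unfolding subring_set_def
proof (intro conjI ballI)
  show "1 \<in> Oset" using \<iota>_Oset[of 1] by (simp add: \<iota>_1)
next
  fix a b assume "a \<in> Oset" "b \<in> Oset"
  then obtain g h g' h' where "a = el g h" "b = el g' h'" unfolding Oset_def by blast
  then show "a + b \<in> Oset" "a * b \<in> Oset" by (simp_all add: el_add el_mult el_Oset)
next
  fix a assume "a \<in> Oset"
  then obtain g h where "a = el g h" unfolding Oset_def by blast
  then show "- a \<in> Oset" by (simp add: el_uminus el_Oset)
qed

lemma card_kset: "finite kset" "card kset = CARD('a)"
  unfolding kset_def by (simp_all add: card_image inj_on_def \<iota>_eq)

text \<open>The primes of the quadratic order above a monic irreducible \<open>p\<close>:
  \<open>(p, None)\<close> is the inert prime generated by \<open>p\<close>, and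
  \<open>(p, Some v)\<close> is the kernel of reduction modulo \<open>p\<close> with
  \<open>w\<close> sent to the square root \<open>v\<close> of \<open>f\<close>. A split prime gives
  two indices, for \<open>v\<close> and \<open>- v\<close>; a ramified one has only
  \<open>v = 0\<close>.\<close>

definition pp :: "'a loc_index \<Rightarrow> 'l set" where
  "pp x = {el g h |g h. case snd x of None \<Rightarrow> fst x dvd g \<and> fst x dvd h | Some v \<Rightarrow> fst x dvd g + h * v}"
text \<open>A uniformiser: at a ramified prime \<open>p\<close> has value 2, so \<open>w\<close> is
  taken there; elsewhere \<open>p\<close> itself serves.\<close>

definition tt :: "'a loc_index \<Rightarrow> 'l" where "tt x = (if snd x = Some 0 then w else \<iota> (fst x))"
definition idx :: "'a loc_index set" where
  "idx = {x. irreducible (fst x) \<and> lead_coeff (fst x) = 1 \<and>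
     (case snd x of None \<Rightarrow> \<forall>v. \<not> fst x dvd f - v * v
      | Some v \<Rightarrow> (v = 0 \<or> Polynomial.degree v < Polynomial.degree (fst x)) \<and> fst x dvd f - v * v)}"
definition \<nu> :: "'a loc_index \<Rightarrow> 'l \<Rightarrow> int" where "\<nu> x = dord Oset (pp x) (tt x)"
definition pdeg :: "'a loc_index \<Rightarrow> nat" where
  "pdeg x = (if snd x = None then 2 else 1) * Polynomial.degree (fst x)"
definition ram :: "'a loc_index \<Rightarrow> nat" where "ram x = (if snd x = Some 0 then 2 else 1)"
definition \<sigma> :: "'a loc_index \<Rightarrow> 'a loc_index" where "\<sigma> x = (fst x, map_option uminus (snd x))"

lemma mem_pp: "el g h \<in> pp x \<longleftrightarrow>
    (case snd x of None \<Rightarrow> fst x dvd g \<and> fst x dvd h | Some v \<Rightarrow> fst x dvd g + h * v)"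
  unfolding pp_def by (auto simp: el_eq)
lemma mem_pp_None: "el g h \<in> pp (p, None) \<longleftrightarrow> p dvd g \<and> p dvd h"
  and mem_pp_Some: "el g h \<in> pp (p, Some v) \<longleftrightarrow> p dvd g + h * v"
  by (simp_all add: mem_pp)
lemma mem_pp_\<iota>: "\<iota> g \<in> pp x \<longleftrightarrow> fst x dvd g"
  using mem_pp[of g 0 x] by (simp add: el_0 split: option.splits)
lemma pp_Oset: "pp x \<subseteq> Oset" unfolding pp_def Oset_def by blast
lemma \<sigma>_\<sigma>: "\<sigma> (\<sigma> x) = x" by (cases x; cases "snd x") (auto simp: \<sigma>_def)
lemma pdeg_\<sigma>: "pdeg (\<sigma> x) = pdeg x" by (simp add: pdeg_def \<sigma>_def)
lemma mem_pp_\<sigma>: "el g (- h) \<in> pp (\<sigma> x) \<longleftrightarrow> el g h \<in> pp x"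
  by (cases "snd x") (simp_all add: mem_pp \<sigma>_def)

lemma \<sigma>_idx: "x \<in> idx \<Longrightarrow> \<sigma> x \<in> idx"
  by (cases "snd x") (simp_all add: idx_def \<sigma>_def)

text \<open>If \<open>p\<close> did not divide \<open>h\<close>, then \<open>g / h\<close> modulo
  \<open>p\<close> would be a square root of \<open>f\<close>.\<close>

lemma inert_dvd:
  assumes "irreducible p" "\<And>v. \<not> p dvd f - v * v" "p dvd nrm g h"
  shows "p dvd g \<and> p dvd h"
proof -
  interpret irr_poly p by unfold_locales (rule assms)
  have h: "p dvd h"
  proof (rule ccontr)
    assume "\<not> p dvd h"
    then obtain s where s: "p dvd s * h - 1" using inverse_mod by blast
    have "f - (s * g) * (s * g) = - (s * s * nrm g h) - f * (s * h + 1) * (s * h - 1)"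
      unfolding nrm_def by (simp add: algebra_simps)
    also have "p dvd - (s * s * nrm g h) - f * (s * h + 1) * (s * h - 1)"
      by (rule dvd_diff[OF _ dvd_mult[OF s]]) (simp add: dvd_mult[OF assms(3)])
    finally show False using assms(2) by blast
  qed
  have "g * g = nrm g h + h * h * f" unfolding nrm_def by simp
  then have "p dvd g * g" using h assms(3) by simp
  then show ?thesis using h prime_dvd_mult by blast
qed

text \<open>Substituting \<open>v\<close> for \<open>w\<close> is multiplicative up to a multiple of
  \<open>f - v * v\<close>; hence the membership test of \<open>pp\<close> respects
  products.\<close>

lemma Some_mult:
  "(a * g + b * h * f) + (a * h + b * g) * v = (a + b * v) * (g + h * v) + b * h * (f - v * v)"
  by (simp add: algebra_simps)

lemma nrm_mult: "nrm (a * g + b * h * f) (a * h + b * g) = nrm a b * nrm g h"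
  unfolding nrm_def by (simp add: algebra_simps)

lemma nrm_Some: "nrm g h = (g + h * v) * (g - h * v) - h * h * (f - v * v)"
  unfolding nrm_def by (simp add: algebra_simps)

lemma not_dvd_two: assumes "irreducible (p :: 'a poly)" shows "\<not> p dvd 2"
proof -
  have "(2 :: 'a poly) dvd 1"
    using two by (simp add: numeral_poly is_unit_iff_degree)
  then show ?thesis using assms dvd_unit_imp_unit[of p 2] Factorial_Ring.irreducible_not_unit[OF assms] by blast
qed

lemma ramified_f:
  assumes "irreducible p" "p dvd f"
  obtains f' where "f = p * f'" "\<not> p dvd f'"
proof -
  interpret irr_poly p by unfold_locales (rule assms)
  obtain f' where f': "f = p * f'" using assms(2) by (elim dvdE)
  moreover have "\<not> p dvd f'" using sqfree[OF assms(1)] p0 unfolding f' by simp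
  ultimately show ?thesis using that by blast
qed

lemma datum_decomp_Some:
  assumes p: "irreducible p" and v: "v = 0 \<or> Polynomial.degree v < Polynomial.degree p" "p dvd f - v * v"
    and z: "z \<in> Oset" "z \<noteq> 0"
  shows "\<exists>n. \<exists>a\<in>Oset - pp (p, Some v). \<exists>b\<in>Oset - pp (p, Some v). b * z = tt (p, Some v) ^ n * a"
proof -
  interpret irr_poly p by unfold_locales (rule p)
  obtain g h where z': "z = el g h" using z(1) unfolding Oset_def by blast
  then have "g \<noteq> 0 \<or> h \<noteq> 0" using z(2) el_eq_0 by simp
  then obtain c g' h' where gh: "g = p ^ c * g'" "h = p ^ c * h'" "\<not> (p dvd g' \<and> p dvd h')"
    using decomp2 by blast
  have zc: "z = \<iota> p ^ c * el g' h'" unfolding z' gh by (simp add: el_smult flip: \<iota>_power)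
  have const: "\<iota> g \<in> Oset - pp (p, Some v)" if "\<not> p dvd g" for g
    using that \<iota>_Oset mem_pp_\<iota>[of g "(p, Some v)"] by simp
  have mem: "el g h \<in> Oset - pp (p, Some v)" if "\<not> p dvd g + h * v" for g h
    using that el_Oset mem_pp_Some by simp
  have wit: ?thesis if "b * z = tt (p, Some v) ^ n * a" "a \<in> Oset - pp (p, Some v)" "b \<in> Oset - pp (p, Some v)"
    for n a b using that by blast
  show ?thesis
  proof (cases "v = 0")
    case False
    then have pv: "\<not> p dvd v" using v(1) dvd_small[of v] by auto
    have tt: "tt (p, Some v) = \<iota> p" using False by (simp add: tt_def)
    show ?thesis
    proof (cases "p dvd g' + h' * v")
      case False
      have "\<iota> 1 * z = tt (p, Some v) ^ c * el g' h'" unfolding tt zc \<iota>_1 by simp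
      then show ?thesis by (rule wit[OF _ mem[OF False] const[OF not_dvd_1]])
    next
      case True
      \<comment> \<open>Split prime with \<open>p\<close> dividing the value at \<open>v\<close>:
        the value at \<open>- v\<close> is then prime to \<open>p\<close>, since \<open>p\<close>
        divides neither 2 nor \<open>v\<close>, and not both of \<open>g'\<close>,
        \<open>h'\<close>. So the conjugate is a local unit, and multiplying by it turns
        \<open>z\<close> into a polynomial.\<close>
      have nd: "\<not> p dvd g' - h' * v"
      proof
        assume *: "p dvd g' - h' * v"
        have "p dvd 2 * g'" using dvd_add[OF True *] by simp
        moreover have "p dvd 2 * (h' * v)" using dvd_diff[OF True *] by simp
        ultimately show False using gh(3) pv not_dvd_two[OF p] by (simp add: prime_dvd_mult)
      qed
      have "nrm g' h' \<noteq> 0" using gh(3) nrm_eq_0[of g' h'] by auto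
      then obtain m N where N: "nrm g' h' = p ^ m * N" "\<not> p dvd N" using decomp by blast
      have "el g' (- h') * z = \<iota> p ^ c * \<iota> (nrm g' h')" unfolding zc el_cj[symmetric] by (simp add: mult_ac)
      also have "\<dots> = tt (p, Some v) ^ (c + m) * \<iota> N" unfolding N tt by (simp add: \<iota>_mult \<iota>_power power_add)
      finally show ?thesis by (rule wit[OF _ const[OF N(2)] mem]) (use nd in simp)
    qed
  next
    case True
    \<comment> \<open>Ramified prime: \<open>w^2 = p f'\<close> with \<open>f'\<close> a local unit,
      so \<open>p^c\<close> counts as \<open>w^(2c)\<close>, and one further factor \<open>w\<close>
      comes out when \<open>p\<close> divides \<open>g'\<close>.\<close>
    obtain f' where f': "f = p * f'" "\<not> p dvd f'" using ramified_f[OF p] v(2) True by auto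
    have tt: "tt (p, Some v) = w" using True by (simp add: tt_def)
    have ww: "w * w = \<iota> p * \<iota> f'" using w2 f' by (simp add: \<iota>_mult)
    have wc: "w ^ (2 * c) = \<iota> p ^ c * \<iota> f' ^ c" by (simp add: power_mult power2_eq_square ww power_mult_distrib)
    have fc: "\<not> p dvd f' ^ n" for n using f'(2) dvd_power[of f' n] by blast
    show ?thesis
    proof (cases "p dvd g'")
      case False
      have "\<iota> (f' ^ c) * z = tt (p, Some v) ^ (2 * c) * el g' h'"
        unfolding tt wc zc by (simp add: \<iota>_power mult_ac)
      moreover have "el g' h' \<in> Oset - pp (p, Some v)" using mem[of g' h'] False True by simp
      ultimately show ?thesis by (rule wit[OF _ _ const[OF fc]])
    next
      case pg: True
      then obtain g1 where g1: "g' = p * g1" by (elim dvdE)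
      have "\<iota> f' * el g' h' = w * el (f' * h') g1"
      proof -
        have "w * el (f' * h') g1 = \<iota> f' * \<iota> h' * w + \<iota> g1 * (w * w)"
          by (simp add: el_def \<iota>_mult algebra_simps)
        also have "\<dots> = \<iota> f' * el g' h'" unfolding ww g1 by (simp add: el_def \<iota>_mult algebra_simps)
        finally show ?thesis by simp
      qed
      then have "\<iota> (f' ^ Suc c) * z = tt (p, Some v) ^ (2 * c + 1) * el (f' * h') g1"
        unfolding tt zc using wc by (simp add: \<iota>_power \<iota>_mult mult_ac)
      moreover have "el (f' * h') g1 \<in> Oset - pp (p, Some v)"
        using mem[of "f' * h'" g1] True gh(3) pg f'(2) by (simp add: prime_dvd_mult)
      ultimately show ?thesis by (rule wit[OF _ _ const[OF fc]])
    qed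
  qed
qed

lemma datum_decomp_None:
  assumes p: "irreducible p" and z: "z \<in> Oset" "z \<noteq> 0"
  shows "\<exists>n. \<exists>a\<in>Oset - pp (p, None). \<exists>b\<in>Oset - pp (p, None). b * z = tt (p, None) ^ n * a"
proof -
  interpret irr_poly p by unfold_locales (rule p)
  obtain g h where z': "z = el g h" using z(1) unfolding Oset_def by blast
  then have "g \<noteq> 0 \<or> h \<noteq> 0" using z(2) el_eq_0 by simp
  then obtain c g' h' where gh: "g = p ^ c * g'" "h = p ^ c * h'" "\<not> (p dvd g' \<and> p dvd h')"
    using decomp2 by blast
  have "1 * z = tt (p, None) ^ c * el g' h'" unfolding z' gh by (simp add: tt_def el_smult flip: \<iota>_power)
  moreover have "el g' h' \<in> Oset - pp (p, None)" using gh(3) mem_pp_None el_Oset by simp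
  moreover have "1 \<in> Oset - pp (p, None)"
    using not_dvd_1 mem_pp_\<iota>[of 1 "(p, None)"] \<iota>_Oset[of 1] by (simp add: \<iota>_1)
  ultimately show ?thesis by blast
qed

lemma datum_idx: assumes x: "x \<in> idx" shows "datum Oset (pp x) (tt x)"
proof -
  obtain p s where ps: "x = (p, s)" by (cases x)
  have p: "irreducible p" using x ps by (simp add: idx_def)
  interpret irr_poly p by unfold_locales (rule p)
  have 1: "\<forall>z\<in>Cset. \<exists>a\<in>Oset. \<exists>b\<in>Oset - {0}. z * b = a"
  proof
    fix z assume "z \<in> Cset"
    then obtain g h d where "d \<noteq> 0" "z * \<iota> d = el g h" by (rule Cset_repr)
    then show "\<exists>a\<in>Oset. \<exists>b\<in>Oset - {0}. z * b = a"
      using el_Oset[of g h] \<iota>_Oset[of d] \<iota>_eq_0[of d] by blast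
  qed
  have 2: "\<forall>z\<in>pp x. \<forall>y\<in>Oset. y * z \<in> pp x"
  proof (intro ballI)
    fix z y assume z: "z \<in> pp x" and y: "y \<in> Oset"
    obtain g h where z': "z = el g h" using z pp_Oset[of x] unfolding Oset_def by blast
    obtain a b where y': "y = el a b" using y unfolding Oset_def by blast
    show "y * z \<in> pp x"
    proof (cases s)
      case None
      then show ?thesis using z unfolding z' y' el_mult ps by (simp add: mem_pp_None)
    next
      case (Some v)
      then have "p dvd f - v * v" using x ps by (simp add: idx_def)
      then show ?thesis using z Some unfolding z' y' el_mult ps by (simp add: mem_pp_Some Some_mult)
    qed
  qed
  have 3: "\<forall>z\<in>Oset - pp x. \<forall>y\<in>Oset - pp x. z * y \<in> Oset - pp x"
  proof (intro ballI)
    fix z y assume z: "z \<in> Oset - pp x" and y: "y \<in> Oset - pp x"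
    obtain a b where z': "z = el a b" using z unfolding Oset_def by blast
    obtain g h where y': "y = el g h" using y unfolding Oset_def by blast
    show "z * y \<in> Oset - pp x"
    proof (cases s)
      case None
      then have "\<And>v. \<not> p dvd f - v * v" using x ps by (simp add: idx_def)
      note in_d = inert_dvd[OF p this]
      show ?thesis
      proof (rule ccontr)
        assume "z * y \<notin> Oset - pp x"
        then have "p dvd a * g + b * h * f \<and> p dvd a * h + b * g"
          unfolding z' y' el_mult ps None by (simp add: el_Oset mem_pp_None)
        \<comment> \<open>Primality of the inert ideal goes through norms: \<open>p\<close> divides
          the norm of the product, hence one of the norms, hence by \<open>inert_dvd\<close> one of
          the factors.\<close>
        then have "p dvd nrm (a * g + b * h * f) (a * h + b * g)" by (simp add: nrm_def[of "a * g + b * h * f"])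
        then have "p dvd nrm a b \<or> p dvd nrm g h" unfolding nrm_mult prime_dvd_mult .
        then show False using in_d[of a b] in_d[of g h] z y unfolding z' y' ps None
          by (simp add: mem_pp_None) blast
      qed
    next
      case (Some v)
      then have "p dvd f - v * v" using x ps by (simp add: idx_def)
      then have "p dvd b * h * (f - v * v)" by simp
      then show ?thesis using z y Some unfolding z' y' el_mult ps
        by (simp add: mem_pp_Some Some_mult el_Oset prime_dvd_mult dvd_add_left_iff)
    qed
  qed
  have 4: "0 \<in> pp x" "1 \<notin> pp x" "tt x \<noteq> 0"
    using mem_pp_\<iota>[of 0 x] mem_pp_\<iota>[of 1 x] not_dvd_1 ps \<iota>_eq_0[of p] p0 el_eq_0[of 0 1]
    by (auto simp: \<iota>_0 \<iota>_1 tt_def el_w)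
  have 5: "tt x \<in> pp x"
  proof (cases "s = Some 0")
    case True
    then show ?thesis using mem_pp_Some[of 0 1 p 0] by (simp add: ps tt_def el_w)
  next
    case False
    then show ?thesis using mem_pp_\<iota>[of p x] by (simp add: ps tt_def)
  qed
  have 6: "\<forall>z\<in>Oset - {0}. \<exists>n. \<exists>a\<in>Oset - pp x. \<exists>b\<in>Oset - pp x. b * z = tt x ^ n * a"
  proof
    fix z assume z: "z \<in> Oset - {0}"
    show "\<exists>n. \<exists>a\<in>Oset - pp x. \<exists>b\<in>Oset - pp x. b * z = tt x ^ n * a"
    proof (cases s)
      case None
      then show ?thesis using datum_decomp_None[OF p] z unfolding ps by simp
    next
      case (Some v)
      then have "v = 0 \<or> Polynomial.degree v < Polynomial.degree p" "p dvd f - v * v"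
        using x ps by (simp_all add: idx_def)
      then show ?thesis using datum_decomp_Some[OF p] z Some unfolding ps by simp
    qed
  qed
  show ?thesis unfolding datum_def
    using subring_Oset kset_Oset Oset_Cset 1 pp_Oset 2 3 4 5 6 by (intro conjI) assumption+
qed

end

context chart
begin

lemma dval_\<nu>: "x \<in> idx \<Longrightarrow> dval (\<nu> x)"
  unfolding \<nu>_def by (rule dval_dord[OF datum_idx])

lemma \<nu>_mult: "x \<in> idx \<Longrightarrow> a \<in> Cset \<Longrightarrow> a \<noteq> 0 \<Longrightarrow> b \<in> Cset \<Longrightarrow> b \<noteq> 0 \<Longrightarrow> \<nu> x (a * b) = \<nu> x a + \<nu> x b"
  by (rule dval_mult[OF dval_\<nu>])
lemma \<nu>_add: "x \<in> idx \<Longrightarrow> a \<in> Cset \<Longrightarrow> a \<noteq> 0 \<Longrightarrow> b \<in> Cset \<Longrightarrow> b \<noteq> 0 \<Longrightarrow> a + b \<noteq> 0 \<Longrightarrow>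
    min (\<nu> x a) (\<nu> x b) \<le> \<nu> x (a + b)"
  by (rule dval_add[OF dval_\<nu>])
lemma \<nu>_uminus: "x \<in> idx \<Longrightarrow> a \<in> Cset \<Longrightarrow> a \<noteq> 0 \<Longrightarrow> \<nu> x (- a) = \<nu> x a"
  by (rule dval_uminus[OF dval_\<nu>])
lemma \<nu>_inverse: "x \<in> idx \<Longrightarrow> a \<in> Cset \<Longrightarrow> a \<noteq> 0 \<Longrightarrow> \<nu> x (inverse a) = - \<nu> x a"
  by (rule dval_inverse[OF dval_\<nu>])
lemma \<nu>_power: "x \<in> idx \<Longrightarrow> a \<in> Cset \<Longrightarrow> a \<noteq> 0 \<Longrightarrow> \<nu> x (a ^ n) = int n * \<nu> x a"
  using dval_power[OF dval_\<nu>] by blast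
lemma \<nu>_1: "x \<in> idx \<Longrightarrow> \<nu> x 1 = 0" by (rule dval_1[OF dval_\<nu>])

lemma \<nu>_nonneg: "x \<in> idx \<Longrightarrow> z \<in> Oset \<Longrightarrow> z \<noteq> 0 \<Longrightarrow> \<nu> x z \<ge> 0"
  unfolding \<nu>_def by (rule dord_nonneg[OF datum_idx])
lemma \<nu>_pos_iff: "x \<in> idx \<Longrightarrow> z \<in> Oset \<Longrightarrow> z \<noteq> 0 \<Longrightarrow> \<nu> x z > 0 \<longleftrightarrow> z \<in> pp x"
  unfolding \<nu>_def by (rule dord_pos_iff[OF datum_idx])
lemma \<nu>_unit: "x \<in> idx \<Longrightarrow> z \<in> Oset \<Longrightarrow> z \<notin> pp x \<Longrightarrow> \<nu> x z = 0"
  using \<nu>_nonneg[of x z] \<nu>_pos_iff[of x z] mem_pp_\<iota>[of 0 x] by (cases "z = 0") (auto simp: \<iota>_0)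

lemma monic_dvd_monic:
  fixes p p' :: "'a poly"
  assumes "irreducible p" "irreducible p'" "lead_coeff p = 1" "lead_coeff p' = 1" "p dvd p'"
  shows "p = p'"
proof -
  obtain c where c: "p' = p * c" using assms(5) by (elim dvdE)
  then have "c dvd 1" using Factorial_Ring.irreducibleD[OF assms(2) c] assms(1)
    by (auto simp: Factorial_Ring.irreducible_def)
  then obtain r where r: "c = [:r:]" using is_unit_polyE[of c] by metis
  then have "lead_coeff p' = lead_coeff p * r" unfolding c by (simp add: lead_coeff_mult)
  then have "r = 1" unfolding assms(3,4) by simp
  then show ?thesis using r c by simp
qed

text \<open>The value is the ramification index; at a ramified place it is 2 because
  \<open>w^2 = p f'\<close> with \<open>f'\<close> prime to \<open>p\<close>.\<close>

lemma \<nu>_prime: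
  assumes x: "x \<in> idx" and p: "irreducible p" "lead_coeff p = 1"
  shows "\<nu> x (\<iota> p) = (if fst x = p then int (ram x) else 0)"
proof -
  obtain p' s where ps: "x = (p', s)" by (cases x)
  have p': "irreducible p'" "lead_coeff p' = 1" using x ps by (simp_all add: idx_def)
  interpret irr_poly p' by unfold_locales (rule p')
  show ?thesis
  proof (cases "p' dvd p")
    case False
    then have "\<iota> p \<notin> pp x" using mem_pp_\<iota>[of p x] ps by simp
    then show ?thesis using \<nu>_unit[OF x \<iota>_Oset] False ps by auto
  next
    case True
    then have pe: "p' = p" using monic_dvd_monic[OF p'(1) p(1) p'(2) p(2)] by simp
    show ?thesis
    proof (cases "s = Some 0")
      case False
      then have "tt x = \<iota> p" using ps pe by (simp add: tt_def)
      then have "\<nu> x (\<iota> p) = 1" unfolding \<nu>_def using dord_t[OF datum_idx[OF x]] by simp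
      then show ?thesis using False ps pe by (simp add: ram_def)
    next
      case T: True
      then have "p' dvd f" using x ps by (simp add: idx_def)
      then obtain f' where f': "f = p' * f'" "\<not> p' dvd f'" using ramified_f[OF p'(1)] by blast
      have 1: "\<iota> f' \<in> Oset - pp x" "\<iota> 1 \<in> Oset - pp x"
        using mem_pp_\<iota>[of f' x] mem_pp_\<iota>[of 1 x] f'(2) ps not_dvd_1 \<iota>_Oset by simp_all
      have "\<iota> f' * \<iota> p = tt x powi 2 * \<iota> 1"
        using w2 T ps pe f'(1) by (simp add: tt_def \<iota>_1 \<iota>_mult power2_eq_square mult.commute)
      then have "\<nu> x (\<iota> p) = 2" unfolding \<nu>_def by (rule dord_eqI[OF datum_idx[OF x] 1(2,1)])
      then show ?thesis using T ps pe by (simp add: ram_def)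
    qed
  qed
qed

definition cj :: "'l \<Rightarrow> 'l" where "cj z = (THE y. \<exists>g h. z = el g h \<and> y = el g (- h))"

lemma cj_el: "cj (el g h) = el g (- h)"
  unfolding cj_def by (rule the_equality) (auto simp: el_eq)

lemma cj_mult: "a \<in> Oset \<Longrightarrow> b \<in> Oset \<Longrightarrow> cj (a * b) = cj a * cj b"
  unfolding Oset_def by (auto simp: el_mult cj_el el_eq)

lemma cj_power: "a \<in> Oset \<Longrightarrow> cj (a ^ n) = cj a ^ n \<and> a ^ n \<in> Oset"
proof (induction n)
  case 0
  then show ?case using cj_el[of 1 0] \<iota>_Oset[of 1] by (simp add: el_0 \<iota>_1)
next
  case (Suc n)
  then have "a * a ^ n \<in> Oset" using subring_Oset unfolding subring_set_def by blast
  then show ?case using Suc cj_mult[of a "a ^ n"] by simp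
qed

lemma cj_mem: "a \<in> Oset - pp x \<Longrightarrow> cj a \<in> Oset - pp (\<sigma> x)"
proof -
  assume a: "a \<in> Oset - pp x"
  then obtain g h where gh: "a = el g h" unfolding Oset_def by blast
  show ?thesis using a unfolding gh by (simp add: cj_el mem_pp_\<sigma> el_Oset)
qed

text \<open>Conjugation carries the relation \<open>b * z = t ^ n * a\<close> at \<open>x\<close>
  into one at \<open>\<sigma> x\<close>; the uniformiser is fixed, or changes sign when it is
  \<open>w\<close>.\<close>

lemma \<nu>_\<sigma>:
  assumes x: "x \<in> idx" and z: "el g h \<noteq> 0"
  shows "\<nu> (\<sigma> x) (el g (- h)) = \<nu> x (el g h)"
proof -
  obtain n a b where 1: "a \<in> Oset - pp x" "b \<in> Oset - pp x" "b * el g h = tt x ^ n * a"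
      "dord Oset (pp x) (tt x) (el g h) = int n"
    using dord_A_repr[OF datum_idx[OF x] el_Oset z] .
  have ttO: "tt x \<in> Oset" using \<iota>_Oset el_Oset[of 0 1] by (simp add: tt_def el_w)
  have cjt: "cj (tt x) = (if snd x = Some 0 then - tt (\<sigma> x) else tt (\<sigma> x))"
    using cj_el[of "fst x" 0] cj_el[of 0 1] el_uminus[of 0 1]
    by (cases "snd x") (auto simp: tt_def \<sigma>_def el_w el_0)
  \<comment> \<open>The sign picked up by \<open>w ^ n\<close> at a ramified place; -1 lies outside
    the prime, so the sign can be absorbed into \<open>cj a\<close>.\<close>
  define s :: 'l where "s = (if snd x = Some 0 then (- 1) ^ n else 1)"
  have st: "cj (tt x) ^ n = tt (\<sigma> x) ^ n * s" unfolding cjt s_def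
    by (simp add: power_minus[of "tt (\<sigma> x)"] mult.commute)
  have "s = 1 \<or> s = - 1" unfolding s_def by (cases "even n") auto
  then have s: "s * cj a \<in> Oset - pp (\<sigma> x)"
  proof
    assume "s = - 1"
    have "- 1 \<in> Oset - pp (\<sigma> x)"
      using datum_facts(1,3,13)[OF datum_idx[OF \<sigma>_idx[OF x]]]
        datum_facts(14)[OF datum_idx[OF \<sigma>_idx[OF x]], of "- 1" "- 1"] by auto
    then show ?thesis using datum_facts(15)[OF datum_idx[OF \<sigma>_idx[OF x]] _ cj_mem[OF 1(1)]] \<open>s = - 1\<close> by blast
  qed (use cj_mem[OF 1(1)] in simp)
  have "cj b * el g (- h) = cj (b * el g h)" using 1(2) by (simp add: cj_mult el_Oset cj_el)
  also have "\<dots> = cj (tt x) ^ n * cj a" unfolding 1(3) using cj_power[OF ttO, of n] 1(1) by (simp add: cj_mult)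
  finally have "cj b * el g (- h) = tt (\<sigma> x) powi int n * (s * cj a)" unfolding st by (simp add: mult.assoc)
  then have "\<nu> (\<sigma> x) (el g (- h)) = int n" unfolding \<nu>_def
    by (rule dord_eqI[OF datum_idx[OF \<sigma>_idx[OF x]] s cj_mem[OF 1(2)]])
  then show ?thesis using 1(4) unfolding \<nu>_def by simp
qed

lemma \<nu>_\<sigma>_\<iota>: "x \<in> idx \<Longrightarrow> g \<noteq> 0 \<Longrightarrow> \<nu> (\<sigma> x) (\<iota> g) = \<nu> x (\<iota> g)"
  using \<nu>_\<sigma>[of x g 0] by (simp add: el_0 \<iota>_eq_0)

text \<open>Membership in the maximal ideal may be tested after multiplying by a local unit, so
  denominators can be cleared.\<close>

lemma vplace_I:
  assumes x: "x \<in> idx" and z: "z \<in> Cset" "b \<in> Oset" "b \<notin> pp x" "b * z \<in> pp x"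
  shows "z \<in> vplace (\<nu> x)"
proof (cases "z = 0")
  case False
  have "0 \<in> pp x" using mem_pp_\<iota>[of 0 x] by (simp add: \<iota>_0)
  then have b: "b \<noteq> 0" using z by auto
  have "\<nu> x (b * z) = \<nu> x b + \<nu> x z" using \<nu>_mult[OF x] z b False Oset_Cset by blast
  moreover have "\<nu> x (b * z) > 0" using \<nu>_pos_iff[OF x, of "b * z"] z(4) pp_Oset[of x] b False by auto
  ultimately show ?thesis using \<nu>_unit[OF x z(2,3)] z unfolding vplace_def by simp
qed (simp add: vplace_def C0)

lemma vring_repr:
  assumes x: "x \<in> idx" and z: "z \<in> vring (\<nu> x)"
  obtains a b where "a \<in> Oset" "b \<in> Oset" "b \<notin> pp x" "b * z = a"
proof (cases "z = 0")
  case True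
  have "1 \<in> Oset" "1 \<notin> pp x" using datum_facts(1,3)[OF datum_idx[OF x]] by auto
  moreover have "0 \<in> Oset" using \<iota>_Oset[of 0] by (simp add: \<iota>_0)
  ultimately show ?thesis using that[of 0 1] True by simp
next
  case False
  have zC: "z \<in> Cset" "\<nu> x z \<ge> 0" using z False unfolding vring_def by auto
  obtain a b where 1: "a \<in> Oset - pp x" "b \<in> Oset - pp x" "b * z = tt x powi (\<nu> x z) * a"
    using dord_repr[OF datum_idx[OF x] zC(1) False] unfolding \<nu>_def by blast
  have "tt x powi (\<nu> x z) * a \<in> Oset"
    using datum_facts(12)[OF datum_idx[OF x] datum_pow_A[OF datum_idx[OF x], of "nat (\<nu> x z)"], of a] 1(1) zC(2)
    by (simp add: power_int_def)
  then show ?thesis using that[of "tt x powi (\<nu> x z) * a" b] 1 by blast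
qed

definition small :: "nat \<Rightarrow> 'a poly set" where "small n = {g. g = 0 \<or> Polynomial.degree g < n}"

lemma small_card: "finite (small n)" "card (small n) = CARD('a) ^ n"
  unfolding small_def using card_polys_degree_less by blast+

lemma small_diff: "g \<in> small n \<Longrightarrow> h \<in> small n \<Longrightarrow> g - h \<in> small n"
  unfolding small_def using degree_diff_less[of g n h] by (cases "n = 0") auto

lemma mod_small: "p \<noteq> 0 \<Longrightarrow> g mod p \<in> small (Polynomial.degree p)"
  unfolding small_def using degree_mod_less[of p g] by auto

text \<open>Representatives of the residue field: of \<open>F_q[x]/(p)\<close> at split and ramified
  primes, of its quadratic extension by \<open>w\<close> at inert ones.\<close>

definition reps :: "'a loc_index \<Rightarrow> 'l set" where
  "reps x = (if snd x = None then (\<lambda>(g, h). el g h) ` (small (Polynomial.degree (fst x)) \<times> small (Polynomial.degree (fst x)))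
     else \<iota> ` small (Polynomial.degree (fst x)))"

lemma card_reps: "finite (reps x)" "card (reps x) = CARD('a) ^ pdeg x"
proof -
  have "inj (\<lambda>(g, h). el g h)" by (rule injI) (auto simp: el_eq)
  then have "card ((\<lambda>(g, h). el g h) ` (A \<times> B)) = card A * card B" for A B
    using card_image[of "\<lambda>(g, h). el g h" "A \<times> B"] inj_on_subset by (simp add: card_cartesian_product) blast
  moreover have "card (\<iota> ` A) = card A" for A by (rule card_image) (auto simp: inj_on_def \<iota>_eq)
  ultimately show "card (reps x) = CARD('a) ^ pdeg x"
    unfolding reps_def pdeg_def by (simp add: small_card mult_2 power_add)
  show "finite (reps x)" unfolding reps_def by (simp add: small_card)
qed

lemma reps_vring: "x \<in> idx \<Longrightarrow> reps x \<subseteq> vring (\<nu> x)"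
  unfolding reps_def vring_def using \<nu>_nonneg[of x] el_Oset \<iota>_Oset el_C \<iota>_C by auto

text \<open>A denominator outside the prime has a reduction that is invertible modulo
  \<open>p\<close>, and the quotient of the reductions represents the class. In the inert case the
  denominator is first made a polynomial by multiplying with its conjugate.\<close>

lemma residue_exists:
  assumes x: "x \<in> idx" and z: "z \<in> vring (\<nu> x)"
  shows "\<exists>s\<in>reps x. z - s \<in> vplace (\<nu> x)"
proof -
  obtain p t where pt: "x = (p, t)" by (cases x)
  have p: "irreducible p" using x pt by (simp add: idx_def)
  interpret irr_poly p by unfold_locales (rule p)
  obtain a b where ab: "a \<in> Oset" "b \<in> Oset" "b \<notin> pp x" "b * z = a" using vring_repr[OF x z] .
  have zC: "z \<in> Cset" using z unfolding vring_def by auto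
  obtain a1 a2 where a: "a = el a1 a2" using ab(1) unfolding Oset_def by blast
  obtain b1 b2 where b: "b = el b1 b2" using ab(2) unfolding Oset_def by blast
  have md: "p dvd g - h * (r mod p)" if "p dvd g - h * r" for g h r
  proof -
    obtain q where q: "r mod p = r - q * p" using minus_div_mult_eq_mod[of r p] by metis
    have "g - h * (r mod p) = (g - h * r) + h * q * p" unfolding q by (simp add: algebra_simps)
    moreover have "p dvd (g - h * r) + h * q * p" by (rule dvd_add[OF that]) simp
    ultimately show ?thesis by metis
  qed
  show ?thesis
  proof (cases t)
    case (Some v)
    have nd: "\<not> p dvd b1 + b2 * v" using ab(3) unfolding b pt Some mem_pp_Some .
    obtain s where s: "p dvd s * (b1 + b2 * v) - 1" using inverse_mod[OF nd] by blast
    define g where "g = (s * (a1 + a2 * v)) mod p"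
    have "(a1 + a2 * v) - (b1 + b2 * v) * (s * (a1 + a2 * v)) = - (a1 + a2 * v) * (s * (b1 + b2 * v) - 1)"
      by (simp add: algebra_simps)
    then have "p dvd (a1 + a2 * v) - (b1 + b2 * v) * (s * (a1 + a2 * v))" using s by (simp add: dvd_mult)
    then have dv: "p dvd (a1 + a2 * v) - (b1 + b2 * v) * g" unfolding g_def by (rule md)
    have eq2: "b * (z - \<iota> g) = el (a1 - g * b1) (a2 - g * b2)"
      unfolding right_diff_distrib ab(4) a using el_smult[of g b1 b2] by (simp add: b mult.commute el_diff)
    have eq: "(a1 - g * b1) + (a2 - g * b2) * v = (a1 + a2 * v) - (b1 + b2 * v) * g"
      by (simp add: algebra_simps)
    have "b * (z - \<iota> g) \<in> pp x" unfolding eq2 pt Some mem_pp_Some eq by (rule dv)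
    then have "z - \<iota> g \<in> vplace (\<nu> x)" by (rule vplace_I[OF x Cdiff[OF zC \<iota>_C] ab(2,3)])
    moreover have "\<iota> g \<in> reps x" unfolding reps_def pt g_def using Some mod_small[OF p0] by simp
    ultimately show ?thesis by blast
  next
    case None
    then have inert: "\<And>v. \<not> p dvd f - v * v" using x pt by (simp add: idx_def)
    have nb: "\<not> (p dvd b1 \<and> p dvd b2)" using ab(3) unfolding b pt None mem_pp_None .
    define N where "N = nrm b1 b2"
    have nd: "\<not> p dvd N" unfolding N_def using inert_dvd[OF p inert] nb by blast
    have bN: "\<iota> N \<notin> pp x" using mem_pp_\<iota>[of N x] nd pt by simp
    obtain s where s: "p dvd s * N - 1" using inverse_mod[OF nd] by blast
    obtain c1 c2 where c: "a * el b1 (- b2) = el c1 c2" unfolding a el_mult by blast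
    have Nz: "\<iota> N * z = el c1 c2" unfolding N_def el_cj[symmetric] c[symmetric] using ab(4) unfolding b
      by (simp add: mult_ac)
    have dv: "p dvd c - N * ((s * c) mod p)" for c
    proof (rule md)
      have "c - N * (s * c) = - c * (s * N - 1)" by (simp add: algebra_simps)
      then show "p dvd c - N * (s * c)" using s by (simp add: dvd_mult)
    qed
    define g where "g = (s * c1) mod p"
    define h where "h = (s * c2) mod p"
    have "\<iota> N * (z - el g h) = el (c1 - N * g) (c2 - N * h)"
      unfolding right_diff_distrib Nz by (simp add: el_smult el_diff)
    then have "\<iota> N * (z - el g h) \<in> pp x" unfolding pt None g_def h_def using dv by (simp add: mem_pp_None)
    then have "z - el g h \<in> vplace (\<nu> x)" by (rule vplace_I[OF x Cdiff[OF zC el_C] \<iota>_Oset bN])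
    moreover have "el g h \<in> reps x"
      unfolding reps_def pt g_def h_def using None mod_small[OF p0] by auto
    ultimately show ?thesis by blast
  qed
qed

lemma vplace_Oset: "x \<in> idx \<Longrightarrow> z \<in> Oset \<Longrightarrow> z \<in> vplace (\<nu> x) \<longleftrightarrow> z \<in> pp x"
  unfolding vplace_def using \<nu>_pos_iff[of x z] Oset_Cset mem_pp_\<iota>[of 0 x] by (auto simp: \<iota>_0)

lemma residue_unique:
  assumes x: "x \<in> idx" and r: "r \<in> reps x" "s \<in> reps x" "r - s \<in> vplace (\<nu> x)"
  shows "r = s"
proof -
  obtain p t where pt: "x = (p, t)" by (cases x)
  have p: "irreducible p" using x pt by (simp add: idx_def)
  interpret irr_poly p by unfold_locales (rule p)
  have sm: "g = h" if "g \<in> small (Polynomial.degree p)" "h \<in> small (Polynomial.degree p)" "p dvd g - h" for g h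
    using small_diff[OF that(1,2)] dvd_small[OF that(3)] unfolding small_def by auto
  show ?thesis
  proof (cases t)
    case None
    obtain g h where r1: "r = el g h" "g \<in> small (Polynomial.degree p)" "h \<in> small (Polynomial.degree p)"
      using r(1) unfolding reps_def pt None by auto
    obtain g' h' where s1: "s = el g' h'" "g' \<in> small (Polynomial.degree p)" "h' \<in> small (Polynomial.degree p)"
      using r(2) unfolding reps_def pt None by auto
    have "el (g - g') (h - h') \<in> pp x" using r(3) vplace_Oset[OF x el_Oset] unfolding r1(1) s1(1) el_diff by simp
    then have "p dvd g - g'" "p dvd h - h'" unfolding pt None mem_pp_None by simp_all
    then show ?thesis using sm[OF r1(2) s1(2)] sm[OF r1(3) s1(3)] r1(1) s1(1) by simp
  next
    case (Some v)
    obtain g where r1: "r = \<iota> g" "g \<in> small (Polynomial.degree p)"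
      using r(1) unfolding reps_def pt Some by auto
    obtain g' where s1: "s = \<iota> g'" "g' \<in> small (Polynomial.degree p)"
      using r(2) unfolding reps_def pt Some by auto
    have "\<iota> (g - g') \<in> pp x" using r(3) vplace_Oset[OF x \<iota>_Oset] unfolding r1(1) s1(1) \<iota>_diff[symmetric] by blast
    then have "p dvd g - g'" unfolding mem_pp_\<iota> pt by simp
    then show ?thesis using sm[OF r1(2) s1(2)] r1(1) s1(1) by simp
  qed
qed

lemma place_degree_\<nu>:
  assumes x: "x \<in> idx"
  shows "place_degree kset (RC Cset) (vplace (\<nu> x)) = pdeg x"
proof (rule place_degree_vplace[OF dval_\<nu>[OF x] card_kset(1) reps_vring[OF x]])
  show "card (reps x) = card kset ^ pdeg x" using card_reps card_kset by simp
  fix z assume z: "z \<in> vring (\<nu> x)"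
  show "\<exists>!s. s \<in> reps x \<and> z - s \<in> vplace (\<nu> x)"
  proof (rule ex_ex1I)
    show "\<exists>s. s \<in> reps x \<and> z - s \<in> vplace (\<nu> x)" using residue_exists[OF x z] by blast
    fix r s assume rs: "r \<in> reps x \<and> z - r \<in> vplace (\<nu> x)" "s \<in> reps x \<and> z - s \<in> vplace (\<nu> x)"
    have M: "ideal (vplace (\<nu> x)) (RC (vring (\<nu> x)))"
      using nonunits_ideal[OF vring_valuation_ring[OF dval_\<nu>[OF x]]] nonunits_vring[OF dval_\<nu>[OF x]] by simp
    interpret M: ideal "vplace (\<nu> x)" "RC (vring (\<nu> x))" by (rule M)
    have mi: "- 1 \<in> vring (\<nu> x)" unfolding vring_def using \<nu>_uminus[OF x, of 1] \<nu>_1[OF x] Cuminus C1 by auto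
    have "- 1 * (z - r) \<in> vplace (\<nu> x)" using M.I_l_closed[of "z - r" "- 1"] rs mi by simp
    from additive_subgroup.a_closed[OF M.additive_subgroup_axioms conjunct2[OF rs(2)] this]
    have "r - s \<in> vplace (\<nu> x)" by simp
    then show "r = s" using residue_unique[OF x] rs by blast
  qed
qed

end

section \<open>Completeness of the list of affine places and the degree formula\<close>

context chart
begin

text \<open>Contracting the maximal ideal of \<open>V\<close> to the polynomials gives an
  irreducible \<open>p\<close>; whether \<open>f\<close> is a square modulo \<open>p\<close>, and to
  which root \<open>w\<close> reduces, then determines the index.\<close>

lemma vplace_classify:
  assumes V: "valuation_ring kset (RC Cset) V" and yV: "\<iota> [:0, 1:] \<in> V"
  shows "\<exists>x\<in>idx. nonunits V = vplace (\<nu> x)"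
proof -
  note V' = V[unfolded valuation_ring_RC subring_set_def]
  define N where "N = nonunits V"
  have Vm: "a * b \<in> V" and Va: "a + b \<in> V" if "a \<in> V" "b \<in> V" for a b using V' that by auto
  have Vu: "- a \<in> V" if "a \<in> V" for a using V' that by auto
  have kV: "kset \<subseteq> V" and VC: "V \<subset> Cset" using V' by auto
  have V1: "1 \<in> V" using V' by simp
  have dich: "z \<in> V \<or> inverse z \<in> V" if "z \<in> Cset" "z \<noteq> 0" for z using V' that by simp
  interpret Ni: ideal N "RC V" unfolding N_def by (rule nonunits_ideal[OF V])
  have NV: "N \<subseteq> V" unfolding N_def nonunits_def by auto
  have Nm: "x * a \<in> N" if "a \<in> N" "x \<in> V" for a x using Ni.I_l_closed[of a x] that by simp
  have Na: "a + b \<in> N" if "a \<in> N" "b \<in> N" for a b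
    using additive_subgroup.a_closed[OF Ni.additive_subgroup_axioms that] by simp
  have Nneg: "- a \<in> N" if "a \<in> N" for a using Nm[OF that Vu[OF V1]] by simp
  have Nd: "a - b \<in> N" if "a \<in> N" "b \<in> N" for a b using Na[OF that(1) Nneg[OF that(2)]] by simp
  have N1: "1 \<notin> N" using V1 unfolding N_def nonunits_def by simp
  have N0: "0 \<in> N" using Nd[of x x for x] additive_subgroup.zero_closed[OF Ni.additive_subgroup_axioms] by simp
  have unit: "a \<noteq> 0" "inverse a \<in> V" if "a \<in> V" "a \<notin> N" for a
    using that unfolding N_def nonunits_def by auto
  have prime: "a \<in> N \<or> b \<in> N" if "a * b \<in> N" "a \<in> V" "b \<in> V" for a b
  proof (rule ccontr)
    assume "\<not> (a \<in> N \<or> b \<in> N)"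
    then have u: "a \<noteq> 0" "inverse a \<in> V" "b \<notin> N" using unit[OF that(2)] by auto
    have "inverse a * (a * b) \<in> N" by (rule Nm[OF that(1) u(2)])
    then show False using u by (simp flip: mult.assoc)
  qed
  have \<iota>V: "\<iota> g \<in> V" for g
  proof (induction g)
    case 0
    then show ?case using N0 NV by (auto simp: \<iota>_0)
  next
    case (pCons a p)
    have "pCons a p = [:a:] + [:0, 1:] * p" by simp
    then have "\<iota> (pCons a p) = \<iota> [:a:] + \<iota> [:0, 1:] * \<iota> p" by (metis \<iota>_add \<iota>_mult)
    moreover have "\<iota> [:a:] \<in> V" using kV unfolding kset_def by auto
    ultimately show ?case using Va Vm yV pCons by simp
  qed
  \<comment> \<open>\<open>w\<close> is integral over the polynomials: were only its inverse in
    \<open>V\<close>, then \<open>w = f / w\<close> would lie in \<open>V\<close> after all.\<close>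
  have wV: "w \<in> V"
  proof (rule ccontr)
    assume nV: "w \<notin> V"
    have w0: "w \<noteq> 0" using el_eq_0[of 0 1] by (simp add: el_w)
    then have "inverse w \<in> V" using dich[OF w_C] nV by simp
    then have "\<iota> f * inverse w \<in> V" using \<iota>V Vm by simp
    moreover have "\<iota> f * inverse w = w" using w0 by (simp add: mult.assoc flip: w2)
    ultimately show False using nV by metis
  qed
  have elV: "el g h \<in> V" for g h unfolding el_def using Va Vm \<iota>V wV by simp
  have OV: "Oset \<subseteq> V" unfolding Oset_def using elV by blast
  \<comment> \<open>If no nonzero polynomial were a nonunit, all denominators would be invertible in
    \<open>V\<close> and \<open>V\<close> would be the whole field.\<close>
  have "\<exists>g. g \<noteq> 0 \<and> \<iota> g \<in> N"
  proof (rule ccontr)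
    assume *: "\<not> (\<exists>g. g \<noteq> 0 \<and> \<iota> g \<in> N)"
    have "z \<in> V" if zC: "z \<in> Cset" for z
    proof -
      obtain g h d where d: "d \<noteq> 0" "z * \<iota> d = el g h" "z = el g h / \<iota> d" using Cset_repr[OF zC] .
      have "inverse (\<iota> d) \<in> V" using unit(2)[OF \<iota>V, of d] * d by blast
      then show ?thesis unfolding d(3) using Vm elV by (simp add: divide_inverse)
    qed
    then show False using VC by blast
  qed
  then obtain g0 where g0: "g0 \<noteq> 0" "\<iota> g0 \<in> N" by blast
  have "\<exists>p. irreducible p \<and> lead_coeff p = 1 \<and> \<iota> p \<in> N"
    using g0
  proof (induction "Polynomial.degree g0" arbitrary: g0 rule: less_induct)
    case less
    show ?case
    proof (cases "Polynomial.degree g0 = 0")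
      case True
      then obtain c where c: "g0 = [:c:]" by (metis degree_eq_zeroE)
      then have c0: "c \<noteq> 0" using less.prems by auto
      have "\<iota> [:inverse c:] \<in> V" by (rule \<iota>V)
      then have "\<iota> [:inverse c:] * \<iota> g0 \<in> N" using Nm less.prems by simp
      moreover have "[:inverse c:] * g0 = 1" using c c0 by simp
      ultimately have "1 \<in> N" by (metis \<iota>_mult \<iota>_1)
      then show ?thesis using N1 by simp
    next
      case False
      then obtain p where p: "irreducible p" "lead_coeff p = 1" "p dvd g0"
        using exists_irreducible_factor[of g0] by auto
      then obtain h where h: "g0 = p * h" by (elim dvdE)
      then have h0: "h \<noteq> 0" "p \<noteq> 0" using less.prems by auto
      have "Polynomial.degree h < Polynomial.degree g0"
        unfolding h degree_mult_eq[OF h0(2,1)] using irreducible_field_poly_degree[OF p(1)] by simp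
      moreover have "\<iota> p \<in> N \<or> \<iota> h \<in> N" using prime[OF _ \<iota>V \<iota>V, of p h] less.prems unfolding h \<iota>_mult by blast
      ultimately show ?thesis using less.hyps[of h] h0 p by blast
    qed
  qed
  then obtain p where p: "irreducible p" "lead_coeff p = 1" "\<iota> p \<in> N" by blast
  interpret irr_poly p by unfold_locales (rule p)
  have mod_N: "\<iota> g \<in> N \<longleftrightarrow> p dvd g" for g
  proof
    assume "p dvd g"
    then obtain h where "g = p * h" by (elim dvdE)
    then show "\<iota> g \<in> N" using Nm[OF p(3) \<iota>V[of h]] by (simp add: \<iota>_mult mult.commute)
  next
    assume g: "\<iota> g \<in> N"
    show "p dvd g"
    proof (rule ccontr)
      assume "\<not> p dvd g"
      then obtain s where "p dvd s * g - 1" using inverse_mod by blast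
      then obtain r where r: "s * g - 1 = p * r" by (elim dvdE)
      have "1 = s * g - r * p" using r by (simp add: algebra_simps)
      then have "1 = \<iota> s * \<iota> g - \<iota> r * \<iota> p" by (metis \<iota>_1 \<iota>_diff \<iota>_mult)
      then show False using N1 Nd[OF Nm[OF g \<iota>V] Nm[OF p(3) \<iota>V]] by metis
    qed
  qed
  have "\<exists>x\<in>idx. \<forall>a\<in>Oset. a \<in> N \<longleftrightarrow> a \<in> pp x"
  proof (cases "\<exists>v. p dvd f - v * v")
    case True
    then obtain v where v: "p dvd f - v * v" by blast
    define v0 where "v0 = v mod p"
    obtain q where q: "v = v0 + q * p" unfolding v0_def by (metis mod_mult_div_eq add.commute mult.commute div_mult_mod_eq)
    have "f - v * v = (f - v0 * v0) - p * (q * (2 * v0 + q * p))" unfolding q by (simp add: algebra_simps)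
    then have v0: "p dvd f - v0 * v0" using v by (metis dvd_diff_left_iff dvd_triv_left)
    have v0s: "v0 = 0 \<or> Polynomial.degree v0 < Polynomial.degree p"
      using mod_small[OF p0, of v] unfolding v0_def small_def by simp
    \<comment> \<open>\<open>w - v0\<close> and \<open>w + v0\<close> multiply into the maximal
      ideal, so one of them lies in it; this picks the sign of the root.\<close>
    have "(w - \<iota> v0) * (w + \<iota> v0) = \<iota> (f - v0 * v0)" using w2 by (simp add: \<iota>_diff \<iota>_mult algebra_simps)
    then have "(w - \<iota> v0) * (w + \<iota> v0) \<in> N" using mod_N v0 by simp
    then have "w - \<iota> v0 \<in> N \<or> w + \<iota> v0 \<in> N"
      using prime Va Vu[OF \<iota>V[of v0]] \<iota>V wV by (metis add_uminus_conv_diff)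
    then obtain u where u: "w - \<iota> u \<in> N" "u = 0 \<or> Polynomial.degree u < Polynomial.degree p" "p dvd f - u * u"
    proof
      assume "w - \<iota> v0 \<in> N"
      then show ?thesis using that[of v0] v0 v0s by blast
    next
      assume "w + \<iota> v0 \<in> N"
      then show ?thesis using that[of "- v0"] v0 v0s by (simp add: \<iota>_uminus)
    qed
    have x: "(p, Some u) \<in> idx" unfolding idx_def using p u by simp
    have "el g h \<in> N \<longleftrightarrow> el g h \<in> pp (p, Some u)" for g h
    proof -
      have "\<iota> h * (w - \<iota> u) \<in> N" by (rule Nm[OF u(1) \<iota>V])
      moreover have "el g h = \<iota> (g + h * u) + \<iota> h * (w - \<iota> u)" by (simp add: el_def \<iota>_add \<iota>_mult algebra_simps)
      ultimately have "el g h \<in> N \<longleftrightarrow> \<iota> (g + h * u) \<in> N"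
        using Na[of "\<iota> (g + h * u)" "\<iota> h * (w - \<iota> u)"] Nd[of "el g h" "\<iota> h * (w - \<iota> u)"] by auto
      then show ?thesis by (simp add: mod_N mem_pp_Some)
    qed
    then show ?thesis using x unfolding Oset_def by blast
  next
    case False
    then have inert: "\<And>v. \<not> p dvd f - v * v" by blast
    have x: "(p, None) \<in> idx" unfolding idx_def using p inert by simp
    have "el g h \<in> N \<longleftrightarrow> el g h \<in> pp (p, None)" for g h
    proof
      assume "el g h \<in> N"
      then have "el g h * el g (- h) \<in> N" using Nm[of "el g h" "el g (- h)"] elV by (simp add: mult.commute)
      then have "p dvd nrm g h" unfolding el_cj mod_N .
      then show "el g h \<in> pp (p, None)" unfolding mem_pp_None by (rule inert_dvd[OF p(1) inert])
    next
      assume "el g h \<in> pp (p, None)"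
      then have "\<iota> g \<in> N" "\<iota> h \<in> N" unfolding mem_pp_None mod_N by simp_all
      then show "el g h \<in> N" unfolding el_def using Na Nm[OF _ wV, of "\<iota> h"] by (simp add: mult.commute)
    qed
    then show ?thesis using x unfolding Oset_def by blast
  qed
  then obtain x where x: "x \<in> idx" "\<And>a. a \<in> Oset \<Longrightarrow> a \<in> N \<longleftrightarrow> a \<in> pp x" by blast
  show ?thesis
    using nonunits_eq_vplace_dord[OF datum_idx[OF x(1)] V OV] x unfolding N_def \<nu>_def by blast
qed

text \<open>The polynomials in the prime determine \<open>p\<close>; the elements
  \<open>g + w\<close> in it then determine the root \<open>v\<close>, and there are none in the
  inert case.\<close>

lemma vplace_inj:
  assumes x: "x \<in> idx" and y: "y \<in> idx" and eq: "vplace (\<nu> x) = vplace (\<nu> y)"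
  shows "x = y"
proof -
  have pe: "a \<in> pp x \<longleftrightarrow> a \<in> pp y" if "a \<in> Oset" for a
    using vplace_Oset[OF x that] vplace_Oset[OF y that] eq by simp
  obtain p s where ps: "x = (p, s)" by (cases x)
  obtain p' s' where ps': "y = (p', s')" by (cases y)
  have irrs: "irreducible p" "lead_coeff p = 1" "irreducible p'" "lead_coeff p' = 1"
    using x y ps ps' by (simp_all add: idx_def)
  interpret irr_poly p by unfold_locales (rule irrs)
  have "p' dvd p" using pe[OF \<iota>_Oset[of p]] unfolding mem_pp_\<iota> ps ps' by simp
  then have pp': "p' = p" by (rule monic_dvd_monic[OF irrs(3,1,4,2)])
  have one: "el g 1 \<in> pp x \<longleftrightarrow> el g 1 \<in> pp y" for g using pe[OF el_Oset] .
  show ?thesis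
  proof (cases s)
    case None
    have "s' = None"
    proof (rule ccontr)
      assume "s' \<noteq> None"
      then obtain v where "s' = Some v" by blast
      then show False using one[of "- v"] not_dvd_1 unfolding ps ps' None by (simp add: mem_pp_None mem_pp_Some)
    qed
    then show ?thesis using ps ps' pp' None by simp
  next
    case (Some v)
    have "p dvd - v' + v" if "s' = Some v'" for v'
      using one[of "- v'"] unfolding ps ps' Some that pp' by (simp add: mem_pp_Some)
    moreover have "s' \<noteq> None"
      using one[of "- v"] not_dvd_1 unfolding ps ps' Some pp' by (cases s') (simp_all add: mem_pp_None mem_pp_Some)
    ultimately obtain v' where v': "s' = Some v'" "p dvd v - v'" by (metis add.commute add_uminus_conv_diff option.exhaust)
    have "v - v' \<in> small (Polynomial.degree p)"
      using x y unfolding ps ps' Some v' pp' idx_def by (intro small_diff) (simp_all add: small_def)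
    then have "v - v' = 0" using dvd_small[OF v'(2)] unfolding small_def by blast
    then show ?thesis using ps ps' pp' Some v' by simp
  qed
qed

lemma pp_dvd_nrm: assumes "x \<in> idx" "el g h \<in> pp x" shows "fst x dvd nrm g h"
proof (cases "snd x")
  case None
  then show ?thesis using assms(2) by (simp add: mem_pp nrm_def)
next
  case (Some v)
  then have "fst x dvd f - v * v" "fst x dvd g + h * v" using assms by (simp_all add: mem_pp idx_def)
  then show ?thesis unfolding nrm_Some[of g h v] by (simp add: dvd_mult dvd_mult2)
qed

lemma finite_idx_dvd: assumes "M \<noteq> 0" shows "finite {x \<in> idx. fst x dvd M}"
proof -
  let ?A = "small (Suc (Polynomial.degree M))"
  have "{x \<in> idx. fst x dvd M} \<subseteq> ?A \<times> insert None (Some ` ?A)"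
  proof
    fix x assume x: "x \<in> {x \<in> idx. fst x dvd M}"
    obtain p s where ps: "x = (p, s)" by (cases x)
    have "Polynomial.degree p \<le> Polynomial.degree M" using x ps dvd_imp_degree_le[OF _ assms] by simp
    then have "p \<in> ?A" "\<And>v. s = Some v \<Longrightarrow> v \<in> ?A" using x ps unfolding small_def idx_def by auto
    then show "x \<in> ?A \<times> insert None (Some ` ?A)" unfolding ps by (cases s) auto
  qed
  then show ?thesis by (rule finite_subset) (simp add: small_card)
qed

lemma finite_support_el: assumes "el g h \<noteq> 0" shows "finite {x \<in> idx. \<nu> x (el g h) \<noteq> 0}"
proof (rule finite_subset)
  show "{x \<in> idx. \<nu> x (el g h) \<noteq> 0} \<subseteq> {x \<in> idx. fst x dvd nrm g h}"
    using \<nu>_unit[OF _ el_Oset] pp_dvd_nrm by blast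
  show "finite {x \<in> idx. fst x dvd nrm g h}" using assms by (intro finite_idx_dvd) (simp add: nrm_eq_0 el_eq_0)
qed

lemma finite_support: assumes "z \<in> Cset" "z \<noteq> 0" shows "finite {x \<in> idx. \<nu> x z \<noteq> 0}"
proof -
  obtain g h d where d: "d \<noteq> 0" "z * \<iota> d = el g h" using Cset_repr[OF assms(1)] .
  have el0: "el g h \<noteq> 0" using d assms(2) by (metis \<iota>_eq_0 mult_eq_0_iff)
  have d0: "el d 0 \<noteq> 0" using d(1) by (simp add: el_eq_0)
  have "\<nu> x z = \<nu> x (el g h) - \<nu> x (el d 0)" if "x \<in> idx" for x
    using \<nu>_mult[OF that assms el_C d0] d(2) by (simp add: el_0)
  then have "{x \<in> idx. \<nu> x z \<noteq> 0} \<subseteq> {x \<in> idx. \<nu> x (el g h) \<noteq> 0} \<union> {x \<in> idx. \<nu> x (el d 0) \<noteq> 0}" by auto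
  then show ?thesis using finite_support_el[OF el0] finite_support_el[OF d0] by (meson finite_UnI finite_subset)
qed

text \<open>Ramification indices times residue degrees add up to the degree 2 of the extension, in
  each of the inert, ramified and split cases.\<close>

lemma sum_fiber:
  assumes p: "irreducible p" "lead_coeff p = 1"
  shows "finite {x \<in> idx. fst x = p} \<and> (\<Sum>x\<in>{x \<in> idx. fst x = p}. ram x * pdeg x) = 2 * Polynomial.degree p"
proof -
  interpret irr_poly p by unfold_locales (rule p)
  show ?thesis
  proof (cases "\<exists>v. p dvd f - v * v")
    case False
    then have "{x \<in> idx. fst x = p} = {(p, None)}"
      using p by (auto simp: idx_def split: option.splits)
    then show ?thesis by (simp add: ram_def pdeg_def)
  next
    case True
    then obtain v where v: "p dvd f - v * v" by blast
    define v0 where "v0 = v mod p"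
    obtain q where q: "v = v0 + q * p" unfolding v0_def by (metis mod_mult_div_eq add.commute mult.commute div_mult_mod_eq)
    have "f - v * v = (f - v0 * v0) - p * (q * (2 * v0 + q * p))" unfolding q by (simp add: algebra_simps)
    then have v0: "p dvd f - v0 * v0" using v by (metis dvd_diff_left_iff dvd_triv_left)
    have v0s: "v0 \<in> small (Polynomial.degree p)"
      using mod_small[OF p0, of v] unfolding v0_def by simp
    have uniq: "u = v0 \<or> u = - v0" if u: "u \<in> small (Polynomial.degree p)" "p dvd f - u * u" for u
    proof -
      have "(u - v0) * (u - (- v0)) = (f - v0 * v0) - (f - u * u)" by (simp add: algebra_simps)
      then have "p dvd (u - v0) * (u - (- v0))" using u(2) v0 by (metis dvd_diff)
      then have "p dvd u - v0 \<or> p dvd u - (- v0)" unfolding prime_dvd_mult .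
      moreover have "- v0 \<in> small (Polynomial.degree p)" using v0s unfolding small_def by simp
      ultimately show ?thesis
        using dvd_small small_diff[OF u(1)] v0s unfolding small_def by (metis (mono_tags, lifting) eq_iff_diff_eq_0 mem_Collect_eq)
    qed
    have fib: "{x \<in> idx. fst x = p} = {(p, Some v0), (p, Some (- v0))}"
    proof (intro equalityI subsetI)
      fix x assume x: "x \<in> {x \<in> idx. fst x = p}"
      then obtain s where s: "x = (p, s)" by (cases x) auto
      then obtain u where u: "s = Some u" using x True by (cases s) (auto simp: idx_def)
      then have "u \<in> small (Polynomial.degree p)" "p dvd f - u * u"
        using x s by (simp_all add: idx_def small_def)
      then show "x \<in> {(p, Some v0), (p, Some (- v0))}" using uniq s u by auto
    next
      fix x assume "x \<in> {(p, Some v0), (p, Some (- v0))}"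
      then show "x \<in> {x \<in> idx. fst x = p}" using p v0 v0s by (auto simp: idx_def small_def)
    qed
    show ?thesis
    proof (cases "v0 = 0")
      case True
      then show ?thesis unfolding fib by (simp add: ram_def pdeg_def)
    next
      case False
      have "(2 :: 'a poly) \<noteq> 0" using two by (simp add: numeral_poly)
      then have "v0 \<noteq> - v0" using False by (metis add_eq_0_iff mult_2 mult_eq_0_iff)
      then show ?thesis unfolding fib using False by (simp add: ram_def pdeg_def)
    qed
  qed
qed

text \<open>The degree of the part of the divisor of \<open>z\<close> that lies in this
  chart.\<close>

definition vsum :: "'l \<Rightarrow> int" where
  "vsum z = (\<Sum>x\<in>{x \<in> idx. \<nu> x z \<noteq> 0}. \<nu> x z * int (pdeg x))"

lemma vsum_eq: assumes "finite A" "{x \<in> idx. \<nu> x z \<noteq> 0} \<subseteq> A" "A \<subseteq> idx"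
  shows "vsum z = (\<Sum>x\<in>A. \<nu> x z * int (pdeg x))"
  unfolding vsum_def using assms by (intro sum.mono_neutral_left) auto

lemma vsum_mult:
  assumes a: "a \<in> Cset" "a \<noteq> 0" and b: "b \<in> Cset" "b \<noteq> 0"
  shows "vsum (a * b) = vsum a + vsum b"
proof -
  let ?A = "{x \<in> idx. \<nu> x a \<noteq> 0} \<union> {x \<in> idx. \<nu> x b \<noteq> 0}"
  have fin: "finite ?A" using finite_support a b by simp
  have ab: "\<nu> x (a * b) = \<nu> x a + \<nu> x b" if "x \<in> idx" for x using \<nu>_mult[OF that a b] .
  then have "{x \<in> idx. \<nu> x (a * b) \<noteq> 0} \<subseteq> ?A" by auto
  then have "vsum (a * b) = (\<Sum>x\<in>?A. \<nu> x (a * b) * int (pdeg x))" by (intro vsum_eq fin) auto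
  also have "\<dots> = (\<Sum>x\<in>?A. \<nu> x a * int (pdeg x) + \<nu> x b * int (pdeg x))"
    by (intro sum.cong) (auto simp: ab algebra_simps)
  also have "\<dots> = vsum a + vsum b"
    unfolding sum.distrib using vsum_eq[OF fin, of a] vsum_eq[OF fin, of b] by (simp add: Collect_mono subset_iff)
  finally show ?thesis .
qed

lemma vsum_prime: assumes p: "irreducible p" "lead_coeff p = 1" shows "vsum (\<iota> p) = 2 * int (Polynomial.degree p)"
proof -
  have *: "\<nu> x (\<iota> p) = (if fst x = p then int (ram x) else 0)" if "x \<in> idx" for x using \<nu>_prime[OF that p] .
  have "vsum (\<iota> p) = (\<Sum>x\<in>{x \<in> idx. fst x = p}. \<nu> x (\<iota> p) * int (pdeg x))"
    by (rule vsum_eq) (use sum_fiber[OF p] * in auto)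
  also have "\<dots> = (\<Sum>x\<in>{x \<in> idx. fst x = p}. int (ram x * pdeg x))" by (intro sum.cong) (auto simp: *)
  also have "\<dots> = int (\<Sum>x\<in>{x \<in> idx. fst x = p}. ram x * pdeg x)" by simp
  also have "\<dots> = int (2 * Polynomial.degree p)" using sum_fiber[OF p] by presburger
  finally show ?thesis by simp
qed

lemma vsum_\<iota>: "g \<noteq> 0 \<Longrightarrow> vsum (\<iota> g) = 2 * int (Polynomial.degree g)"
proof (induction "Polynomial.degree g" arbitrary: g rule: less_induct)
  case less
  show ?case
  proof (cases "Polynomial.degree g = 0")
    case True
    then obtain c where c: "g = [:c:]" by (metis degree_eq_zeroE)
    then have "\<iota> g \<in> kset" "\<iota> g \<noteq> 0" using less.prems \<iota>_eq_0 unfolding kset_def by auto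
    then have "\<nu> x (\<iota> g) = 0" if "x \<in> idx" for x using dval_const[OF dval_\<nu>[OF that]] by blast
    then have "{x \<in> idx. \<nu> x (\<iota> g) \<noteq> 0} = {}" by blast
    then have "vsum (\<iota> g) = 0" unfolding vsum_def by (simp only: sum.empty)
    then show ?thesis using True by simp
  next
    case False
    then obtain p where p: "irreducible p" "lead_coeff p = 1" "p dvd g"
      using exists_irreducible_factor[of g] by auto
    then obtain h where h: "g = p * h" by (elim dvdE)
    then have h0: "h \<noteq> 0" "p \<noteq> 0" using less.prems by auto
    have dg: "Polynomial.degree g = Polynomial.degree p + Polynomial.degree h"
      unfolding h degree_mult_eq[OF h0(2,1)] ..
    have "vsum (\<iota> g) = vsum (\<iota> p) + vsum (\<iota> h)"
      unfolding h \<iota>_mult by (rule vsum_mult) (use h0 \<iota>_C \<iota>_eq_0 in auto)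
    also have "vsum (\<iota> h) = 2 * int (Polynomial.degree h)"
      using less.hyps[of h] h0 dg irreducible_field_poly_degree[OF p(1)] by simp
    finally show ?thesis using vsum_prime[OF p(1,2)] dg by simp
  qed
qed

text \<open>An element and its conjugate have the same total degree, because \<open>\<sigma>\<close>
  permutes the places and preserves their degrees. Their product is the norm, whose total degree is
  twice its degree as a polynomial.\<close>

lemma vsum_el: assumes "el g h \<noteq> 0" shows "vsum (el g h) = int (Polynomial.degree (nrm g h))"
proof -
  have c0: "el g (- h) \<noteq> 0" and N: "nrm g h \<noteq> 0" using assms by (auto simp: el_eq_0 nrm_eq_0)
  have "vsum (el g (- h)) = vsum (el g h)" unfolding vsum_def
  proof (rule sum.reindex_bij_witness[of _ \<sigma> \<sigma>])
    fix x assume "x \<in> {x \<in> idx. \<nu> x (el g (- h)) \<noteq> 0}"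
    then have x: "x \<in> idx" "\<nu> x (el g (- h)) \<noteq> 0" by auto
    have e: "\<nu> (\<sigma> x) (el g h) = \<nu> x (el g (- h))" using \<nu>_\<sigma>[OF x(1) c0] by simp
    show "\<sigma> x \<in> {x \<in> idx. \<nu> x (el g h) \<noteq> 0}" using x \<sigma>_idx e by simp
    show "\<nu> (\<sigma> x) (el g h) * int (pdeg (\<sigma> x)) = \<nu> x (el g (- h)) * int (pdeg x)" using e pdeg_\<sigma> by simp
  next
    fix x assume "x \<in> {x \<in> idx. \<nu> x (el g h) \<noteq> 0}"
    then show "\<sigma> x \<in> {x \<in> idx. \<nu> x (el g (- h)) \<noteq> 0}" using \<sigma>_idx \<nu>_\<sigma>[OF _ assms] by simp
  qed (simp_all add: \<sigma>_\<sigma>)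
  then have "vsum (\<iota> (nrm g h)) = 2 * vsum (el g h)"
    unfolding el_cj[symmetric] using vsum_mult[OF el_C assms el_C c0] by simp
  then show ?thesis using vsum_\<iota>[OF N] by simp
qed

end

section \<open>The curve and its place at infinity\<close>

lemma square_dvd_pderiv: assumes "p * p dvd (f :: 'a::field poly)" shows "p dvd pderiv f"
proof -
  obtain r where r: "f = p * p * r" using assms by (elim dvdE)
  have "pderiv f = p * (p * pderiv r + 2 * (r * pderiv p))"
    unfolding r by (simp add: pderiv_mult algebra_simps)
  then show ?thesis by simp
qed

lemma const_not_dvd: assumes "irreducible (p :: 'a::field poly)" "c \<noteq> 0" shows "\<not> p dvd [:c:]"
proof
  assume "p dvd [:c:]"
  then have "Polynomial.degree p \<le> Polynomial.degree [:c:]" using assms by (intro dvd_imp_degree_le) simp_all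
  then show False using irreducible_field_poly_degree[OF assms(1)] by simp
qed

locale const_hom =
  fixes c :: "'a::{field,finite} \<Rightarrow> 'l::field"
  assumes c_add: "c (a + b) = c a + c b" and c_mult: "c (a * b) = c a * c b" and c_1: "c 1 = 1"
begin

definition ev :: "'l \<Rightarrow> 'a poly \<Rightarrow> 'l" where "ev t p = poly (map_poly c p) t"

lemma c_0: "c 0 = 0" using c_add[of 0 0] by (metis add_0 add_cancel_right_right)
lemma ev_0: "ev t 0 = 0" by (simp add: ev_def)
lemma ev_pCons: "ev t (pCons a p) = c a + t * ev t p" by (simp add: ev_def map_poly_pCons c_0)
lemma ev_1: "ev t 1 = 1" unfolding one_pCons by (simp add: ev_pCons ev_0 c_1)

lemma ev_add: "ev t (p + q) = ev t p + ev t q"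
  by (induction p q rule: poly_induct2) (simp_all add: ev_pCons ev_0 c_add algebra_simps)

lemma ev_smult: "ev t (Polynomial.smult a p) = c a * ev t p"
  by (induction p) (simp_all add: ev_pCons ev_0 c_mult algebra_simps)

lemma ev_mult: "ev t (p * q) = ev t p * ev t q"
  by (induction p) (simp_all add: ev_pCons ev_0 ev_add ev_smult c_0 algebra_simps)

lemma ev_monom: "ev t (Polynomial.monom a n) = c a * t ^ n"
  by (induction n) (simp_all add: Polynomial.monom_0 monom_Suc ev_pCons ev_0 c_0 algebra_simps)

end

locale curve = const_hom c for c :: "'a::{field,finite} \<Rightarrow> 'l::field" +
  fixes y w :: 'l and e :: 'a
  assumes transc: "poly (map_poly c p) y = 0 \<Longrightarrow> p = 0"
    and weq: "w * w = y ^ 5 + c e" and e0: "e \<noteq> 0" and two: "(2::'a) \<noteq> 0" and five: "(5::'a) \<noteq> 0"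
begin

lemma y0: "y \<noteq> 0" using transc[of "[:0, 1:]"] by (auto simp: map_poly_pCons c_0)

text \<open>\<open>f1\<close> is \<open>x^5 + e\<close> for the coordinate \<open>x = y\<close>.
  \<open>f2\<close> is \<open>x + e x^6\<close> for \<open>x = 1/y\<close> and
  \<open>w / y^3\<close>, obtained by dividing \<open>w^2 = y^5 + e\<close> by
  \<open>y^6\<close>.\<close>

definition f1 :: "'a poly" where "f1 = [:e:] + Polynomial.monom 1 5"
definition f2 :: "'a poly" where "f2 = [:0, 1:] + Polynomial.monom e 6"

lemma f1_coeffs: "f1 = [:e, 0, 0, 0, 0, 1:]"
  unfolding f1_def by (simp add: Polynomial.monom_altdef eval_nat_numeral)
lemma f2_coeffs: "f2 = [:0, 1, 0, 0, 0, 0, e:]"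
  unfolding f2_def by (simp add: Polynomial.monom_altdef eval_nat_numeral)
lemma X_dvd_f2: "[:0, 1:] dvd f2"
proof
  show "f2 = [:0, 1:] * [:1, 0, 0, 0, 0, e:]" unfolding f2_coeffs by simp
qed

lemma c_eq_0: "c a = 0 \<longleftrightarrow> a = 0"
proof
  assume "c a = 0"
  show "a = 0"
  proof (rule ccontr)
    assume "a \<noteq> 0"
    then have "c a * c (inverse a) = 1" unfolding c_mult[symmetric] by (simp add: c_1)
    then show False using \<open>c a = 0\<close> by simp
  qed
qed (simp add: c_0)

text \<open>Transcendence passes from \<open>y\<close> to \<open>1/y\<close> by reversing the
  coefficients.\<close>

lemma ev_inverse_inj: assumes "ev (inverse y) p = 0" shows "p = 0"
proof -
  let ?P = "map_poly c p"
  have "reflect_poly ?P = map_poly c (reflect_poly p)"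
    by (rule poly_eqI) (simp add: coeff_reflect_poly coeff_map_poly c_0 degree_map_poly c_eq_0)
  moreover have "poly (reflect_poly ?P) y = y ^ Polynomial.degree ?P * poly ?P (inverse y)"
    by (rule poly_reflect_poly_nz[OF y0])
  ultimately have "poly (map_poly c (reflect_poly p)) y = 0" using assms by (simp add: ev_def)
  then have "reflect_poly p = 0" by (rule transc)
  then show ?thesis by simp
qed

sublocale fin: chart "ev y" w f1
proof
  show "w * w = ev y f1" unfolding weq f1_def by (simp add: ev_add ev_pCons ev_0 ev_monom c_1)
  show "Polynomial.degree f1 > 0"
    unfolding f1_def by (subst degree_add_eq_right) (simp_all add: Polynomial.degree_monom_eq)
  show "\<not> p * p dvd f1" if p: "irreducible p" for p
  proof
    assume pf: "p * p dvd f1"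
    then have d: "p dvd f1" "p dvd pderiv f1" using dvd_mult_left square_dvd_pderiv by blast+
    \<comment> \<open>This combination of \<open>f1\<close> and its derivative is the nonzero
      constant \<open>5 e\<close>, so a repeated factor would divide a unit.\<close>
    have "Polynomial.smult 5 f1 - [:0, 1:] * pderiv f1 = [:5 * e:]"
      unfolding f1_coeffs by (simp add: pderiv_pCons)
    moreover have "p dvd Polynomial.smult 5 f1 - [:0, 1:] * pderiv f1"
      using d by (intro dvd_diff dvd_smult dvd_mult)
    ultimately show False using const_not_dvd[OF p, of "5 * e"] e0 five by simp
  qed
qed (simp_all add: ev_add ev_mult ev_1 two transc[folded ev_def])

lemma deg_f1: "Polynomial.degree f1 = 5"
  unfolding f1_def by (subst degree_add_eq_right) (simp_all add: Polynomial.degree_monom_eq)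

sublocale inf: chart "ev (inverse y)" "w / y ^ 3" f2
proof
  show "w / y ^ 3 * (w / y ^ 3) = ev (inverse y) f2"
  proof -
    have "w / y ^ 3 * (w / y ^ 3) = (w * w) / y ^ 6" by (simp flip: power_add)
    also have "\<dots> = inverse y + c e * inverse y ^ 6"
      unfolding weq using y0 by (simp add: field_simps eval_nat_numeral)
    finally show ?thesis unfolding f2_def by (simp add: ev_add ev_pCons ev_0 ev_monom c_1 c_0)
  qed
  show "Polynomial.degree f2 > 0"
  proof -
    have "Polynomial.degree f2 = 6"
      unfolding f2_def using e0 by (subst degree_add_eq_right) (simp_all add: Polynomial.degree_monom_eq)
    then show ?thesis by simp
  qed
  show "\<not> p * p dvd f2" if p: "irreducible p" for p
  proof
    assume pf: "p * p dvd f2"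
    then have d: "p dvd f2" "p dvd pderiv f2" using dvd_mult_left square_dvd_pderiv by blast+
    \<comment> \<open>A repeated factor divides \<open>5 x\<close>; but the derivative of
      \<open>f2\<close> is \<open>1 + 6 e x^5\<close>, which is then 1 modulo that factor.\<close>
    have "Polynomial.smult 6 f2 - [:0, 1:] * pderiv f2 = [:0, 5:]"
      unfolding f2_coeffs by (simp add: pderiv_pCons)
    moreover have "p dvd Polynomial.smult 6 f2 - [:0, 1:] * pderiv f2"
      using d by (intro dvd_diff dvd_smult dvd_mult)
    ultimately have p5: "p dvd [:0, 5:]" by simp
    have "pderiv f2 = 1 + [:0, 5:] * [:0, 0, 0, 0, 6 * e / 5:]"
      unfolding f2_coeffs using five by (simp add: pderiv_pCons one_pCons)
    then have "p dvd 1" using d(2) p5 by (metis dvd_add_left_iff dvd_mult2)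
    then show False using p by (simp add: Factorial_Ring.irreducible_def)
  qed
qed (simp_all add: ev_add ev_mult ev_1 two ev_inverse_inj)

lemma kset_eq: "fin.kset = range c" "inf.kset = range c"
  unfolding fin.kset_def inf.kset_def by (simp_all add: ev_pCons ev_0)

lemma y_C: "y \<in> fin.Cset" using fin.\<iota>_C[of "[:0, 1:]"] by (simp add: ev_pCons ev_0 c_0 c_1)
lemma y_inf: "inverse y \<in> inf.Cset" using inf.\<iota>_C[of "[:0, 1:]"] by (simp add: ev_pCons ev_0 c_0 c_1)

lemma ev_fin: "t \<in> fin.Cset \<Longrightarrow> ev t g \<in> fin.Cset"
proof (induction g)
  case (pCons a p)
  have "c a \<in> fin.Cset" using fin.kC kset_eq by auto
  then show ?case using fin.Cadd[OF _ fin.Cmult] pCons by (simp add: ev_pCons)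
qed (simp add: ev_0 fin.C0)

lemma ev_inf: "t \<in> inf.Cset \<Longrightarrow> ev t g \<in> inf.Cset"
proof (induction g)
  case (pCons a p)
  have "c a \<in> inf.Cset" using inf.kC kset_eq by auto
  then show ?case using inf.Cadd[OF _ inf.Cmult] pCons by (simp add: ev_pCons)
qed (simp add: ev_0 inf.C0)

lemma fin_pow: "t \<in> fin.Cset \<Longrightarrow> t ^ n \<in> fin.Cset" by (induction n) (simp_all add: fin.C1 fin.Cmult)
lemma inf_pow: "t \<in> inf.Cset \<Longrightarrow> t ^ n \<in> inf.Cset" by (induction n) (simp_all add: inf.C1 inf.Cmult)

lemma C_eq: "inf.Cset = fin.Cset"
proof (intro equalityI subsetI)
  fix z assume "z \<in> inf.Cset"
  then obtain g h d where z: "z = inf.el g h / ev (inverse y) d" by (rule inf.Cset_repr)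
  have ev: "ev (inverse y) p \<in> fin.Cset" for p by (rule ev_fin[OF fin.Cinv[OF y_C]])
  have "w / y ^ 3 \<in> fin.Cset" by (rule fin.Cdiv[OF fin.w_C fin_pow[OF y_C]])
  from fin.Cdiv[OF fin.Cadd[OF ev fin.Cmult[OF ev this]] ev]
  show "z \<in> fin.Cset" unfolding z inf.el_def .
next
  fix z assume "z \<in> fin.Cset"
  then obtain g h d where z: "z = fin.el g h / ev y d" by (rule fin.Cset_repr)
  have y: "y \<in> inf.Cset" using inf.Cinv[OF y_inf] by simp
  have "w / y ^ 3 * y ^ 3 \<in> inf.Cset" by (rule inf.Cmult[OF inf.w_C inf_pow[OF y]])
  then have "w \<in> inf.Cset" using y0 by simp
  from inf.Cdiv[OF inf.Cadd[OF ev_inf[OF y] inf.Cmult[OF ev_inf[OF y] this]] ev_inf[OF y]]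
  show "z \<in> inf.Cset" unfolding z fin.el_def .
qed

abbreviation "C \<equiv> fin.Cset"
abbreviation "k \<equiv> fin.kset"
abbreviation "K \<equiv> (ring_of_type_algebra\<lparr>carrier := fin.Cset\<rparr> :: 'l ring)"

lemma k_eq: "inf.kset = k" using kset_eq by simp

text \<open>The point at infinity: \<open>x = 1/y\<close> divides \<open>f2\<close>, so the prime
  above it is ramified and its root is 0.\<close>

definition xinf :: "'a loc_index" where "xinf = ([:0, 1:], Some 0)"
definition \<nu>inf :: "'l \<Rightarrow> int" where "\<nu>inf = inf.\<nu> xinf"
definition Pinf :: "'l set" where "Pinf = fin.vplace \<nu>inf"
definition Pl :: "'a loc_index \<Rightarrow> 'l set" where "Pl x = fin.vplace (fin.\<nu> x)"

lemma irr_X: "irreducible [:0, 1 :: 'a:]" by (rule irreducible_linear_field_poly) simp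

lemma xinf_idx: "xinf \<in> inf.idx"
  unfolding xinf_def inf.idx_def using irr_X X_dvd_f2 by simp

lemma dval_eq: "inf.dval = fin.dval" unfolding C_eq k_eq ..
lemma vplace_eq: "inf.vplace = fin.vplace" unfolding C_eq k_eq ..

lemma dval_inf: "fin.dval \<nu>inf" unfolding \<nu>inf_def using inf.dval_\<nu>[OF xinf_idx] unfolding dval_eq .

lemma xinf_unique: assumes "x \<in> inf.idx" "fst x dvd [:0, 1:]" shows "x = xinf"
proof -
  obtain p s where ps: "x = (p, s)" by (cases x)
  have "irreducible p" "lead_coeff p = 1" using assms(1) ps by (simp_all add: inf.idx_def)
  from inf.monic_dvd_monic[OF this(1) irr_X this(2)] have p: "p = [:0, 1:]" using assms(2) ps by simp
  note xf = X_dvd_f2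
  show ?thesis
  proof (cases s)
    case None
    then have "\<forall>v. \<not> p dvd f2 - v * v" using assms(1) unfolding ps inf.idx_def by simp
    from this[rule_format, of 0] show ?thesis using xf p by simp
  next
    case (Some v)
    then have v: "v = 0 \<or> Polynomial.degree v < 1" "p dvd f2 - v * v"
      using assms(1) unfolding ps inf.idx_def p by simp_all
    interpret irr_poly "[:0, 1 :: 'a:]" by unfold_locales (rule irr_X)
    have "[:0, 1:] dvd f2 - (f2 - v * v)" by (rule dvd_diff[OF xf v(2)[unfolded p]])
    then have "[:0, 1:] dvd v" by (simp add: prime_dvd_mult)
    then have "v = 0" using v(1) dvd_small[of v] by auto
    then show ?thesis using ps p Some by (simp add: xinf_def)
  qed
qed

text \<open>Either \<open>y\<close> lies in \<open>V\<close> and the affine chart applies, or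
  \<open>1/y\<close> is a nonunit of \<open>V\<close>, which then lies above \<open>x = 0\<close> in
  the chart at infinity, where there is a single ramified place.\<close>

lemma places_eq: "places k K = insert Pinf (Pl ` fin.idx)"
proof (intro equalityI subsetI)
  fix P assume "P \<in> places k K"
  then obtain V where V: "valuation_ring k K V" "P = fin.nonunits V" unfolding fin.places_RC by blast
  show "P \<in> insert Pinf (Pl ` fin.idx)"
  proof (cases "y \<in> V")
    case True
    then have "ev y [:0, 1:] \<in> V" by (simp add: ev_pCons ev_0 c_0 c_1)
    then show ?thesis using fin.vplace_classify[OF V(1)] V(2) unfolding Pl_def by blast
  next
    case False
    then have yi: "inverse y \<in> V" using V(1) y_C y0 unfolding fin.valuation_ring_RC by blast
    then have n: "inverse y \<in> fin.nonunits V" using False unfolding fin.nonunits_def by simp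
    have "valuation_ring inf.kset (inf.RC inf.Cset) V" using V(1) unfolding C_eq k_eq .
    moreover have "ev (inverse y) [:0, 1:] \<in> V" using yi by (simp add: ev_pCons ev_0 c_0 c_1)
    ultimately obtain x where x: "x \<in> inf.idx" "inf.nonunits V = inf.vplace (inf.\<nu> x)"
      using inf.vplace_classify by blast
    have "ev (inverse y) [:0, 1:] \<in> inf.vplace (inf.\<nu> x)"
      using n unfolding x(2)[symmetric] by (simp add: ev_pCons ev_0 c_0 c_1)
    then have "fst x dvd [:0, 1:]" unfolding inf.vplace_Oset[OF x(1) inf.\<iota>_Oset] inf.mem_pp_\<iota> .
    then have "x = xinf" using xinf_unique x(1) by simp
    then show ?thesis using x(2) V(2) unfolding Pinf_def \<nu>inf_def vplace_eq by simp
  qed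
next
  fix P assume "P \<in> insert Pinf (Pl ` fin.idx)"
  then consider "P = Pinf" | x where "x \<in> fin.idx" "P = Pl x" by blast
  then show "P \<in> places k K"
    using fin.vplace_places[OF dval_inf] fin.vplace_places[OF fin.dval_\<nu>]
    unfolding Pinf_def Pl_def by cases simp_all
qed

lemma ev_y_X: "ev t [:0, 1:] = t" by (simp add: ev_pCons ev_0 c_0 c_1)

lemma \<nu>inf_y: "\<nu>inf y = - 2"
proof -
  have "\<nu>inf (inverse y) = 2"
    using inf.\<nu>_prime[OF xinf_idx irr_X] unfolding \<nu>inf_def ev_y_X by (simp add: xinf_def inf.ram_def)
  then show ?thesis using fin.dval_inverse[OF dval_inf y_C y0] by simp
qed

lemma w0: "w \<noteq> 0" using fin.el_eq_0[of 0 1] by (simp add: fin.el_w)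

lemma \<nu>inf_w: "\<nu>inf w = - 5"
proof -
  have "inf.tt xinf = w / y ^ 3" by (simp add: inf.tt_def xinf_def)
  then have 1: "\<nu>inf (w / y ^ 3) = 1"
    unfolding \<nu>inf_def inf.\<nu>_def using inf.dord_t[OF inf.datum_idx[OF xinf_idx]] by simp
  have y3: "y ^ 3 \<in> C" "y ^ 3 \<noteq> 0" using fin_pow[OF y_C] y0 by auto
  have "\<nu>inf (w / y ^ 3 * y ^ 3) = \<nu>inf (w / y ^ 3) + \<nu>inf (y ^ 3)"
    by (rule fin.dval_mult[OF dval_inf]) (use fin.Cdiv[OF fin.w_C y3(1)] y3 w0 in auto)
  moreover have "w / y ^ 3 * y ^ 3 = w" using y0 by simp
  moreover have "\<nu>inf (y ^ 3) = 3 * \<nu>inf y" using fin.dval_power[OF dval_inf y_C y0, of 3] by simp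
  ultimately show ?thesis using 1 \<nu>inf_y by simp
qed

lemma dval_strict:
  assumes nu: "fin.dval \<nu>" and a: "a \<in> C" "a \<noteq> 0" and b: "b \<in> C" "b \<noteq> 0" and lt: "\<nu> a < \<nu> b"
  shows "\<nu> (a + b) = \<nu> a \<and> a + b \<noteq> 0"
proof -
  have nb: "- b \<in> C" "- b \<noteq> 0" "\<nu> (- b) = \<nu> b" using fin.dval_uminus[OF nu b] fin.Cuminus b by auto
  have ne: "a + b \<noteq> 0"
  proof
    assume "a + b = 0"
    then have "a = - b" by (simp add: eq_neg_iff_add_eq_0)
    then show False using lt nb by simp
  qed
  have "\<nu> a \<le> \<nu> (a + b)" using fin.dval_add[OF nu a b ne] lt by simp
  moreover have "min (\<nu> (a + b)) (\<nu> (- b)) \<le> \<nu> ((a + b) + (- b))"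
    by (rule fin.dval_add[OF nu fin.Cadd[OF a(1) b(1)] ne nb(1,2)]) (use a in simp)
  ultimately show ?thesis using lt nb ne by auto
qed

lemma \<nu>inf_\<iota>: "g \<noteq> 0 \<Longrightarrow> \<nu>inf (ev y g) = - 2 * int (Polynomial.degree g)"
proof (induction g)
  case (pCons a p)
  show ?case
  proof (cases "p = 0")
    case True
    then have "ev y (pCons a p) = c a" "c a \<in> k" "c a \<noteq> 0"
      using pCons.prems by (auto simp: ev_pCons ev_0 kset_eq c_eq_0)
    then show ?thesis using fin.dval_const[OF dval_inf] True by simp
  next
    case False
    have p: "ev y p \<in> C" "ev y p \<noteq> 0" using fin.\<iota>_C fin.\<iota>_eq_0 False by auto
    have m: "\<nu>inf (y * ev y p) = - 2 * int (Polynomial.degree (pCons a p))"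
      using fin.dval_mult[OF dval_inf y_C y0 p] \<nu>inf_y pCons.IH False by simp
    have yp: "y * ev y p \<in> C" "y * ev y p \<noteq> 0" using fin.Cmult y_C p y0 by auto
    show ?thesis
    proof (cases "a = 0")
      case True
      then show ?thesis using m by (simp add: ev_pCons c_0)
    next
      case a: False
      have ca: "c a \<in> k" "c a \<noteq> 0" "c a \<in> C" using a fin.kC kset_eq by (auto simp: c_eq_0)
      have "\<nu>inf (c a) = 0" using fin.dval_const[OF dval_inf ca(1,2)] .
      then have "\<nu>inf (y * ev y p + c a) = \<nu>inf (y * ev y p)"
        using dval_strict[OF dval_inf yp ca(3,2)] m False by simp
      then show ?thesis using m by (simp add: ev_pCons add.commute)
    qed
  qed
qed simp

text \<open>For nonzero \<open>g\<close>, \<open>h\<close> the pole orders at infinity of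
  \<open>g\<close> and \<open>h w\<close> are \<open>2 deg g\<close> and \<open>2 deg h + 5\<close>.
  Their parities differ, so nothing cancels and the pole order of the sum is the degree of the
  norm.\<close>

lemma deg_nrm: assumes "g \<noteq> 0 \<or> h \<noteq> 0"
  shows "\<nu>inf (fin.el g h) = - int (Polynomial.degree (fin.nrm g h))"
    "h \<noteq> 0 \<Longrightarrow> Polynomial.degree (fin.nrm g h) \<ge> 2 * Polynomial.degree h + 5"
    "g \<noteq> 0 \<Longrightarrow> Polynomial.degree (fin.nrm g h) \<ge> 2 * Polynomial.degree g"
    "Polynomial.degree (fin.nrm g h) \<le> max (2 * Polynomial.degree g) (2 * Polynomial.degree h + 5)"
proof -
  have f1n: "f1 \<noteq> 0" using deg_f1 by auto
  have hw: "ev y h * w \<in> C \<and> ev y h * w \<noteq> 0 \<and> \<nu>inf (ev y h * w) = - 2 * int (Polynomial.degree h) - 5 \<and>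
      Polynomial.degree (h * h * f1) = 2 * Polynomial.degree h + 5" if "h \<noteq> 0"
    using that fin.dval_mult[OF dval_inf fin.\<iota>_C _ fin.w_C w0, of h] \<nu>inf_\<iota>[OF that] \<nu>inf_w w0
      fin.Cmult[OF fin.\<iota>_C fin.w_C] fin.\<iota>_eq_0[of h] f1n deg_f1
    by (simp add: degree_mult_eq)
  have gg: "ev y g \<in> C \<and> ev y g \<noteq> 0 \<and> \<nu>inf (ev y g) = - 2 * int (Polynomial.degree g) \<and>
      Polynomial.degree (g * g) = 2 * Polynomial.degree g" if "g \<noteq> 0"
    using that \<nu>inf_\<iota>[OF that] fin.\<iota>_eq_0[of g] fin.\<iota>_C[of g] by (simp add: degree_mult_eq)
  have "\<nu>inf (fin.el g h) = - int (Polynomial.degree (fin.nrm g h)) \<and>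
    (h \<noteq> 0 \<longrightarrow> Polynomial.degree (fin.nrm g h) \<ge> 2 * Polynomial.degree h + 5) \<and>
    (g \<noteq> 0 \<longrightarrow> Polynomial.degree (fin.nrm g h) \<ge> 2 * Polynomial.degree g) \<and>
    Polynomial.degree (fin.nrm g h) \<le> max (2 * Polynomial.degree g) (2 * Polynomial.degree h + 5)"
  proof (cases "g = 0 \<or> h = 0")
    case True
    then show ?thesis using assms hw gg by (auto simp: fin.el_def ev_0 fin.nrm_def)
  next
    case False
    have "2 * Polynomial.degree g \<noteq> 2 * Polynomial.degree h + 5" by presburger
    then consider "2 * Polynomial.degree g < 2 * Polynomial.degree h + 5"
      | "2 * Polynomial.degree h + 5 < 2 * Polynomial.degree g" by linarith
    then show ?thesis
    proof cases
      case 1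
      then have "\<nu>inf (ev y h * w + ev y g) = \<nu>inf (ev y h * w)"
        using dval_strict[OF dval_inf, of "ev y h * w" "ev y g"] hw gg False by simp
      moreover have "Polynomial.degree (fin.nrm g h) = 2 * Polynomial.degree h + 5"
        unfolding fin.nrm_def using 1 hw gg False degree_add_eq_right[of "g * g" "- (h * h * f1)"] by simp
      ultimately show ?thesis using hw False 1 by (simp add: fin.el_def add.commute)
    next
      case 2
      then have "\<nu>inf (ev y g + ev y h * w) = \<nu>inf (ev y g)"
        using dval_strict[OF dval_inf, of "ev y g" "ev y h * w"] hw gg False by simp
      moreover have "Polynomial.degree (fin.nrm g h) = 2 * Polynomial.degree g"
        unfolding fin.nrm_def using 2 hw gg False degree_add_eq_left[of "- (h * h * f1)" "g * g"] by simp
      ultimately show ?thesis using gg False 2 by (simp add: fin.el_def)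
    qed
  qed
  then show "\<nu>inf (fin.el g h) = - int (Polynomial.degree (fin.nrm g h))"
    "h \<noteq> 0 \<Longrightarrow> Polynomial.degree (fin.nrm g h) \<ge> 2 * Polynomial.degree h + 5"
    "g \<noteq> 0 \<Longrightarrow> Polynomial.degree (fin.nrm g h) \<ge> 2 * Polynomial.degree g"
    "Polynomial.degree (fin.nrm g h) \<le> max (2 * Polynomial.degree g) (2 * Polynomial.degree h + 5)"
    by blast+
qed

text \<open>Principal divisors have degree zero: write \<open>z\<close> as a quotient; for numerator
  and denominator the affine degree and the pole order at infinity are both the degree of the
  norm.\<close>

lemma product_formula: assumes z: "z \<in> C" "z \<noteq> 0" shows "fin.vsum z + \<nu>inf z = 0"
proof -
  obtain g h d where d: "d \<noteq> 0" "z * ev y d = fin.el g h" using fin.Cset_repr[OF z(1)] by metis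
  have d0: "ev y d \<in> C" "ev y d \<noteq> 0" using fin.\<iota>_C fin.\<iota>_eq_0 d by auto
  have el0: "fin.el g h \<noteq> 0" using d(2) d0 z by (metis mult_eq_0_iff)
  then have gh: "g \<noteq> 0 \<or> h \<noteq> 0" by (simp add: fin.el_eq_0)
  have "fin.vsum z + fin.vsum (ev y d) = fin.vsum (fin.el g h)"
    using fin.vsum_mult[OF z d0] d(2) by simp
  moreover have "\<nu>inf z + \<nu>inf (ev y d) = \<nu>inf (fin.el g h)"
    using fin.dval_mult[OF dval_inf z d0] d(2) by simp
  ultimately show ?thesis
    using deg_nrm(1)[OF gh] fin.vsum_el[OF el0] fin.vsum_\<iota>[OF d(1)] \<nu>inf_\<iota>[OF d(1)] by simp
qed

lemma Pinf_ne: assumes x: "x \<in> fin.idx" shows "Pinf \<noteq> Pl x"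
proof
  assume eq: "Pinf = Pl x"
  have "\<nu>inf (inverse y) = 2" using \<nu>inf_y fin.dval_inverse[OF dval_inf y_C y0] by simp
  then have "inverse y \<in> Pinf" unfolding Pinf_def fin.vplace_def using fin.Cinv[OF y_C] by simp
  then have "fin.\<nu> x (inverse y) > 0" using y0 unfolding eq Pl_def fin.vplace_def by simp
  moreover have "fin.\<nu> x y \<ge> 0" using fin.\<nu>_nonneg[OF x fin.\<iota>_Oset[of "[:0, 1:]"]] y0 unfolding ev_y_X by simp
  ultimately show False using fin.\<nu>_inverse[OF x y_C y0] by simp
qed

lemma Pl_inj: "inj_on Pl fin.idx"
  unfolding Pl_def using fin.vplace_inj by (rule inj_onI)

lemma place_val_Pl: "x \<in> fin.idx \<Longrightarrow> z \<in> C \<Longrightarrow> z \<noteq> 0 \<Longrightarrow> place_val K (Pl x) z = fin.\<nu> x z"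
  unfolding Pl_def by (rule fin.place_val_vplace[OF fin.dval_\<nu>])
lemma place_val_Pinf: "z \<in> C \<Longrightarrow> z \<noteq> 0 \<Longrightarrow> place_val K Pinf z = \<nu>inf z"
  unfolding Pinf_def by (rule fin.place_val_vplace[OF dval_inf])
lemma place_degree_Pl: "x \<in> fin.idx \<Longrightarrow> place_degree k K (Pl x) = fin.pdeg x"
  unfolding Pl_def by (rule fin.place_degree_\<nu>)
lemma place_degree_Pinf: "place_degree k K Pinf = 1"
proof -
  have "place_degree k K Pinf = inf.pdeg xinf"
    using inf.place_degree_\<nu>[OF xinf_idx] unfolding Pinf_def \<nu>inf_def vplace_eq C_eq k_eq .
  then show ?thesis by (simp add: inf.pdeg_def xinf_def)
qed

end

section \<open>Divisor classes and Mumford representatives\<close>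

context curve
begin

definition fs :: "('a loc_index \<Rightarrow> int) \<Rightarrow> bool" where "fs E \<longleftrightarrow> finite {x \<in> fin.idx. E x \<noteq> 0}"
definition edeg :: "('a loc_index \<Rightarrow> int) \<Rightarrow> int" where
  "edeg E = (\<Sum>x\<in>{x \<in> fin.idx. E x \<noteq> 0}. E x * int (fin.pdeg x))"
text \<open>Completes affine coefficients to a divisor of degree zero; the coefficient at infinity
  is forced, and it is an integer because that place has degree 1.\<close>

definition mk :: "('a loc_index \<Rightarrow> int) \<Rightarrow> 'l set \<Rightarrow>\<^sub>0 int" where
  "mk E = Abs_poly_mapping (\<lambda>Q. if Q = Pinf then - edeg E
     else if Q \<in> Pl ` fin.idx then E (the_inv_into fin.idx Pl Q) else 0)"

lemma edeg_eq: assumes "finite A" "{x \<in> fin.idx. E x \<noteq> 0} \<subseteq> A" "A \<subseteq> fin.idx"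
  shows "edeg E = (\<Sum>x\<in>A. E x * int (fin.pdeg x))"
  unfolding edeg_def using assms by (intro sum.mono_neutral_left) auto

lemma fs_add: assumes "fs E" "fs F" shows "fs (\<lambda>x. E x + F x)"
proof -
  have "{x \<in> fin.idx. E x + F x \<noteq> 0} \<subseteq> {x \<in> fin.idx. E x \<noteq> 0} \<union> {x \<in> fin.idx. F x \<noteq> 0}"
  proof
    fix x assume "x \<in> {x \<in> fin.idx. E x + F x \<noteq> 0}"
    then show "x \<in> {x \<in> fin.idx. E x \<noteq> 0} \<union> {x \<in> fin.idx. F x \<noteq> 0}" by (cases "E x = 0") simp_all
  qed
  then show ?thesis using assms unfolding fs_def by (meson finite_UnI finite_subset)
qed

lemma fs_uminus: "fs E \<Longrightarrow> fs (\<lambda>x. - E x)" unfolding fs_def by simp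

lemma edeg_uminus: "edeg (\<lambda>x. - E x) = - edeg E"
  unfolding edeg_def by (simp add: sum_negf)

lemma edeg_add: assumes "fs E" "fs F" shows "edeg (\<lambda>x. E x + F x) = edeg E + edeg F"
proof -
  let ?A = "{x \<in> fin.idx. E x \<noteq> 0} \<union> {x \<in> fin.idx. F x \<noteq> 0}"
  have fin: "finite ?A" using assms unfolding fs_def by simp
  have "edeg (\<lambda>x. E x + F x) = (\<Sum>x\<in>?A. (E x + F x) * int (fin.pdeg x))" by (rule edeg_eq[OF fin]) auto
  also have "\<dots> = (\<Sum>x\<in>?A. E x * int (fin.pdeg x)) + (\<Sum>x\<in>?A. F x * int (fin.pdeg x))"
    by (simp add: sum.distrib algebra_simps)
  also have "\<dots> = edeg E + edeg F" using edeg_eq[OF fin, of E] edeg_eq[OF fin, of F] by (simp add: subset_iff)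
  finally show ?thesis .
qed

lemma fs_\<nu>: "z \<in> C \<Longrightarrow> z \<noteq> 0 \<Longrightarrow> fs (\<lambda>x. fin.\<nu> x z)" unfolding fs_def by (rule fin.finite_support)

lemma edeg_\<nu>: "edeg (\<lambda>x. fin.\<nu> x z) = fin.vsum z" unfolding edeg_def fin.vsum_def ..

lemma edeg_cong: "(\<And>x. x \<in> fin.idx \<Longrightarrow> E x = F x) \<Longrightarrow> edeg E = edeg F"
  unfolding edeg_def by (rule sum.cong) auto

lemma lookup_mk_fun:
  assumes "fs E"
  shows "Poly_Mapping.lookup (mk E) = (\<lambda>Q. if Q = Pinf then - edeg E
     else if Q \<in> Pl ` fin.idx then E (the_inv_into fin.idx Pl Q) else 0)"
proof -
  define \<phi> where "\<phi> = (\<lambda>Q. if Q = Pinf then - edeg E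
     else if Q \<in> Pl ` fin.idx then E (the_inv_into fin.idx Pl Q) else 0)"
  have "{Q. \<phi> Q \<noteq> 0} \<subseteq> insert Pinf (Pl ` {x \<in> fin.idx. E x \<noteq> 0})"
  proof
    fix Q assume "Q \<in> {Q. \<phi> Q \<noteq> 0}"
    then have Q: "\<phi> Q \<noteq> 0" by simp
    show "Q \<in> insert Pinf (Pl ` {x \<in> fin.idx. E x \<noteq> 0})"
    proof (cases "Q = Pinf")
      case False
      then have "Q \<in> Pl ` fin.idx" using Q unfolding \<phi>_def by metis
      then obtain x where x: "x \<in> fin.idx" "Q = Pl x" by blast
      then have "\<phi> Q = E x" using False the_inv_into_f_f[OF Pl_inj x(1)] unfolding \<phi>_def by simp
      then show ?thesis using x Q by simp
    qed simp
  qed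
  moreover have "finite (insert Pinf (Pl ` {x \<in> fin.idx. E x \<noteq> 0}))"
    using assms unfolding fs_def by simp
  ultimately have "finite {Q. \<phi> Q \<noteq> 0}" by (rule finite_subset)
  then show ?thesis unfolding mk_def \<phi>_def[symmetric] by (rule Abs_poly_mapping_inverse[OF CollectI])
qed

lemma lookup_mk:
  assumes "fs E"
  shows "x \<in> fin.idx \<Longrightarrow> Poly_Mapping.lookup (mk E) (Pl x) = E x"
    and "Poly_Mapping.lookup (mk E) Pinf = - edeg E"
    and "Poly_Mapping.keys (mk E) \<subseteq> places k K"
proof -
  show "Poly_Mapping.lookup (mk E) (Pl x) = E x" if "x \<in> fin.idx"
    unfolding lookup_mk_fun[OF assms] using that Pinf_ne[OF that] the_inv_into_f_f[OF Pl_inj that] by simp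
  show "Poly_Mapping.lookup (mk E) Pinf = - edeg E" unfolding lookup_mk_fun[OF assms] by simp
  show "Poly_Mapping.keys (mk E) \<subseteq> places k K"
  proof
    fix Q assume "Q \<in> Poly_Mapping.keys (mk E)"
    then have "Poly_Mapping.lookup (mk E) Q \<noteq> 0" by (simp add: in_keys_iff)
    then show "Q \<in> places k K" unfolding places_eq lookup_mk_fun[OF assms] by (metis insertCI)
  qed
qed

lemma fs_lookup: "fs (\<lambda>x. Poly_Mapping.lookup D (Pl x))"
proof -
  have "Pl ` {x \<in> fin.idx. Poly_Mapping.lookup D (Pl x) \<noteq> 0} \<subseteq> Poly_Mapping.keys D"
    by (simp add: in_keys_iff image_subset_iff)
  then have "finite (Pl ` {x \<in> fin.idx. Poly_Mapping.lookup D (Pl x) \<noteq> 0})"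
    by (rule finite_subset) simp
  then show ?thesis unfolding fs_def
    by (rule finite_imageD) (rule inj_on_subset[OF Pl_inj], simp)
qed

lemma divisor_degree_eq:
  assumes "Poly_Mapping.keys D \<subseteq> places k K"
  shows "divisor_degree k K D = edeg (\<lambda>x. Poly_Mapping.lookup D (Pl x)) + Poly_Mapping.lookup D Pinf"
proof -
  let ?S = "{x \<in> fin.idx. Poly_Mapping.lookup D (Pl x) \<noteq> 0}"
  have fin: "finite ?S" using fs_lookup unfolding fs_def .
  have ninf: "Pinf \<notin> Pl ` ?S" using Pinf_ne by blast
  have sub: "Poly_Mapping.keys D \<subseteq> insert Pinf (Pl ` ?S)"
  proof
    fix Q assume Q: "Q \<in> Poly_Mapping.keys D"
    then have "Q = Pinf \<or> (\<exists>x\<in>fin.idx. Q = Pl x)" using assms unfolding places_eq by blast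
    then show "Q \<in> insert Pinf (Pl ` ?S)" using Q by (elim disjE bexE) (simp_all add: in_keys_iff)
  qed
  have "divisor_degree k K D = (\<Sum>P\<in>insert Pinf (Pl ` ?S). Poly_Mapping.lookup D P * int (place_degree k K P))"
    unfolding divisor_degree_def using fin sub
    by (intro sum.mono_neutral_left) (simp_all add: in_keys_iff)
  also have "\<dots> = Poly_Mapping.lookup D Pinf +
      (\<Sum>P\<in>Pl ` ?S. Poly_Mapping.lookup D P * int (place_degree k K P))"
    using fin ninf by (simp add: place_degree_Pinf)
  also have "(\<Sum>P\<in>Pl ` ?S. Poly_Mapping.lookup D P * int (place_degree k K P)) =
      (\<Sum>x\<in>?S. Poly_Mapping.lookup D (Pl x) * int (place_degree k K (Pl x)))"
    by (rule sum.reindex[unfolded o_def]) (rule inj_on_subset[OF Pl_inj], simp)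
  also have "\<dots> = edeg (\<lambda>x. Poly_Mapping.lookup D (Pl x))"
    unfolding edeg_def by (intro sum.cong) (simp_all add: place_degree_Pl)
  finally show ?thesis by simp
qed

abbreviation "Prin \<equiv> principal_divisors k K"
abbreviation "DG \<equiv> divisors_deg0 k K"

lemma Prin_iff: "D \<in> Prin \<longleftrightarrow> Poly_Mapping.keys D \<subseteq> places k K \<and>
    (\<exists>z\<in>C - {0}. (\<forall>x\<in>fin.idx. Poly_Mapping.lookup D (Pl x) = fin.\<nu> x z) \<and> Poly_Mapping.lookup D Pinf = \<nu>inf z)"
proof -
  have "(\<forall>P\<in>places k K. Poly_Mapping.lookup D P = place_val K P z) \<longleftrightarrow>
    (\<forall>x\<in>fin.idx. Poly_Mapping.lookup D (Pl x) = fin.\<nu> x z) \<and> Poly_Mapping.lookup D Pinf = \<nu>inf z"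
    if z: "z \<in> C - {0}" for z
    unfolding places_eq using z by (simp add: place_val_Pl place_val_Pinf conj_commute)
  then show ?thesis unfolding principal_divisors_def by simp
qed

lemma DG_carrier: "D \<in> carrier DG \<longleftrightarrow> Poly_Mapping.keys D \<subseteq> places k K \<and> divisor_degree k K D = 0"
  unfolding divisors_deg0_def Let_def by simp
lemma DG_mult: "D \<otimes>\<^bsub>DG\<^esub> D' = D + D'"
  unfolding divisors_deg0_def Let_def free_Abelian_group_def by simp

lemma Prin_group:
  "0 \<in> Prin" "D \<in> Prin \<Longrightarrow> D' \<in> Prin \<Longrightarrow> D + D' \<in> Prin" "D \<in> Prin \<Longrightarrow> - D \<in> Prin"
proof -
  show "0 \<in> Prin" unfolding Prin_iff
    using fin.dval_1[OF dval_inf] fin.C1 by (intro conjI bexI[of _ 1]) (simp_all add: fin.\<nu>_1)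
next
  assume "D \<in> Prin" "D' \<in> Prin"
  then obtain z z' where z: "Poly_Mapping.keys D \<subseteq> places k K" "z \<in> C - {0}"
      "\<forall>x\<in>fin.idx. Poly_Mapping.lookup D (Pl x) = fin.\<nu> x z" "Poly_Mapping.lookup D Pinf = \<nu>inf z"
    and z': "Poly_Mapping.keys D' \<subseteq> places k K" "z' \<in> C - {0}"
      "\<forall>x\<in>fin.idx. Poly_Mapping.lookup D' (Pl x) = fin.\<nu> x z'" "Poly_Mapping.lookup D' Pinf = \<nu>inf z'"
    unfolding Prin_iff by blast
  have "Poly_Mapping.keys (D + D') \<subseteq> places k K" using Poly_Mapping.keys_add[of D D'] z(1) z'(1) by blast
  moreover have "z * z' \<in> C - {0}" using z z' fin.Cmult by simp
  ultimately show "D + D' \<in> Prin" unfolding Prin_iff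
    using z z' fin.\<nu>_mult[of _ z z'] fin.dval_mult[OF dval_inf, of z z']
    by (intro conjI bexI[of _ "z * z'"]) (simp_all add: lookup_add)
next
  assume "D \<in> Prin"
  then obtain z where z: "Poly_Mapping.keys D \<subseteq> places k K" "z \<in> C - {0}"
      "\<forall>x\<in>fin.idx. Poly_Mapping.lookup D (Pl x) = fin.\<nu> x z" "Poly_Mapping.lookup D Pinf = \<nu>inf z"
    unfolding Prin_iff by blast
  have "inverse z \<in> C - {0}" using z fin.Cinv by simp
  then show "- D \<in> Prin" unfolding Prin_iff
    using z fin.\<nu>_inverse[of _ z] fin.dval_inverse[OF dval_inf, of z]
    by (intro conjI bexI[of _ "inverse z"]) simp_all
qed

text \<open>Only affine coefficients need comparing: both divisors and the divisor of
  \<open>z\<close> have degree zero, so the coefficients at infinity agree by themselves.\<close>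

lemma Prin_diff_iff:
  assumes D: "D \<in> carrier DG" and D': "D' \<in> carrier DG"
  shows "D - D' \<in> Prin \<longleftrightarrow> (\<exists>z\<in>C - {0}. \<forall>x\<in>fin.idx.
     Poly_Mapping.lookup D (Pl x) - Poly_Mapping.lookup D' (Pl x) = fin.\<nu> x z)"
proof
  assume "D - D' \<in> Prin"
  then show "\<exists>z\<in>C - {0}. \<forall>x\<in>fin.idx. Poly_Mapping.lookup D (Pl x) - Poly_Mapping.lookup D' (Pl x) = fin.\<nu> x z"
    unfolding Prin_iff lookup_minus by blast
next
  assume "\<exists>z\<in>C - {0}. \<forall>x\<in>fin.idx. Poly_Mapping.lookup D (Pl x) - Poly_Mapping.lookup D' (Pl x) = fin.\<nu> x z"
  then obtain z where z: "z \<in> C" "z \<noteq> 0" and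
    zx: "\<And>x. x \<in> fin.idx \<Longrightarrow> Poly_Mapping.lookup D (Pl x) - Poly_Mapping.lookup D' (Pl x) = fin.\<nu> x z"
    by blast
  have "edeg (\<lambda>x. Poly_Mapping.lookup D (Pl x) + - Poly_Mapping.lookup D' (Pl x)) =
      edeg (\<lambda>x. Poly_Mapping.lookup D (Pl x)) - edeg (\<lambda>x. Poly_Mapping.lookup D' (Pl x))"
    using edeg_add[OF fs_lookup fs_uminus[OF fs_lookup], of D D'] by (simp add: edeg_uminus)
  moreover have "edeg (\<lambda>x. Poly_Mapping.lookup D (Pl x) + - Poly_Mapping.lookup D' (Pl x)) = fin.vsum z"
    unfolding edeg_\<nu>[symmetric] using zx by (intro edeg_cong) simp
  ultimately have inf: "Poly_Mapping.lookup D Pinf - Poly_Mapping.lookup D' Pinf = \<nu>inf z"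
    using product_formula[OF z] D D' divisor_degree_eq[of D] divisor_degree_eq[of D'] unfolding DG_carrier by simp
  have "Poly_Mapping.keys (D - D') \<subseteq> places k K"
    using Poly_Mapping.keys_diff[of D D'] D D' unfolding DG_carrier by blast
  then show "D - D' \<in> Prin" unfolding Prin_iff using z zx inf
    by (intro conjI bexI[of _ z]) (simp_all add: lookup_minus)
qed

text \<open>\<open>M\<close> is to index a system of representatives \<open>F m\<close> of the
  affine divisors modulo divisors of functions; \<open>mk\<close> turns them into representatives of
  the cosets of degree-zero divisors.\<close>

theorem class_number_eq:
  assumes F: "\<And>m. m \<in> M \<Longrightarrow> fs (F m)"
    and inj: "\<And>m m' z. m \<in> M \<Longrightarrow> m' \<in> M \<Longrightarrow> z \<in> C \<Longrightarrow> z \<noteq> 0 \<Longrightarrow>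
      (\<And>x. x \<in> fin.idx \<Longrightarrow> F m x - F m' x = fin.\<nu> x z) \<Longrightarrow> m = m'"
    and surj: "\<And>E. fs E \<Longrightarrow> \<exists>m\<in>M. \<exists>z\<in>C - {0}. \<forall>x\<in>fin.idx. E x - F m x = fin.\<nu> x z"
  shows "class_number k K = card M"
proof -
  have coset: "Prin #>\<^bsub>DG\<^esub> D = {h + D |h. h \<in> Prin}" for D
    unfolding r_coset_def DG_mult by blast
  have coset_eq: "Prin #>\<^bsub>DG\<^esub> D = Prin #>\<^bsub>DG\<^esub> D' \<longleftrightarrow> D - D' \<in> Prin" for D D'
  proof
    assume "Prin #>\<^bsub>DG\<^esub> D = Prin #>\<^bsub>DG\<^esub> D'"
    moreover have "0 + D \<in> Prin #>\<^bsub>DG\<^esub> D" unfolding coset using Prin_group(1) by blast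
    ultimately obtain h where "h \<in> Prin" "0 + D = h + D'" unfolding coset by blast
    then show "D - D' \<in> Prin" by simp
  next
    assume d: "D - D' \<in> Prin"
    have "h + D = (h + (D - D')) + D'" "h + D' = (h + - (D - D')) + D" for h by simp_all
    then show "Prin #>\<^bsub>DG\<^esub> D = Prin #>\<^bsub>DG\<^esub> D'"
      unfolding coset using Prin_group(2)[OF _ d] Prin_group(2)[OF _ Prin_group(3)[OF d]] by blast
  qed
  have mkG: "mk (F m) \<in> carrier DG" if "m \<in> M" for m
  proof -
    have "edeg (\<lambda>x. Poly_Mapping.lookup (mk (F m)) (Pl x)) = edeg (F m)"
      by (rule edeg_cong) (rule lookup_mk(1)[OF F[OF that]])
    then show ?thesis unfolding DG_carrier using divisor_degree_eq lookup_mk[OF F[OF that]] by simp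
  qed
  have "bij_betw (\<lambda>m. Prin #>\<^bsub>DG\<^esub> mk (F m)) M (carrier (DG Mod Prin))"
  proof (rule bij_betwI')
    fix m m' assume m: "m \<in> M" "m' \<in> M"
    show "(Prin #>\<^bsub>DG\<^esub> mk (F m) = Prin #>\<^bsub>DG\<^esub> mk (F m')) = (m = m')"
    proof
      assume "Prin #>\<^bsub>DG\<^esub> mk (F m) = Prin #>\<^bsub>DG\<^esub> mk (F m')"
      then obtain z where z: "z \<in> C - {0}" "\<forall>x\<in>fin.idx.
         Poly_Mapping.lookup (mk (F m)) (Pl x) - Poly_Mapping.lookup (mk (F m')) (Pl x) = fin.\<nu> x z"
        unfolding coset_eq Prin_diff_iff[OF mkG[OF m(1)] mkG[OF m(2)]] by blast
      then show "m = m'"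
        using inj[OF m, of z] lookup_mk(1)[OF F[OF m(1)]] lookup_mk(1)[OF F[OF m(2)]] by simp
    qed simp
  next
    fix m assume "m \<in> M"
    then show "Prin #>\<^bsub>DG\<^esub> mk (F m) \<in> carrier (DG Mod Prin)"
      using mkG[of m] unfolding FactGroup_def RCOSETS_def by simp blast
  next
    fix Q assume "Q \<in> carrier (DG Mod Prin)"
    then obtain D where D: "D \<in> carrier DG" "Q = Prin #>\<^bsub>DG\<^esub> D" unfolding FactGroup_def RCOSETS_def by simp blast
    obtain m z where m: "m \<in> M" and z: "z \<in> C - {0}"
      "\<forall>x\<in>fin.idx. Poly_Mapping.lookup D (Pl x) - F m x = fin.\<nu> x z" using surj[OF fs_lookup] by blast
    have "D - mk (F m) \<in> Prin"
      unfolding Prin_diff_iff[OF D(1) mkG[OF m]] using z lookup_mk(1)[OF F[OF m]] by (intro bexI[of _ z]) simp_all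
    then have "Q = Prin #>\<^bsub>DG\<^esub> mk (F m)" unfolding D(2) coset_eq .
    then show "\<exists>m\<in>M. Q = Prin #>\<^bsub>DG\<^esub> mk (F m)" using m by blast
  qed
  then have "card M = card (carrier (DG Mod Prin))" by (rule bij_betw_same_card)
  then show ?thesis unfolding class_number_def Coset.order_def by simp
qed

end

lemma card_le_fibers:
  assumes "finite B" "f ` B \<subseteq> R" "finite R" "\<And>r. r \<in> R \<Longrightarrow> card {z \<in> B. f z = r} \<le> N"
  shows "card B \<le> N * card R"
proof -
  have "B = (\<Union>r\<in>R. {z \<in> B. f z = r})" using assms(2) by blast
  then have "card B \<le> (\<Sum>r\<in>R. card {z \<in> B. f z = r})" using card_UN_le[OF assms(3), of "\<lambda>r. {z \<in> B. f z = r}"] by simp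
  also have "\<dots> \<le> of_nat (card R) * N" by (rule sum_bounded_above[OF assms(4)])
  finally show ?thesis by (simp add: mult.commute)
qed

section \<open>Functions with prescribed zeros, found by counting\<close>

context curve
begin

abbreviation ip :: "'a poly \<Rightarrow> 'l" where "ip \<equiv> ev y"

definition above :: "('a loc_index \<Rightarrow> int) \<Rightarrow> 'l \<Rightarrow> bool" where
  "above E z \<longleftrightarrow> (\<forall>x\<in>fin.idx. E x \<le> fin.\<nu> x z)"

lemma ge_diff:
  assumes x: "x \<in> fin.idx" and a: "a \<in> C" "a \<noteq> 0" "n \<le> fin.\<nu> x a" and b: "b \<in> C" "b \<noteq> 0" "n \<le> fin.\<nu> x b"
    and ab: "a - b \<noteq> 0"
  shows "n \<le> fin.\<nu> x (a - b)"
proof -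
  have "min (fin.\<nu> x a) (fin.\<nu> x (- b)) \<le> fin.\<nu> x (a + (- b))"
    using fin.\<nu>_add[OF x a(1,2) fin.Cuminus[OF b(1)]] b(2) ab by simp
  then show ?thesis using fin.\<nu>_uminus[OF x b(1,2)] a(3) b(3) by simp
qed

text \<open>The substitute for Riemann-Roch. Raising the required order at one place
  \<open>x0\<close> by 1 shrinks the group of solutions by at most the size of the residue field
  there: solutions with the same leading residue at \<open>x0\<close> differ by an element of the
  smaller group. The induction removes one point at a time from \<open>E\<close>.\<close>

lemma pigeonhole_aux:
  assumes A: "finite A" "A \<subseteq> fin.Oset" "\<And>a b. a \<in> A \<Longrightarrow> b \<in> A \<Longrightarrow> a - b \<in> A"
    and E: "fs E" "\<And>x. x \<in> fin.idx \<Longrightarrow> E x \<ge> 0" and N: "nat (edeg E) = n"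
  shows "card A \<le> card {z \<in> A. z = 0 \<or> above E z} * CARD('a) ^ n"
  using E N
proof (induction n arbitrary: E rule: less_induct)
  case (less n)
  have AC: "A \<subseteq> C" using A(2) fin.Oset_Cset by blast
  show ?case
  proof (cases "{x \<in> fin.idx. E x \<noteq> 0} = {}")
    case True
    have "above E z" if z: "z \<in> A" "z \<noteq> 0" for z
      unfolding above_def
    proof
      fix x assume x: "x \<in> fin.idx"
      have "E x = 0" using True x by blast
      then show "E x \<le> fin.\<nu> x z" using fin.\<nu>_nonneg[OF x _ z(2)] z(1) A(2) by (simp add: subset_iff)
    qed
    then have "{z \<in> A. z = 0 \<or> above E z} = A" by blast
    then show ?thesis by simp
  next
    case False
    then obtain x0 where x0: "x0 \<in> fin.idx" "E x0 \<noteq> 0" by blast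
    define E' where "E' = (\<lambda>x. if x = x0 then E x - 1 else E x)"
    define d where "d = (\<lambda>x. if x = x0 then 1 else 0 :: int)"
    have Ed: "E = (\<lambda>x. E' x + d x)" unfolding E'_def d_def by auto
    have dset: "{x \<in> fin.idx. d x \<noteq> 0} = {x0}" unfolding d_def using x0 by auto
    have fsd: "fs d" unfolding fs_def dset by simp
    have degd: "edeg d = int (fin.pdeg x0)" unfolding edeg_def dset by (simp add: d_def)
    have "{x \<in> fin.idx. E' x \<noteq> 0} \<subseteq> {x \<in> fin.idx. E x \<noteq> 0}" unfolding E'_def using x0 by auto
    then have fsE': "fs E'" using less.prems(1) unfolding fs_def by (rule finite_subset)
    have nn': "E' x \<ge> 0" if "x \<in> fin.idx" for x
      using less.prems(2)[OF that] x0 less.prems(2)[OF x0(1)] unfolding E'_def by auto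
    have degE: "edeg E = edeg E' + int (fin.pdeg x0)"
      using edeg_add[OF fsE' fsd] Ed degd by simp
    have nonneg: "edeg E' \<ge> 0" unfolding edeg_def using nn' by (intro sum_nonneg) simp
    have pd: "fin.pdeg x0 > 0" using x0(1) irreducible_field_poly_degree[of "fst x0"]
      unfolding fin.pdeg_def fin.idx_def by simp
    define n' where "n' = nat (edeg E')"
    have n: "n = n' + fin.pdeg x0" "n' < n"
      using degE nonneg less.prems(3) pd unfolding n'_def by linarith+
    have IH: "card A \<le> card {z \<in> A. z = 0 \<or> above E' z} * CARD('a) ^ n'"
      by (rule less.IH[OF n(2) fsE' nn']) (simp_all add: n'_def)
    define B where "B = {z \<in> A. z = 0 \<or> above E' z}"
    define B' where "B' = {z \<in> A. z = 0 \<or> above E z}"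
    have finB: "finite B" "finite B'" unfolding B_def B'_def using A(1) by simp_all
    obtain t where t: "t \<in> C" "t \<noteq> 0" "fin.\<nu> x0 t = 1" using fin.dval_uniformizer[OF fin.dval_\<nu>[OF x0(1)]] by blast
    define s where "s = t ^ nat (E' x0)"
    have s: "s \<in> C" "s \<noteq> 0" "fin.\<nu> x0 s = E' x0"
      unfolding s_def using fin.dval_power[OF fin.dval_\<nu>[OF x0(1)] t(1,2)] t nn'[OF x0(1)] by simp_all
    have sdiv: "fin.\<nu> x0 (z / s) = fin.\<nu> x0 z - E' x0" if "z \<in> C" "z \<noteq> 0" for z
      using fin.\<nu>_mult[OF x0(1) that fin.Cinv[OF s(1)]] fin.\<nu>_inverse[OF x0(1) s(1,2)] s
      by (simp add: divide_inverse)
    have vr: "z / s \<in> fin.vring (fin.\<nu> x0)" if "z \<in> B" for z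
    proof (cases "z = 0")
      case False
      then have "z \<in> C" "E' x0 \<le> fin.\<nu> x0 z" using that AC x0(1) unfolding B_def above_def by blast+
      then show ?thesis using sdiv[OF _ False] fin.Cdiv[OF _ s(1)] unfolding fin.vring_def by simp
    qed (simp add: fin.vring_def fin.C0)
    \<comment> \<open>The leading residue of \<open>z\<close> at \<open>x0\<close>: \<open>s\<close>
      has exactly the order \<open>E' x0\<close> that is already guaranteed.\<close>
    define r where "r = (\<lambda>z. SOME u. u \<in> fin.reps x0 \<and> z / s - u \<in> fin.vplace (fin.\<nu> x0))"
    have r: "r z \<in> fin.reps x0 \<and> z / s - r z \<in> fin.vplace (fin.\<nu> x0)" if "z \<in> B" for z
      unfolding r_def by (rule someI_ex) (use fin.residue_exists[OF x0(1) vr[OF that]] in blast)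
    have M: "ideal (fin.vplace (fin.\<nu> x0)) (fin.RC (fin.vring (fin.\<nu> x0)))"
      using fin.nonunits_ideal[OF fin.vring_valuation_ring[OF fin.dval_\<nu>[OF x0(1)]]]
        fin.nonunits_vring[OF fin.dval_\<nu>[OF x0(1)]] by simp
    have vadd: "a - b \<in> fin.vplace (fin.\<nu> x0)" if "a \<in> fin.vplace (fin.\<nu> x0)" "b \<in> fin.vplace (fin.\<nu> x0)" for a b
    proof -
      interpret M: ideal "fin.vplace (fin.\<nu> x0)" "fin.RC (fin.vring (fin.\<nu> x0))" by (rule M)
      have mi: "- 1 \<in> fin.vring (fin.\<nu> x0)"
        unfolding fin.vring_def using fin.\<nu>_uminus[OF x0(1) fin.C1] fin.\<nu>_1[OF x0(1)] fin.Cuminus[OF fin.C1] by simp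
      have "- 1 * b \<in> fin.vplace (fin.\<nu> x0)" using M.I_l_closed[of b "- 1"] that mi by simp
      from additive_subgroup.a_closed[OF M.additive_subgroup_axioms that(1) this]
      show ?thesis by simp
    qed
    have fib: "card {z \<in> B. r z = u} \<le> card B'" for u
    proof (cases "{z \<in> B. r z = u} = {}")
      case False
      then obtain z0 where z0: "z0 \<in> B" "r z0 = u" by blast
      have "z - z0 \<in> B'" if z: "z \<in> B" "r z = u" for z
      proof (cases "z - z0 = 0")
        case True
        then show ?thesis using A(3)[of z0 z0] z0 unfolding B_def B'_def by simp
      next
        case zz: False
        have zA: "z - z0 \<in> A" using A(3) z(1) z0(1) unfolding B_def by blast
        have "above E (z - z0)" unfolding above_def
        proof
          fix x assume x: "x \<in> fin.idx"
          have E'x: "E' x \<le> fin.\<nu> x (z - z0)"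
          proof (cases "z = 0 \<or> z0 = 0")
            case True
            have "z \<noteq> 0 \<Longrightarrow> E' x \<le> fin.\<nu> x z" "z0 \<noteq> 0 \<Longrightarrow> E' x \<le> fin.\<nu> x z0"
              using z(1) z0(1) x unfolding B_def above_def by blast+
            then show ?thesis using True zz fin.\<nu>_uminus[OF x, of z0] AC z0(1) unfolding B_def by auto
          next
            case False
            then show ?thesis
              using ge_diff[OF x, of z "E' x" z0] z(1) z0(1) AC zz x unfolding B_def above_def by (simp add: subset_iff)
          qed
          show "E x \<le> fin.\<nu> x (z - z0)"
          proof (cases "x = x0")
            case True
            have "z / s - z0 / s \<in> fin.vplace (fin.\<nu> x0)"
              using vadd[OF conjunct2[OF r[OF z(1)]] conjunct2[OF r[OF z0(1)]]] z(2) z0(2) by simp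
            then have "(z - z0) / s \<in> fin.vplace (fin.\<nu> x0)" by (simp add: diff_divide_distrib)
            then have "fin.\<nu> x0 ((z - z0) / s) > 0" using zz s(2) unfolding fin.vplace_def by simp
            then show ?thesis using sdiv[OF _ zz] zA AC unfolding True E'_def by (simp add: subset_iff)
          qed (use E'x in \<open>simp add: E'_def\<close>)
        qed
        then show ?thesis using zA unfolding B'_def by simp
      qed
      then have "(\<lambda>z. z - z0) ` {z \<in> B. r z = u} \<subseteq> B'" by blast
      then have "card ((\<lambda>z. z - z0) ` {z \<in> B. r z = u}) \<le> card B'" by (rule card_mono[OF finB(2)])
      moreover have "inj_on (\<lambda>z. z - z0) {z \<in> B. r z = u}" by (rule inj_onI) simp
      ultimately show ?thesis by (simp add: card_image)
    next
      case True
      then show ?thesis by (simp only: card.empty)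
    qed
    have "card B \<le> card B' * card (fin.reps x0)"
      by (rule card_le_fibers[OF finB(1) _ fin.card_reps(1) fib]) (use r in blast)
    then have "card B * CARD('a) ^ n' \<le> card B' * CARD('a) ^ n"
      unfolding fin.card_reps n(1) power_add by (simp add: mult.assoc mult.commute mult.left_commute)
    then show ?thesis using IH unfolding B_def B'_def by linarith
  qed
qed

lemma pigeonhole:
  assumes A: "finite A" "A \<subseteq> fin.Oset" "\<And>a b. a \<in> A \<Longrightarrow> b \<in> A \<Longrightarrow> a - b \<in> A"
    and E: "fs E" "\<And>x. x \<in> fin.idx \<Longrightarrow> E x \<ge> 0" and N: "card A > CARD('a) ^ nat (edeg E)"
  shows "\<exists>z\<in>A. z \<noteq> 0 \<and> above E z"
proof (rule ccontr)
  assume "\<not> (\<exists>z\<in>A. z \<noteq> 0 \<and> above E z)"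
  then have "{z \<in> A. z = 0 \<or> above E z} \<subseteq> {0}" by blast
  then have "card {z \<in> A. z = 0 \<or> above E z} \<le> 1" using card_mono[of "{0 :: 'l}"] by fastforce
  then have "card {z \<in> A. z = 0 \<or> above E z} * CARD('a) ^ nat (edeg E) \<le> 1 * CARD('a) ^ nat (edeg E)"
    by (rule mult_le_mono1)
  then show False using pigeonhole_aux[OF A E refl] N by linarith
qed

lemma ip_decomp:
  assumes g: "g \<noteq> 0" and p: "irreducible p" "lead_coeff p = 1"
  obtains n g' where "g = p ^ n * g'" "\<not> p dvd g'"
    "\<And>x. x \<in> fin.idx \<Longrightarrow> fst x = p \<Longrightarrow> fin.\<nu> x (ip g) = int n * int (fin.ram x)"
proof -
  interpret irr_poly p by unfold_locales (rule p)
  obtain n g' where 1: "g = p ^ n * g'" "\<not> p dvd g'" using decomp[OF g] by blast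
  have "fin.\<nu> x (ip g) = int n * int (fin.ram x)" if x: "x \<in> fin.idx" "fst x = p" for x
  proof -
    have nz: "ip p \<noteq> 0" "ip g' \<noteq> 0" using p0 1(2) fin.\<iota>_eq_0 by auto
    have "fin.\<nu> x (ip g) = fin.\<nu> x (ip p ^ n) + fin.\<nu> x (ip g')"
      unfolding 1(1) fin.\<iota>_mult fin.\<iota>_power
      by (rule fin.\<nu>_mult[OF x(1) fin_pow[OF fin.\<iota>_C] _ fin.\<iota>_C]) (use nz in simp_all)
    moreover have "fin.\<nu> x (ip g') = 0"
      by (rule fin.\<nu>_unit[OF x(1) fin.\<iota>_Oset]) (simp add: fin.mem_pp_\<iota> x(2) 1(2))
    ultimately show ?thesis
      using fin.\<nu>_power[OF x(1) fin.\<iota>_C nz(1)] fin.\<nu>_prime[OF x(1) p] x(2) by simp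
  qed
  then show ?thesis using that 1 by blast
qed

text \<open>The prime below a branch place has order 2 there, so all polynomials have even order.
  This parity settles the ramified cases later on.\<close>

lemma ip_even: assumes "x \<in> fin.idx" "snd x = Some 0" "g \<noteq> 0" shows "even (fin.\<nu> x (ip g))"
proof -
  have "irreducible (fst x)" "lead_coeff (fst x) = 1" using assms(1) by (simp_all add: fin.idx_def)
  from ip_decomp[OF assms(3) this] obtain n where "fin.\<nu> x (ip g) = int n * int (fin.ram x)"
    using assms(1) by metis
  then show ?thesis using assms(2) by (simp add: fin.ram_def)
qed

lemma \<sigma>_fixed: "snd x = None \<or> snd x = Some 0 \<Longrightarrow> fin.\<sigma> x = x"
  by (cases x) (auto simp: fin.\<sigma>_def)

lemma \<nu>_ip_nonneg: "x \<in> fin.idx \<Longrightarrow> g \<noteq> 0 \<Longrightarrow> fin.\<nu> x (ip g) \<ge> 0"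
  by (rule fin.\<nu>_nonneg[OF _ fin.\<iota>_Oset]) (simp_all add: fin.\<iota>_eq_0)

text \<open>Each prime factor of \<open>u\<close> has a place above it, where \<open>g\<close> then
  has positive order; cancel the factor on both sides and continue.\<close>

lemma ip_dvd:
  assumes "u \<noteq> 0" "g \<noteq> 0" "\<And>x. x \<in> fin.idx \<Longrightarrow> fin.\<nu> x (ip u) \<le> fin.\<nu> x (ip g)"
  shows "u dvd g"
  using assms
proof (induction "Polynomial.degree u" arbitrary: u g rule: less_induct)
  case less
  show ?case
  proof (cases "Polynomial.degree u = 0")
    case True
    then have "u dvd 1" using is_unit_iff_degree[OF less.prems(1)] by simp
    then show ?thesis by (rule dvd_trans) simp
  next
    case False
    then obtain p where p: "irreducible p" "lead_coeff p = 1" "p dvd u"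
      using exists_irreducible_factor[of u] by auto
    then obtain u' where u': "u = p * u'" by (elim dvdE)
    have nz: "p \<noteq> 0" "u' \<noteq> 0" using u' less.prems(1) by auto
    have "{x \<in> fin.idx. fst x = p} \<noteq> {}"
    proof
      assume "{x \<in> fin.idx. fst x = p} = {}"
      then show False using conjunct2[OF fin.sum_fiber[OF p(1,2)]] irreducible_field_poly_degree[OF p(1)]
        by (simp only: sum.empty)
    qed
    then obtain x where x: "x \<in> fin.idx" "fst x = p" by blast
    have nup: "fin.\<nu> x (ip u) > 0"
      using fin.\<nu>_pos_iff[OF x(1) fin.\<iota>_Oset, of u] p(3) x(2) less.prems(1)
      by (simp add: fin.mem_pp_\<iota> fin.\<iota>_eq_0)
    then have "fin.\<nu> x (ip g) > 0" using less.prems(3)[OF x(1)] by simp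
    then have "p dvd g"
      using fin.\<nu>_pos_iff[OF x(1) fin.\<iota>_Oset, of g] x(2) less.prems(2) by (simp add: fin.mem_pp_\<iota> fin.\<iota>_eq_0)
    then obtain g' where g': "g = p * g'" by (elim dvdE)
    have g'0: "g' \<noteq> 0" using g' less.prems(2) by auto
    have "u' dvd g'"
    proof (rule less.hyps[OF _ nz(2) g'0])
      show "Polynomial.degree u' < Polynomial.degree u"
        unfolding u' degree_mult_eq[OF nz] using irreducible_field_poly_degree[OF p(1)] by simp
      fix z assume z: "z \<in> fin.idx"
      have "fin.\<nu> z (ip u) = fin.\<nu> z (ip p) + fin.\<nu> z (ip u')" "fin.\<nu> z (ip g) = fin.\<nu> z (ip p) + fin.\<nu> z (ip g')"
        unfolding u' g' fin.\<iota>_mult using nz g'0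
        by (simp_all add: fin.\<nu>_mult[OF z fin.\<iota>_C _ fin.\<iota>_C] fin.\<iota>_eq_0)
      then show "fin.\<nu> z (ip u') \<le> fin.\<nu> z (ip g')" using less.prems(3)[OF z] by simp
    qed
    then show ?thesis unfolding u' g' by (rule mult_dvd_mono[OF dvd_refl])
  qed
qed

text \<open>Semi-reduced effective divisors: nothing at inert places, never a point together with
  its conjugate, branch points at most once. From these no divisor of a nonconstant polynomial can
  be subtracted.\<close>

definition semired :: "('a loc_index \<Rightarrow> int) \<Rightarrow> bool" where
  "semired E \<longleftrightarrow> (\<forall>x\<in>fin.idx. E x \<ge> 0 \<and> (E x > 0 \<longrightarrow> snd x \<noteq> None \<and>
     (E (fin.\<sigma> x) = 0 \<or> snd x = Some 0 \<and> E x = 1)))"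

text \<open>A polynomial has equal orders at conjugate places, so if it vanishes on a semi-reduced
  \<open>E\<close> it vanishes on the conjugate as well; at a branch place parity improves the bound
  from 1 to 2.\<close>

lemma semired_above:
  assumes E: "semired E" and g: "g \<noteq> 0" "above E (ip g)" and x: "x \<in> fin.idx"
  shows "E x + E (fin.\<sigma> x) \<le> fin.\<nu> x (ip g)"
proof -
  have 1: "E x \<le> fin.\<nu> x (ip g)" using g(2) x unfolding above_def by simp
  have 2: "E (fin.\<sigma> x) \<le> fin.\<nu> x (ip g)"
    using g(2) fin.\<sigma>_idx[OF x] fin.\<nu>_\<sigma>_\<iota>[OF x g(1)] unfolding above_def by fastforce
  have nn: "E x \<ge> 0" "E (fin.\<sigma> x) \<ge> 0" using E x fin.\<sigma>_idx[OF x] unfolding semired_def by auto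
  show ?thesis
  proof (cases "E x = 0 \<or> E (fin.\<sigma> x) = 0")
    case False
    then have s: "snd x = Some 0" "E x = 1" using E x nn unfolding semired_def by force+
    have "even (fin.\<nu> x (ip g))" by (rule ip_even[OF x s(1) g(1)])
    then have "fin.\<nu> x (ip g) \<ge> 2" using 1 s(2) by (cases "fin.\<nu> x (ip g) = 1") auto
    then show ?thesis using s \<sigma>_fixed[of x] by simp
  qed (use 1 2 in auto)
qed

lemma edeg_\<sigma>: "edeg (\<lambda>x. E (fin.\<sigma> x)) = edeg E"
  unfolding edeg_def
proof (rule sum.reindex_bij_witness[of _ fin.\<sigma> fin.\<sigma>])
  fix x assume "x \<in> {x \<in> fin.idx. E x \<noteq> 0}"
  then show "fin.\<sigma> x \<in> {x \<in> fin.idx. E (fin.\<sigma> x) \<noteq> 0}" using fin.\<sigma>_idx[of x] by (simp add: fin.\<sigma>_\<sigma>)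
next
  fix x assume "x \<in> {x \<in> fin.idx. E (fin.\<sigma> x) \<noteq> 0}"
  then show "fin.\<sigma> x \<in> {x \<in> fin.idx. E x \<noteq> 0}" using fin.\<sigma>_idx[of x] by simp
qed (simp_all add: fin.\<sigma>_\<sigma> fin.pdeg_\<sigma>)

lemma fs_\<sigma>: assumes "fs E" shows "fs (\<lambda>x. E (fin.\<sigma> x))"
proof -
  have "{x \<in> fin.idx. E (fin.\<sigma> x) \<noteq> 0} \<subseteq> fin.\<sigma> ` {x \<in> fin.idx. E x \<noteq> 0}"
  proof
    fix x assume "x \<in> {x \<in> fin.idx. E (fin.\<sigma> x) \<noteq> 0}"
    then have "fin.\<sigma> x \<in> {x \<in> fin.idx. E x \<noteq> 0}" using fin.\<sigma>_idx[of x] by simp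
    from imageI[OF this, of fin.\<sigma>] show "x \<in> fin.\<sigma> ` {x \<in> fin.idx. E x \<noteq> 0}" by (simp add: fin.\<sigma>_\<sigma>)
  qed
  then show ?thesis using assms unfolding fs_def by (meson finite_imageI finite_subset)
qed

lemma edeg_mono:
  assumes "fs E" "fs F" "\<And>x. x \<in> fin.idx \<Longrightarrow> E x \<le> F x"
  shows "edeg E \<le> edeg F" "edeg E = edeg F \<Longrightarrow> x \<in> fin.idx \<Longrightarrow> E x = F x"
proof -
  have fsd: "fs (\<lambda>x. F x + - E x)" by (rule fs_add[OF assms(2) fs_uminus[OF assms(1)]])
  have d: "edeg (\<lambda>x. F x + - E x) = edeg F - edeg E"
    using edeg_add[OF assms(2) fs_uminus[OF assms(1)]] by (simp add: edeg_uminus)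
  have nn: "(F x + - E x) * int (fin.pdeg x) \<ge> 0" if "x \<in> fin.idx" for x using assms(3)[OF that] by simp
  then have "edeg (\<lambda>x. F x + - E x) \<ge> 0" unfolding edeg_def by (intro sum_nonneg) blast
  then show "edeg E \<le> edeg F" using d by simp
  show "E x = F x" if "edeg E = edeg F" "x \<in> fin.idx"
  proof (rule ccontr)
    assume ne: "E x \<noteq> F x"
    have "edeg (\<lambda>x. F x + - E x) = 0" using d that(1) by simp
    then have all0: "\<forall>x\<in>{x \<in> fin.idx. F x + - E x \<noteq> 0}. (F x + - E x) * int (fin.pdeg x) = 0"
      unfolding edeg_def using sum_nonneg_eq_0_iff[of "{x \<in> fin.idx. F x + - E x \<noteq> 0}" "\<lambda>x. (F x + - E x) * int (fin.pdeg x)"]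
        fsd nn unfolding fs_def by blast
    have "fin.pdeg x > 0" using that(2) irreducible_field_poly_degree[of "fst x"]
      unfolding fin.pdeg_def fin.idx_def by simp
    have "x \<in> {x \<in> fin.idx. F x + - E x \<noteq> 0}" using ne that(2) by simp
    from bspec[OF all0 this] have "F x + - E x = 0 \<or> int (fin.pdeg x) = 0" by (simp only: mult_eq_0_iff)
    then show False using \<open>fin.pdeg x > 0\<close> ne by linarith
  qed
qed

end

section \<open>Mumford pairs and their divisors\<close>

definition mumford :: "'a::field poly \<Rightarrow> ('a poly \<times> 'a poly) set" where
  "mumford f = {(u, v). lead_coeff u = 1 \<and> Polynomial.degree u \<le> 2 \<and>
     (v = 0 \<or> Polynomial.degree v < Polynomial.degree u) \<and> u dvd f - v * v}"

context curve
begin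

text \<open>The affine divisor of the ideal generated by \<open>u\<close> and \<open>w - v\<close>,
  that is, the common zeros of both with multiplicity.\<close>

definition Em :: "'a poly \<times> 'a poly \<Rightarrow> 'a loc_index \<Rightarrow> int" where
  "Em m x = min (fin.\<nu> x (ip (fst m))) (fin.\<nu> x (fin.el (- snd m) 1))"

lemma wv: "fin.el (- v) 1 \<noteq> 0" "fin.el (- v) 1 \<in> C" "fin.el (- v) 1 \<in> fin.Oset"
  by (simp_all add: fin.el_eq_0 fin.el_C fin.el_Oset)

lemma wv_\<sigma>: assumes x: "x \<in> fin.idx" shows "fin.\<nu> (fin.\<sigma> x) (fin.el (- v) 1) = fin.\<nu> x (fin.el v 1)"
proof -
  have 0: "fin.el (- v) (- 1) \<noteq> 0" by (simp add: fin.el_eq_0)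
  have "fin.\<nu> (fin.\<sigma> x) (fin.el (- v) (- (- 1))) = fin.\<nu> x (fin.el (- v) (- 1))"
    by (rule fin.\<nu>_\<sigma>[OF x 0])
  also have "fin.el (- v) (- 1) = - fin.el v 1" by (simp add: fin.el_uminus)
  also have "fin.\<nu> x (- fin.el v 1) = fin.\<nu> x (fin.el v 1)" by (rule fin.\<nu>_uminus[OF x fin.el_C]) (simp add: fin.el_eq_0)
  finally show ?thesis by simp
qed

lemma wv_prod: "fin.el (- v) 1 * fin.el v 1 = ip (f1 - v * v)"
  by (simp add: fin.el_mult flip: fin.el_0)

lemma f1_v_nz: "f1 - v * v \<noteq> 0"
  using wv(1)[of v] wv(1)[of "- v"] fin.\<iota>_eq_0[of "f1 - v * v"] by (auto simp flip: wv_prod)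

lemma wv_sum: assumes x: "x \<in> fin.idx"
  shows "fin.\<nu> x (fin.el (- v) 1) + fin.\<nu> x (fin.el v 1) = fin.\<nu> x (ip (f1 - v * v))"
  unfolding wv_prod[symmetric] using fin.\<nu>_mult[OF x wv(2,1), of "fin.el v 1"] by (simp add: fin.el_C fin.el_eq_0)

text \<open>A common zero of \<open>w - v\<close> and \<open>w + v\<close> is one of
  \<open>2 w\<close> and \<open>2 v\<close>, hence a branch point. There \<open>w\<close> has order
  1, while the polynomial \<open>v\<close>, if nonzero, has order at least 2.\<close>

lemma wv_both:
  assumes x: "x \<in> fin.idx" and p: "fin.\<nu> x (fin.el (- v) 1) > 0" "fin.\<nu> x (fin.el v 1) > 0"
  shows "snd x = Some 0 \<and> fin.\<nu> x (fin.el (- v) 1) = 1 \<and> fin.\<nu> x (fin.el v 1) = 1"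
proof -
  obtain p t where pt: "x = (p, t)" by (cases x)
  have irr: "irreducible p" "lead_coeff p = 1" using x pt by (simp_all add: fin.idx_def)
  interpret irr_poly p by unfold_locales (rule irr)
  have n2: "\<not> p dvd 2" by (rule fin.not_dvd_two[OF irr(1)])
  have m: "fin.el (- v) 1 \<in> fin.pp x" "fin.el v 1 \<in> fin.pp x"
    using p fin.\<nu>_pos_iff[OF x fin.el_Oset] by (simp_all add: fin.el_eq_0)
  then have "t \<noteq> None" using not_dvd_1 unfolding pt by (cases t) (simp_all add: fin.mem_pp_None)
  then obtain r where r: "t = Some r" by blast
  have d: "p dvd - v + r" "p dvd v + r" using m unfolding pt r by (simp_all add: fin.mem_pp_Some)
  have "p dvd 2 * r" "p dvd 2 * v" using dvd_add[OF d] dvd_diff[OF d(2,1)] by simp_all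
  then have dr: "p dvd r" "p dvd v" using n2 by (simp_all add: prime_dvd_mult)
  have r0: "r = 0" using x dvd_small[OF dr(1)] unfolding pt r by (auto simp: fin.idx_def)
  have nw: "fin.\<nu> x w = 1"
    using fin.dord_t[OF fin.datum_idx[OF x]] unfolding fin.\<nu>_def pt r r0 by (simp add: fin.tt_def)
  have *: "fin.\<nu> x (fin.el u 1) = 1" if u: "p dvd u" for u
  proof (cases "u = 0")
    case True
    then show ?thesis using nw by (simp add: fin.el_w)
  next
    case False
    have "fin.\<nu> x (ip u) > 0"
      using fin.\<nu>_pos_iff[OF x fin.\<iota>_Oset, of u] u False pt by (simp add: fin.mem_pp_\<iota> fin.\<iota>_eq_0)
    moreover have "even (fin.\<nu> x (ip u))" by (rule ip_even[OF x _ False]) (simp add: pt r r0)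
    ultimately have "fin.\<nu> x (ip u) \<noteq> 1 \<and> fin.\<nu> x (ip u) \<ge> 1" by auto
    then have lt: "fin.\<nu> x w < fin.\<nu> x (ip u)" using nw by simp
    have "fin.\<nu> x (w + ip u) = fin.\<nu> x w"
      using dval_strict[OF fin.dval_\<nu>[OF x] fin.w_C w0 fin.\<iota>_C _ lt] False fin.\<iota>_eq_0 by simp
    then show ?thesis using nw by (simp add: fin.el_def ev_1 add.commute)
  qed
  show ?thesis using *[of v] *[of "- v"] dr r0 by (simp add: pt r)
qed

lemma mumfordD:
  assumes "(u, v) \<in> mumford f1"
  shows "u \<noteq> 0" "lead_coeff u = 1" "Polynomial.degree u \<le> 2" "v = 0 \<or> Polynomial.degree v < Polynomial.degree u"
    "u dvd f1 - v * v"
  using assms unfolding mumford_def by auto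

text \<open>Let \<alpha>, \<beta>, \<gamma> be the orders of \<open>w - v\<close>,
  \<open>w + v\<close>, \<open>u\<close>; divisibility of \<open>f1 - v * v\<close> by
  \<open>u\<close> gives \<open>\<gamma> \<le> \<alpha> + \<beta>\<close>. Either one of \<alpha>,
  \<beta> is 0, or both are 1 at a branch place and the even number \<gamma> is 0 or 2.\<close>

lemma Em_props:
  assumes m: "m \<in> mumford f1" and x: "x \<in> fin.idx"
  shows "Em m x \<ge> 0" "Em m x + Em m (fin.\<sigma> x) = fin.\<nu> x (ip (fst m))"
    "Em m x > 0 \<Longrightarrow> snd x \<noteq> None \<and> (Em m (fin.\<sigma> x) = 0 \<or> snd x = Some 0 \<and> Em m x = 1)"
proof -
  obtain u v where uv: "m = (u, v)" by (cases m)
  note M = mumfordD[OF m[unfolded uv]]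
  define \<alpha> where "\<alpha> = fin.\<nu> x (fin.el (- v) 1)"
  define \<beta> where "\<beta> = fin.\<nu> x (fin.el v 1)"
  define \<gamma> where "\<gamma> = fin.\<nu> x (ip u)"
  have a: "\<alpha> \<ge> 0" unfolding \<alpha>_def by (rule fin.\<nu>_nonneg[OF x wv(3,1)])
  have b: "\<beta> \<ge> 0" unfolding \<beta>_def using fin.\<nu>_nonneg[OF x wv(3,1), of "- v"] by simp
  have c: "\<gamma> \<ge> 0" unfolding \<gamma>_def by (rule \<nu>_ip_nonneg[OF x M(1)])
  have E: "Em m x = min \<gamma> \<alpha>" unfolding Em_def uv \<alpha>_def \<gamma>_def by simp
  have E\<sigma>: "Em m (fin.\<sigma> x) = min \<gamma> \<beta>"
    unfolding Em_def uv \<beta>_def \<gamma>_def using wv_\<sigma>[OF x] fin.\<nu>_\<sigma>_\<iota>[OF x M(1)] by simp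
  obtain q where q: "f1 - v * v = u * q" using M(5) by (elim dvdE)
  have q0: "q \<noteq> 0" using q f1_v_nz[of v] by auto
  have "fin.\<nu> x (ip (u * q)) = \<gamma> + fin.\<nu> x (ip q)"
    unfolding fin.\<iota>_mult \<gamma>_def using M(1) q0 by (simp add: fin.\<nu>_mult[OF x fin.\<iota>_C _ fin.\<iota>_C] fin.\<iota>_eq_0)
  then have sum: "\<gamma> \<le> \<alpha> + \<beta>"
    using wv_sum[OF x, of v] \<nu>_ip_nonneg[OF x q0] unfolding q \<alpha>_def \<beta>_def by simp
  show "Em m x \<ge> 0" unfolding E using a c by simp
  have both: "snd x = Some 0 \<and> \<alpha> = 1 \<and> \<beta> = 1 \<and> even \<gamma>" if "\<alpha> > 0" "\<beta> > 0"
    using wv_both[OF x, of v] ip_even[OF x _ M(1)] that unfolding \<alpha>_def \<beta>_def \<gamma>_def by simp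
  show "Em m x + Em m (fin.\<sigma> x) = fin.\<nu> x (ip (fst m))"
  proof (cases "\<alpha> > 0 \<and> \<beta> > 0")
    case True
    then have 1: "\<alpha> = 1" "\<beta> = 1" "even \<gamma>" using both by auto
    then have "\<gamma> = 0 \<or> \<gamma> = 2" using sum c by presburger
    then show ?thesis unfolding E E\<sigma> using 1 by (auto simp: uv \<gamma>_def)
  next
    case False
    then have "\<alpha> = 0 \<or> \<beta> = 0" using a b by auto
    then have "min \<gamma> \<alpha> + min \<gamma> \<beta> = \<gamma>" using sum a b c by auto
    then show ?thesis unfolding E E\<sigma> by (simp add: uv \<gamma>_def)
  qed
  assume pos: "Em m x > 0"
  then have ap: "\<alpha> > 0" "\<gamma> > 0" unfolding E by auto
  show "snd x \<noteq> None \<and> (Em m (fin.\<sigma> x) = 0 \<or> snd x = Some 0 \<and> Em m x = 1)"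
  proof (cases "\<beta> > 0")
    case True
    then have "snd x = Some 0" "\<alpha> = 1" using both ap by auto
    then show ?thesis unfolding E using ap by simp
  next
    case False
    then have b0: "\<beta> = 0" using b by simp
    have "snd x \<noteq> None"
    proof
      assume "snd x = None"
      then have "fin.\<sigma> x = x" using \<sigma>_fixed by simp
      then have "\<alpha> = \<beta>" using wv_\<sigma>[OF x, of v] unfolding \<alpha>_def \<beta>_def by simp
      then show False using b0 ap by simp
    qed
    then show ?thesis unfolding E\<sigma> using b0 c by simp
  qed
qed

lemma Em_semired: "m \<in> mumford f1 \<Longrightarrow> semired (Em m)"
  unfolding semired_def using Em_props(1,3) by blast

lemma Em_fs: assumes m: "m \<in> mumford f1" shows "fs (Em m)"
proof -
  have u0: "fst m \<noteq> 0" using mumfordD(1)[of "fst m" "snd m"] m by simp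
  have "{x \<in> fin.idx. Em m x \<noteq> 0} \<subseteq> {x \<in> fin.idx. fin.\<nu> x (ip (fst m)) \<noteq> 0}"
  proof
    fix x assume "x \<in> {x \<in> fin.idx. Em m x \<noteq> 0}"
    then have x: "x \<in> fin.idx" "Em m x \<noteq> 0" by auto
    then show "x \<in> {x \<in> fin.idx. fin.\<nu> x (ip (fst m)) \<noteq> 0}"
      using Em_props(1,2)[OF m x(1)] Em_props(1)[OF m fin.\<sigma>_idx[OF x(1)]] by simp
  qed
  moreover have "finite {x \<in> fin.idx. fin.\<nu> x (ip (fst m)) \<noteq> 0}"
    by (rule fin.finite_support[OF fin.\<iota>_C]) (simp add: fin.\<iota>_eq_0 u0)
  ultimately show ?thesis unfolding fs_def by (rule finite_subset)
qed

lemma edeg_semired_ip: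
  assumes "fs E" "g \<noteq> 0" "\<And>x. x \<in> fin.idx \<Longrightarrow> E x + E (fin.\<sigma> x) = fin.\<nu> x (ip g)"
  shows "edeg E = int (Polynomial.degree g)"
proof -
  have "2 * edeg E = edeg (\<lambda>x. E x + E (fin.\<sigma> x))"
    using edeg_add[OF assms(1) fs_\<sigma>[OF assms(1)]] edeg_\<sigma>[of E] by simp
  also have "\<dots> = edeg (\<lambda>x. fin.\<nu> x (ip g))" by (rule edeg_cong[OF assms(3)])
  also have "\<dots> = 2 * int (Polynomial.degree g)" unfolding edeg_\<nu> by (rule fin.vsum_\<iota>[OF assms(2)])
  finally show ?thesis by simp
qed

lemma edeg_Em: assumes m: "m \<in> mumford f1" shows "edeg (Em m) = int (Polynomial.degree (fst m))"
  by (rule edeg_semired_ip[OF Em_fs[OF m] _ Em_props(2)[OF m]]) (use mumfordD(1)[of "fst m" "snd m"] m in simp_all)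

text \<open>A polynomial vanishing on \<open>Em m\<close> also vanishes on the conjugate divisor,
  and the two add up to the divisor of \<open>u\<close>.\<close>

lemma Em_above_dvd:
  assumes m: "m \<in> mumford f1" and g: "g \<noteq> 0" "above (Em m) (ip g)"
  shows "fst m dvd g"
proof (rule ip_dvd[OF _ g(1)])
  show "fst m \<noteq> 0" using mumfordD(1)[of "fst m" "snd m"] m by simp
  fix x assume x: "x \<in> fin.idx"
  show "fin.\<nu> x (ip (fst m)) \<le> fin.\<nu> x (ip g)"
    using semired_above[OF Em_semired[OF m] g x] Em_props(2)[OF m x] by simp
qed

text \<open>The two polynomials \<open>u\<close>, \<open>u'\<close> divide each other and are monic.
  The difference \<open>v - v'\<close> vanishes on the divisor, so it is a multiple of
  \<open>u\<close> of degree below \<open>u\<close>.\<close>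

lemma Em_inj:
  assumes m: "m \<in> mumford f1" "m' \<in> mumford f1" and eq: "\<And>x. x \<in> fin.idx \<Longrightarrow> Em m x = Em m' x"
  shows "m = m'"
proof -
  obtain u v where uv: "m = (u, v)" by (cases m)
  obtain u' v' where uv': "m' = (u', v')" by (cases m')
  note M = mumfordD[OF m(1)[unfolded uv]] and M' = mumfordD[OF m(2)[unfolded uv']]
  have le: "above (Em m) (ip u)" "above (Em m') (ip u')" "above (Em m) (fin.el (- v) 1)" "above (Em m') (fin.el (- v') 1)"
    unfolding above_def Em_def uv uv' by simp_all
  have eqa: "above (Em m) z \<longleftrightarrow> above (Em m') z" for z unfolding above_def using eq by simp
  have 1: "u dvd u'" using Em_above_dvd[OF m(1) M'(1)] le eqa uv by simp
  have 2: "u' dvd u" using Em_above_dvd[OF m(2) M(1)] le eqa uv' by simp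
  obtain c where c: "u' = u * c" using 1 by (elim dvdE)
  have "c dvd 1" using 2 M(1) unfolding c by (metis dvd_mult_cancel_left mult.right_neutral)
  then obtain r where r: "c = [:r:]" using is_unit_polyE[of c] by metis
  have "lead_coeff u' = lead_coeff u * r" unfolding c r by (simp add: lead_coeff_mult)
  then have "r = 1" unfolding M(2) M'(2) by simp
  then have uu: "u' = u" using c r by simp
  have "v = v'"
  proof (rule ccontr)
    assume ne: "v \<noteq> v'"
    have e: "fin.el (- v') 1 - fin.el (- v) 1 = ip (v - v')" by (simp add: fin.el_diff fin.el_0)
    have nz: "fin.el (- v') 1 - fin.el (- v) 1 \<noteq> 0" unfolding e using ne by (simp add: fin.\<iota>_eq_0)
    have "above (Em m) (ip (v - v'))" unfolding above_def
    proof
      fix x assume x: "x \<in> fin.idx"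
      have "Em m x \<le> fin.\<nu> x (fin.el (- v') 1)" "Em m x \<le> fin.\<nu> x (fin.el (- v) 1)"
        using le eqa x unfolding above_def by blast+
      then show "Em m x \<le> fin.\<nu> x (ip (v - v'))"
        unfolding e[symmetric] using ge_diff[OF x wv(2,1) _ wv(2,1) _ nz] by blast
    qed
    then have "u dvd v - v'" using Em_above_dvd[OF m(1)] ne uv by simp
    then have "Polynomial.degree u \<le> Polynomial.degree (v - v')" using ne by (intro dvd_imp_degree_le) simp_all
    moreover have "v - v' \<in> fin.small (Polynomial.degree u)"
      using M(4) M'(4) uu by (intro fin.small_diff) (simp_all add: fin.small_def)
    ultimately show False using ne unfolding fin.small_def by simp
  qed
  then show ?thesis using uu uv uv' by simp
qed

text \<open>Normality of the affine ring: a prime \<open>p\<close> of the denominator divides both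
  coordinates of the numerator and cancels. At a split prime this comes from the two values
  \<open>g + h v\<close> and \<open>g - h v\<close>; at a ramified one, from order at least 2 and
  the evenness of the orders of polynomials.\<close>

lemma Oset_of_nonneg:
  assumes "z \<in> C" "z \<noteq> 0" "\<And>x. x \<in> fin.idx \<Longrightarrow> fin.\<nu> x z \<ge> 0"
  shows "z \<in> fin.Oset"
proof -
  obtain g h d where "d \<noteq> 0" "z * ip d = fin.el g h" using fin.Cset_repr[OF assms(1)] by metis
  then show ?thesis
  proof (induction "Polynomial.degree d" arbitrary: d g h rule: less_induct)
    case less
    show ?case
    proof (cases "Polynomial.degree d = 0")
      case True
      then obtain c where c: "d = [:c:]" by (metis degree_eq_zeroE)
      then have "[:inverse c:] * d = 1" using less.prems by simp
      then have "ip [:inverse c:] * ip d = 1" by (metis fin.\<iota>_mult fin.\<iota>_1)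
      then have "z = ip [:inverse c:] * (z * ip d)" by (simp add: mult_ac)
      then have "z = fin.el ([:inverse c:] * g) ([:inverse c:] * h)" unfolding less.prems(2) fin.el_smult .
      then show ?thesis using fin.el_Oset by simp
    next
      case False
      then obtain p where p: "irreducible p" "lead_coeff p = 1" "p dvd d"
        using exists_irreducible_factor[of d] by auto
      interpret irr_poly p by unfold_locales (rule p)
      obtain d' where d': "d = p * d'" using p(3) by (elim dvdE)
      have nz: "p \<noteq> 0" "d' \<noteq> 0" using d' less.prems(1) by auto
      have ipz: "ip p \<noteq> 0" "ip d' \<noteq> 0" "ip d \<noteq> 0" using nz less.prems(1) by (simp_all add: fin.\<iota>_eq_0)
      have el0: "fin.el g h \<noteq> 0" using less.prems(2) ipz assms(2) by (metis mult_eq_0_iff)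
      have ge: "fin.\<nu> x (fin.el g h) \<ge> int (fin.ram x)" if x: "x \<in> fin.idx" "fst x = p" for x
      proof -
        have "fin.\<nu> x (fin.el g h) = fin.\<nu> x z + (fin.\<nu> x (ip p) + fin.\<nu> x (ip d'))"
          unfolding less.prems(2)[symmetric] d' fin.\<iota>_mult
          using fin.\<nu>_mult[OF x(1) assms(1,2) fin.Cmult[OF fin.\<iota>_C fin.\<iota>_C]] fin.\<nu>_mult[OF x(1) fin.\<iota>_C ipz(1) fin.\<iota>_C ipz(2)] ipz
          by simp
        then show ?thesis using assms(3)[OF x(1)] \<nu>_ip_nonneg[OF x(1) nz(2)] fin.\<nu>_prime[OF x(1) p(1,2)] x(2) by simp
      qed
      have mem: "fin.el g h \<in> fin.pp x" if x: "x \<in> fin.idx" "fst x = p" for x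
        using ge[OF x] fin.\<nu>_pos_iff[OF x(1) fin.el_Oset el0] by (simp add: fin.ram_def split: if_splits)
      have "p dvd g \<and> p dvd h"
      proof (cases "\<exists>v. p dvd f1 - v * v")
        case False
        then have "(p, None) \<in> fin.idx" using p by (simp add: fin.idx_def)
        then show ?thesis using mem[of "(p, None)"] by (simp add: fin.mem_pp_None)
      next
        case True
        have "{x \<in> fin.idx. fst x = p} \<noteq> {}"
        proof
          assume "{x \<in> fin.idx. fst x = p} = {}"
          then show False using conjunct2[OF fin.sum_fiber[OF p(1,2)]] deg_pos by (simp only: sum.empty)
        qed
        then obtain t where t: "(p, t) \<in> fin.idx" by (metis (mono_tags, lifting) Collect_empty_eq prod.collapse)
        have "t \<noteq> None" using t True by (cases t) (simp_all add: fin.idx_def)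
        then obtain v where v: "t = Some v" by blast
        have x1: "(p, Some v) \<in> fin.idx" using t v by simp
        have x2: "(p, Some (- v)) \<in> fin.idx" using fin.\<sigma>_idx[OF x1] by (simp add: fin.\<sigma>_def)
        have d1: "p dvd g + h * v" using mem[OF x1] by (simp add: fin.mem_pp_Some)
        have d2: "p dvd g - h * v" using mem[OF x2] by (simp add: fin.mem_pp_Some)
        have n2: "\<not> p dvd 2" by (rule fin.not_dvd_two[OF p(1)])
        have "p dvd 2 * g" using dvd_add[OF d1 d2] by simp
        then have pg: "p dvd g" using n2 by (simp add: prime_dvd_mult)
        have "p dvd 2 * (h * v)" using dvd_diff[OF d1 d2] by simp
        then have phv: "p dvd h * v" using n2 by (simp add: prime_dvd_mult)
        show ?thesis
        proof (cases "v = 0")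
          case False
          then have "\<not> p dvd v" using x1 dvd_small[of v] by (auto simp: fin.idx_def)
          then show ?thesis using pg phv by (simp add: prime_dvd_mult)
        next
          case v0: True
          let ?x = "(p, Some (0 :: 'a poly))"
          have x0: "?x \<in> fin.idx" using x1 v0 by simp
          have "p dvd h"
          proof (rule ccontr)
            assume ph: "\<not> p dvd h"
            have h0: "h \<noteq> 0" using ph by auto
            have "fin.\<nu> ?x (ip h) = 0" by (rule fin.\<nu>_unit[OF x0 fin.\<iota>_Oset]) (simp add: fin.mem_pp_\<iota> ph)
            moreover have "fin.\<nu> ?x w = 1"
              using fin.dord_t[OF fin.datum_idx[OF x0]] unfolding fin.\<nu>_def by (simp add: fin.tt_def)
            ultimately have hw: "fin.\<nu> ?x (ip h * w) = 1"
              using fin.\<nu>_mult[OF x0 fin.\<iota>_C _ fin.w_C w0, of h] h0 by (simp add: fin.\<iota>_eq_0)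
            have hwC: "ip h * w \<in> C" "ip h * w \<noteq> 0" using fin.Cmult[OF fin.\<iota>_C fin.w_C] h0 w0 by (simp_all add: fin.\<iota>_eq_0)
            have two: "fin.\<nu> ?x (fin.el g h) \<ge> 2" using ge[OF x0] by (simp add: fin.ram_def)
            show False
            proof (cases "g = 0")
              case True
              then show False using two hw by (simp add: fin.el_def ev_0)
            next
              case g0: False
              have "fin.\<nu> ?x (ip g) > 0"
                using fin.\<nu>_pos_iff[OF x0 fin.\<iota>_Oset, of g] pg g0 by (simp add: fin.mem_pp_\<iota> fin.\<iota>_eq_0)
              moreover have "even (fin.\<nu> ?x (ip g))" by (rule ip_even[OF x0 _ g0]) simp
              ultimately have "fin.\<nu> ?x (ip g) \<noteq> 1 \<and> fin.\<nu> ?x (ip g) \<ge> 1" by auto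
              then have lt: "fin.\<nu> ?x (ip h * w) < fin.\<nu> ?x (ip g)" using hw by simp
              have "fin.\<nu> ?x (ip h * w + ip g) = 1"
                using dval_strict[OF fin.dval_\<nu>[OF x0] hwC fin.\<iota>_C _ lt] g0 hw by (simp add: fin.\<iota>_eq_0)
              then show False using two by (simp add: fin.el_def add.commute)
            qed
          qed
          then show ?thesis using pg by simp
        qed
      qed
      then obtain g' h' where gh: "g = p * g'" "h = p * h'" by (elim conjE dvdE)
      have "ip p * (z * ip d') = ip p * fin.el g' h'"
        using less.prems(2) unfolding d' gh fin.el_smult fin.\<iota>_mult by (simp add: mult_ac)
      then have "z * ip d' = fin.el g' h'" using ipz(1) by simp
      moreover have "Polynomial.degree d' < Polynomial.degree d"
        unfolding d' degree_mult_eq[OF nz] using deg_pos by simp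
      ultimately show ?thesis using less.hyps[of d' g' h'] nz(2) by simp
    qed
  qed
qed

end

section \<open>Each class contains exactly one Mumford divisor\<close>

context curve
begin

lemma snd_\<sigma>: "snd (fin.\<sigma> x) = Some 0 \<longleftrightarrow> snd x = Some 0" "snd (fin.\<sigma> x) = None \<longleftrightarrow> snd x = None"
  by (cases x; cases "snd x"; simp add: fin.\<sigma>_def)+

text \<open>Multiplying \<open>z\<close> by \<open>u'\<close> gives a function whose affine divisor
  is \<open>Em m\<close> plus the conjugate of \<open>Em m'\<close>, of degree at most 4. A function
  involving \<open>w\<close> has norm degree at least 5, so this one is a polynomial; its orders at
  conjugate places agree, and semi-reducedness identifies the divisors.\<close>

lemma Em_class_inj:
  assumes m: "m \<in> mumford f1" "m' \<in> mumford f1" and z: "z \<in> C" "z \<noteq> 0"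
    and eq: "\<And>x. x \<in> fin.idx \<Longrightarrow> Em m x - Em m' x = fin.\<nu> x z"
  shows "m = m'"
proof -
  define u' where "u' = fst m'"
  have u'0: "u' \<noteq> 0" "Polynomial.degree u' \<le> 2" "Polynomial.degree (fst m) \<le> 2"
    using mumfordD(1,3)[of "fst m'" "snd m'"] mumfordD(3)[of "fst m" "snd m"] m unfolding u'_def by simp_all
  have ip0: "ip u' \<noteq> 0" using u'0 by (simp add: fin.\<iota>_eq_0)
  define t where "t = z * ip u'"
  have t: "t \<in> C" "t \<noteq> 0" unfolding t_def using z ip0 fin.Cmult[OF z(1) fin.\<iota>_C] by simp_all
  have nt: "fin.\<nu> x t = Em m x + Em m' (fin.\<sigma> x)" if x: "x \<in> fin.idx" for x
    unfolding t_def fin.\<nu>_mult[OF x z fin.\<iota>_C ip0] using eq[OF x] Em_props(2)[OF m(2) x] unfolding u'_def by simp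
  have "t \<in> fin.Oset"
  proof (rule Oset_of_nonneg[OF t])
    fix x assume x: "x \<in> fin.idx"
    show "fin.\<nu> x t \<ge> 0"
      using nt[OF x] Em_props(1)[OF m(1) x] Em_props(1)[OF m(2) fin.\<sigma>_idx[OF x]] by simp
  qed
  then obtain g h where gh: "t = fin.el g h" unfolding fin.Oset_def by blast
  have "fin.vsum t = edeg (\<lambda>x. Em m x + Em m' (fin.\<sigma> x))"
    unfolding edeg_\<nu>[symmetric] by (rule edeg_cong[OF nt])
  also have "\<dots> = edeg (Em m) + edeg (Em m')"
    using edeg_add[OF Em_fs[OF m(1)] fs_\<sigma>[OF Em_fs[OF m(2)]]] edeg_\<sigma>[of "Em m'"] by simp
  also have "\<dots> \<le> 4" using edeg_Em[OF m(1)] edeg_Em[OF m(2)] u'0 unfolding u'_def by simp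
  finally have deg: "Polynomial.degree (fin.nrm g h) \<le> 4" using fin.vsum_el[of g h] t(2) unfolding gh by simp
  have h0: "h = 0"
  proof (rule ccontr)
    assume "h \<noteq> 0"
    then show False using deg_nrm(2)[of g h] deg by simp
  qed
  then have tg: "t = ip g" "g \<noteq> 0" using gh t(2) by (auto simp: fin.el_def ev_0)
  show ?thesis
  proof (rule Em_inj[OF m])
    fix x assume x: "x \<in> fin.idx"
    define a where "a = Em m x" define a' where "a' = Em m (fin.\<sigma> x)"
    define b where "b = Em m' x" define b' where "b' = Em m' (fin.\<sigma> x)"
    note \<sigma>x = fin.\<sigma>_idx[OF x]
    have nn: "a \<ge> 0" "a' \<ge> 0" "b \<ge> 0" "b' \<ge> 0"
      unfolding a_def a'_def b_def b'_def
      using Em_props(1)[OF m(1)] Em_props(1)[OF m(2)] x \<sigma>x by simp_all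
    have s1: "a + b' = fin.\<nu> x (ip g)" using nt[OF x] unfolding tg a_def b'_def by simp
    have s2: "a' + b = fin.\<nu> x (ip g)"
      using nt[OF \<sigma>x] fin.\<nu>_\<sigma>_\<iota>[OF x tg(2)] unfolding tg a'_def b_def fin.\<sigma>_\<sigma> by simp
    have A: "a > 0 \<Longrightarrow> snd x \<noteq> None \<and> (a' = 0 \<or> snd x = Some 0 \<and> a = 1)"
      unfolding a_def a'_def by (rule Em_props(3)[OF m(1) x])
    have A': "a' > 0 \<Longrightarrow> snd x \<noteq> None \<and> (a = 0 \<or> snd x = Some 0 \<and> a' = 1)"
      using Em_props(3)[OF m(1) \<sigma>x] unfolding a_def a'_def fin.\<sigma>_\<sigma> snd_\<sigma> by blast
    have B: "b > 0 \<Longrightarrow> snd x \<noteq> None \<and> (b' = 0 \<or> snd x = Some 0 \<and> b = 1)"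
      unfolding b_def b'_def by (rule Em_props(3)[OF m(2) x])
    have B': "b' > 0 \<Longrightarrow> snd x \<noteq> None \<and> (b = 0 \<or> snd x = Some 0 \<and> b' = 1)"
      using Em_props(3)[OF m(2) \<sigma>x] unfolding b_def b'_def fin.\<sigma>_\<sigma> snd_\<sigma> by blast
    \<comment> \<open>\<open>s1\<close> and \<open>s2\<close> give \<open>a - a' = b - b'\<close>,
      with one entry of each pair equal to 0; at a branch place the evenness of \<open>a + b\<close>
      decides instead.\<close>
    have "a = b"
    proof (cases "snd x = Some 0")
      case True
      then have "a' = a" "b' = b" using \<sigma>_fixed[of x] unfolding a_def a'_def b_def b'_def by simp_all
      moreover have "even (fin.\<nu> x (ip g))" by (rule ip_even[OF x True tg(2)])
      ultimately have "even (a + b)" "a = 0 \<or> a = 1" "b = 0 \<or> b = 1" using s1 A B nn by auto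
      then show ?thesis by auto
    next
      case False
      then have "a = 0 \<or> a' = 0" "b = 0 \<or> b' = 0" using A B nn by auto
      then show ?thesis using s1 s2 nn by auto
    qed
    then show "Em m x = Em m' x" unfolding a_def b_def .
  qed
qed

definition box :: "nat \<Rightarrow> nat \<Rightarrow> 'l set" where
  "box a b = {fin.el g h |g h. g \<in> fin.small a \<and> h \<in> fin.small b}"

lemma box_eq_image: "box a b = (\<lambda>(g, h). fin.el g h) ` (fin.small a \<times> fin.small b)"
  unfolding box_def by force

lemma box_props:
  shows "finite (box a b)" "box a b \<subseteq> fin.Oset" "\<And>s t. s \<in> box a b \<Longrightarrow> t \<in> box a b \<Longrightarrow> s - t \<in> box a b"
    "card (box a b) = CARD('a) ^ (a + b)"
proof -
  show "finite (box a b)" unfolding box_eq_image by (simp add: fin.small_card)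
  show "box a b \<subseteq> fin.Oset" unfolding box_def fin.Oset_def by blast
  fix s t assume "s \<in> box a b" "t \<in> box a b"
  then obtain g h g' h' where 1: "s = fin.el g h" "g \<in> fin.small a" "h \<in> fin.small b"
    and 2: "t = fin.el g' h'" "g' \<in> fin.small a" "h' \<in> fin.small b" unfolding box_def by blast
  have "g - g' \<in> fin.small a" "h - h' \<in> fin.small b" using 1 2 fin.small_diff by simp_all
  then show "s - t \<in> box a b" unfolding box_def 1(1) 2(1) fin.el_diff by blast
next
  have "inj_on (\<lambda>(g, h). fin.el g h) (fin.small a \<times> fin.small b)"
    by (rule inj_onI) (clarsimp simp: fin.el_eq)
  then show "card (box a b) = CARD('a) ^ (a + b)"
    unfolding box_eq_image by (simp add: card_image card_cartesian_product fin.small_card power_add)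
qed

lemma q_ge_2: "CARD('a) \<ge> 2"
proof -
  have "card {0, 1 :: 'a} \<le> CARD('a)" by (rule card_mono) simp_all
  then show ?thesis by simp
qed

text \<open>Adding the divisor of a polynomial that vanishes to high enough order along the support
  makes all coefficients nonnegative.\<close>

lemma effective_exists:
  assumes D: "fs D"
  shows "\<exists>E. fs E \<and> (\<forall>x\<in>fin.idx. E x \<ge> 0) \<and> (\<exists>z\<in>C - {0}. \<forall>x\<in>fin.idx. E x - D x = fin.\<nu> x z)"
proof -
  define S where "S = {x \<in> fin.idx. D x \<noteq> 0}"
  have finS: "finite S" using D unfolding fs_def S_def .
  define g where "g = (\<Prod>x\<in>S. fst x ^ nat \<bar>D x\<bar>)"
  have irr: "irreducible (fst x)" "lead_coeff (fst x) = 1" "fst x \<noteq> 0" if "x \<in> fin.idx" for x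
    using that by (auto simp: fin.idx_def Factorial_Ring.irreducible_def)
  have g0: "g \<noteq> 0" unfolding g_def using finS irr(3) by (simp add: S_def)
  have ge: "fin.\<nu> x (ip g) \<ge> \<bar>D x\<bar>" if x: "x \<in> S" for x
  proof -
    have xi: "x \<in> fin.idx" using x unfolding S_def by simp
    have "fst x ^ nat \<bar>D x\<bar> dvd g" unfolding g_def by (rule dvd_prodI[OF finS x])
    then obtain q where q: "g = fst x ^ nat \<bar>D x\<bar> * q" by (elim dvdE)
    have q0: "q \<noteq> 0" using q g0 by auto
    have ip0: "ip (fst x) \<noteq> 0" using irr(3)[OF xi] by (simp add: fin.\<iota>_eq_0)
    have "fin.\<nu> x (ip g) = fin.\<nu> x (ip (fst x) ^ nat \<bar>D x\<bar>) + fin.\<nu> x (ip q)"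
      unfolding q fin.\<iota>_mult fin.\<iota>_power
      by (rule fin.\<nu>_mult[OF xi fin_pow[OF fin.\<iota>_C] _ fin.\<iota>_C]) (use ip0 q0 in \<open>simp_all add: fin.\<iota>_eq_0\<close>)
    also have "fin.\<nu> x (ip (fst x) ^ nat \<bar>D x\<bar>) = \<bar>D x\<bar> * int (fin.ram x)"
      using fin.\<nu>_power[OF xi fin.\<iota>_C ip0] fin.\<nu>_prime[OF xi irr(1,2)[OF xi]] by simp
    finally show ?thesis using \<nu>_ip_nonneg[OF xi q0] by (simp add: fin.ram_def)
  qed
  have ipg: "ip g \<in> C" "ip g \<noteq> 0" using g0 fin.\<iota>_C by (simp_all add: fin.\<iota>_eq_0)
  define E where "E = (\<lambda>x. D x + fin.\<nu> x (ip g))"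
  have "E x \<ge> 0" if x: "x \<in> fin.idx" for x
  proof (cases "x \<in> S")
    case True
    then show ?thesis using ge[OF True] unfolding E_def by simp
  next
    case False
    then have "D x = 0" using x unfolding S_def by simp
    then show ?thesis using \<nu>_ip_nonneg[OF x g0] unfolding E_def by simp
  qed
  moreover have "fs E" unfolding E_def by (rule fs_add[OF D fs_\<nu>[OF ipg]])
  moreover have "\<forall>x\<in>fin.idx. E x - D x = fin.\<nu> x (ip g)" unfolding E_def by simp
  ultimately show ?thesis using ipg by blast
qed

text \<open>For an effective \<open>E1\<close> equivalent to \<open>- D\<close>, a function
  vanishing on \<open>E1\<close> leaves a residual divisor equivalent to \<open>D\<close>. The
  residue has degree at most 2, the genus, as soon as the norm of the function has degree at most
  \<open>edeg E1 + 2\<close>.\<close>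

lemma degree_two_exists:
  assumes D: "fs D"
  shows "\<exists>E. fs E \<and> (\<forall>x\<in>fin.idx. E x \<ge> 0) \<and> edeg E \<le> 2 \<and>
    (\<exists>z\<in>C - {0}. \<forall>x\<in>fin.idx. E x - D x = fin.\<nu> x z)"
proof -
  obtain E1 z1 where E1: "fs E1" "\<And>x. x \<in> fin.idx \<Longrightarrow> E1 x \<ge> 0" and z1: "z1 \<in> C" "z1 \<noteq> 0"
    and D1: "\<And>x. x \<in> fin.idx \<Longrightarrow> E1 x - - D x = fin.\<nu> x z1"
    using effective_exists[OF fs_uminus[OF D]] by blast
  define n where "n = nat (edeg E1)"
  have "edeg E1 \<ge> 0" unfolding edeg_def using E1(2) by (intro sum_nonneg) simp
  then have n: "edeg E1 = int n" unfolding n_def by simp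
  \<comment> \<open>The bounds \<open>deg g < a\<close>, \<open>deg h < b\<close> express norm
    degree at most \<open>n + 2\<close>. They leave \<open>q^(a + b)\<close> functions, and
    \<open>a + b > n\<close>, also for \<open>n = 0\<close>, where the subtraction in
    \<open>b\<close> truncates.\<close>
  define a where "a = (n + 2) div 2 + 1"
  define b where "b = (n - 1) div 2"
  have "a + b > n" unfolding a_def b_def by presburger
  then have "CARD('a) ^ n < CARD('a) ^ (a + b)" using q_ge_2 by (simp add: power_strict_increasing_iff)
  then have "\<exists>z\<in>box a b. z \<noteq> 0 \<and> above E1 z"
    by (intro pigeonhole[OF box_props(1,2,3) E1]) (simp_all add: box_props(4) n_def)
  then obtain g h where gh: "g \<in> fin.small a" "h \<in> fin.small b" "fin.el g h \<noteq> 0" "above E1 (fin.el g h)"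
    unfolding box_def by blast
  have deg: "Polynomial.degree (fin.nrm g h) \<le> n + 2"
  proof (cases "h = 0")
    case True
    then have "g \<noteq> 0" using gh(3) by (simp add: fin.el_eq_0)
    then have "Polynomial.degree (fin.nrm g h) = 2 * Polynomial.degree g"
      unfolding fin.nrm_def True by (simp add: degree_mult_eq)
    also have "\<dots> \<le> n + 2" using gh(1) \<open>g \<noteq> 0\<close> unfolding fin.small_def a_def by simp
    finally show ?thesis .
  next
    case False
    have "Polynomial.degree h < b" using gh(2) False unfolding fin.small_def by simp
    then have "2 * Polynomial.degree h + 5 \<le> n + 2" unfolding b_def by linarith
    moreover have "2 * Polynomial.degree g \<le> n + 2" using gh(1) unfolding fin.small_def a_def by auto
    ultimately show ?thesis using deg_nrm(4)[of g h] False by simp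
  qed
  define E where "E = (\<lambda>x. fin.\<nu> x (fin.el g h) + - E1 x)"
  have fsz: "fs (\<lambda>x. fin.\<nu> x (fin.el g h))" by (rule fs_\<nu>[OF fin.el_C gh(3)])
  have "fs E" unfolding E_def by (rule fs_add[OF fsz fs_uminus[OF E1(1)]])
  moreover have "\<forall>x\<in>fin.idx. E x \<ge> 0" using gh(4) unfolding E_def above_def by simp
  moreover have "edeg E = fin.vsum (fin.el g h) - edeg E1"
    unfolding E_def using edeg_add[OF fsz fs_uminus[OF E1(1)]] by (simp add: edeg_uminus edeg_\<nu>)
  then have "edeg E \<le> 2" using fin.vsum_el[OF gh(3)] deg n by simp
  moreover have "\<forall>x\<in>fin.idx. E x - D x = fin.\<nu> x (fin.el g h * inverse z1)"
  proof
    fix x assume x: "x \<in> fin.idx"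
    have "fin.\<nu> x (fin.el g h * inverse z1) = fin.\<nu> x (fin.el g h) - fin.\<nu> x z1"
      using fin.\<nu>_mult[OF x fin.el_C gh(3) fin.Cinv[OF z1(1)]] fin.\<nu>_inverse[OF x z1] z1(2) by simp
    then show "E x - D x = fin.\<nu> x (fin.el g h * inverse z1)" unfolding E_def using D1[OF x] by simp
  qed
  moreover have "fin.el g h * inverse z1 \<in> C - {0}"
    using fin.Cmult[OF fin.el_C fin.Cinv[OF z1(1)]] gh(3) z1(2) by simp
  ultimately show ?thesis by blast
qed

lemma idx_fiber: assumes "x \<in> fin.idx" "x' \<in> fin.idx" "fst x = fst x'" shows "x' = x \<or> x' = fin.\<sigma> x"
proof -
  obtain p s where ps: "x = (p, s)" by (cases x)
  obtain s' where ps': "x' = (p, s')" using assms(3) ps by (cases x') simp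
  have irr: "irreducible p" using assms(1) ps by (simp add: fin.idx_def)
  interpret irr_poly p by unfold_locales (rule irr)
  show ?thesis
  proof (cases s)
    case None
    then have "s' = None" using assms(1,2) unfolding ps ps' by (cases s') (simp_all add: fin.idx_def)
    then show ?thesis using ps ps' None by simp
  next
    case (Some v)
    then have "s' \<noteq> None" using assms(1,2) unfolding ps ps' by (cases s') (auto simp: fin.idx_def)
    then obtain v' where v': "s' = Some v'" by blast
    have d: "p dvd f1 - v * v" "p dvd f1 - v' * v'" and sm: "v \<in> fin.small (Polynomial.degree p)" "v' \<in> fin.small (Polynomial.degree p)"
      using assms(1,2) unfolding ps ps' Some v' by (simp_all add: fin.idx_def fin.small_def)
    have "p dvd (f1 - v * v) - (f1 - v' * v')" by (rule dvd_diff[OF d])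
    moreover have "(f1 - v * v) - (f1 - v' * v') = (v' - v) * (v' - (- v))" by (simp add: algebra_simps)
    ultimately have "p dvd v' - v \<or> p dvd v' - (- v)" by (simp only: prime_dvd_mult)
    moreover have "- v \<in> fin.small (Polynomial.degree p)" using sm unfolding fin.small_def by simp
    ultimately have "v' - v = 0 \<or> v' - (- v) = 0"
      using dvd_small[of "v' - v"] dvd_small[of "v' - (- v)"] fin.small_diff[OF sm(2,1)] fin.small_diff[OF sm(2), of "- v"]
      unfolding fin.small_def by blast
    then have "v' = v \<or> v' = - v" by (simp add: eq_neg_iff_add_eq_0)
    then show ?thesis unfolding ps ps' Some v' by (auto simp: fin.\<sigma>_def)
  qed
qed

text \<open>An effective representative of least degree is semi-reduced: any violation would let the
  divisor of some irreducible polynomial be subtracted, lowering the degree.\<close>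

lemma semired_exists:
  assumes D: "fs D"
  shows "\<exists>E. fs E \<and> semired E \<and> edeg E \<le> 2 \<and> edeg E \<ge> 0 \<and>
    (\<exists>z\<in>C - {0}. \<forall>x\<in>fin.idx. E x - D x = fin.\<nu> x z)"
proof -
  define P where "P E \<longleftrightarrow> fs E \<and> (\<forall>x\<in>fin.idx. E x \<ge> 0) \<and>
    (\<exists>z\<in>C - {0}. \<forall>x\<in>fin.idx. E x - D x = fin.\<nu> x z)" for E
  have edeg_nn: "edeg E \<ge> 0" if "P E" for E
    unfolding edeg_def using that unfolding P_def by (intro sum_nonneg) simp
  obtain E0 where E0: "P E0" "edeg E0 \<le> 2" using degree_two_exists[OF D] unfolding P_def by blast
  obtain E where E: "P E" and min: "\<And>F. P F \<Longrightarrow> nat (edeg E) \<le> nat (edeg F)"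
    using ex_has_least_nat[of P E0 "\<lambda>E. nat (edeg E)"] E0(1) by blast
  have deg2: "edeg E \<le> 2" using min[OF E0(1)] E0(2) edeg_nn[OF E] by linarith
  obtain z where z: "z \<in> C" "z \<noteq> 0" "\<And>x. x \<in> fin.idx \<Longrightarrow> E x - D x = fin.\<nu> x z"
    using E unfolding P_def by blast
  have Enn: "E x \<ge> 0" if "x \<in> fin.idx" for x using E that unfolding P_def by blast
  have no: False if x: "x \<in> fin.idx" and ge: "\<And>x'. x' \<in> fin.idx \<Longrightarrow> fst x' = fst x \<Longrightarrow> int (fin.ram x') \<le> E x'" for x
  proof -
    define p where "p = fst x"
    have p: "irreducible p" "lead_coeff p = 1" using x unfolding p_def by (simp_all add: fin.idx_def)
    have ip0: "ip p \<noteq> 0" using p by (auto simp: fin.\<iota>_eq_0 Factorial_Ring.irreducible_def)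
    define F where "F = (\<lambda>x. E x + - fin.\<nu> x (ip p))"
    have fsE: "fs E" using E unfolding P_def by blast
    have fsp: "fs (\<lambda>x. fin.\<nu> x (ip p))" by (rule fs_\<nu>[OF fin.\<iota>_C ip0])
    have fsF: "fs F" unfolding F_def by (rule fs_add[OF fsE fs_uminus[OF fsp]])
    have Fnn: "\<forall>x\<in>fin.idx. F x \<ge> 0"
    proof
      fix x' assume x': "x' \<in> fin.idx"
      show "F x' \<ge> 0" unfolding F_def
        using fin.\<nu>_prime[OF x' p] ge[OF x'] Enn[OF x'] p_def by simp
    qed
    have zz: "z * inverse (ip p) \<in> C - {0}" using fin.Cmult[OF z(1) fin.Cinv[OF fin.\<iota>_C]] z(2) ip0 by simp
    have eqv: "\<forall>x\<in>fin.idx. F x - D x = fin.\<nu> x (z * inverse (ip p))"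
    proof
      fix x' assume x': "x' \<in> fin.idx"
      have "fin.\<nu> x' (z * inverse (ip p)) = fin.\<nu> x' z - fin.\<nu> x' (ip p)"
        using fin.\<nu>_mult[OF x' z(1,2) fin.Cinv[OF fin.\<iota>_C]] fin.\<nu>_inverse[OF x' fin.\<iota>_C ip0] ip0 by simp
      then show "F x' - D x' = fin.\<nu> x' (z * inverse (ip p))" unfolding F_def using z(3)[OF x'] by simp
    qed
    have PF: "P F" unfolding P_def using fsF Fnn eqv zz by blast
    have "edeg F = edeg E - fin.vsum (ip p)"
      unfolding F_def using edeg_add[OF fsE fs_uminus[OF fsp]] by (simp add: edeg_uminus edeg_\<nu>)
    then have "edeg F < edeg E" using fin.vsum_prime[OF p] irreducible_field_poly_degree[OF p(1)] by simp
    then show False using min[OF PF] edeg_nn[OF PF] by linarith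
  qed
  have "semired E" unfolding semired_def
  proof (intro ballI conjI impI)
    fix x assume x: "x \<in> fin.idx"
    show "E x \<ge> 0" by (rule Enn[OF x])
    assume pos: "E x > 0"
    show nn: "snd x \<noteq> None"
    proof
      assume N: "snd x = None"
      show False
      proof (rule no[OF x])
        fix x' assume x': "x' \<in> fin.idx" "fst x' = fst x"
        then have "x' = x" using idx_fiber[OF x x'(1)] \<sigma>_fixed[of x] N by simp
        then show "int (fin.ram x') \<le> E x'" using pos N by (simp add: fin.ram_def)
      qed
    qed
    show "E (fin.\<sigma> x) = 0 \<or> snd x = Some 0 \<and> E x = 1"
    proof (rule ccontr)
      assume *: "\<not> (E (fin.\<sigma> x) = 0 \<or> snd x = Some 0 \<and> E x = 1)"
      then have \<sigma>pos: "E (fin.\<sigma> x) > 0" using Enn[OF fin.\<sigma>_idx[OF x]] by simp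
      show False
      proof (rule no[OF x])
        fix x' assume x': "x' \<in> fin.idx" "fst x' = fst x"
        then have c: "x' = x \<or> x' = fin.\<sigma> x" using idx_fiber[OF x x'(1)] by simp
        show "int (fin.ram x') \<le> E x'"
        proof (cases "snd x = Some 0")
          case True
          then have "x' = x" "E x \<ge> 2" using c \<sigma>_fixed[of x] * pos by auto
          then show ?thesis using True by (simp add: fin.ram_def)
        next
          case False
          then have "fin.ram x' = 1" using c snd_\<sigma>(1)[of x] by (auto simp: fin.ram_def)
          then show ?thesis using c pos \<sigma>pos by auto
        qed
      qed
    qed
  qed
  moreover have "fs E" "\<exists>z\<in>C - {0}. \<forall>x\<in>fin.idx. E x - D x = fin.\<nu> x z" using E unfolding P_def by simp_all
  ultimately show ?thesis using deg2 edeg_nn[OF E] by blast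
qed

text \<open>For a semi-reduced divisor of degree \<open>n\<close>, counting yields two functions
  vanishing on it: a polynomial of degree at most \<open>n\<close>, which becomes \<open>u\<close>,
  and some \<open>g + c w\<close> with \<open>g\<close> of degree below \<open>n\<close>, which
  becomes \<open>w - v\<close>. A nonzero polynomial vanishing on \<open>E\<close> has degree at
  least \<open>n\<close>; this gives \<open>c \<noteq> 0\<close>, and in case of equality its
  divisor is \<open>E\<close> plus the conjugate of \<open>E\<close>.\<close>

lemma Em_surj:
  assumes D: "fs D"
  shows "\<exists>m\<in>mumford f1. \<exists>z\<in>C - {0}. \<forall>x\<in>fin.idx. D x - Em m x = fin.\<nu> x z"
proof -
  obtain E z where E: "fs E" "semired E" "edeg E \<le> 2" "edeg E \<ge> 0" and z: "z \<in> C" "z \<noteq> 0"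
    "\<And>x. x \<in> fin.idx \<Longrightarrow> E x - D x = fin.\<nu> x z" using semired_exists[OF D] by (elim exE conjE bexE) blast
  have Enn: "E x \<ge> 0" if "x \<in> fin.idx" for x using E(2) that unfolding semired_def by blast
  define n where "n = nat (edeg E)"
  have n: "edeg E = int n" "n \<le> 2" unfolding n_def using E(3,4) by simp_all
  have fsE2: "fs (\<lambda>x. E x + E (fin.\<sigma> x))" by (rule fs_add[OF E(1) fs_\<sigma>[OF E(1)]])
  have edegE2: "edeg (\<lambda>x. E x + E (fin.\<sigma> x)) = 2 * int n"
    using edeg_add[OF E(1) fs_\<sigma>[OF E(1)]] edeg_\<sigma>[of E] n by simp
  have low: "n \<le> Polynomial.degree g \<and> (Polynomial.degree g = n \<longrightarrow>
      (\<forall>x\<in>fin.idx. E x + E (fin.\<sigma> x) = fin.\<nu> x (ip g)))" if g: "g \<noteq> 0" "above E (ip g)" for g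
  proof -
    have ip0: "ip g \<noteq> 0" using g by (simp add: fin.\<iota>_eq_0)
    note mono = edeg_mono[OF fsE2 fs_\<nu>[OF fin.\<iota>_C ip0] semired_above[OF E(2) g]]
    have dg: "edeg (\<lambda>x. fin.\<nu> x (ip g)) = 2 * int (Polynomial.degree g)"
      unfolding edeg_\<nu> by (rule fin.vsum_\<iota>[OF g(1)])
    show ?thesis
    proof (intro conjI impI ballI)
      show "n \<le> Polynomial.degree g" using mono(1) unfolding dg edegE2 by simp
      fix x assume "Polynomial.degree g = n" "x \<in> fin.idx"
      then show "E x + E (fin.\<sigma> x) = fin.\<nu> x (ip g)" using mono(2)[of x] unfolding dg edegE2 by simp
    qed
  qed
  have pig: "\<exists>g h. g \<in> fin.small a \<and> h \<in> fin.small b \<and> fin.el g h \<noteq> 0 \<and> above E (fin.el g h)" if "a + b > n" for a b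
  proof -
    have "CARD('a) ^ n < CARD('a) ^ (a + b)" using q_ge_2 that by (simp add: power_strict_increasing_iff)
    then have "\<exists>z\<in>box a b. z \<noteq> 0 \<and> above E z"
      by (intro pigeonhole[OF box_props(1,2,3) E(1) Enn]) (simp_all add: box_props(4) n)
    then show ?thesis unfolding box_def by blast
  qed
  obtain g h where gh: "g \<in> fin.small n" "h \<in> fin.small 1" "fin.el g h \<noteq> 0" "above E (fin.el g h)"
    using pig[of n 1] by auto
  have h0: "h \<noteq> 0"
  proof
    assume "h = 0"
    then have "g \<noteq> 0" "above E (ip g)" using gh(3,4) by (simp_all add: fin.el_0 fin.\<iota>_eq_0)
    then show False using low[of g] gh(1) unfolding fin.small_def by auto
  qed
  then have "Polynomial.degree h = 0" using gh(2) unfolding fin.small_def by simp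
  then obtain c where c: "h = [:c:]" by (metis degree_eq_zeroE)
  have c0: "c \<noteq> 0" using c h0 by auto
  \<comment> \<open>Chosen so that \<open>w - v\<close> is the multiple of \<open>g + c w\<close>
    with coefficient of \<open>w\<close> equal to 1.\<close>
  define v where "v = Polynomial.smult (- inverse c) g"
  have v: "v = 0 \<or> Polynomial.degree v < n" using gh(1) c0 unfolding v_def fin.small_def by auto
  have elv: "fin.el (- v) 1 = ip [:inverse c:] * fin.el g h"
    unfolding fin.el_smult v_def c using c0 by (simp add: one_pCons)
  have cz: "ip [:inverse c:] \<in> k" "ip [:inverse c:] \<noteq> 0"
    using c0 by (auto simp: fin.kset_def fin.\<iota>_eq_0)
  have above_v: "above E (fin.el (- v) 1)" unfolding above_def
  proof
    fix x assume x: "x \<in> fin.idx"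
    have "fin.\<nu> x (fin.el (- v) 1) = fin.\<nu> x (fin.el g h)"
      unfolding elv fin.\<nu>_mult[OF x fin.\<iota>_C cz(2) fin.el_C gh(3)]
      using fin.dval_const[OF fin.dval_\<nu>[OF x] cz] by simp
    then show "E x \<le> fin.\<nu> x (fin.el (- v) 1)" using gh(4) x unfolding above_def by simp
  qed
  obtain u0 where u0: "u0 \<in> fin.small (n + 1)" "u0 \<noteq> 0" "above E (ip u0)"
  proof -
    obtain g h where 1: "g \<in> fin.small (n + 1)" "h \<in> fin.small 0" "fin.el g h \<noteq> 0" "above E (fin.el g h)"
      using pig[of "n + 1" 0] by auto
    then have "h = 0" unfolding fin.small_def by simp
    then show ?thesis using that[of g] 1 by (simp add: fin.el_0 fin.\<iota>_eq_0)
  qed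
  define r where "r = inverse (lead_coeff u0)"
  have r0: "r \<noteq> 0" unfolding r_def using u0(2) by simp
  define u where "u = Polynomial.smult r u0"
  have u1: "lead_coeff u = 1" "u \<noteq> 0" unfolding u_def r_def using u0(2) by simp_all
  have ipu: "ip u = ip [:r:] * ip u0" unfolding u_def by (simp flip: fin.\<iota>_mult)
  have rz: "ip [:r:] \<in> k" "ip [:r:] \<noteq> 0" using r0 by (auto simp: fin.kset_def fin.\<iota>_eq_0)
  have "above E (ip u)" unfolding above_def
  proof
    fix x assume x: "x \<in> fin.idx"
    have "fin.\<nu> x (ip u) = fin.\<nu> x (ip u0)"
      using fin.\<nu>_mult[OF x fin.\<iota>_C rz(2) fin.\<iota>_C, of u0] u0(2)
      using fin.dval_const[OF fin.dval_\<nu>[OF x] rz] by (simp add: ipu fin.\<iota>_eq_0)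
    then show "E x \<le> fin.\<nu> x (ip u)" using u0(3) x unfolding above_def by simp
  qed
  note lowu = low[OF u1(2) this]
  have "Polynomial.degree u \<le> n" using u0(1) r0 u0(2) unfolding u_def fin.small_def by simp
  then have degu: "Polynomial.degree u = n" using lowu by simp
  then have equ: "E x + E (fin.\<sigma> x) = fin.\<nu> x (ip u)" if "x \<in> fin.idx" for x using lowu that by blast
  have "u dvd f1 - v * v"
  proof (rule ip_dvd[OF u1(2) f1_v_nz])
    fix x assume x: "x \<in> fin.idx"
    have "E x \<le> fin.\<nu> x (fin.el (- v) 1)" using above_v x unfolding above_def by blast
    moreover have "E (fin.\<sigma> x) \<le> fin.\<nu> x (fin.el v 1)"
      using above_v fin.\<sigma>_idx[OF x] wv_\<sigma>[OF x, of v] unfolding above_def by fastforce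
    ultimately show "fin.\<nu> x (ip u) \<le> fin.\<nu> x (ip (f1 - v * v))" using equ[OF x] wv_sum[OF x, of v] by simp
  qed
  then have m: "(u, v) \<in> mumford f1" unfolding mumford_def using u1 degu n v by simp
  have le: "E x \<le> Em (u, v) x" if x: "x \<in> fin.idx" for x
    unfolding Em_def using above_v \<open>above E (ip u)\<close> x unfolding above_def by simp
  have "edeg E = edeg (Em (u, v))" using edeg_Em[OF m] degu n by simp
  then have eq: "E x = Em (u, v) x" if "x \<in> fin.idx" for x
    using edeg_mono(2)[of E "Em (u, v)" x] E(1) Em_fs[OF m] le that by simp
  have "\<forall>x\<in>fin.idx. D x - Em (u, v) x = fin.\<nu> x (inverse z)"
  proof
    fix x assume x: "x \<in> fin.idx"
    show "D x - Em (u, v) x = fin.\<nu> x (inverse z)"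
      using fin.\<nu>_inverse[OF x z(1,2)] z(3)[OF x] eq[OF x] by simp
  qed
  moreover have "inverse z \<in> C - {0}" using fin.Cinv[OF z(1)] z(2) by simp
  ultimately show ?thesis using m by blast
qed

theorem class_number_mumford: "class_number k K = card (mumford f1)"
proof (rule class_number_eq[where F = Em])
  show "fs (Em m)" if "m \<in> mumford f1" for m by (rule Em_fs[OF that])
  show "m = m'" if "m \<in> mumford f1" "m' \<in> mumford f1" "z \<in> C" "z \<noteq> 0"
    "\<And>x. x \<in> fin.idx \<Longrightarrow> Em m x - Em m' x = fin.\<nu> x z" for m m' z by (rule Em_class_inj[OF that])
  show "\<exists>m\<in>mumford f1. \<exists>z\<in>C - {0}. \<forall>x\<in>fin.idx. D x - Em m x = fin.\<nu> x z" if "fs D" for D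
    by (rule Em_surj[OF that])
qed

end

section \<open>Counting Mumford representatives\<close>

definition quint :: "'a::field \<Rightarrow> 'a poly" where "quint e = [:e, 0, 0, 0, 0, 1:]"

definition Aq :: "'a::field \<Rightarrow> 'a \<Rightarrow> 'a" where "Aq s p = s ^ 4 - 3 * s\<^sup>2 * p + p\<^sup>2"
definition Bq :: "'a::field \<Rightarrow> 'a \<Rightarrow> 'a" where "Bq s p = - p * (s ^ 3 - 2 * p * s)"

text \<open>Modulo \<open>y^2 - s y + p\<close> the left side is the norm of
  \<open>Aq y + Bq = y^5\<close>, and \<open>y\<close> has norm \<open>p\<close>.\<close>

lemma Aq_Bq_norm: "(Bq s p)\<^sup>2 + Aq s p * Bq s p * s + (Aq s p)\<^sup>2 * p = p ^ 5"
  unfolding Aq_def Bq_def by (simp add: algebra_simps eval_nat_numeral)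

lemma quint_mod:
  "quint e - [:v0, v1:] * [:v0, v1:] =
     ([:s ^ 3 - 2 * p * s - v1\<^sup>2, s\<^sup>2 - p, s, 1:]) * [:p, - s, 1:] +
     [:e + Bq s p - v0\<^sup>2 + v1\<^sup>2 * p, Aq s p - (2 * v0 * v1 + v1\<^sup>2 * s):]"
  unfolding quint_def Aq_def Bq_def by (simp add: algebra_simps eval_nat_numeral)

lemma quint_dvd_quadratic:
  "[:p, - s, 1:] dvd quint e - [:v0, v1:] * [:v0, v1:] \<longleftrightarrow>
     2 * v0 * v1 + v1\<^sup>2 * s = Aq s p \<and> v0\<^sup>2 - v1\<^sup>2 * p - Bq s p = e"
proof -
  let ?u = "[:p, - s, 1:]" and ?r = "[:e + Bq s p - v0\<^sup>2 + v1\<^sup>2 * p, Aq s p - (2 * v0 * v1 + v1\<^sup>2 * s):]"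
  have "?u dvd quint e - [:v0, v1:] * [:v0, v1:] \<longleftrightarrow> ?u dvd ?r"
    unfolding quint_mod[of e v0 v1 s p] by (simp only: dvd_add_right_iff dvd_triv_right)
  also have "\<dots> \<longleftrightarrow> ?r = 0"
  proof
    assume d: "?u dvd ?r"
    show "?r = 0"
    proof (rule ccontr)
      assume "?r \<noteq> 0"
      from dvd_imp_degree_le[OF d this] show False by (simp split: if_splits)
    qed
  qed simp
  also have "\<dots> \<longleftrightarrow> 2 * v0 * v1 + v1\<^sup>2 * s = Aq s p \<and> v0\<^sup>2 - v1\<^sup>2 * p - Bq s p = e"
    by (auto simp: algebra_simps)
  finally show ?thesis .
qed

lemma quint_dvd_linear: "[:- c, 1:] dvd quint e - [:t:] * [:t:] \<longleftrightarrow> t\<^sup>2 = c ^ 5 + e"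
proof -
  have "poly (quint e - [:t:] * [:t:]) c = c ^ 5 + e - t\<^sup>2"
    unfolding quint_def by (simp add: algebra_simps eval_nat_numeral)
  then show ?thesis unfolding poly_eq_0_iff_dvd[symmetric] by auto
qed

text \<open>\<open>S1 e\<close> encodes the pairs with \<open>u = y - c\<close> and
  \<open>v = t\<close>, which are the affine points; \<open>S2 e\<close> those with
  \<open>u = y^2 - s y + p\<close> and \<open>v = v0 + v1 y\<close>.\<close>

definition S1 :: "'a::field \<Rightarrow> ('a \<times> 'a) set" where "S1 e = {(c, t). t\<^sup>2 = c ^ 5 + e}"
definition S2 :: "'a::field \<Rightarrow> ('a \<times> 'a \<times> 'a \<times> 'a) set" where
  "S2 e = {(s, p, v0, v1). 2 * v0 * v1 + v1\<^sup>2 * s = Aq s p \<and> v0\<^sup>2 - v1\<^sup>2 * p - Bq s p = e}"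

lemma mumford_quint:
  "mumford (quint e) = {(1, 0)} \<union> (\<lambda>(c, t). ([:- c, 1:], [:t:])) ` S1 e \<union>
     (\<lambda>(s, p, v0, v1). ([:p, - s, 1:], [:v0, v1:])) ` S2 e"
proof (intro equalityI subsetI)
  fix m assume "m \<in> mumford (quint e)"
  then obtain u v where m: "m = (u, v)" "lead_coeff u = 1" "Polynomial.degree u \<le> 2"
     "v = 0 \<or> Polynomial.degree v < Polynomial.degree u" "u dvd quint e - v * v"
    unfolding mumford_def by auto
  consider "Polynomial.degree u = 0" | "Polynomial.degree u = 1" | "Polynomial.degree u = 2"
    using m(3) by linarith
  then show "m \<in> {(1, 0)} \<union> (\<lambda>(c, t). ([:- c, 1:], [:t:])) ` S1 e \<union>
     (\<lambda>(s, p, v0, v1). ([:p, - s, 1:], [:v0, v1:])) ` S2 e"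
  proof cases
    case 1
    then obtain a where "u = [:a:]" by (metis degree_eq_zeroE)
    then have "u = 1" using m(2) by (simp add: one_pCons)
    then show ?thesis using m(1,4) 1 by simp
  next
    case 2
    then obtain a b where ab: "u = [:a, b:]" by (metis degree1_coeffs)
    then have u: "u = [:- (- a), 1:]" using m(2) 2 by (simp split: if_splits)
    have "Polynomial.degree v = 0" using m(4) 2 by auto
    then obtain t where t: "v = [:t:]" by (metis degree_eq_zeroE)
    have "(- a, t) \<in> S1 e" using m(5) unfolding S1_def u t quint_dvd_linear by simp
    then have "(u, v) \<in> (\<lambda>(c, t). ([:- c, 1:], [:t:])) ` S1 e" unfolding u t by force
    then show ?thesis using m(1) by simp
  next
    case 3
    obtain a u1 where u1: "u = pCons a u1" by (cases u)
    then have "Polynomial.degree u1 = 1" using 3 by (simp split: if_splits)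
    then obtain b c where "u1 = [:b, c:]" by (metis degree1_coeffs)
    then have u: "u = [:a, - (- b), 1:]" using m(2) 3 u1 by (simp add: numeral_2_eq_2 split: if_splits)
    obtain v0 v' where v': "v = pCons v0 v'" by (cases v)
    then have "Polynomial.degree v' = 0" using m(4) 3 by (auto split: if_splits)
    then obtain v1 where v: "v = [:v0, v1:]" using v' by (metis degree_eq_zeroE)
    have "(- b, a, v0, v1) \<in> S2 e" using m(5) unfolding S2_def u v quint_dvd_quadratic by simp
    then have "(u, v) \<in> (\<lambda>(s, p, v0, v1). ([:p, - s, 1:], [:v0, v1:])) ` S2 e" unfolding u v by force
    then show ?thesis using m(1) by simp
  qed
next
  fix m assume "m \<in> {(1, 0)} \<union> (\<lambda>(c, t). ([:- c, 1:], [:t:])) ` S1 e \<union>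
     (\<lambda>(s, p, v0, v1). ([:p, - s, 1:], [:v0, v1:])) ` S2 e"
  then consider "m = (1, 0)" | c t where "m = ([:- c, 1:], [:t:])" "(c, t) \<in> S1 e"
    | s p v0 v1 where "m = ([:p, - s, 1:], [:v0, v1:])" "(s, p, v0, v1) \<in> S2 e" by auto
  then show "m \<in> mumford (quint e)"
  proof cases
    case 1
    then show ?thesis by (simp add: mumford_def)
  next
    case 2
    then show ?thesis unfolding mumford_def S1_def by (simp add: quint_dvd_linear del: mult_pCons_left mult_pCons_right)
  next
    case 3
    then show ?thesis unfolding mumford_def S2_def by (simp add: quint_dvd_quadratic del: mult_pCons_left mult_pCons_right)
  qed
qed

lemma card_mumford_quint:
  fixes e :: "'a::{field,finite}"
  shows "card (mumford (quint e)) = 1 + card (S1 e) + card (S2 e)"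
proof -
  let ?f = "\<lambda>(c, t). ([:- c, 1:], [:t:]) :: 'a poly \<times> 'a poly"
  let ?g = "\<lambda>(s, p, v0, v1). ([:p, - s, 1:], [:v0, v1:]) :: 'a poly \<times> 'a poly"
  have f: "card (?f ` S1 e) = card (S1 e)" by (rule card_image) (auto simp: inj_on_def)
  have g: "card (?g ` S2 e) = card (S2 e)" by (rule card_image) (auto simp: inj_on_def)
  have d1: "{(1, 0)} \<inter> ?f ` S1 e = {}" by (auto simp: one_pCons)
  have d2: "({(1, 0)} \<union> ?f ` S1 e) \<inter> ?g ` S2 e = {}" by (auto simp: one_pCons)
  have "card (mumford (quint e)) = card ({(1, 0)} \<union> ?f ` S1 e) + card (?g ` S2 e)"
    unfolding mumford_quint using d2 by (intro card_Un_disjoint) simp_all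
  also have "card ({(1, 0)} \<union> ?f ` S1 e) = card {(1 :: 'a poly, 0 :: 'a poly)} + card (?f ` S1 e)"
    using d1 by (intro card_Un_disjoint) simp_all
  finally show ?thesis unfolding f g by simp
qed

lemma sum_card_fibers:
  fixes g :: "'b \<Rightarrow> 'c::finite"
  assumes "finite A"
  shows "(\<Sum>e\<in>UNIV. card {x \<in> A. g x = e}) = card A"
  using sum.group[OF assms, of "UNIV :: 'c set" g "\<lambda>_. 1 :: nat"] by simp

lemma sum_card_pairs:
  fixes P :: "'b::finite \<Rightarrow> 'c::finite \<Rightarrow> bool"
  shows "(\<Sum>f\<in>UNIV. card {x. P x f}) = card {(x, f). P x f}"
proof -
  have "card {z \<in> {(x, f). P x f}. snd z = f} = card {x. P x f}" for f
  proof -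
    have "{z \<in> {(x, f). P x f}. snd z = f} = (\<lambda>x. (x, f)) ` {x. P x f}" by auto
    then show ?thesis by (simp add: card_image inj_on_def)
  qed
  then show ?thesis using sum_card_fibers[of "{(x, f). P x f}" snd] by simp
qed

lemma card_eqI_inverse:
  assumes "\<And>x. x \<in> A \<Longrightarrow> f x \<in> B \<and> g (f x) = x" "\<And>y. y \<in> B \<Longrightarrow> g y \<in> A \<and> f (g y) = y"
  shows "card A = card B"
  by (rule bij_betw_same_card[of f], rule bij_betwI[of f A B g]) (use assms in auto)

definition nz :: "'a::{field,finite} set" where "nz = {x. x \<noteq> 0}"
text \<open>The quadratic \<open>u\<close> prime to \<open>y\<close> for which \<open>y^5\<close>
  reduces to a constant. The only other zero of \<open>Aq\<close> is the origin.\<close>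

definition \<alpha>s :: "('a::{field,finite} \<times> 'a) set" where "\<alpha>s = {(s, p). p \<noteq> 0 \<and> Aq s p = 0}"

lemma card_UNIV_nz: "CARD('a::{field,finite}) = card (nz :: 'a set) + 1"
proof -
  have "(UNIV :: 'a set) = insert 0 nz" unfolding nz_def by auto
  moreover have "card (insert 0 (nz :: 'a set)) = Suc (card (nz :: 'a set))"
    by (rule card_insert_disjoint) (simp_all add: nz_def)
  ultimately show ?thesis by simp
qed

lemma halves:
  fixes u v :: "'a::field"
  assumes "(2 :: 'a) \<noteq> 0"
  shows "(u + v) / 2 - (v - u) / 2 = u" "(u + v) / 2 + (v - u) / 2 = v"
proof -
  have "(u + v) / 2 - (v - u) / 2 = (2 * u) / 2" unfolding diff_divide_distrib[symmetric] by simp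
  then show "(u + v) / 2 - (v - u) / 2 = u" using assms by simp
  have "(u + v) / 2 + (v - u) / 2 = (2 * v) / 2" unfolding add_divide_distrib[symmetric] by simp
  then show "(u + v) / 2 + (v - u) / 2 = v" using assms by simp
qed

lemma nz_pos: "card (nz :: 'a::{field,finite} set) > 0"
  unfolding nz_def by (subst card_gt_0_iff) (auto intro: exI[of _ 1])

lemma Aq_0_iff: "{(s, p). Aq s p = (0 :: 'a::{field,finite})} = insert (0, 0) \<alpha>s"
  unfolding \<alpha>s_def by (auto simp: Aq_def)

lemma card_Aq_0: "card {(s, p). Aq s p = (0 :: 'a::{field,finite})} = card (\<alpha>s :: ('a \<times> 'a) set) + 1"
  unfolding Aq_0_iff by (subst card_insert_disjoint) (auto simp: \<alpha>s_def)

text \<open>The system of \<open>S2\<close> without the equation that fixes \<open>e\<close>; its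
  fibres over \<open>e\<close> are the sets \<open>S2 e\<close>.\<close>

definition S2all :: "('a::{field,finite} \<times> 'a \<times> 'a \<times> 'a) set" where
  "S2all = {(s, p, v0, v1). 2 * v0 * v1 + v1\<^sup>2 * s = Aq s p}"

text \<open>For nonzero \<open>v1\<close> the equation is linear in \<open>v0\<close> and determines
  it; for \<open>v1 = 0\<close> it reads \<open>Aq s p = 0\<close> and leaves \<open>v0\<close>
  free.\<close>

lemma card_S2all:
  assumes two: "(2 :: 'a::{field,finite}) \<noteq> 0"
  shows "card (S2all :: ('a \<times> 'a \<times> 'a \<times> 'a) set) =
     CARD('a)\<^sup>2 * card (nz :: 'a set) + CARD('a) * (card (\<alpha>s :: ('a \<times> 'a) set) + 1)"
proof -
  let ?P = "{(s, p, v0, v1). v1 \<noteq> 0 \<and> 2 * v0 * v1 + v1\<^sup>2 * s = Aq s p} :: ('a \<times> 'a \<times> 'a \<times> 'a) set"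
  let ?Z = "{(s, p, v0, v1). v1 = 0 \<and> Aq s p = 0} :: ('a \<times> 'a \<times> 'a \<times> 'a) set"
  have "S2all = ?P \<union> ?Z" unfolding S2all_def by auto
  moreover have "card (?P \<union> ?Z) = card ?P + card ?Z" by (rule card_Un_disjoint) auto
  ultimately have "card (S2all :: ('a \<times> 'a \<times> 'a \<times> 'a) set) = card ?P + card ?Z" by simp
  moreover have "card ?P = card ((UNIV :: 'a set) \<times> (UNIV :: 'a set) \<times> (nz :: 'a set))"
    by (rule card_eqI_inverse[where f = "\<lambda>(s, p, v0, v1). (s, p, v1)" and
          g = "\<lambda>(s, p, v1). (s, p, (Aq s p - v1\<^sup>2 * s) / (2 * v1), v1)"])
       (use two in \<open>auto simp: nz_def field_simps\<close>)
  moreover have "card ?Z = card ({(s, p). Aq s p = (0 :: 'a)} \<times> (UNIV :: 'a set))"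
    by (rule card_eqI_inverse[where f = "\<lambda>(s, p, v0, v1). ((s, p), v0)" and g = "\<lambda>((s, p), v0). (s, p, v0, 0)"]) auto
  ultimately show ?thesis
    by (simp add: card_cartesian_product card_Aq_0 power2_eq_square)
qed

lemma sum_S1: "(\<Sum>e\<in>UNIV. card (S1 (e :: 'a::{field,finite}))) = CARD('a)\<^sup>2"
proof -
  have "S1 e = {z \<in> UNIV. (case z of (c, t) \<Rightarrow> t\<^sup>2 - c ^ 5) = e}" for e :: 'a
    unfolding S1_def by (auto simp: algebra_simps)
  then have "(\<Sum>e\<in>UNIV. card (S1 (e :: 'a))) = card (UNIV :: ('a \<times> 'a) set)"
    using sum_card_fibers[of "UNIV :: ('a \<times> 'a) set" "\<lambda>z. case z of (c, t) \<Rightarrow> t\<^sup>2 - c ^ 5"] by simp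
  then show ?thesis by (simp add: card_cartesian_product power2_eq_square flip: UNIV_Times_UNIV)
qed

lemma sum_S2: "(\<Sum>e\<in>UNIV. card (S2 (e :: 'a::{field,finite}))) = card (S2all :: ('a \<times> 'a \<times> 'a \<times> 'a) set)"
proof -
  have "S2 e = {z \<in> S2all. (case z of (s, p, v0, v1) \<Rightarrow> v0\<^sup>2 - v1\<^sup>2 * p - Bq s p) = e}" for e :: 'a
    unfolding S2_def S2all_def by auto
  then show ?thesis
    using sum_card_fibers[of "S2all :: ('a \<times> 'a \<times> 'a \<times> 'a) set"
      "\<lambda>z. case z of (s, p, v0, v1) \<Rightarrow> v0\<^sup>2 - v1\<^sup>2 * p - Bq s p"] by simp
qed

text \<open>The cusp is parametrised by \<open>c = r^2\<close>, \<open>t = r^5\<close>, with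
  \<open>r = t / c^2\<close> away from the origin and \<open>r = 0\<close> there.\<close>

lemma card_square_odd: "card {(c, t). t\<^sup>2 = (c :: 'a::{field,finite}) ^ 5} = CARD('a)"
  by (rule card_eqI_inverse[where f = "\<lambda>(c, t). if c = 0 then 0 else t / c\<^sup>2" and g = "\<lambda>r. (r\<^sup>2, r ^ 5)"])
     (auto simp: field_simps power2_eq_square eval_nat_numeral split: if_splits)

lemma card_square_cube: "card {(s, r). s \<noteq> 0 \<and> r\<^sup>2 = (s :: 'a::{field,finite}) ^ 3} = card (nz :: 'a set)"
  by (rule card_eqI_inverse[where f = "\<lambda>(c, t). t / c" and g = "\<lambda>r. (r\<^sup>2, r ^ 3)"])
     (auto simp: nz_def field_simps power2_eq_square eval_nat_numeral)

lemma card_T0: "card {(s, r). r\<^sup>2 * s = (s :: 'a::{field,finite}) ^ 4} = CARD('a) + card (nz :: 'a set)"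
proof -
  have "{(s, r). r\<^sup>2 * s = (s :: 'a) ^ 4} = ({0} \<times> UNIV) \<union> {(s, r). s \<noteq> 0 \<and> r\<^sup>2 = s ^ 3}"
    by (auto simp: eval_nat_numeral)
  moreover have "card (({0 :: 'a} \<times> (UNIV :: 'a set)) \<union> {(s, r). s \<noteq> 0 \<and> r\<^sup>2 = s ^ 3}) =
     card ({0 :: 'a} \<times> (UNIV :: 'a set)) + card {(s, r). s \<noteq> 0 \<and> r\<^sup>2 = (s :: 'a) ^ 3}"
    by (rule card_Un_disjoint) auto
  ultimately show ?thesis by (simp add: card_square_cube card_cartesian_product)
qed

text \<open>Replacing \<open>a0 + a1 y\<close> by its product with \<open>y\<close> multiplies its
  square by \<open>y^2\<close>. The two systems therefore differ by the matrix of multiplication by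
  \<open>y^2\<close>, which is invertible for nonzero \<open>p\<close>.\<close>

lemma mult_y_cancel:
  fixes p s a0 a1 \<alpha> \<beta> :: "'a::field"
  assumes p: "p \<noteq> 0"
  shows "(a0 + s * a1)\<^sup>2 * s + 2 * (- p * a1) * (a0 + s * a1) = \<alpha> * (s\<^sup>2 - p) + \<beta> * s \<and>
      (- p * a1)\<^sup>2 - (a0 + s * a1)\<^sup>2 * p = - \<alpha> * p * s - \<beta> * p \<longleftrightarrow>
    a1\<^sup>2 * s + 2 * a0 * a1 = \<alpha> \<and> a0\<^sup>2 - a1\<^sup>2 * p = \<beta>" (is "?L \<longleftrightarrow> ?R")
proof -
  define x where "x = a1\<^sup>2 * s + 2 * a0 * a1 - \<alpha>"
  define y where "y = a0\<^sup>2 - a1\<^sup>2 * p - \<beta>"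
  have 1: "(a0 + s * a1)\<^sup>2 * s + 2 * (- p * a1) * (a0 + s * a1) - (\<alpha> * (s\<^sup>2 - p) + \<beta> * s) = x * (s\<^sup>2 - p) + y * s"
    unfolding x_def y_def by (simp add: algebra_simps power2_eq_square)
  have 2: "(- p * a1)\<^sup>2 - (a0 + s * a1)\<^sup>2 * p - (- \<alpha> * p * s - \<beta> * p) = - p * (x * s + y)"
    unfolding x_def y_def by (simp add: algebra_simps power2_eq_square)
  have "?L \<longleftrightarrow> x * (s\<^sup>2 - p) + y * s = 0 \<and> x * s + y = 0"
    using 1 2 p by (metis eq_iff_diff_eq_0 mult_eq_0_iff neg_equal_0_iff_equal)
  also have "\<dots> \<longleftrightarrow> x = 0 \<and> y = 0"
  proof
    assume *: "x * (s\<^sup>2 - p) + y * s = 0 \<and> x * s + y = 0"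
    have "x * p = s * (x * s + y) - (x * (s\<^sup>2 - p) + y * s)" by (simp add: algebra_simps power2_eq_square)
    then have "x = 0" using * p by simp
    then show "x = 0 \<and> y = 0" using * by simp
  qed simp
  also have "\<dots> \<longleftrightarrow> ?R" unfolding x_def y_def by auto
  finally show ?thesis .
qed

text \<open>
  The elements \<open>a0 + a1 y\<close> of \<open>\<bbbF>\<^sub>q[y]/(y\<^sup>2 - s y + p)\<close> with square \<open>\<alpha> y + \<beta>\<close>. Multiplication by the unit \<open>y\<close>
  turns the right-hand side into \<open>(\<alpha> y + \<beta>) y\<^sup>2\<close>, so two steps reduce \<open>y\<^sup>5\<close> to \<open>y\<close>.
\<close>

definition Py :: "('a \<Rightarrow> 'a \<Rightarrow> 'a) \<Rightarrow> ('a \<Rightarrow> 'a \<Rightarrow> 'a) \<Rightarrow> ('a::{field,finite} \<times> 'a \<times> 'a \<times> 'a) set" where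
  "Py \<alpha> \<beta> = {(s, p, a0, a1). p \<noteq> 0 \<and> a1\<^sup>2 * s + 2 * a0 * a1 = \<alpha> s p \<and> a0\<^sup>2 - a1\<^sup>2 * p = \<beta> s p}"

text \<open>The bijection is multiplication by \<open>y\<close>, with inverse coming from
  \<open>1/y = (s - y)/p\<close>.\<close>

lemma card_Py_step:
  "card (Py (\<lambda>s p. \<alpha> s p * (s\<^sup>2 - p) + \<beta> s p * s) (\<lambda>s p. - \<alpha> s p * p * s - \<beta> s p * p)) = card (Py \<alpha> \<beta>)"
proof (rule card_eqI_inverse[symmetric, where f = "\<lambda>(s, p, a0, a1). (s, p, - p * a1, a0 + s * a1)"
    and g = "\<lambda>(s, p, v0, v1). (s, p, v1 + v0 * s / p, - (v0 / p))"])
  fix x assume "x \<in> Py \<alpha> \<beta>"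
  then obtain s p a0 a1 where x: "x = (s, p, a0, a1)" "p \<noteq> 0"
    "a1\<^sup>2 * s + 2 * a0 * a1 = \<alpha> s p \<and> a0\<^sup>2 - a1\<^sup>2 * p = \<beta> s p" unfolding Py_def by auto
  show "(\<lambda>(s, p, a0, a1). (s, p, - p * a1, a0 + s * a1)) x \<in> Py (\<lambda>s p. \<alpha> s p * (s\<^sup>2 - p) + \<beta> s p * s) (\<lambda>s p. - \<alpha> s p * p * s - \<beta> s p * p)
     \<and> (\<lambda>(s, p, v0, v1). (s, p, v1 + v0 * s / p, - (v0 / p))) ((\<lambda>(s, p, a0, a1). (s, p, - p * a1, a0 + s * a1)) x) = x"
    using mult_y_cancel[OF x(2), of a0 s a1 "\<alpha> s p" "\<beta> s p"] x unfolding Py_def by simp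
next
  fix z assume "z \<in> Py (\<lambda>s p. \<alpha> s p * (s\<^sup>2 - p) + \<beta> s p * s) (\<lambda>s p. - \<alpha> s p * p * s - \<beta> s p * p)"
  then obtain s p v0 v1 where z: "z = (s, p, v0, v1)" "p \<noteq> 0"
    "v1\<^sup>2 * s + 2 * v0 * v1 = \<alpha> s p * (s\<^sup>2 - p) + \<beta> s p * s \<and> v0\<^sup>2 - v1\<^sup>2 * p = - \<alpha> s p * p * s - \<beta> s p * p"
    unfolding Py_def by auto
  define a0 where "a0 = v1 + v0 * s / p"
  define a1 where "a1 = - (v0 / p)"
  have v: "v0 = - p * a1" "v1 = a0 + s * a1" unfolding a0_def a1_def using z(2) by (simp_all add: field_simps)
  have "a1\<^sup>2 * s + 2 * a0 * a1 = \<alpha> s p \<and> a0\<^sup>2 - a1\<^sup>2 * p = \<beta> s p"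
    using z(3) unfolding v mult_y_cancel[OF z(2)] .
  then show "(\<lambda>(s, p, v0, v1). (s, p, v1 + v0 * s / p, - (v0 / p))) z \<in> Py \<alpha> \<beta> \<and>
     (\<lambda>(s, p, a0, a1). (s, p, - p * a1, a0 + s * a1)) ((\<lambda>(s, p, v0, v1). (s, p, v1 + v0 * s / p, - (v0 / p))) z) = z"
    unfolding z(1) using z(2) v unfolding Py_def by (simp flip: a0_def a1_def)
qed

text \<open>Elements with square \<open>y\<close>: both coordinates are nonzero, and the coordinates
  determine \<open>s\<close> and \<open>p\<close> rather than the other way round.\<close>

lemma card_Py_base:
  assumes two: "(2 :: 'a::{field,finite}) \<noteq> 0"
  shows "card (Py (\<lambda>s p. 1) (\<lambda>s p. 0) :: ('a \<times> 'a \<times> 'a \<times> 'a) set) = card (nz :: 'a set) * card (nz :: 'a set)"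
proof -
  have "card (Py (\<lambda>s p. 1) (\<lambda>s p. 0) :: ('a \<times> 'a \<times> 'a \<times> 'a) set) = card ((nz :: 'a set) \<times> (nz :: 'a set))"
  proof (rule card_eqI_inverse[where f = "\<lambda>(s, p, a0, a1). (a0, a1)"
        and g = "\<lambda>(t0, t1). ((1 - 2 * t0 * t1) / t1\<^sup>2, t0\<^sup>2 / t1\<^sup>2, t0, t1)"])
    fix x :: "'a \<times> 'a \<times> 'a \<times> 'a" assume "x \<in> Py (\<lambda>s p. 1) (\<lambda>s p. 0)"
    then obtain s p a0 a1 where x: "x = (s, p, a0, a1)" "p \<noteq> 0" "a1\<^sup>2 * s + 2 * a0 * a1 = 1" "a0\<^sup>2 = a1\<^sup>2 * p"
      unfolding Py_def by auto
    have a1: "a1 \<noteq> 0" using x(3) by auto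
    then have "a0 \<noteq> 0" using x(2,4) by auto
    moreover have "(1 - 2 * a0 * a1) / a1\<^sup>2 = s" using a1 by (simp add: x(3)[symmetric])
    moreover have "a0\<^sup>2 / a1\<^sup>2 = p" using a1 x(4) by simp
    ultimately show "(\<lambda>(s, p, a0, a1). (a0, a1)) x \<in> nz \<times> nz \<and>
       (\<lambda>(t0, t1). ((1 - 2 * t0 * t1) / t1\<^sup>2, t0\<^sup>2 / t1\<^sup>2, t0, t1)) ((\<lambda>(s, p, a0, a1). (a0, a1)) x) = x"
      using a1 x(1) by (simp add: nz_def)
  qed (auto simp: nz_def Py_def)
  then show ?thesis by (simp add: card_cartesian_product)
qed

text \<open>For \<open>e = 0\<close> the condition is \<open>v^2 = y^5\<close> modulo
  \<open>u\<close>. If \<open>p\<close> is nonzero, \<open>y\<close> is a unit and the problem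
  reduces to square roots of \<open>y\<close>; if \<open>p = 0\<close>, the system collapses to
  \<open>v0 = 0\<close> and \<open>v1^2 s = s^4\<close>.\<close>

lemma card_S2_0:
  assumes two: "(2 :: 'a::{field,finite}) \<noteq> 0"
  shows "card (S2 (0 :: 'a)) = CARD('a)\<^sup>2"
proof -
  let ?A = "{(s, p, v0, v1). p = 0 \<and> v0 = 0 \<and> v1\<^sup>2 * s = s ^ 4} :: ('a \<times> 'a \<times> 'a \<times> 'a) set"
  have PP: "Py Aq Bq = ({(s, p, v0, v1). p \<noteq> 0 \<and> 2 * v0 * v1 + v1\<^sup>2 * s = Aq s p \<and> v0\<^sup>2 - v1\<^sup>2 * p - Bq s p = 0}
      :: ('a \<times> 'a \<times> 'a \<times> 'a) set)"
    unfolding Py_def by (auto simp: algebra_simps)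
  have "S2 (0 :: 'a) = ?A \<union> Py Aq Bq"
    unfolding PP S2_def by (auto simp: Aq_def Bq_def)
  moreover have "?A \<inter> Py Aq Bq = {}" unfolding PP by auto
  ultimately have "card (S2 (0 :: 'a)) = card ?A + card (Py Aq Bq :: ('a \<times> 'a \<times> 'a \<times> 'a) set)"
    by (simp add: card_Un_disjoint)
  moreover have "card ?A = CARD('a) + card (nz :: 'a set)"
  proof -
    have "card ?A = card {(s, r). r\<^sup>2 * s = (s :: 'a) ^ 4}"
      by (rule card_eqI_inverse[where f = "\<lambda>(s, p, v0, v1). (s, v1)" and g = "\<lambda>(s, r). (s, 0, 0, r)"]) auto
    then show ?thesis using card_T0 by simp
  qed
  moreover have "card (Py Aq Bq :: ('a \<times> 'a \<times> 'a \<times> 'a) set) = card (nz :: 'a set) * card (nz :: 'a set)"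
  proof -
    let ?\<alpha>3 = "\<lambda>s p :: 'a. s\<^sup>2 - p" and ?\<beta>3 = "\<lambda>s p :: 'a. - p * s"
    have a: "(\<lambda>s p. ?\<alpha>3 s p * (s\<^sup>2 - p) + ?\<beta>3 s p * s) = Aq" "(\<lambda>s p. - ?\<alpha>3 s p * p * s - ?\<beta>3 s p * p) = Bq"
      by (simp_all add: fun_eq_iff Aq_def Bq_def algebra_simps eval_nat_numeral)
    have b: "(\<lambda>s p. (1 :: 'a) * (s\<^sup>2 - p) + 0 * s) = ?\<alpha>3" "(\<lambda>s p. - (1 :: 'a) * p * s - 0 * p) = ?\<beta>3"
      by (simp_all add: fun_eq_iff)
    have "card (Py Aq Bq :: ('a \<times> 'a \<times> 'a \<times> 'a) set) = card (Py ?\<alpha>3 ?\<beta>3)"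
      using card_Py_step[of ?\<alpha>3 ?\<beta>3] unfolding a .
    also have "\<dots> = card (Py (\<lambda>s p. 1) (\<lambda>s p. 0) :: ('a \<times> 'a \<times> 'a \<times> 'a) set)"
      using card_Py_step[of "\<lambda>s p. 1 :: 'a" "\<lambda>s p. 0"] unfolding b .
    finally show ?thesis unfolding card_Py_base[OF two] .
  qed
  ultimately show ?thesis unfolding card_UNIV_nz by (simp add: power2_eq_square)
qed

lemma card_S1_0: "card (S1 (0 :: 'a::{field,finite})) = CARD('a)"
  using card_square_odd unfolding S1_def by simp

section \<open>The sum over the parameters that are squares\<close>

lemma sum_S1_squares:
  assumes two: "(2 :: 'a::{field,finite}) \<noteq> 0"
  shows "(\<Sum>f\<in>UNIV. card (S1 ((f :: 'a)\<^sup>2))) = CARD('a)\<^sup>2"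
proof -
  have "(\<Sum>f\<in>UNIV. card (S1 ((f :: 'a)\<^sup>2))) = card {(z, f). z \<in> S1 ((f :: 'a)\<^sup>2)}"
    using sum_card_pairs[of "\<lambda>z f. z \<in> S1 ((f :: 'a)\<^sup>2)"] by simp
  \<comment> \<open>\<open>t^2 = c^5 + f^2\<close> is the factorisation
    \<open>(t - f)(t + f) = c^5\<close>, and halving recovers \<open>t\<close> and \<open>f\<close>
    from the factors.\<close>
  also have "\<dots> = card {(c, u, v). u * v = (c :: 'a) ^ 5}"
  proof (rule card_eqI_inverse[where f = "\<lambda>((c, t), f). (c, t - f, t + f)" and
        g = "\<lambda>(c, u, v). ((c, (u + v) / 2), (v - u) / 2)"])
    fix x assume "x \<in> {(z, f). z \<in> S1 ((f :: 'a)\<^sup>2)}"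
    then obtain c t f where x: "x = ((c, t), f)" "t\<^sup>2 = c ^ 5 + f\<^sup>2" unfolding S1_def by auto
    have "(t - f) * (t + f) = c ^ 5" using x(2) by (simp add: algebra_simps power2_eq_square)
    then show "(\<lambda>((c, t), f). (c, t - f, t + f)) x \<in> {(c, u, v). u * v = c ^ 5} \<and>
       (\<lambda>(c, u, v). ((c, (u + v) / 2), (v - u) / 2)) ((\<lambda>((c, t), f). (c, t - f, t + f)) x) = x"
      unfolding x(1) using two by simp
  next
    fix x :: "'a \<times> 'a \<times> 'a" assume "x \<in> {(c, u, v). u * v = c ^ 5}"
    then obtain c u v where x: "x = (c, u, v)" "u * v = c ^ 5" by auto
    define t where "t = (u + v) / 2"
    define f where "f = (v - u) / 2"
    have e: "t - f = u" "t + f = v" unfolding t_def f_def using halves[OF two] by simp_all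
    have "t\<^sup>2 = c ^ 5 + f\<^sup>2" unfolding x(2)[symmetric] e[symmetric] by (simp add: algebra_simps power2_eq_square)
    then show "(\<lambda>(c, u, v). ((c, (u + v) / 2), (v - u) / 2)) x \<in> {(z, f). z \<in> S1 (f\<^sup>2)} \<and>
       (\<lambda>((c, t), f). (c, t - f, t + f)) ((\<lambda>(c, u, v). ((c, (u + v) / 2), (v - u) / 2)) x) = x"
      unfolding x(1) S1_def using e by (simp flip: t_def f_def)
  qed
  also have "\<dots> = card {(c, u, v). u \<noteq> 0 \<and> u * v = (c :: 'a) ^ 5} + card {(c :: 'a, u :: 'a, v :: 'a). u = 0 \<and> c = 0}"
  proof -
    have "{(c, u, v). u * v = (c :: 'a) ^ 5} =
      {(c, u, v). u \<noteq> 0 \<and> u * v = (c :: 'a) ^ 5} \<union> {(c :: 'a, u :: 'a, v :: 'a). u = 0 \<and> c = 0}" by auto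
    moreover have "card ({(c, u, v). u \<noteq> 0 \<and> u * v = (c :: 'a) ^ 5} \<union> {(c :: 'a, u :: 'a, v :: 'a). u = 0 \<and> c = 0}) =
      card {(c, u, v). u \<noteq> 0 \<and> u * v = (c :: 'a) ^ 5} + card {(c :: 'a, u :: 'a, v :: 'a). u = 0 \<and> c = 0}"
      by (rule card_Un_disjoint) auto
    ultimately show ?thesis by simp
  qed
  also have "card {(c, u, v). u \<noteq> 0 \<and> u * v = (c :: 'a) ^ 5} = card ((UNIV :: 'a set) \<times> (nz :: 'a set))"
    by (rule card_eqI_inverse[where f = "\<lambda>(c, u, v). (c, u)" and g = "\<lambda>(c, u). (c, u, c ^ 5 / u)"])
       (auto simp: nz_def field_simps)
  also have "card {(c :: 'a, u :: 'a, v :: 'a). u = 0 \<and> c = 0} = CARD('a)"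
    by (rule card_eqI_inverse[where f = "\<lambda>(c, u, v). v" and g = "\<lambda>v. (0, 0, v)"]) auto
  finally show ?thesis by (simp add: card_cartesian_product card_UNIV_nz[where ?'a = 'a] power2_eq_square algebra_simps)
qed

text \<open>
  Here \<open>r0 + r1 y\<close> and \<open>q0 + r1 y\<close> stand for \<open>v - f\<close> and \<open>v + f\<close>.
\<close>

definition Rr :: "('a::{field,finite} \<times> 'a \<times> 'a \<times> 'a \<times> 'a) set" where
  "Rr = {(s, p, r1, r0, q0). r1\<^sup>2 * s + r1 * (r0 + q0) = Aq s p \<and> r0 * q0 - r1\<^sup>2 * p = Bq s p}"

text \<open>\<open>v - f\<close> and \<open>v + f\<close> differ by a constant, so they share the
  linear coefficient \<open>r1\<close>; their constant terms are independent because 2 is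
  invertible.\<close>

lemma sum_S2_squares:
  assumes two: "(2 :: 'a::{field,finite}) \<noteq> 0"
  shows "(\<Sum>f\<in>UNIV. card (S2 ((f :: 'a)\<^sup>2))) = card (Rr :: ('a \<times> 'a \<times> 'a \<times> 'a \<times> 'a) set)"
proof -
  have "(\<Sum>f\<in>UNIV. card (S2 ((f :: 'a)\<^sup>2))) = card {(z, f). z \<in> S2 ((f :: 'a)\<^sup>2)}"
    using sum_card_pairs[of "\<lambda>z f. z \<in> S2 ((f :: 'a)\<^sup>2)"] by simp
  also have "\<dots> = card (Rr :: ('a \<times> 'a \<times> 'a \<times> 'a \<times> 'a) set)"
  proof (rule card_eqI_inverse[where f = "\<lambda>((s, p, v0, v1), f). (s, p, v1, v0 - f, v0 + f)" and
        g = "\<lambda>(s, p, r1, r0, q0). ((s, p, (r0 + q0) / 2, r1), (q0 - r0) / 2)"])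
    fix x assume "x \<in> {(z, f). z \<in> S2 ((f :: 'a)\<^sup>2)}"
    then obtain s p v0 v1 f where x: "x = ((s, p, v0, v1), f)"
      "2 * v0 * v1 + v1\<^sup>2 * s = Aq s p" "v0\<^sup>2 - v1\<^sup>2 * p - Bq s p = f\<^sup>2" unfolding S2_def by auto
    have "v1\<^sup>2 * s + v1 * ((v0 - f) + (v0 + f)) = Aq s p" using x(2) by (simp add: algebra_simps)
    moreover have "(v0 - f) * (v0 + f) - v1\<^sup>2 * p = Bq s p"
      using x(3) by (simp add: algebra_simps power2_eq_square)
    ultimately show "(\<lambda>((s, p, v0, v1), f). (s, p, v1, v0 - f, v0 + f)) x \<in> Rr \<and>
       (\<lambda>(s, p, r1, r0, q0). ((s, p, (r0 + q0) / 2, r1), (q0 - r0) / 2)) ((\<lambda>((s, p, v0, v1), f). (s, p, v1, v0 - f, v0 + f)) x) = x"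
      unfolding x(1) Rr_def using two by simp
  next
    fix x :: "'a \<times> 'a \<times> 'a \<times> 'a \<times> 'a" assume "x \<in> Rr"
    then obtain s p r1 r0 q0 where x: "x = (s, p, r1, r0, q0)"
      "r1\<^sup>2 * s + r1 * (r0 + q0) = Aq s p" "r0 * q0 - r1\<^sup>2 * p = Bq s p" unfolding Rr_def by auto
    define t where "t = (r0 + q0) / 2"
    define f where "f = (q0 - r0) / 2"
    have e: "t - f = r0" "t + f = q0" unfolding t_def f_def using halves[OF two] by simp_all
    have "2 * t * r1 + r1\<^sup>2 * s = Aq s p" unfolding x(2)[symmetric] e[symmetric] by (simp add: algebra_simps)
    moreover have "t\<^sup>2 - r1\<^sup>2 * p - Bq s p = f\<^sup>2"
      unfolding x(3)[symmetric] e[symmetric] by (simp add: algebra_simps power2_eq_square)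
    ultimately show "(\<lambda>(s, p, r1, r0, q0). ((s, p, (r0 + q0) / 2, r1), (q0 - r0) / 2)) x \<in> {(z, f). z \<in> S2 (f\<^sup>2)} \<and>
       (\<lambda>((s, p, v0, v1), f). (s, p, v1, v0 - f, v0 + f)) ((\<lambda>(s, p, r1, r0, q0). ((s, p, (r0 + q0) / 2, r1), (q0 - r0) / 2)) x) = x"
      unfolding x(1) S2_def using e by (simp flip: t_def f_def)
  qed
  finally show ?thesis .
qed

text \<open>Serves the case \<open>p = 0\<close>, where \<open>r0 q0 = 0\<close>: here
  \<open>t\<close> is the one of the two that is nonzero. For nonzero \<open>s\<close>, also
  \<open>r\<close> is nonzero and determines \<open>t\<close>, which would vanish just when
  \<open>r^2 = s^3\<close>.\<close>

lemma card_H: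
  "card {(s, r, t). t \<noteq> 0 \<and> r\<^sup>2 * s + r * t = (s :: 'a::{field,finite}) ^ 4} = card (nz :: 'a set) * card (nz :: 'a set)"
proof -
  let ?H = "{(s, r, t). t \<noteq> 0 \<and> r\<^sup>2 * s + r * t = s ^ 4} :: ('a \<times> 'a \<times> 'a) set"
  let ?Hb = "{(s, r, t). s \<noteq> 0 \<and> t \<noteq> 0 \<and> r\<^sup>2 * s + r * t = s ^ 4} :: ('a \<times> 'a \<times> 'a) set"
  let ?Ha = "{(s, r, t). s = 0 \<and> r = 0 \<and> t \<noteq> 0} :: ('a \<times> 'a \<times> 'a) set"
  let ?G = "{(s, r). s \<noteq> 0 \<and> r \<noteq> 0 \<and> r\<^sup>2 \<noteq> s ^ 3} :: ('a \<times> 'a) set"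
  have "?H = ?Hb \<union> ?Ha" by (auto simp: power2_eq_square)
  moreover have "card (?Hb \<union> ?Ha) = card ?Hb + card ?Ha" by (rule card_Un_disjoint) auto
  moreover have "card ?Ha = card (nz :: 'a set)"
    by (rule card_eqI_inverse[where f = "\<lambda>(s, r, t). t" and g = "\<lambda>t. (0, 0, t)"]) (auto simp: nz_def)
  moreover have "card ?Hb = card ?G"
  proof (rule card_eqI_inverse[where f = "\<lambda>(s, r, t). (s, r)" and g = "\<lambda>(s, r). (s, r, s ^ 4 / r - r * s)"])
    fix x assume "x \<in> ?Hb"
    then obtain s r t where x: "x = (s, r, t)" "s \<noteq> 0" "t \<noteq> 0" "r\<^sup>2 * s + r * t = s ^ 4" by auto
    have r: "r \<noteq> 0" using x(2,4) by auto
    have t: "s ^ 4 / r - r * s = t" unfolding x(4)[symmetric] using r by (simp add: field_simps power2_eq_square)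
    have "r\<^sup>2 \<noteq> s ^ 3"
    proof
      assume "r\<^sup>2 = s ^ 3"
      then have "r * t = 0" using x(4) by (simp add: eval_nat_numeral)
      then show False using r x(3) by simp
    qed
    then show "(\<lambda>(s, r, t). (s, r)) x \<in> ?G \<and> (\<lambda>(s, r). (s, r, s ^ 4 / r - r * s)) ((\<lambda>(s, r, t). (s, r)) x) = x"
      using x(1,2) r t by simp
  next
    fix x assume "x \<in> ?G"
    then obtain s r where x: "x = (s, r)" "s \<noteq> 0" "r \<noteq> 0" "r\<^sup>2 \<noteq> s ^ 3" by auto
    define t where "t = s ^ 4 / r - r * s"
    have e: "r\<^sup>2 * s + r * t = s ^ 4" unfolding t_def using x(3) by (simp add: field_simps power2_eq_square)
    have "t \<noteq> 0"
    proof
      assume "t = 0"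
      then have "r\<^sup>2 * s = s ^ 3 * s" using e by (simp add: eval_nat_numeral)
      then show False using x(2,4) by simp
    qed
    then show "(\<lambda>(s, r). (s, r, s ^ 4 / r - r * s)) x \<in> ?Hb \<and> (\<lambda>(s, r, t). (s, r)) ((\<lambda>(s, r). (s, r, s ^ 4 / r - r * s)) x) = x"
      using x(1,2) e by (simp flip: t_def)
  qed
  moreover have "card ?G + card (nz :: 'a set) = card (nz :: 'a set) * card (nz :: 'a set)"
  proof -
    let ?D = "{(s, r). s \<noteq> 0 \<and> r\<^sup>2 = s ^ 3} :: ('a \<times> 'a) set"
    have "(nz :: 'a set) \<times> (nz :: 'a set) = ?G \<union> ?D" by (auto simp: nz_def)
    moreover have "card (?G \<union> ?D) = card ?G + card ?D" by (rule card_Un_disjoint) auto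
    ultimately have "card ((nz :: 'a set) \<times> (nz :: 'a set)) = card ?G + card ?D" by simp
    then show ?thesis by (simp add: card_cartesian_product card_square_cube)
  qed
  ultimately show ?thesis by simp
qed

lemma card_Rr_p0:
  "card {(s, p, r1, r0, q0). p = 0 \<and> (s, p, r1, r0, q0) \<in> (Rr :: ('a::{field,finite} \<times> 'a \<times> 'a \<times> 'a \<times> 'a) set)} =
     2 * card (nz :: 'a set) + 1 + 2 * (card (nz :: 'a set) * card (nz :: 'a set))"
proof -
  let ?R = "{(s, p, r1, r0, q0). p = 0 \<and> (s, p, r1, r0, q0) \<in> Rr} :: ('a \<times> 'a \<times> 'a \<times> 'a \<times> 'a) set"
  let ?Raa = "{(s, p, r1, r0, q0). p = 0 \<and> r0 = 0 \<and> q0 = 0 \<and> r1\<^sup>2 * s = s ^ 4} :: ('a \<times> 'a \<times> 'a \<times> 'a \<times> 'a) set"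
  let ?Rba = "{(s, p, r1, r0, q0). p = 0 \<and> r0 \<noteq> 0 \<and> q0 = 0 \<and> r1\<^sup>2 * s + r1 * r0 = s ^ 4} :: ('a \<times> 'a \<times> 'a \<times> 'a \<times> 'a) set"
  let ?Rab = "{(s, p, r1, r0, q0). p = 0 \<and> r0 = 0 \<and> q0 \<noteq> 0 \<and> r1\<^sup>2 * s + r1 * q0 = s ^ 4} :: ('a \<times> 'a \<times> 'a \<times> 'a \<times> 'a) set"
  have "?R = ?Raa \<union> (?Rba \<union> ?Rab)" by (auto simp: Rr_def Aq_def Bq_def)
  moreover have "card (?Raa \<union> (?Rba \<union> ?Rab)) = card ?Raa + card (?Rba \<union> ?Rab)" by (rule card_Un_disjoint) auto
  moreover have "card (?Rba \<union> ?Rab) = card ?Rba + card ?Rab" by (rule card_Un_disjoint) auto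
  moreover have "card ?Raa = card {(s, r). r\<^sup>2 * s = (s :: 'a) ^ 4}"
    by (rule card_eqI_inverse[where f = "\<lambda>(s, p, r1, r0, q0). (s, r1)" and g = "\<lambda>(s, r). (s, 0, r, 0, 0)"]) auto
  moreover have "card ?Rba = card {(s, r, t). t \<noteq> 0 \<and> r\<^sup>2 * s + r * t = (s :: 'a) ^ 4}"
    by (rule card_eqI_inverse[where f = "\<lambda>(s, p, r1, r0, q0). (s, r1, r0)" and g = "\<lambda>(s, r, t). (s, 0, r, t, 0)"]) auto
  moreover have "card ?Rab = card {(s, r, t). t \<noteq> 0 \<and> r\<^sup>2 * s + r * t = (s :: 'a) ^ 4}"
    by (rule card_eqI_inverse[where f = "\<lambda>(s, p, r1, r0, q0). (s, r1, q0)" and g = "\<lambda>(s, r, t). (s, 0, r, 0, t)"]) auto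
  ultimately show ?thesis
    by (simp add: card_H card_T0 card_UNIV_nz[where ?'a = 'a])
qed

text \<open>When \<open>Aq\<close> vanishes, the norm identity becomes
  \<open>Bq^2 = p^5\<close>.\<close>

lemma Bq_nz: "p \<noteq> 0 \<Longrightarrow> Aq s p = 0 \<Longrightarrow> Bq s p \<noteq> (0 :: 'a::field)"
  using Aq_Bq_norm[of s p] by auto

text \<open>Both factors are constants, so \<open>y^5\<close> must be the constant
  \<open>Bq\<close>, which is nonzero; one factor is then free and determines the other.\<close>

lemma card_Rr_r0:
  "card {(s, p, r1, r0, q0). p \<noteq> 0 \<and> r1 = 0 \<and> (s, p, r1, r0, q0) \<in> (Rr :: ('a::{field,finite} \<times> 'a \<times> 'a \<times> 'a \<times> 'a) set)} =
     card (\<alpha>s :: ('a \<times> 'a) set) * card (nz :: 'a set)"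
proof -
  have "card {(s, p, r1, r0, q0). p \<noteq> 0 \<and> r1 = 0 \<and> (s, p, r1, r0, q0) \<in> (Rr :: ('a \<times> 'a \<times> 'a \<times> 'a \<times> 'a) set)} =
      card ((\<alpha>s :: ('a \<times> 'a) set) \<times> (nz :: 'a set))"
  proof (rule card_eqI_inverse[where f = "\<lambda>(s, p, r1, r0, q0). ((s, p), r0)" and g = "\<lambda>((s, p), r0). (s, p, 0, r0, Bq s p / r0)"])
    fix x :: "'a \<times> 'a \<times> 'a \<times> 'a \<times> 'a" assume "x \<in> {(s, p, r1, r0, q0). p \<noteq> 0 \<and> r1 = 0 \<and> (s, p, r1, r0, q0) \<in> Rr}"
    then obtain s p r0 q0 where x: "x = (s, p, 0, r0, q0)" "p \<noteq> 0" "Aq s p = 0" "r0 * q0 = Bq s p"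
      unfolding Rr_def by auto
    have "r0 \<noteq> 0" using Bq_nz[OF x(2,3)] x(4) by auto
    then show "(\<lambda>(s, p, r1, r0, q0). ((s, p), r0)) x \<in> \<alpha>s \<times> nz \<and>
        (\<lambda>((s, p), r0). (s, p, 0, r0, Bq s p / r0)) ((\<lambda>(s, p, r1, r0, q0). ((s, p), r0)) x) = x"
      unfolding x(1) using x(2,3) by (simp add: \<alpha>s_def nz_def flip: x(4))
  qed (auto simp: Rr_def \<alpha>s_def nz_def)
  then show ?thesis by (simp add: card_cartesian_product)
qed

text \<open>
  \<open>(r0 + r1 y) (q0 + q1 y) = y\<^sup>5\<close> in \<open>\<bbbF>\<^sub>q[y]/(y\<^sup>2 - s y + p)\<close>. The weighted scaling below multiplies \<open>r1\<close> and
  \<open>q1\<close> by different powers of \<open>t\<close>, so it can normalise \<open>q1 = r1\<close>, as required in \<open>Rr\<close>.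
\<close>

definition Zc :: "'a::{field,finite} \<Rightarrow> 'a \<Rightarrow> 'a \<Rightarrow> 'a \<Rightarrow> 'a \<Rightarrow> 'a \<Rightarrow> bool" where
  "Zc s p r1 r0 q1 q0 \<longleftrightarrow> r1 * q1 * s + r1 * q0 + q1 * r0 = Aq s p \<and> r0 * q0 - r1 * q1 * p = Bq s p"

text \<open>Giving \<open>y\<close> weight 1 gives \<open>s\<close>, \<open>p\<close> weights 1, 2
  and \<open>y^5\<close> weight 5. The two factors receive weights 2 and 3, whence 1, 2 for
  \<open>r1\<close>, \<open>r0\<close> and 2, 3 for \<open>q1\<close>, \<open>q0\<close>.\<close>

lemma Zc_scale:
  assumes t: "t \<noteq> 0"
  shows "Zc (t * s) (t\<^sup>2 * p) (t * r1) (t\<^sup>2 * r0) (t\<^sup>2 * q1) (t ^ 3 * q0) \<longleftrightarrow> Zc s p r1 r0 q1 q0"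
proof -
  have 1: "(t * r1) * (t\<^sup>2 * q1) * (t * s) + (t * r1) * (t ^ 3 * q0) + (t\<^sup>2 * q1) * (t\<^sup>2 * r0) =
      t ^ 4 * (r1 * q1 * s + r1 * q0 + q1 * r0)" by (simp add: algebra_simps eval_nat_numeral)
  have 2: "(t\<^sup>2 * r0) * (t ^ 3 * q0) - (t * r1) * (t\<^sup>2 * q1) * (t\<^sup>2 * p) = t ^ 5 * (r0 * q0 - r1 * q1 * p)"
    by (simp add: algebra_simps eval_nat_numeral)
  have 3: "Aq (t * s) (t\<^sup>2 * p) = t ^ 4 * Aq s p" "Bq (t * s) (t\<^sup>2 * p) = t ^ 5 * Bq s p"
    unfolding Aq_def Bq_def by (simp_all add: algebra_simps eval_nat_numeral)
  show ?thesis unfolding Zc_def 1 2 3 using t by simp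
qed

definition Zs :: "('a::{field,finite} \<times> 'a \<times> 'a \<times> 'a \<times> 'a \<times> 'a) set" where
  "Zs = {(s, p, r1, r0, q1, q0). p \<noteq> 0 \<and> r1 \<noteq> 0 \<and> q1 \<noteq> 0 \<and> Zc s p r1 r0 q1 q0}"

text \<open>Each element of \<open>Zs\<close> arises by scaling from a solution with
  \<open>q1 = r1\<close> for exactly one parameter, namely \<open>q1 / r1\<close>; so the constraint
  costs precisely a factor \<open>card nz\<close>.\<close>

lemma card_Rr_torus:
  "card {(s, p, r1, r0, q0). p \<noteq> 0 \<and> r1 \<noteq> 0 \<and> (s, p, r1, r0, q0) \<in> (Rr :: ('a::{field,finite} \<times> 'a \<times> 'a \<times> 'a \<times> 'a) set)} *
     card (nz :: 'a set) = card (Zs :: ('a \<times> 'a \<times> 'a \<times> 'a \<times> 'a \<times> 'a) set)"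
proof -
  let ?R = "{(s, p, r1, r0, q0). p \<noteq> 0 \<and> r1 \<noteq> 0 \<and> (s, p, r1, r0, q0) \<in> Rr} :: ('a \<times> 'a \<times> 'a \<times> 'a \<times> 'a) set"
  have Rr: "(s, p, r1, r0, q0) \<in> Rr \<longleftrightarrow> Zc s p r1 r0 r1 q0" for s p r1 r0 q0 :: 'a
    unfolding Rr_def Zc_def by (simp add: algebra_simps power2_eq_square)
  have "card (?R \<times> (nz :: 'a set)) = card (Zs :: ('a \<times> 'a \<times> 'a \<times> 'a \<times> 'a \<times> 'a) set)"
  proof (rule card_eqI_inverse[where f = "\<lambda>((s, p, r1, r0, q0), t). (t * s, t\<^sup>2 * p, t * r1, t\<^sup>2 * r0, t\<^sup>2 * r1, t ^ 3 * q0)"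
        and g = "\<lambda>(s, p, r1, r0, q1, q0). ((s / (q1 / r1), p / (q1 / r1)\<^sup>2, r1 / (q1 / r1), r0 / (q1 / r1)\<^sup>2, q0 / (q1 / r1) ^ 3), q1 / r1)"])
    fix x assume "x \<in> ?R \<times> (nz :: 'a set)"
    then obtain s p r1 r0 q0 t where x: "x = ((s, p, r1, r0, q0), t)" "p \<noteq> 0" "r1 \<noteq> 0" "Zc s p r1 r0 r1 q0" "t \<noteq> 0"
      unfolding nz_def Rr by auto
    have q: "(t\<^sup>2 * r1) / (t * r1) = t" using x by (simp add: power2_eq_square)
    show "(\<lambda>((s, p, r1, r0, q0), t). (t * s, t\<^sup>2 * p, t * r1, t\<^sup>2 * r0, t\<^sup>2 * r1, t ^ 3 * q0)) x \<in> Zs \<and>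
      (\<lambda>(s, p, r1, r0, q1, q0). ((s / (q1 / r1), p / (q1 / r1)\<^sup>2, r1 / (q1 / r1), r0 / (q1 / r1)\<^sup>2, q0 / (q1 / r1) ^ 3), q1 / r1))
        ((\<lambda>((s, p, r1, r0, q0), t). (t * s, t\<^sup>2 * p, t * r1, t\<^sup>2 * r0, t\<^sup>2 * r1, t ^ 3 * q0)) x) = x"
      unfolding x(1) Zs_def prod.case mem_Collect_eq q using x(2-5) Zc_scale[OF x(5), of s p r1 r0 r1 q0] by simp
  next
    fix x :: "'a \<times> 'a \<times> 'a \<times> 'a \<times> 'a \<times> 'a" assume "x \<in> Zs"
    then obtain s p r1 r0 q1 q0 where x: "x = (s, p, r1, r0, q1, q0)" "p \<noteq> 0" "r1 \<noteq> 0" "q1 \<noteq> 0" "Zc s p r1 r0 q1 q0"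
      unfolding Zs_def by auto
    define t where "t = q1 / r1"
    have t: "t \<noteq> 0" "t * r1 = q1" unfolding t_def using x by simp_all
    have e: "t * (s / t) = s" "t\<^sup>2 * (p / t\<^sup>2) = p" "t * (r1 / t) = r1" "t\<^sup>2 * (r0 / t\<^sup>2) = r0" "t\<^sup>2 * (r1 / t) = q1"
      "t ^ 3 * (q0 / t ^ 3) = q0" using t(1) by (simp_all add: power2_eq_square t(2)[symmetric])
    have z: "Zc (s / t) (p / t\<^sup>2) (r1 / t) (r0 / t\<^sup>2) (r1 / t) (q0 / t ^ 3)"
      using Zc_scale[OF t(1), of "s / t" "p / t\<^sup>2" "r1 / t" "r0 / t\<^sup>2" "r1 / t" "q0 / t ^ 3"] x(5) unfolding e by simp
    show "(\<lambda>(s, p, r1, r0, q1, q0). ((s / (q1 / r1), p / (q1 / r1)\<^sup>2, r1 / (q1 / r1), r0 / (q1 / r1)\<^sup>2, q0 / (q1 / r1) ^ 3), q1 / r1)) x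
        \<in> ?R \<times> nz \<and>
      (\<lambda>((s, p, r1, r0, q0), t). (t * s, t\<^sup>2 * p, t * r1, t\<^sup>2 * r0, t\<^sup>2 * r1, t ^ 3 * q0))
       ((\<lambda>(s, p, r1, r0, q1, q0). ((s / (q1 / r1), p / (q1 / r1)\<^sup>2, r1 / (q1 / r1), r0 / (q1 / r1)\<^sup>2, q0 / (q1 / r1) ^ 3), q1 / r1)) x) = x"
      unfolding x(1) prod.case t_def[symmetric] mem_Sigma_iff mem_Collect_eq Rr e nz_def using x(2,3) t(1) z by simp
  qed
  then show ?thesis by (simp add: card_cartesian_product)
qed

text \<open>The norm of \<open>r0 + r1 y\<close> modulo \<open>y^2 - s y + p\<close>.\<close>

definition Nn :: "'a::field \<Rightarrow> 'a \<Rightarrow> 'a \<Rightarrow> 'a \<Rightarrow> 'a" where "Nn s p r1 r0 = r0\<^sup>2 + r0 * r1 * s + r1\<^sup>2 * p"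

text \<open>What remains of \<open>Zs\<close> after the second factor is eliminated as
  \<open>y^5 / (r0 + r1 y)\<close>; the last inequality says that the coefficient \<open>q1\<close>
  of the quotient is nonzero.\<close>

definition Zs' :: "('a::{field,finite} \<times> 'a \<times> 'a \<times> 'a) set" where
  "Zs' = {(s, p, r1, r0). p \<noteq> 0 \<and> r1 \<noteq> 0 \<and> Nn s p r1 r0 \<noteq> 0 \<and> Aq s p * r0 \<noteq> r1 * Bq s p}"

text \<open>The equation makes \<open>r0 + r1 y\<close> proportional to
  \<open>Bq + Aq y = y^5\<close>, which is a unit because \<open>p\<close> is nonzero.\<close>

lemma Nn_nz_aux:
  assumes "p \<noteq> 0" "r1 \<noteq> 0" "Aq s p * r0 = r1 * Bq s p"
  shows "Nn s p r1 r0 \<noteq> (0 :: 'a::field) \<and> Aq s p \<noteq> 0"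
proof -
  have "(Aq s p)\<^sup>2 * Nn s p r1 r0 =
      (Aq s p * r0)\<^sup>2 + Aq s p * (Aq s p * r0) * r1 * s + (Aq s p)\<^sup>2 * (r1\<^sup>2 * p)"
    unfolding Nn_def by (simp add: algebra_simps power2_eq_square)
  also have "\<dots> = r1\<^sup>2 * ((Bq s p)\<^sup>2 + Aq s p * Bq s p * s + (Aq s p)\<^sup>2 * p)"
    unfolding assms(3) by (simp add: algebra_simps power2_eq_square)
  also have "\<dots> \<noteq> 0" unfolding Aq_Bq_norm using assms by simp
  finally show ?thesis by auto
qed

lemma card_Zs: "card (Zs :: ('a::{field,finite} \<times> 'a \<times> 'a \<times> 'a \<times> 'a \<times> 'a) set) = card (Zs' :: ('a \<times> 'a \<times> 'a \<times> 'a) set)"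
proof (rule card_eqI_inverse[where f = "\<lambda>(s, p, r1, r0, q1, q0). (s, p, r1, r0)" and
      g = "\<lambda>(s, p, r1, r0). (s, p, r1, r0, (Aq s p * r0 - r1 * Bq s p) / Nn s p r1 r0,
             (r1 * Aq s p * p + Bq s p * (r0 + r1 * s)) / Nn s p r1 r0)"])
  fix x :: "'a \<times> 'a \<times> 'a \<times> 'a \<times> 'a \<times> 'a" assume "x \<in> Zs"
  then obtain s p r1 r0 q1 q0 where x: "x = (s, p, r1, r0, q1, q0)" "p \<noteq> 0" "r1 \<noteq> 0" "q1 \<noteq> 0"
    "r1 * q1 * s + r1 * q0 + q1 * r0 = Aq s p" "r0 * q0 - r1 * q1 * p = Bq s p"
    unfolding Zs_def Zc_def by auto
  have 1: "Aq s p * r0 - r1 * Bq s p = q1 * Nn s p r1 r0"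
    unfolding x(5,6)[symmetric] Nn_def by (simp add: algebra_simps power2_eq_square)
  have 2: "r1 * Aq s p * p + Bq s p * (r0 + r1 * s) = q0 * Nn s p r1 r0"
    unfolding x(5,6)[symmetric] Nn_def by (simp add: algebra_simps power2_eq_square)
  \<comment> \<open>A zero norm would make \<open>Aq r0 - r1 Bq\<close> vanish, and that by the
    previous lemma forces a nonzero norm.\<close>
  have N: "Nn s p r1 r0 \<noteq> 0"
  proof
    assume N0: "Nn s p r1 r0 = 0"
    then have "Aq s p * r0 = r1 * Bq s p" using 1 by simp
    then show False using Nn_nz_aux[OF x(2,3)] N0 by blast
  qed
  have "Aq s p * r0 \<noteq> r1 * Bq s p" using 1 N x(4) by auto
  then show "(\<lambda>(s, p, r1, r0, q1, q0). (s, p, r1, r0)) x \<in> Zs' \<and>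
     (\<lambda>(s, p, r1, r0). (s, p, r1, r0, (Aq s p * r0 - r1 * Bq s p) / Nn s p r1 r0,
             (r1 * Aq s p * p + Bq s p * (r0 + r1 * s)) / Nn s p r1 r0))
       ((\<lambda>(s, p, r1, r0, q1, q0). (s, p, r1, r0)) x) = x"
    unfolding x(1) Zs'_def using x(2,3) N by (simp add: 1 2)
next
  fix x :: "'a \<times> 'a \<times> 'a \<times> 'a" assume "x \<in> Zs'"
  then obtain s p r1 r0 where x: "x = (s, p, r1, r0)" "p \<noteq> 0" "r1 \<noteq> 0" "Nn s p r1 r0 \<noteq> 0" "Aq s p * r0 \<noteq> r1 * Bq s p"
    unfolding Zs'_def by auto
  define q1 where "q1 = (Aq s p * r0 - r1 * Bq s p) / Nn s p r1 r0"
  define q0 where "q0 = (r1 * Aq s p * p + Bq s p * (r0 + r1 * s)) / Nn s p r1 r0"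
  have q: "q1 * Nn s p r1 r0 = Aq s p * r0 - r1 * Bq s p" "q0 * Nn s p r1 r0 = r1 * Aq s p * p + Bq s p * (r0 + r1 * s)"
    unfolding q1_def q0_def using x(4) by simp_all
  have "(r1 * q1 * s + r1 * q0 + q1 * r0) * Nn s p r1 r0 =
      (q1 * Nn s p r1 r0) * (r1 * s + r0) + r1 * (q0 * Nn s p r1 r0)" by (simp add: algebra_simps)
  also have "\<dots> = Aq s p * Nn s p r1 r0" unfolding q unfolding Nn_def by (simp add: algebra_simps power2_eq_square)
  finally have 1: "r1 * q1 * s + r1 * q0 + q1 * r0 = Aq s p" using x(4) by simp
  have "(r0 * q0 - r1 * q1 * p) * Nn s p r1 r0 =
      r0 * (q0 * Nn s p r1 r0) - r1 * p * (q1 * Nn s p r1 r0)" by (simp add: algebra_simps)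
  also have "\<dots> = Bq s p * Nn s p r1 r0" unfolding q unfolding Nn_def by (simp add: algebra_simps power2_eq_square)
  finally have 2: "r0 * q0 - r1 * q1 * p = Bq s p" using x(4) by simp
  have "q1 \<noteq> 0" unfolding q1_def using x(4,5) by simp
  then show "(\<lambda>(s, p, r1, r0). (s, p, r1, r0, (Aq s p * r0 - r1 * Bq s p) / Nn s p r1 r0,
             (r1 * Aq s p * p + Bq s p * (r0 + r1 * s)) / Nn s p r1 r0)) x \<in> Zs \<and>
      (\<lambda>(s, p, r1, r0, q1, q0). (s, p, r1, r0)) ((\<lambda>(s, p, r1, r0). (s, p, r1, r0, (Aq s p * r0 - r1 * Bq s p) / Nn s p r1 r0,
             (r1 * Aq s p * p + Bq s p * (r0 + r1 * s)) / Nn s p r1 r0)) x) = x"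
    unfolding x(1) Zs_def Zc_def using x(2,3) 1 2 by (simp flip: q1_def q0_def)
qed

text \<open>First factors \<open>r0 + r1 y\<close> of nonzero norm are counted, and those whose
  cofactor has \<open>q1 = 0\<close> are taken away.\<close>

lemma card_Zs':
  fixes n defines "n \<equiv> card (nz :: 'a::{field,finite} set)"
  shows "card (Zs' :: ('a \<times> 'a \<times> 'a \<times> 'a) set) = n * (n ^ 3 + card (\<alpha>s :: ('a \<times> 'a) set))"
proof -
  let ?Y = "{(s, p, r1, r0). p \<noteq> 0 \<and> r1 \<noteq> 0 \<and> Nn s p r1 r0 \<noteq> 0} :: ('a \<times> 'a \<times> 'a \<times> 'a) set"
  let ?Ya = "{(s, p, r1, r0). p \<noteq> 0 \<and> r1 \<noteq> 0 \<and> r0 = 0} :: ('a \<times> 'a \<times> 'a \<times> 'a) set"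
  let ?Yb = "{(s, p, r1, r0). p \<noteq> 0 \<and> r1 \<noteq> 0 \<and> r0 \<noteq> 0 \<and> Nn s p r1 r0 \<noteq> 0} :: ('a \<times> 'a \<times> 'a \<times> 'a) set"
  let ?Yz = "{(s, p, r1, r0). p \<noteq> 0 \<and> r1 \<noteq> 0 \<and> Aq s p * r0 = r1 * Bq s p} :: ('a \<times> 'a \<times> 'a \<times> 'a) set"
  let ?W = "{(s, p, r1). p \<noteq> 0 \<and> r1 \<noteq> 0 \<and> Aq s p \<noteq> 0} :: ('a \<times> 'a \<times> 'a) set"
  let ?Wz = "{(s, p, r1). p \<noteq> 0 \<and> r1 \<noteq> 0 \<and> Aq s p = 0} :: ('a \<times> 'a \<times> 'a) set"
  have "?Y = ?Ya \<union> ?Yb" by (auto simp: Nn_def)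
  moreover have "card (?Ya \<union> ?Yb) = card ?Ya + card ?Yb" by (rule card_Un_disjoint) auto
  moreover have "card ?Ya = card ((UNIV :: 'a set) \<times> (nz :: 'a set) \<times> (nz :: 'a set))"
    by (rule card_eqI_inverse[where f = "\<lambda>(s, p, r1, r0). (s, p, r1)" and g = "\<lambda>(s, p, r1). (s, p, r1, 0)"]) (auto simp: nz_def)
  \<comment> \<open>For nonzero \<open>r0\<close>, \<open>r1\<close> the norm is affine in
    \<open>s\<close> with slope \<open>r0 r1\<close>, so \<open>s\<close> can be traded for the
    value of the norm.\<close>
  moreover have "card ?Yb = card ((nz :: 'a set) \<times> (nz :: 'a set) \<times> (nz :: 'a set) \<times> (nz :: 'a set))"
  proof (rule card_eqI_inverse[where f = "\<lambda>(s, p, r1, r0). (Nn s p r1 r0, p, r1, r0)" and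
          g = "\<lambda>(m, p, r1, r0). ((m - r0\<^sup>2 - r1\<^sup>2 * p) / (r0 * r1), p, r1, r0)"])
    fix x assume "x \<in> ?Yb"
    then obtain s p r1 r0 where x: "x = (s, p, r1, r0)" "p \<noteq> 0" "r1 \<noteq> 0" "r0 \<noteq> 0" "Nn s p r1 r0 \<noteq> 0" by auto
    have "(Nn s p r1 r0 - r0\<^sup>2 - r1\<^sup>2 * p) / (r0 * r1) = s" unfolding Nn_def using x(3,4) by simp
    then show "(\<lambda>(s, p, r1, r0). (Nn s p r1 r0, p, r1, r0)) x \<in> nz \<times> nz \<times> nz \<times> nz \<and>
      (\<lambda>(m, p, r1, r0). ((m - r0\<^sup>2 - r1\<^sup>2 * p) / (r0 * r1), p, r1, r0)) ((\<lambda>(s, p, r1, r0). (Nn s p r1 r0, p, r1, r0)) x) = x"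
      unfolding x(1) using x(2-5) by (simp add: nz_def)
  next
    fix x :: "'a \<times> 'a \<times> 'a \<times> 'a" assume "x \<in> nz \<times> nz \<times> nz \<times> nz"
    then obtain m p r1 r0 where x: "x = (m, p, r1, r0)" "m \<noteq> 0" "p \<noteq> 0" "r1 \<noteq> 0" "r0 \<noteq> 0" unfolding nz_def by auto
    have "Nn ((m - r0\<^sup>2 - r1\<^sup>2 * p) / (r0 * r1)) p r1 r0 = m" unfolding Nn_def using x(4,5) by simp
    then show "(\<lambda>(m, p, r1, r0). ((m - r0\<^sup>2 - r1\<^sup>2 * p) / (r0 * r1), p, r1, r0)) x \<in> ?Yb \<and>
      (\<lambda>(s, p, r1, r0). (Nn s p r1 r0, p, r1, r0)) ((\<lambda>(m, p, r1, r0). ((m - r0\<^sup>2 - r1\<^sup>2 * p) / (r0 * r1), p, r1, r0)) x) = x"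
      unfolding x(1) using x(2-5) by simp
  qed
  ultimately have Y: "card ?Y = (n + 1) * (n * n) + n ^ 4"
    by (simp add: card_cartesian_product card_UNIV_nz[where ?'a = 'a] n_def eval_nat_numeral)
  have "?Y = Zs' \<union> ?Yz" unfolding Zs'_def using Nn_nz_aux by auto
  moreover have "card (Zs' \<union> ?Yz) = card (Zs' :: ('a \<times> 'a \<times> 'a \<times> 'a) set) + card ?Yz"
    by (rule card_Un_disjoint) (auto simp: Zs'_def)
  \<comment> \<open>In the part to be removed \<open>Aq\<close> is nonzero, so \<open>r0\<close> is
    determined by the rest.\<close>
  moreover have "card ?Yz = card ?W"
  proof (rule card_eqI_inverse[where f = "\<lambda>(s, p, r1, r0). (s, p, r1)" and g = "\<lambda>(s, p, r1). (s, p, r1, r1 * Bq s p / Aq s p)"])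
    fix x assume "x \<in> ?Yz"
    then obtain s p r1 r0 where x: "x = (s, p, r1, r0)" "p \<noteq> 0" "r1 \<noteq> 0" "Aq s p * r0 = r1 * Bq s p" by auto
    have "Aq s p \<noteq> 0" using Nn_nz_aux[OF x(2-4)] by simp
    then show "(\<lambda>(s, p, r1, r0). (s, p, r1)) x \<in> ?W \<and> (\<lambda>(s, p, r1). (s, p, r1, r1 * Bq s p / Aq s p)) ((\<lambda>(s, p, r1, r0). (s, p, r1)) x) = x"
      unfolding x(1) using x(2,3) by (simp flip: x(4))
  qed auto
  moreover have "card ?W + card ?Wz = card ((UNIV :: 'a set) \<times> (nz :: 'a set) \<times> (nz :: 'a set))"
  proof -
    have "(UNIV :: 'a set) \<times> (nz :: 'a set) \<times> (nz :: 'a set) = ?W \<union> ?Wz" by (auto simp: nz_def)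
    moreover have "card (?W \<union> ?Wz) = card ?W + card ?Wz" by (rule card_Un_disjoint) auto
    ultimately show ?thesis by simp
  qed
  moreover have "card ?Wz = card ((\<alpha>s :: ('a \<times> 'a) set) \<times> (nz :: 'a set))"
    by (rule card_eqI_inverse[where f = "\<lambda>(s, p, r1). ((s, p), r1)" and g = "\<lambda>((s, p), r1). (s, p, r1)"]) (auto simp: \<alpha>s_def nz_def)
  ultimately have "card (Zs' :: ('a \<times> 'a \<times> 'a \<times> 'a) set) + card ?W = (n + 1) * (n * n) + n ^ 4"
    "card ?W + card (\<alpha>s :: ('a \<times> 'a) set) * n = (n + 1) * (n * n)"
    using Y by (simp_all add: card_cartesian_product card_UNIV_nz[where ?'a = 'a] n_def)
  then have "card (Zs' :: ('a \<times> 'a \<times> 'a \<times> 'a) set) = n ^ 4 + card (\<alpha>s :: ('a \<times> 'a) set) * n" by linarith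
  then show ?thesis by (simp add: algebra_simps eval_nat_numeral)
qed

lemma card_Rr:
  fixes n defines "n \<equiv> card (nz :: 'a::{field,finite} set)"
  shows "card (Rr :: ('a \<times> 'a \<times> 'a \<times> 'a \<times> 'a) set) =
    2 * n + 1 + 2 * (n * n) + card (\<alpha>s :: ('a \<times> 'a) set) * n + (n ^ 3 + card (\<alpha>s :: ('a \<times> 'a) set))"
proof -
  let ?Ra = "{(s, p, r1, r0, q0). p = 0 \<and> (s, p, r1, r0, q0) \<in> Rr} :: ('a \<times> 'a \<times> 'a \<times> 'a \<times> 'a) set"
  let ?Rb = "{(s, p, r1, r0, q0). p \<noteq> 0 \<and> r1 = 0 \<and> (s, p, r1, r0, q0) \<in> Rr} :: ('a \<times> 'a \<times> 'a \<times> 'a \<times> 'a) set"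
  let ?Rc = "{(s, p, r1, r0, q0). p \<noteq> 0 \<and> r1 \<noteq> 0 \<and> (s, p, r1, r0, q0) \<in> Rr} :: ('a \<times> 'a \<times> 'a \<times> 'a \<times> 'a) set"
  have "Rr = ?Ra \<union> (?Rb \<union> ?Rc)" by auto
  moreover have "card (?Ra \<union> (?Rb \<union> ?Rc)) = card ?Ra + card (?Rb \<union> ?Rc)" by (rule card_Un_disjoint) auto
  moreover have "card (?Rb \<union> ?Rc) = card ?Rb + card ?Rc" by (rule card_Un_disjoint) auto
  ultimately have sum: "card (Rr :: ('a \<times> 'a \<times> 'a \<times> 'a \<times> 'a) set) = card ?Ra + (card ?Rb + card ?Rc)" by metis
  have "card ?Rc * n = n * (n ^ 3 + card (\<alpha>s :: ('a \<times> 'a) set))"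
    using card_Rr_torus[where ?'a = 'a] card_Zs[where ?'a = 'a] card_Zs'[where ?'a = 'a] unfolding n_def by simp
  then have "n * card ?Rc = n * (n ^ 3 + card (\<alpha>s :: ('a \<times> 'a) set))" by (simp only: mult.commute)
  moreover have "n > 0" using nz_pos[where ?'a = 'a] unfolding n_def .
  ultimately have Rc: "card ?Rc = n ^ 3 + card (\<alpha>s :: ('a \<times> 'a) set)"
    using nat_mult_eq_cancel1[of n] by blast
  show ?thesis unfolding sum Rc card_Rr_p0 card_Rr_r0 unfolding n_def by simp
qed

section \<open>Zeros of \<open>Aq\<close> and the averages over all, square and non-square
  parameters\<close>

lemma four_nz: "(2 :: 'a::field) \<noteq> 0 \<Longrightarrow> (4 :: 'a) \<noteq> 0"
proof -
  have "(4 :: 'a) = 2 * 2" by simp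
  then show "(2 :: 'a) \<noteq> 0 \<Longrightarrow> (4 :: 'a) \<noteq> 0" by (metis mult_eq_0_iff)
qed

lemma four_Aq: "4 * Aq s p = (2 * p - 3 * s\<^sup>2)\<^sup>2 - 5 * s ^ 4"
  unfolding Aq_def by (simp add: algebra_simps eval_nat_numeral)

lemma alphas_s_nz: "(s, p) \<in> \<alpha>s \<Longrightarrow> s \<noteq> 0"
  unfolding \<alpha>s_def Aq_def by auto

lemma alphas_square:
  assumes "(2 :: 'a::{field,finite}) \<noteq> 0" "(s, p :: 'a) \<in> \<alpha>s"
  shows "((2 * p - 3 * s\<^sup>2) / s\<^sup>2)\<^sup>2 = 5"
proof -
  have "s \<noteq> 0" using alphas_s_nz assms(2) .
  have "(2 * p - 3 * s\<^sup>2)\<^sup>2 = 5 * s ^ 4" using four_Aq[of s p] assms(2) by (simp add: \<alpha>s_def)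
  then have "((2 * p - 3 * s\<^sup>2) / s\<^sup>2)\<^sup>2 = 5 * s ^ 4 / (s\<^sup>2)\<^sup>2" unfolding power_divide by simp
  also have "\<dots> = 5" using \<open>s \<noteq> 0\<close> by (simp flip: power_mult)
  finally show ?thesis .
qed

lemma card_alphas_nonsquare:
  assumes "(2 :: 'a::{field,finite}) \<noteq> 0" "\<And>k :: 'a. k\<^sup>2 \<noteq> 5"
  shows "card (\<alpha>s :: ('a \<times> 'a) set) = 0"
proof -
  have "\<alpha>s = ({} :: ('a \<times> 'a) set)" using alphas_square[OF assms(1)] assms(2) by fast
  then show ?thesis by simp
qed

text \<open>For each nonzero \<open>s\<close> the zeros are \<open>p = s^2 (3 + j)/2\<close> with
  \<open>j = k\<close> or \<open>j = - k\<close>. Neither is 0, since \<open>j = - 3\<close> would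
  give \<open>9 = 5\<close>, that is \<open>4 = 0\<close>.\<close>

lemma card_alphas_square:
  assumes two: "(2 :: 'a::{field,finite}) \<noteq> 0" and five: "(5 :: 'a) \<noteq> 0" and k: "(k :: 'a)\<^sup>2 = 5"
  shows "card (\<alpha>s :: ('a \<times> 'a) set) = 2 * card (nz :: 'a set)"
proof -
  have "k \<noteq> 0" using k five by auto
  have four: "(4 :: 'a) \<noteq> 0" using four_nz[OF two] .
  have "k \<noteq> - k"
  proof
    assume "k = - k"
    then have "2 * k = 0" by (metis add.right_inverse mult_2)
    then show False using two \<open>k \<noteq> 0\<close> by simp
  qed
  have "card (\<alpha>s :: ('a \<times> 'a) set) = card ((nz :: 'a set) \<times> {k, - k})"
  proof (rule card_eqI_inverse[where f = "\<lambda>(s, p). (s, (2 * p - 3 * s\<^sup>2) / s\<^sup>2)"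
        and g = "\<lambda>(s, j). (s, s\<^sup>2 * (3 + j) / 2)"])
    fix x :: "'a \<times> 'a" assume "x \<in> \<alpha>s"
    then obtain s p where x: "x = (s, p)" "(s, p) \<in> \<alpha>s" by (cases x) auto
    have s: "s \<noteq> 0" using alphas_s_nz x(2) .
    have "((2 * p - 3 * s\<^sup>2) / s\<^sup>2)\<^sup>2 = k\<^sup>2" using alphas_square[OF two x(2)] k by simp
    then have j: "(2 * p - 3 * s\<^sup>2) / s\<^sup>2 \<in> {k, - k}" by (simp add: power2_eq_iff)
    have "s\<^sup>2 * (3 + (2 * p - 3 * s\<^sup>2) / s\<^sup>2) / 2 = p"
    proof -
      have "s\<^sup>2 * (3 + (2 * p - 3 * s\<^sup>2) / s\<^sup>2) = 2 * p" using s by (simp add: distrib_left)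
      then show ?thesis using two by simp
    qed
    then show "(case x of (s, p) \<Rightarrow> (s, (2 * p - 3 * s\<^sup>2) / s\<^sup>2)) \<in> nz \<times> {k, - k} \<and>
        (case (case x of (s, p) \<Rightarrow> (s, (2 * p - 3 * s\<^sup>2) / s\<^sup>2)) of (s, j) \<Rightarrow> (s, s\<^sup>2 * (3 + j) / 2)) = x"
      using x s j by (simp add: nz_def)
  next
    fix z :: "'a \<times> 'a" assume "z \<in> nz \<times> {k, - k}"
    then obtain s j where z: "z = (s, j)" "s \<noteq> 0" and j: "j = k \<or> j = - k" by (cases z) (auto simp: nz_def)
    have jj: "j\<^sup>2 = 5" using j k by auto
    define p where "p = s\<^sup>2 * (3 + j) / 2"
    have "2 * p = s\<^sup>2 * (3 + j)" using two unfolding p_def by (simp del: distrib_left_numeral)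
    then have p: "2 * p - 3 * s\<^sup>2 = s\<^sup>2 * j" by (simp add: distrib_left)
    have "4 * Aq s p = (s\<^sup>2 * j)\<^sup>2 - 5 * s ^ 4" using four_Aq[of s p] p by simp
    also have "\<dots> = 0" using jj by (simp add: power_mult_distrib flip: power_mult)
    finally have A: "Aq s p = 0" using four by simp
    have "3 + j \<noteq> 0"
    proof
      assume "3 + j = 0"
      then have "j = - 3" by (simp add: eq_neg_iff_add_eq_0 add.commute)
      then have "(9 :: 'a) = 5" using jj by simp
      moreover have "(4 :: 'a) = 9 - 5" by simp
      ultimately have "(4 :: 'a) = 0" by (simp only: diff_self)
      then show False using four by simp
    qed
    then have "p \<noteq> 0" using z two unfolding p_def by simp
    moreover have "(2 * p - 3 * s\<^sup>2) / s\<^sup>2 = j" unfolding p using z by simp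
    ultimately show "(case z of (s, j) \<Rightarrow> (s, s\<^sup>2 * (3 + j) / 2)) \<in> \<alpha>s \<and>
        (case (case z of (s, j) \<Rightarrow> (s, s\<^sup>2 * (3 + j) / 2)) of (s, p) \<Rightarrow> (s, (2 * p - 3 * s\<^sup>2) / s\<^sup>2)) = z"
      using z A unfolding \<alpha>s_def p_def by simp
  qed
  also have "\<dots> = 2 * card (nz :: 'a set)" using \<open>k \<noteq> - k\<close> by (simp add: card_cartesian_product)
  finally show ?thesis .
qed

definition Nm :: "'a::{field,finite} \<Rightarrow> nat" where "Nm e = card (mumford (quint e))"
definition Sq :: "'a::{field,finite} set" where "Sq = {e \<in> nz. \<exists>f. e = f\<^sup>2}"

lemma sum_nz: "(\<Sum>e\<in>UNIV. g e) = g 0 + (\<Sum>e\<in>(nz :: 'a::{field,finite} set). g e :: nat)"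
proof -
  have "(UNIV :: 'a set) = insert 0 nz" unfolding nz_def by auto
  moreover have "sum g (insert 0 (nz :: 'a set)) = g 0 + sum g nz" by (rule sum.insert) (auto simp: nz_def)
  ultimately show ?thesis by simp
qed

lemma Nm_0: "(2 :: 'a::{field,finite}) \<noteq> 0 \<Longrightarrow> Nm (0 :: 'a) = 1 + CARD('a) + CARD('a)\<^sup>2"
  unfolding Nm_def card_mumford_quint by (simp add: card_S1_0 card_S2_0)

lemma sum_Nm_nz:
  assumes two: "(2 :: 'a::{field,finite}) \<noteq> 0"
  shows "(\<Sum>e\<in>(nz :: 'a set). Nm e) = card (nz :: 'a set) * (CARD('a)\<^sup>2 + 1) + CARD('a) * card (\<alpha>s :: ('a \<times> 'a) set)"
proof -
  let ?n = "card (nz :: 'a set)" and ?q = "CARD('a)" and ?al = "card (\<alpha>s :: ('a \<times> 'a) set)"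
  have "(\<Sum>e\<in>UNIV. Nm (e :: 'a)) = ?q + ?q\<^sup>2 + (?q\<^sup>2 * ?n + ?q * (?al + 1))"
    unfolding Nm_def card_mumford_quint sum.distrib sum_S1 sum_S2 card_S2all[OF two] by simp
  then have "1 + ?q + ?q\<^sup>2 + (\<Sum>e\<in>(nz :: 'a set). Nm e) = ?q + ?q\<^sup>2 + (?q\<^sup>2 * ?n + ?q * (?al + 1))"
    unfolding sum_nz Nm_0[OF two] .
  then have "1 + (\<Sum>e\<in>(nz :: 'a set). Nm e) = ?q\<^sup>2 * ?n + ?q * (?al + 1)" by linarith
  moreover have "?q\<^sup>2 * ?n + ?q * (?al + 1) = 1 + (?n * (?q\<^sup>2 + 1) + ?q * ?al)"
    using card_UNIV_nz[where 'a='a] by (simp add: algebra_simps)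
  ultimately show ?thesis by linarith
qed

lemma sum_Nm_squares:
  assumes two: "(2 :: 'a::{field,finite}) \<noteq> 0"
  shows "(\<Sum>f\<in>(nz :: 'a set). Nm (f\<^sup>2)) = card (nz :: 'a set) * (CARD('a)\<^sup>2 + 1) + CARD('a) * card (\<alpha>s :: ('a \<times> 'a) set)"
proof -
  let ?n = "card (nz :: 'a set)" and ?q = "CARD('a)" and ?al = "card (\<alpha>s :: ('a \<times> 'a) set)"
  let ?R = "2 * ?n + 1 + 2 * (?n * ?n) + ?al * ?n + (?n ^ 3 + ?al)"
  have "(\<Sum>f\<in>UNIV. Nm ((f :: 'a)\<^sup>2)) = ?q + ?q\<^sup>2 + ?R"
    unfolding Nm_def card_mumford_quint sum.distrib sum_S1_squares[OF two] sum_S2_squares[OF two] card_Rr by simp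
  then have "Nm ((0 :: 'a)\<^sup>2) + (\<Sum>e\<in>(nz :: 'a set). Nm (e\<^sup>2)) = ?q + ?q\<^sup>2 + ?R"
    unfolding sum_nz .
  then have "1 + ?q + ?q\<^sup>2 + (\<Sum>e\<in>(nz :: 'a set). Nm (e\<^sup>2)) = ?q + ?q\<^sup>2 + ?R" using Nm_0[OF two] by simp
  then have "1 + (\<Sum>e\<in>(nz :: 'a set). Nm (e\<^sup>2)) = ?R" by linarith
  moreover have "?R = 1 + (?n * (?q\<^sup>2 + 1) + ?q * ?al)"
    using card_UNIV_nz[where 'a='a] by (simp add: algebra_simps eval_nat_numeral)
  ultimately show ?thesis by linarith
qed

lemma sum_over_squares:
  assumes two: "(2 :: 'a::{field,finite}) \<noteq> 0"
  shows "(\<Sum>f\<in>(nz :: 'a set). g (f\<^sup>2)) = 2 * (\<Sum>e\<in>(Sq :: 'a set). g e :: nat)"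
proof -
  have sub: "(\<lambda>f. f\<^sup>2) ` (nz :: 'a set) \<subseteq> Sq" unfolding Sq_def nz_def by auto
  have fib: "(\<Sum>f\<in>{f \<in> nz. f\<^sup>2 = e}. g (f\<^sup>2)) = 2 * g e" if eS: "e \<in> Sq" for e :: 'a
  proof -
    obtain f where f: "e = f\<^sup>2" "f \<noteq> 0" using eS unfolding Sq_def nz_def by auto
    have "f \<noteq> - f"
    proof
      assume "f = - f"
      then have "2 * f = 0" by (metis add.right_inverse mult_2)
      then show False using two f by simp
    qed
    moreover have "{x \<in> nz. x\<^sup>2 = e} = {f, - f}"
      using f unfolding nz_def by (auto simp: power2_eq_iff)
    ultimately show ?thesis using f by simp
  qed
  have "(\<Sum>f\<in>(nz :: 'a set). g (f\<^sup>2)) = (\<Sum>e\<in>(Sq :: 'a set). \<Sum>f\<in>{f \<in> nz. f\<^sup>2 = e}. g (f\<^sup>2))"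
    by (rule sum.group[symmetric, OF _ _ sub]) simp_all
  also have "\<dots> = (\<Sum>e\<in>(Sq :: 'a set). 2 * g e)" using fib by (intro sum.cong) auto
  finally show ?thesis by (simp add: sum_distrib_left)
qed

definition avg :: "'a::{field,finite} itself \<Rightarrow> nat" where
  "avg _ = (if \<exists>k :: 'a. k\<^sup>2 = 5 then (CARD('a) + 1)\<^sup>2 else CARD('a)\<^sup>2 + 1)"

text \<open>Write \<open>n = q - 1\<close>. With \<open>2 n\<close> elements in \<alpha>s the common
  value \<open>n (q^2 + 1) + q * 2 n\<close> of both sums is \<open>n (q + 1)^2\<close>; with none
  it is \<open>n (q^2 + 1)\<close>. Squares make up half of the nonzero elements.\<close>

lemma
  assumes two: "(2 :: 'a::{field,finite}) \<noteq> 0" and five: "(5 :: 'a) \<noteq> 0"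
  shows average_Nm: "(\<Sum>e\<in>(nz :: 'a set). Nm e) = card (nz :: 'a set) * avg TYPE('a)"
    and average_Nm_Sq: "(\<Sum>e\<in>(Sq :: 'a set). Nm e) = card (Sq :: 'a set) * avg TYPE('a)"
    and average_Nm_nonsq: "(\<Sum>e\<in>(nz - Sq :: 'a set). Nm e) = card (nz - Sq :: 'a set) * avg TYPE('a)"
proof -
  let ?n = "card (nz :: 'a set)" and ?al = "card (\<alpha>s :: ('a \<times> 'a) set)"
  have v: "?n * (CARD('a)\<^sup>2 + 1) + CARD('a) * ?al = ?n * avg TYPE('a)"
  proof (cases "\<exists>k :: 'a. k\<^sup>2 = 5")
    case True
    then obtain k :: 'a where "k\<^sup>2 = 5" by blast
    then have "?al = 2 * ?n" by (rule card_alphas_square[OF two five])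
    then show ?thesis using True unfolding avg_def by (simp add: algebra_simps power2_eq_square)
  next
    case False
    then show ?thesis using card_alphas_nonsquare[OF two] unfolding avg_def by simp
  qed
  show 1: "(\<Sum>e\<in>(nz :: 'a set). Nm e) = ?n * avg TYPE('a)" using sum_Nm_nz[OF two] v by simp
  have 2: "2 * (\<Sum>e\<in>(Sq :: 'a set). Nm e) = ?n * avg TYPE('a)"
    using sum_Nm_squares[OF two] v sum_over_squares[OF two, of Nm] by simp
  have n: "?n = 2 * card (Sq :: 'a set)" using sum_over_squares[OF two, of "\<lambda>_. 1"] by simp
  show 3: "(\<Sum>e\<in>(Sq :: 'a set). Nm e) = card (Sq :: 'a set) * avg TYPE('a)" using 2 unfolding n by simp
  have sub: "Sq \<subseteq> (nz :: 'a set)" unfolding Sq_def by blast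
  have 4: "(\<Sum>e\<in>(nz - Sq :: 'a set). Nm e) + (\<Sum>e\<in>(Sq :: 'a set). Nm e) = (\<Sum>e\<in>(nz :: 'a set). Nm e)"
    by (rule sum.subset_diff[symmetric, OF sub]) simp
  have "card (nz - Sq :: 'a set) = card (Sq :: 'a set)" using card_Diff_subset[OF _ sub] n by simp
  then show "(\<Sum>e\<in>(nz - Sq :: 'a set). Nm e) = card (nz - Sq :: 'a set) * avg TYPE('a)" using 1 3 4 n by simp
qed

section \<open>Finite fields inside the algebraic closure\<close>

lemma rta_simps:
  "carrier (ring_of_type_algebra :: 'b::field ring) = UNIV"
  "monoid.mult (ring_of_type_algebra :: 'b::field ring) = (*)"
  "ring.add (ring_of_type_algebra :: 'b::field ring) = (+)"
  "\<one>\<^bsub>ring_of_type_algebra\<^esub> = (1 :: 'b::field)" "\<zero>\<^bsub>ring_of_type_algebra\<^esub> = (0 :: 'b::field)"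
  by (auto simp: ring_of_type_algebra_def fun_eq_iff)

lemma rta_uminus: "\<ominus>\<^bsub>ring_of_type_algebra\<^esub> x = - (x :: 'b::field)"
proof -
  interpret R: field "ring_of_type_algebra :: 'b ring" by (rule field_from_type_algebra)
  show ?thesis by (rule R.minus_equality) (simp_all add: rta_simps)
qed

lemma rta_inv: "(x :: 'b::field) \<noteq> 0 \<Longrightarrow> inv\<^bsub>ring_of_type_algebra\<^esub> x = inverse x"
proof -
  interpret R: field "ring_of_type_algebra :: 'b ring" by (rule field_from_type_algebra)
  show "x \<noteq> 0 \<Longrightarrow> inv\<^bsub>ring_of_type_algebra\<^esub> x = inverse x"
    by (rule R.comm_inv_char) (simp_all add: rta_simps)
qed

lemma subfield_rtaI:
  fixes F :: "'b::field set"
  assumes "1 \<in> F" "\<And>x. x \<in> F \<Longrightarrow> - x \<in> F" "\<And>x. x \<in> F \<Longrightarrow> inverse x \<in> F"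
    "\<And>x y. x \<in> F \<Longrightarrow> y \<in> F \<Longrightarrow> x + y \<in> F" "\<And>x y. x \<in> F \<Longrightarrow> y \<in> F \<Longrightarrow> x * y \<in> F"
  shows "subfield F ring_of_type_algebra"
proof -
  interpret R: field "ring_of_type_algebra :: 'b ring" by (rule field_from_type_algebra)
  show ?thesis
    by (intro R.subfieldI' R.subringI) (use assms in \<open>simp_all add: rta_simps rta_uminus rta_inv\<close>)
qed

text \<open>As for Fermat's little theorem: multiplication by a nonzero \<open>x\<close> permutes
  the nonzero elements and so fixes their product.\<close>

lemma finite_mult_closed_power_card:
  fixes F :: "'b::field set"
  assumes fin: "finite F" and "0 \<in> F" and mult: "\<And>x y. x \<in> F \<Longrightarrow> y \<in> F \<Longrightarrow> x * y \<in> F" and x: "x \<in> F"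
  shows "x ^ card F = x"
proof (cases "x = 0")
  case True
  then show ?thesis using assms(1,2) by (auto simp: card_gt_0_iff power_0_left)
next
  case False
  let ?G = "F - {0}"
  have inj: "inj_on ((*) x) ?G" using False by (auto simp: inj_on_def)
  have "(*) x ` ?G \<subseteq> ?G" using mult[OF x] False by auto
  then have img: "(*) x ` ?G = ?G" using fin inj by (intro endo_inj_surj) auto
  have "(\<Prod>z\<in>?G. z) = (\<Prod>z\<in>?G. x * z)" using prod.reindex[OF inj, of "\<lambda>z. z"] unfolding img by simp
  also have "\<dots> = x ^ card ?G * (\<Prod>z\<in>?G. z)" by (simp add: prod.distrib)
  finally have "x ^ card ?G = 1" using fin by (simp add: prod_zero_iff)
  moreover have "card F = Suc (card ?G)" using card.remove[OF fin assms(2)] .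
  ultimately show ?thesis by simp
qed

lemma power_CARD: "(x :: 'a::{field,finite}) ^ CARD('a) = x"
  by (rule finite_mult_closed_power_card) auto

lemma CARD_gt_1: "CARD('a::{field,finite}) > 1"
  using card_mono[of "UNIV :: 'a set" "{0, 1}"] by simp

text \<open>The field is a finite-dimensional vector space over its prime field. This makes the
  \<open>q\<close>-th power an iterate of the characteristic power map, hence additive.\<close>

lemma CARD_power_CHAR: "\<exists>n. CARD('a::{field,finite}) = CHAR('a) ^ n"
proof -
  let ?P = "range (of_nat :: nat \<Rightarrow> 'a)"
  interpret R: field "ring_of_type_algebra :: 'a ring" by (rule field_from_type_algebra)
  have pos: "CHAR('a) > 0" by (rule finite_imp_CHAR_pos) simp
  have P: "subfield ?P ring_of_type_algebra"
  proof (rule subfield_rtaI)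
    show "1 \<in> ?P" by (metis of_nat_1 rangeI)
  next
    fix x assume "x \<in> ?P"
    then obtain i where i: "x = of_nat i" by blast
    have "x + of_nat ((CHAR('a) - 1) * i) = of_nat (i + (CHAR('a) - 1) * i)" using i by simp
    also have "i + (CHAR('a) - 1) * i = CHAR('a) * i" using pos by (cases "CHAR('a)") auto
    finally have "x + of_nat ((CHAR('a) - 1) * i) = 0" by simp
    then have "- x = of_nat ((CHAR('a) - 1) * i)" by (simp only: neg_eq_iff_add_eq_0)
    then show "- x \<in> ?P" by (metis rangeI)
    show "inverse x \<in> ?P"
    proof (cases "x = 0")
      case True
      then show ?thesis by (metis inverse_zero of_nat_0 rangeI)
    next
      case False
      \<comment> \<open>Writing \<open>q = r + 2\<close>, the inverse of a nonzero \<open>x\<close>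
        is \<open>x^r\<close>, again the image of a natural number.\<close>
      obtain r where r: "CARD('a) = Suc (Suc r)" using CARD_gt_1[where 'a='a] by (metis less_imp_Suc_add add_Suc_right plus_1_eq_Suc add_Suc)
      have "x * (x * x ^ r) = x" using power_CARD[of x] unfolding r by simp
      then have "x * x ^ r = 1" using False by simp
      then have "inverse x = x ^ r" by (rule inverse_unique)
      then have "inverse x = of_nat (i ^ r)" unfolding i by simp
      then show ?thesis by (metis rangeI)
    qed
  next
    fix x y assume "x \<in> ?P" "y \<in> ?P"
    then obtain i j where ij: "x = of_nat i" "y = of_nat j" by blast
    have "x + y = of_nat (i + j)" "x * y = of_nat (i * j)" unfolding ij by simp_all
    then show "x + y \<in> ?P" "x * y \<in> ?P" by (metis rangeI)+
  qed
  obtain Us where Us: "set Us = (UNIV :: 'a set)" using finite_list[of "UNIV :: 'a set"] by auto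
  have car: "set Us \<subseteq> carrier (ring_of_type_algebra :: 'a ring)" by (simp add: rta_simps)
  have "R.Span ?P Us = UNIV" using R.Span_base_incl[OF P car] Us by auto
  then obtain d where d: "R.dimension d ?P UNIV"
    using R.Span_finite_dimension[OF P car] unfolding R.finite_dimension_def by auto
  have "CARD('a) = card ?P ^ d" using R.card_dimension[OF P _ d] by simp
  moreover have "card ?P = CHAR('a)"
  proof -
    have "?P = of_nat ` {..<CHAR('a)}"
    proof (intro equalityI subsetI)
      fix x assume "x \<in> ?P"
      then obtain i where "x = of_nat i" by blast
      then have "x = of_nat (i mod CHAR('a))" by (simp add: of_nat_eq_iff_cong_CHAR cong_def)
      then show "x \<in> of_nat ` {..<CHAR('a)}" using pos by simp
    qed auto
    moreover have "inj_on (of_nat :: nat \<Rightarrow> 'a) {..<CHAR('a)}"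
      by (auto simp: inj_on_def of_nat_eq_iff_cong_CHAR cong_def)
    ultimately show ?thesis by (simp add: card_image)
  qed
  ultimately show ?thesis by auto
qed

lemma of_nat_CARD: "of_nat CARD('a::{field,finite}) = (0 :: 'a)"
  using CHAR_dvd_CARD[where 'a='a] by (simp add: of_nat_eq_0_iff_char_dvd)

lemma prime_CHAR_finite: "Factorial_Ring.prime CHAR('a::{field,finite})"
  by (rule prime_CHAR_semidom) (rule finite_imp_CHAR_pos, simp)

lemma numeral_nz_of_coprime:
  assumes "coprime n CARD('a::{field,finite})"
  shows "of_nat n \<noteq> (0 :: 'a)"
proof
  assume "of_nat n = (0 :: 'a)"
  then have "CHAR('a) dvd n" by (simp add: of_nat_eq_0_iff_char_dvd)
  then have "is_unit CHAR('a)" using assms CHAR_dvd_CARD[where 'a='a] by (meson coprime_common_divisor)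
  then show False using prime_CHAR_finite[where 'a='a] by auto
qed

lemma frobenius_add:
  "(x + y :: 'a::{field,finite} alg_closure) ^ (CARD('a) ^ m) = x ^ (CARD('a) ^ m) + y ^ (CARD('a) ^ m)"
proof -
  obtain n where n: "CARD('a) = CHAR('a) ^ n" using CARD_power_CHAR by blast
  show ?thesis
    by (rule freshmans_dream'[of _ "n * m"]) (simp_all add: prime_CHAR_finite n power_mult)
qed

definition Fq :: "nat \<Rightarrow> 'a::{field,finite} alg_closure set" where
  "Fq m = {x. x ^ (CARD('a) ^ m) = x}"

lemma to_ac_Fq: "to_ac (x :: 'a::{field,finite}) \<in> Fq m"
proof -
  have "x ^ (CARD('a) ^ m) = x" by (induction m) (simp_all add: power_CARD power_mult)
  then show ?thesis unfolding Fq_def by (simp flip: to_ac_power)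
qed

text \<open>The derivative -1 makes all roots of \<open>x^N - x\<close> simple, so that there are
  exactly \<open>N\<close> of them.\<close>

lemma frobenius_poly:
  fixes m :: nat assumes m: "m > 0"
  defines "N \<equiv> CARD('a::{field,finite}) ^ m"
  defines "p \<equiv> Polynomial.monom (1 :: 'a alg_closure) N - Polynomial.monom 1 1"
  shows "Polynomial.degree p = N" "lead_coeff p = 1" "pderiv p = - 1" "{x. poly p x = 0} = Fq m"
proof -
  have N: "N > 1" unfolding N_def using CARD_gt_1 m by (rule one_less_power)
  show d: "Polynomial.degree p = N"
    unfolding p_def diff_conv_add_uminus using N by (subst degree_add_eq_left) (simp_all add: Polynomial.degree_monom_eq)
  show "lead_coeff p = 1" unfolding d unfolding p_def using N by simp
  have "(of_nat N :: 'a alg_closure) = 0"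
  proof -
    have "of_nat N = to_ac (of_nat N :: 'a)" by simp
    also have "(of_nat N :: 'a) = 0" unfolding N_def using m by (simp add: of_nat_CARD)
    finally show ?thesis by simp
  qed
  then show "pderiv p = - 1" unfolding p_def by (simp add: pderiv_diff pderiv_monom one_pCons Polynomial.monom_0)
  show "{x. poly p x = 0} = Fq m" unfolding p_def Fq_def N_def by (simp add: poly_monom)
qed

lemma
  assumes m: "m > 0"
  shows finite_Fq: "finite (Fq m :: 'a::{field,finite} alg_closure set)"
    and card_Fq: "card (Fq m :: 'a alg_closure set) = CARD('a) ^ m"
proof -
  let ?N = "CARD('a) ^ m"
  define p where "p = Polynomial.monom (1 :: 'a alg_closure) ?N - Polynomial.monom 1 1"
  note fp = frobenius_poly[OF m, where 'a='a, folded p_def]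
  have p0: "p \<noteq> 0" using fp(2) by auto
  have "finite {x. poly p x = 0}" using p0 by (rule poly_roots_finite)
  then show fin: "finite (Fq m :: 'a alg_closure set)" unfolding fp(4) .
  obtain A where A: "size A = ?N" "p = (\<Prod>x\<in>#A. [:- x, 1:])"
    using alg_closed_imp_factorization[OF p0] fp(1,2) by auto
  have mult: "count A x = 1" if x: "x \<in># A" for x
  proof (rule ccontr)
    assume "count A x \<noteq> 1"
    then obtain B where B: "A = add_mset x (add_mset x B)"
      using x by (metis count_add_mset count_eq_zero_iff multi_member_split One_nat_def)
    have "[:- x, 1:] * [:- x, 1:] dvd p" unfolding A(2) B by (simp add: mult.assoc[symmetric] del: mult_pCons_left mult_pCons_right)
    then have "[:- x, 1:] dvd pderiv p" by (rule square_dvd_pderiv)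
    then have "poly (pderiv p) x = 0" unfolding poly_eq_0_iff_dvd .
    then show False unfolding fp(3) by simp
  qed
  have "size A = (\<Sum>x\<in>set_mset A. count A x)" by (simp add: size_multiset_overloaded_eq)
  also have "\<dots> = card (set_mset A)" using mult by simp
  also have "\<dots> \<le> card (Fq m :: 'a alg_closure set)"
  proof (rule card_mono[OF fin subsetI])
    fix x assume "x \<in># A"
    then have "poly p x = 0" unfolding A(2) by (auto simp: poly_prod_mset image_iff)
    then show "x \<in> Fq m" using fp(4) by blast
  qed
  finally have "?N \<le> card (Fq m :: 'a alg_closure set)" unfolding A .
  moreover have "card (Fq m :: 'a alg_closure set) \<le> ?N" using card_poly_roots_bound[OF p0] unfolding fp(1,4) .
  ultimately show "card (Fq m :: 'a alg_closure set) = ?N" by simp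
qed

lemma subfield_Fq: "subfield (Fq m :: 'a::{field,finite} alg_closure set) ring_of_type_algebra"
proof (rule subfield_rtaI)
  fix x :: "'a alg_closure" assume x: "x \<in> Fq m"
  have "x ^ (CARD('a) ^ m) + (- x) ^ (CARD('a) ^ m) = (x + - x) ^ (CARD('a) ^ m)" by (rule frobenius_add[symmetric])
  also have "\<dots> = 0" by (simp add: power_0_left)
  finally show "- x \<in> Fq m" using x unfolding Fq_def by (simp add: eq_neg_iff_add_eq_0 add.commute)
  show "inverse x \<in> Fq m" using x unfolding Fq_def by (simp add: power_inverse)
qed (simp_all add: Fq_def frobenius_add power_mult_distrib)

text \<open>The definite description is well posed: every element of a subfield with
  \<open>q^m\<close> elements satisfies \<open>x^(q^m) = x\<close>, so the subfield lies in
  \<open>Fq m\<close>, which has the same size.\<close>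

lemma finite_ext_eq:
  assumes m: "m > 0"
  shows "finite_ext m = (Fq m :: 'a::{field,finite} alg_closure set)"
  unfolding finite_ext_def
proof (rule the_equality)
  show "subfield (Fq m :: 'a alg_closure set) ring_of_type_algebra \<and> finite (Fq m :: 'a alg_closure set) \<and>
      card (Fq m :: 'a alg_closure set) = CARD('a) ^ m"
    using subfield_Fq finite_Fq[OF m] card_Fq[OF m] by blast
next
  interpret R: field "ring_of_type_algebra :: 'a alg_closure ring" by (rule field_from_type_algebra)
  fix F :: "'a alg_closure set"
  assume F: "subfield F ring_of_type_algebra \<and> finite F \<and> card F = CARD('a) ^ m"
  then have "subring F ring_of_type_algebra" using subfieldE(1) by blast
  note sr = subringE[OF this, unfolded rta_simps]
  have "F \<subseteq> Fq m"
  proof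
    fix x assume "x \<in> F"
    then have "x ^ card F = x" using finite_mult_closed_power_card[of F x] F sr(2,6) by blast
    then show "x \<in> Fq m" using F unfolding Fq_def by simp
  qed
  then show "F = Fq m" using F card_Fq[OF m, where 'a='a] finite_Fq[OF m, where 'a='a] by (intro card_subset_eq) auto
qed

lemma Fq_1: "Fq 1 = range (to_ac :: 'a::{field,finite} \<Rightarrow> 'a alg_closure)"
proof -
  have "range (to_ac :: 'a \<Rightarrow> 'a alg_closure) = Fq 1"
  proof (rule card_subset_eq)
    show "finite (Fq 1 :: 'a alg_closure set)" by (rule finite_Fq) simp
    show "range (to_ac :: 'a \<Rightarrow> 'a alg_closure) \<subseteq> Fq 1" using to_ac_Fq by blast
    have "inj (to_ac :: 'a \<Rightarrow> 'a alg_closure)" by (simp add: inj_def)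
    then show "card (range (to_ac :: 'a \<Rightarrow> 'a alg_closure)) = card (Fq 1 :: 'a alg_closure set)"
      using card_Fq[of 1, where 'a='a] by (simp add: card_image)
  qed
  then show ?thesis by simp
qed

text \<open>For a square root \<open>s\<close> of a nonzero \<open>d\<close>,
  \<open>s^(q^2 - 1)\<close> is the power of \<open>d^(q - 1) = 1\<close> with exponent
  \<open>(q + 1)/2\<close>. So \<open>s\<close> lies already in \<open>F_(q^2)\<close>.\<close>

lemma square_in_Fq_even:
  fixes d :: "'a::{field,finite}"
  assumes odd: "odd CARD('a)"
  shows "\<exists>s\<in>Fq (2 * j). to_ac d = s\<^sup>2"
proof -
  obtain s where s: "s\<^sup>2 = to_ac d" using nth_root_exists[of 2 "to_ac d"] by auto
  obtain r where r: "CARD('a) = Suc (2 * r)" using odd by (elim oddE) simp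
  have q2: "CARD('a)\<^sup>2 = Suc (2 * (2 * r * Suc r))" unfolding r by (simp add: algebra_simps power2_eq_square)
  have "s ^ (CARD('a)\<^sup>2) = s"
  proof (cases "d = 0")
    case True
    then show ?thesis using s by (simp add: power_0_left)
  next
    case False
    have "d ^ Suc (2 * r) = d" using power_CARD[of d] r by simp
    then have d1: "d ^ (2 * r) = 1" using False by simp
    have "s ^ (CARD('a)\<^sup>2) = s * (s\<^sup>2) ^ (2 * r * Suc r)" unfolding q2 by (simp only: power_Suc power_mult)
    also have "(s\<^sup>2) ^ (2 * r * Suc r) = to_ac ((d ^ (2 * r)) ^ Suc r)" unfolding s by (simp only: power_mult to_ac_power)
    also have "\<dots> = 1" unfolding d1 by simp
    finally show ?thesis by simp
  qed
  then have "s ^ (CARD('a) ^ (2 * j)) = s" 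
  proof (induction j)
    case (Suc j)
    have "CARD('a) ^ (2 * Suc j) = CARD('a)\<^sup>2 * CARD('a) ^ (2 * j)" by (simp add: power2_eq_square)
    then show ?case using Suc by (simp only: power_mult)
  qed simp
  then show ?thesis using s unfolding Fq_def by auto
qed

text \<open>Frobenius sends the root of unity \<open>z\<close> to \<open>z^q\<close>, so it fixes
  the square root \<open>t\<close> of 5 when \<open>q\<close> is 1 or 4 modulo 5 and negates it when
  \<open>q\<close> is 2 or 3.\<close>

lemma five_square_iff:
  assumes two: "(2 :: 'a::{field,finite}) \<noteq> 0" and five: "(5 :: 'a) \<noteq> 0" and q5: "\<not> 5 dvd CARD('a)"
  shows "(\<exists>k :: 'a. k\<^sup>2 = 5) \<longleftrightarrow> CARD('a) mod 5 = 1 \<or> CARD('a) mod 5 = 4"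
proof -
  let ?q = "CARD('a)"
  have "Polynomial.degree [:1, 1, 1, 1, 1 :: 'a alg_closure:] > 0" by simp
  then obtain z :: "'a alg_closure" where "poly [:1, 1, 1, 1, 1:] z = 0"
    using alg_closed_imp_poly_has_root by blast
  then have z: "1 + z + z ^ 2 + z ^ 3 + z ^ 4 = 0" by (simp add: algebra_simps eval_nat_numeral)
  have "z ^ 5 - 1 = (z - 1) * (1 + z + z ^ 2 + z ^ 3 + z ^ 4)" by (simp add: algebra_simps eval_nat_numeral)
  then have z5: "z ^ 5 = 1" using z by simp
  \<comment> \<open>The quadratic Gauss sum \<open>z - z^2 - z^3 + z^4\<close> modulo 5, rewritten
    by \<open>1 + z + z^2 + z^3 + z^4 = 0\<close>.\<close>
  define t where "t = 1 + 2 * z + 2 * z ^ 4"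
  have "t\<^sup>2 = 1 + 4 * (z + z ^ 2 + z ^ 4) + 8 * z ^ 5 + 4 * z ^ 8"
    unfolding t_def by (simp add: algebra_simps eval_nat_numeral)
  also have "z ^ 8 = z ^ 5 * z ^ 3" by (simp flip: power_add)
  also have "1 + 4 * (z + z ^ 2 + z ^ 4) + 8 * z ^ 5 + 4 * (z ^ 5 * z ^ 3) = 5 + 4 * (1 + z + z ^ 2 + z ^ 3 + z ^ 4)"
    unfolding z5 by (simp add: algebra_simps)
  finally have t2: "t\<^sup>2 = 5" using z by simp
  have red: "z ^ i = z ^ (i mod 5)" for i
  proof -
    have "z ^ i = z ^ (5 * (i div 5) + i mod 5)" by simp
    also have "\<dots> = z ^ (i mod 5)" unfolding power_add power_mult z5 by simp
    finally show ?thesis .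
  qed
  have two_q: "(2 :: 'a alg_closure) ^ ?q = 2" using to_ac_Fq[of "2 :: 'a" 1] unfolding Fq_def by simp
  have "t ^ ?q = 1 + 2 * z ^ ?q + 2 * z ^ (4 * ?q)"
    using frobenius_add[of "1 + 2 * z" "2 * z ^ 4" 1] frobenius_add[of 1 "2 * z" 1]
    unfolding t_def by (simp add: power_mult_distrib two_q flip: power_mult)
  also have "\<dots> = 1 + 2 * z ^ (?q mod 5) + 2 * z ^ (4 * (?q mod 5) mod 5)"
    using red[of ?q] red[of "4 * ?q"] by (simp add: mod_mult_right_eq)
  finally have tq: "t ^ ?q = 1 + 2 * z ^ (?q mod 5) + 2 * z ^ (4 * (?q mod 5) mod 5)" .
  have "?q mod 5 \<noteq> 0" using q5 by (simp add: dvd_eq_mod_eq_0)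
  moreover have "?q mod 5 < 5" by simp
  ultimately consider "?q mod 5 = 1 \<or> ?q mod 5 = 4" | "?q mod 5 = 2 \<or> ?q mod 5 = 3" by linarith
  then show ?thesis
  proof cases
    case 1
    then have "t ^ ?q = 1 + 2 * z + 2 * z ^ 4" unfolding tq by auto
    then have "t ^ ?q = t" by (simp only: t_def)
    then have "t \<in> Fq 1" unfolding Fq_def by simp
    then obtain k :: 'a where "t = to_ac k" unfolding Fq_1 by blast
    then have "to_ac (k\<^sup>2) = to_ac (5 :: 'a)" using t2 by simp
    then have "k\<^sup>2 = 5" unfolding to_ac_eq_iff .
    then show ?thesis using 1 by blast
  next
    case 2
    then have "t ^ ?q = 1 + 2 * z ^ 2 + 2 * z ^ 3" unfolding tq by auto
    then have "t ^ ?q + t = 2 * (1 + z + z ^ 2 + z ^ 3 + z ^ 4)" unfolding t_def by (simp add: algebra_simps)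
    then have neg: "t ^ ?q + t = 0" using z by simp
    have "\<not> (\<exists>k :: 'a. k\<^sup>2 = 5)"
    proof
      assume "\<exists>k :: 'a. k\<^sup>2 = 5"
      then obtain k :: 'a where k: "k\<^sup>2 = 5" by blast
      then have "t\<^sup>2 = (to_ac k)\<^sup>2" using t2 by (simp flip: to_ac_power)
      then have "t = to_ac k \<or> t = to_ac (- k)" by (simp add: power2_eq_iff)
      then obtain x :: 'a where x: "t = to_ac x" by (elim disjE) (rule that, assumption)+
      have "t ^ ?q = t" unfolding x to_ac_power[symmetric] power_CARD ..
      then have "2 * t = 0" using neg by (simp only: mult_2)
      then have "to_ac (2 :: 'a) * to_ac x = 0" unfolding x by (simp only: to_ac_numeral)
      then have "2 * x = 0" unfolding to_ac_mult[symmetric] to_ac_eq_0_iff .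
      then have "t = 0" unfolding x using two by simp
      then have "to_ac (5 :: 'a) = 0" using t2 by simp
      then show False using five by (simp only: to_ac_eq_0_iff)
    qed
    then show ?thesis using 2 by auto
  qed
qed

lemma ord_5:
  fixes q :: nat assumes "\<not> 5 dvd q"
  shows "q mod 5 = 1 \<Longrightarrow> ord 5 q = 1" "q mod 5 = 4 \<Longrightarrow> ord 5 q = 2"
    "q mod 5 = 2 \<or> q mod 5 = 3 \<Longrightarrow> ord 5 q = 4"
proof -
  show "q mod 5 = 1 \<Longrightarrow> ord 5 q = 1" using ord_eq_Suc_0_iff[of 5 q] by (simp add: cong_def)
  have pw: "q ^ i mod 5 = (q mod 5) ^ i mod 5" for i by (simp add: power_mod)
  show "q mod 5 = 4 \<Longrightarrow> ord 5 q = 2" using ord_eq_2_iff[of 5 q] pw[of 2] by (simp add: cong_def)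
  assume a: "q mod 5 = 2 \<or> q mod 5 = 3"
  have "[q ^ 4 = 1] (mod 5)" using a pw[of 4] by (auto simp: cong_def)
  then have "ord 5 q dvd 4" unfolding ord_divides .
  moreover have "\<not> ord 5 q dvd 2" using a pw[of 2] unfolding ord_divides[symmetric] by (auto simp: cong_def)
  moreover have "x = 4" if "x dvd 4" "\<not> x dvd 2" for x :: nat
  proof -
    have "x \<le> 4" using that(1) by (auto dest: dvd_imp_le)
    then have "x = 0 \<or> x = 1 \<or> x = 2 \<or> x = 3 \<or> x = 4" by linarith
    then show ?thesis using that by auto
  qed
  ultimately show "ord 5 q = 4" by blast
qed

section \<open>The averages\<close>

text \<open>One half of identifying \<open>C\<close> with the generated field
  \<open>adjoin r\<close>.\<close>

lemma (in curve) Cset_min: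
  assumes F: "\<And>x y. x \<in> F \<Longrightarrow> y \<in> F \<Longrightarrow> x + y \<in> F" "\<And>x y. x \<in> F \<Longrightarrow> y \<in> F \<Longrightarrow> x * y \<in> F"
      "\<And>x. x \<in> F \<Longrightarrow> x \<noteq> 0 \<Longrightarrow> inverse x \<in> F" "range c \<subseteq> F" "y \<in> F" "w \<in> F"
  shows "C \<subseteq> F"
proof
  fix z assume "z \<in> C"
  then obtain g h d where z: "d \<noteq> 0" "z * ev y d = fin.el g h" "z = fin.el g h / ev y d" by (rule fin.Cset_repr)
  have evF: "ev y p \<in> F" for p
  proof (induction p)
    case 0
    have "c 0 \<in> F" using F(4) by blast
    then show ?case by (simp add: ev_0 c_0)
  next
    case (pCons a p)
    have "c a \<in> F" using F(4) by blast
    then show ?case using pCons F(1,2,5) by (simp add: ev_pCons)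
  qed
  have "ev y d \<noteq> 0" using z(1) transc[folded ev_def] by blast
  then have "inverse (ev y d) \<in> F" using F(3) evF by blast
  moreover have "fin.el g h \<in> F" unfolding fin.el_def by (intro F(1) F(2) evF F(6))
  ultimately show "z \<in> F" unfolding z(3) divide_inverse by (rule F(2)[rotated])
qed

text \<open>Over a finite field the powers of an algebraic element lie in a finite set of values of
  polynomials of bounded degree. This serves to show that the adjoined root is
  transcendental.\<close>

lemma (in const_hom) algebraic_powers:
  assumes p: "p \<noteq> 0" "ev t p = 0"
  obtains i j :: nat where "i < j" "t ^ i = t ^ j"
proof -
  define V where "V = ev t ` {g. g = 0 \<or> Polynomial.degree g < Polynomial.degree p}"
  have "t ^ n \<in> V" for n
  proof -
    define m where "m = Polynomial.monom (1 :: 'a) n"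
    have "p * (m div p) + m mod p = m" by (rule mult_div_mod_eq)
    then have "ev t m = ev t (p * (m div p) + m mod p)" by (rule arg_cong[OF sym])
    also have "\<dots> = ev t (p * (m div p)) + ev t (m mod p)" by (rule ev_add)
    also have "ev t (p * (m div p)) = ev t p * ev t (m div p)" by (rule ev_mult)
    finally have "ev t m = ev t p * ev t (m div p) + ev t (m mod p)" .
    then have "ev t m = ev t (m mod p)" unfolding p(2) mult_zero_left add_0 .
    then have tn: "t ^ n = ev t (m mod p)" unfolding m_def ev_monom c_1 mult_1 .
    have "m mod p = 0 \<or> Polynomial.degree (m mod p) < Polynomial.degree p" by (rule degree_mod_less[OF p(1)])
    then show ?thesis unfolding V_def tn by (intro imageI) simp
  qed
  then have "range (\<lambda>n. t ^ n) \<subseteq> V" by blast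
  moreover have "finite V" unfolding V_def using card_polys_degree_less by blast
  ultimately have "finite (range (\<lambda>n. t ^ n))" by (rule finite_subset)
  then have "\<not> inj (\<lambda>n. t ^ n)" using finite_imageD infinite_UNIV_nat by blast
  then obtain i j :: nat where "i \<noteq> j" "t ^ i = t ^ j" by (auto simp: inj_def)
  then show ?thesis using that[of i j] that[of j i] by (cases "i < j") auto
qed

lemma poly_embed_add: "poly_embed (f + g) = poly_embed f + poly_embed g"
  and poly_embed_mult: "poly_embed (f * g) = poly_embed f * poly_embed g"
  and poly_embed_1: "poly_embed 1 = 1" and poly_embed_0: "poly_embed 0 = 0"
  and poly_embed_diff: "poly_embed (f - g) = poly_embed f - poly_embed g"
  and poly_embed_eq_iff: "poly_embed f = poly_embed g \<longleftrightarrow> f = g"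
  unfolding poly_embed_def by simp_all

lemma poly_embed_power: "poly_embed (f ^ n) = poly_embed f ^ n"
  by (induction n) (simp_all add: poly_embed_mult poly_embed_1)

lemma class_number_adjoin:
  fixes a b :: "'a::{field,finite}"
  assumes two: "(2 :: 'a) \<noteq> 0" and five: "(5 :: 'a) \<noteq> 0" and ab: "(a, b) \<in> HE5_params"
    and r: "r ^ 5 = poly_embed [:b, a, 1:]"
  shows "class_number const_field (adjoin r) = Nm ((a\<^sup>2 - 4 * b) / 4)"
proof -
  define c where "c = (\<lambda>x :: 'a. poly_embed [:x:])"
  define w where "w = poly_embed [:a / 2, 1:]"
  define e where "e = (a\<^sup>2 - 4 * b) / 4"
  have four: "(4 :: 'a) \<noteq> 0" using four_nz[OF two] .
  have e0: "e \<noteq> 0" using ab four unfolding e_def HE5_params_def by simp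
  have e4: "a / 2 * (a / 2) = b + e" using four two unfolding e_def by (simp add: field_simps power2_eq_square)
  interpret H: const_hom c
    by standard (simp_all add: c_def mult.commute flip: poly_embed_add poly_embed_mult poly_embed_1 one_pCons)
  have transc: "p = 0" if root: "poly (map_poly c p) r = 0" for p
  proof (rule ccontr)
    assume "p \<noteq> 0"
    then obtain i j :: nat where ij: "i < j" "r ^ i = r ^ j"
      using H.algebraic_powers[of p r] root unfolding H.ev_def by blast
    \<comment> \<open>Fifth powers turn this into two equal powers of \<open>T^2 + a T + b\<close>
      with different exponents, which have different degrees. Only the fifth power of
      \<open>r\<close> enters, so the choice of root does not matter.\<close>
    have "(r ^ 5) ^ i = (r ^ 5) ^ j" using ij(2) by (metis power_commutes power_mult mult.commute)
    then have "[:b, a, 1:] ^ i = [:b, a, 1:] ^ j" unfolding r poly_embed_power[symmetric] poly_embed_eq_iff .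
    then have "Polynomial.degree ([:b, a, 1:] ^ i) = Polynomial.degree ([:b, a, 1:] ^ j)" by simp
    then show False using ij(1) by (simp add: degree_power_eq)
  qed
  interpret Cu: curve c r w e
  proof
    have "a / 2 + a / 2 = a" using two by (simp flip: add_divide_distrib mult_2)
    then have sq: "[:a / 2, 1:] * [:a / 2, 1:] = [:b, a, 1:] + [:e:]" using e4 by simp
    show "w * w = r ^ 5 + c e" unfolding w_def c_def r poly_embed_mult[symmetric] sq poly_embed_add ..
  qed (use transc e0 two five in auto)
  interpret R: field "ring_of_type_algebra :: 'a poly fract alg_closure ring" by (rule field_from_type_algebra)
  let ?H = "insert r (range (to_ac :: 'a poly fract \<Rightarrow> _))"
  let ?G = "generate_field ring_of_type_algebra ?H"
  have G: "\<And>x y. x \<in> ?G \<Longrightarrow> y \<in> ?G \<Longrightarrow> x + y \<in> ?G" "\<And>x y. x \<in> ?G \<Longrightarrow> y \<in> ?G \<Longrightarrow> x * y \<in> ?G"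
    using generate_field.eng_add[of _ ring_of_type_algebra ?H] generate_field.eng_mult[of _ ring_of_type_algebra ?H]
    by (simp_all add: rta_simps)
  have "Cu.fin.Cset \<subseteq> ?G"
  proof (rule Cu.Cset_min)
    show "inverse x \<in> ?G" if "x \<in> ?G" "x \<noteq> 0" for x
      using generate_field.m_inv[OF that(1)] that(2) by (simp add: rta_simps rta_inv)
    show "range c \<subseteq> ?G" "r \<in> ?G" "w \<in> ?G"
      unfolding c_def w_def poly_embed_def by (auto intro: generate_field.incl)
  qed (use G in blast)+
  moreover have "?G \<subseteq> Cu.fin.Cset"
  proof (rule R.generate_field_min_subfield1)
    show "?H \<subseteq> carrier ring_of_type_algebra" by (simp add: rta_simps)
    show "subfield Cu.fin.Cset ring_of_type_algebra"
      by (rule subfield_rtaI) (fact Cu.fin.C1 Cu.fin.Cuminus Cu.fin.Cinv Cu.fin.Cadd Cu.fin.Cmult)+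
    \<comment> \<open>\<open>T\<close> is recovered as \<open>w - a/2\<close>, so all of
      \<open>F_q(T)\<close> lies in the field generated by \<open>r\<close> and
      \<open>w\<close>.\<close>
    have "poly_embed [:0, 1:] = w - c (a / 2)" unfolding w_def c_def by (simp flip: poly_embed_diff)
    moreover have "c x \<in> Cu.fin.Cset" for x using Cu.fin.kC unfolding Cu.kset_eq by blast
    ultimately have T: "poly_embed [:0, 1:] \<in> Cu.fin.Cset" using Cu.fin.Cdiff Cu.fin.w_C by simp
    have emb: "poly_embed g = H.ev (poly_embed [:0, 1:]) g" for g
    proof (induction g)
      case 0
      then show ?case by (simp add: poly_embed_0 H.ev_0)
    next
      case (pCons x g)
      have "poly_embed (pCons x g) = poly_embed ([:x:] + [:0, 1:] * g)" by simp
      also have "\<dots> = c x + poly_embed [:0, 1:] * poly_embed g" unfolding poly_embed_add poly_embed_mult c_def ..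
      finally show ?case unfolding pCons H.ev_pCons .
    qed
    have embC: "poly_embed g \<in> Cu.fin.Cset" for g by (subst emb) (rule Cu.ev_fin[OF T])
    have "to_ac z \<in> Cu.fin.Cset" for z :: "'a poly fract"
    proof -
      obtain g h where "z = Fract g h" by (cases z)
      then have "to_ac z = poly_embed g / poly_embed h" unfolding poly_embed_def by (simp add: Fract_conv_to_fract)
      then show ?thesis using Cu.fin.Cdiv[OF embC embC] by simp
    qed
    then show "?H \<subseteq> Cu.fin.Cset" using Cu.y_C by blast
  qed
  ultimately have "?G = Cu.fin.Cset" by blast
  then have "adjoin r = ring_of_type_algebra\<lparr>carrier := Cu.fin.Cset\<rparr>" unfolding adjoin_def by simp
  moreover have "const_field = range c" unfolding const_field_def c_def ..
  then have "const_field = Cu.fin.kset" unfolding Cu.kset_eq .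
  ultimately show ?thesis
    using Cu.class_number_mumford unfolding Cu.f1_coeffs Nm_def quint_def e_def[symmetric] by simp
qed

text \<open>For fixed \<open>a\<close> the passage from \<open>b\<close> to
  \<open>e = (a^2 - 4 b)/4\<close> is a bijection, so every \<open>e\<close> in \<open>S\<close>
  occurs for exactly \<open>q\<close> pairs and averaging over the pairs is averaging over
  \<open>S\<close>.\<close>

lemma average_eq:
  fixes S :: "'a::{field,finite} set" and \<rho> :: "'a \<times> 'a \<Rightarrow> 'a poly fract alg_closure"
  assumes two: "(2 :: 'a) \<noteq> 0" and five: "(5 :: 'a) \<noteq> 0"
    and \<rho>: "\<And>a b. (a, b) \<in> HE5_params \<Longrightarrow> \<rho> (a, b) ^ 5 = poly_embed [:b, a, 1:]"
    and S: "S \<subseteq> nz" "S \<noteq> {}" "(\<Sum>e\<in>S. Nm e) = card S * v"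
    and P: "P = {(a, b). (a\<^sup>2 - 4 * b) / 4 \<in> S}"
  shows "average_class_number \<rho> P = real v"
proof -
  have four: "(4 :: 'a) \<noteq> 0" using four_nz[OF two] .
  have inv: "(x - 4 * (x / 4 - d)) / 4 = d" "x / 4 - (x - 4 * d) / 4 = d" for x d :: 'a
    using four by (simp_all add: right_diff_distrib diff_divide_distrib)
  let ?f = "\<lambda>(a, e). (a :: 'a, a\<^sup>2 / 4 - e)"
  have bij: "bij_betw ?f (UNIV \<times> S) P"
    unfolding P by (rule bij_betwI[of _ _ _ "\<lambda>(a, b). (a, (a\<^sup>2 - 4 * b) / 4)"]) (auto simp: inv four)
  have cl: "class_number const_field (adjoin (\<rho> p)) = Nm (((fst p)\<^sup>2 - 4 * snd p) / 4)" if pP: "p \<in> P" for p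
  proof -
    obtain a b where p: "p = (a, b)" by (cases p)
    then have "(a, b) \<in> HE5_params" using pP S(1) unfolding P HE5_params_def nz_def by auto
    then show ?thesis using class_number_adjoin[OF two five _ \<rho>] p by simp
  qed
  have "(\<Sum>p\<in>P. class_number const_field (adjoin (\<rho> p))) = (\<Sum>p\<in>P. Nm (((fst p)\<^sup>2 - 4 * snd p) / 4))"
    using cl by simp
  also have "\<dots> = (\<Sum>x\<in>UNIV \<times> S. Nm (((fst (?f x))\<^sup>2 - 4 * snd (?f x)) / 4))"
    by (rule sum.reindex_bij_betw[OF bij, symmetric])
  also have "\<dots> = (\<Sum>x\<in>(UNIV :: 'a set) \<times> S. Nm (snd x))"
    by (rule sum.cong) (auto simp: inv four)
  also have "\<dots> = (\<Sum>a\<in>(UNIV :: 'a set). \<Sum>e\<in>S. Nm e)" unfolding sum.cartesian_product case_prod_unfold ..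
  also have "\<dots> = card P * v" using bij_betw_same_card[OF bij] S(3) by (simp add: card_cartesian_product)
  finally have "(\<Sum>p\<in>P. real (class_number const_field (adjoin (\<rho> p)))) = real (card P) * real v"
    by (metis of_nat_sum of_nat_mult)
  moreover have "card P > 0"
    unfolding bij_betw_same_card[OF bij, symmetric] using S(2) by (simp add: card_cartesian_product card_gt_0_iff)
  then have "real (card P) \<noteq> 0" unfolding of_nat_eq_0_iff by (rule gr_implies_not0)
  ultimately show ?thesis unfolding average_class_number_def by (metis nonzero_mult_div_cancel_left)
qed

theorem theorem4p3:
  fixes q m :: nat
    and \<rho> :: "'a::{field,finite} \<times> 'a \<Rightarrow> 'a poly fract alg_closure"
  assumes q: "q = CARD('a)" "odd q" "\<not> 5 dvd q"
    and m: "m = ord 5 q"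
    and \<rho>: "\<And>a b. (a, b) \<in> HE5_params \<Longrightarrow> \<rho> (a, b) ^ 5 = poly_embed [:b, a, 1:]"
  shows "(m = 1 \<or> m = 2 \<longleftrightarrow> [int q = 1] (mod 5) \<or> [int q = -1] (mod 5))
    \<and> (m = 4 \<longleftrightarrow> \<not> ([int q = 1] (mod 5) \<or> [int q = -1] (mod 5)))
    \<and> (let v = (if m = 1 \<or> m = 2 then (real q + 1)\<^sup>2 else (real q)\<^sup>2 + 1) in
         average_class_number \<rho> HE5_params = v
       \<and> average_class_number \<rho> (HE5_params_square m) = v
       \<and> (HE5_params_nonsquare m \<noteq> ({} :: ('a \<times> 'a) set) \<longrightarrow>
            average_class_number \<rho> (HE5_params_nonsquare m) = v))"
proof -
  have "coprime 2 CARD('a)" using q by simp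
  then have two: "(2 :: 'a) \<noteq> 0" using numeral_nz_of_coprime[of 2] by simp
  have "Factorial_Ring.prime (5 :: nat)" by simp
  then have "coprime 5 CARD('a)" using q prime_imp_coprime by blast
  then have five: "(5 :: 'a) \<noteq> 0" using numeral_nz_of_coprime[of 5] by simp
  have four: "(4 :: 'a) \<noteq> 0" using four_nz[OF two] .
  have "q mod 5 \<noteq> 0" "q mod 5 < 5" using q(3) by (simp_all add: dvd_eq_mod_eq_0)
  then have qcases: "q mod 5 = 1 \<or> q mod 5 = 4 \<or> q mod 5 = 2 \<or> q mod 5 = 3" by linarith
  have cong: "[int q = 1] (mod 5) \<or> [int q = -1] (mod 5) \<longleftrightarrow> q mod 5 = 1 \<or> q mod 5 = 4"
  proof -
    have "int q mod 5 = int (q mod 5)" by (simp add: zmod_int)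
    then show ?thesis unfolding cong_def by auto
  qed
  have m12: "m = 1 \<or> m = 2 \<longleftrightarrow> q mod 5 = 1 \<or> q mod 5 = 4" and m4: "m = 4 \<longleftrightarrow> \<not> (q mod 5 = 1 \<or> q mod 5 = 4)"
    and m124: "m = 1 \<or> m = 2 \<or> m = 4"
    using qcases ord_5[OF q(3)] unfolding m by auto
  have v: "(if m = 1 \<or> m = 2 then (real q + 1)\<^sup>2 else (real q)\<^sup>2 + 1) = real (avg TYPE('a))"
    unfolding m12 avg_def using five_square_iff[OF two five] q by (auto simp: add.commute)
  note av = average_eq[OF two five \<rho>]
  have one: "1 \<in> (nz :: 'a set)" by (simp add: nz_def)
  have "\<exists>f :: 'a. 1 = f\<^sup>2" by (rule exI[of _ 1]) simp
  then have "1 \<in> (Sq :: 'a set)" unfolding Sq_def using one by blast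
  then have ne: "(nz :: 'a set) \<noteq> {}" "(Sq :: 'a set) \<noteq> {}" using one by blast+
  have params: "(a, b) \<in> HE5_params \<longleftrightarrow> (a\<^sup>2 - 4 * b) / 4 \<in> nz" for a b :: 'a
    unfolding HE5_params_def nz_def mem_Collect_eq case_prod_conv divide_eq_0_iff using four by blast
  have "HE5_params = {(a, b). (a, b) \<in> (HE5_params :: ('a \<times> 'a) set)}" by simp
  then have P: "HE5_params = {(a, b). (a\<^sup>2 - 4 * b) / 4 \<in> (nz :: 'a set)}" unfolding params .
  have all: "average_class_number \<rho> HE5_params = real (avg TYPE('a))"
    by (rule av[OF _ subset_refl ne(1) average_Nm[OF two five] P])
  have sq: "average_class_number \<rho> (HE5_params_square m) = real (avg TYPE('a)) \<and>
      (HE5_params_nonsquare m \<noteq> ({} :: ('a \<times> 'a) set) \<longrightarrow>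
        average_class_number \<rho> (HE5_params_nonsquare m) = real (avg TYPE('a)))"
  proof (cases "m = 1")
    case True
    have fe: "finite_ext m = range (to_ac :: 'a \<Rightarrow> 'a alg_closure)" 
      unfolding True Fq_1[symmetric] by (rule finite_ext_eq) simp
    \<comment> \<open>For \<open>m = 1\<close> only roots in \<open>F_q\<close> are allowed, and 4
      is a square, so the discriminant and \<open>e\<close> are squares together.\<close>
    have iff: "(\<exists>s\<in>finite_ext m. to_ac d = s\<^sup>2) \<longleftrightarrow> (\<exists>x. d / 4 = x\<^sup>2)" for d :: 'a
    proof
      assume "\<exists>s\<in>finite_ext m. to_ac d = s\<^sup>2"
      then obtain x :: 'a where "to_ac d = to_ac (x\<^sup>2)" unfolding fe by auto
      then have "d / 4 = (x / 2)\<^sup>2" unfolding to_ac_eq_iff by (simp add: power_divide)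
      then show "\<exists>x. d / 4 = x\<^sup>2" ..
    next
      assume "\<exists>x. d / 4 = x\<^sup>2"
      then obtain x where "d / 4 = x\<^sup>2" ..
      then have "d = (2 * x)\<^sup>2" using four by (simp add: field_simps power_mult_distrib)
      then have "to_ac d = (to_ac (2 * x))\<^sup>2" by (simp only: to_ac_power)
      then show "\<exists>s\<in>finite_ext m. to_ac d = s\<^sup>2" unfolding fe by blast
    qed
    have Sq: "d \<in> Sq \<longleftrightarrow> d \<in> nz \<and> (\<exists>x. d = x\<^sup>2)" for d :: 'a unfolding Sq_def by blast
    have S: "HE5_params_square m = {(a, b). (a\<^sup>2 - 4 * b) / 4 \<in> (Sq :: 'a set)}"
      unfolding HE5_params_square_def iff Sq params ..
    have N: "HE5_params_nonsquare m = {(a, b). (a\<^sup>2 - 4 * b) / 4 \<in> (nz - Sq :: 'a set)}"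
      unfolding HE5_params_nonsquare_def iff Diff_iff Sq params by blast
    have sub: "Sq \<subseteq> (nz :: 'a set)" using Sq by blast
    have "average_class_number \<rho> (HE5_params_square m) = real (avg TYPE('a))"
      by (rule av[OF _ sub ne(2) average_Nm_Sq[OF two five] S])
    moreover have "average_class_number \<rho> (HE5_params_nonsquare m) = real (avg TYPE('a))"
      if nonempty: "HE5_params_nonsquare m \<noteq> ({} :: ('a \<times> 'a) set)"
    proof -
      have ns: "nz - Sq \<noteq> ({} :: 'a set)" using nonempty unfolding N by auto
      show ?thesis by (rule av[OF _ Diff_subset ns average_Nm_nonsq[OF two five] N])
    qed
    ultimately show ?thesis by blast
  next
    case False
    \<comment> \<open>Now \<open>m\<close> is 2 or 4, and every element of \<open>F_q\<close> is a
      square in \<open>finite_ext m\<close>; the non-square subfamily is empty.\<close>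
    define j where "j = m div 2"
    have j: "m = 2 * j" "m > 0" using m124 False unfolding j_def by auto
    have ex: "\<exists>s\<in>finite_ext m. to_ac d = s\<^sup>2" for d :: 'a
      using square_in_Fq_even[where d = d and j = j] q(1,2) j(1) unfolding finite_ext_eq[OF j(2)] by simp
    have "HE5_params_square m = (HE5_params :: ('a \<times> 'a) set)"
      "HE5_params_nonsquare m = ({} :: ('a \<times> 'a) set)"
      unfolding HE5_params_square_def HE5_params_nonsquare_def by (auto simp: ex simp del: to_ac_diff)
    then show ?thesis using all by simp
  qed
  show ?thesis unfolding cong v Let_def using m12 m4 all sq by blast
qed

end
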